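(* Let $p>1$, $q>0$, and let $\mathbf{A}=\mathbf{A}(x,u,\xi):E\times\mathbb{R}\times\mathbb{R}^N\to\mathbb{R}^N$ be a Carathéodory vector field independent of $t$ satisfying, for constants $C_1,\Lambda>0$, $$|\mathbf{A}(x,u,\xi)|\le C_1\big(1+|\xi|^{p-1}\big),$$ $$\big(\mathbf{A}(x,u,\xi_1)-\mathbf{A}(x,u,\xi_2)\big)\cdot(\xi_1-\xi_2)\ge0,$$ $$|\mathbf{A}(x,u_1,\xi)-\mathbf{A}(x,u_2,\xi)|\le\Lambda|u_1-u_2|\big(1+|\xi|^{p-1}\big)$$ for a.e. $x\in E$ and all $u,u_1,u_2\in\mathbb{R}$, $\xi,\xi_1,\xi_2\in\mathbb{R}^N$. Suppose that $w$ is a non-negative weak solution to $\partial_t(|w|^{q-1}w)-\operatorname{div}\mathbf{A}(x,w,Dw)=0$ in $E_T$, and that $v$ is a non-negative weak solution to the Cauchy-Dirichlet problem $$\partial_t(|v|^{q-1}v)-\operatorname{div}\mathbf{A}(x,v,Dv)=0\ \text{in }E_T,\qquad v=0\ \text{on }\partial E\times(0,T],\qquad v(\cdot,0)=v_o\ \text{in }E,$$ with $v_o\ge0$, $v_o\in L^{q+1}(E)$. If $v_o\le w(\cdot,0)$ a.e. in $E$, then $v\le w$ a.e. in $E_T$.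
   Context: $E\subset\mathbb{R}^N$ is open and bounded, $T>0$, $E_T=E\times(0,T]$. Carathéodory means measurable in $x$ for every $(u,\xi)$ and continuous in $(u,\xi)$ for a.e. $x$. A function $u$ is a weak solution to the Cauchy-Dirichlet problem with initial datum $u_o\in L^{q+1}(E)$ and lateral datum $g\in L^p(0,T;W^{1,p}(E))$ if $u\in C([0,T];L^{q+1}(E))\cap\big(g+L^p(0,T;W^{1,p}_0(E))\big)$ and $$\iint_{E_T}\Big[\big(|u_o|^{q-1}u_o-|u|^{q-1}u\big)\partial_t\zeta+\mathbf{A}(x,u,Du)\cdot D\zeta\Big]\,dx\,dt=0$$ for every $\zeta\in W^{1,q+1}(0,T;L^{q+1}(E))\cap L^p(0,T;W^{1,p}_0(E))$ with $\zeta(\cdot,T)=0$. For $v$ this is required with $g\equiv0$ and $u_o=v_o$. For $w$, being a weak solution to the equation in this sense means $w\in C([0,T];L^{q+1}(E))\cap L^p(0,T;W^{1,p}(E))$ and the same identity holds with $u_o=w(\cdot,0)$ (no condition on the lateral values). *)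

theory Defs
  imports "HOL-Analysis.Analysis"
begin

text \<open>
  Elements of Lebesgue and Sobolev spaces are represented by functions, and
  equality of elements by equality almost everywhere; the norms below are
  therefore seminorms on functions. A function of space and time is a function
  of the pair \<open>(x, t)\<close>, and \<open>\<lambda>x. u (x, t)\<close> is the slice $u(\cdot,t)$.
\<close>

subsection \<open>Lebesgue and Sobolev spaces\<close>

definition Lp_space :: "'a measure \<Rightarrow> real \<Rightarrow> ('a \<Rightarrow> 'b::real_normed_vector) set" where
  "Lp_space M r =
     {f \<in> borel_measurable M. integrable M (\<lambda>x. norm (f x) powr r)}"

definition Lp_norm :: "'a measure \<Rightarrow> real \<Rightarrow> ('a \<Rightarrow> 'b::real_normed_vector) \<Rightarrow> real" where
  "Lp_norm M r f = (\<integral>x. norm (f x) powr r \<partial>M) powr (1 / r)"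

primrec Ck :: "nat \<Rightarrow> ('a::euclidean_space \<Rightarrow> real) \<Rightarrow> bool" where
  "Ck 0 f \<longleftrightarrow> continuous_on UNIV f"
| "Ck (Suc k) f \<longleftrightarrow>
     f differentiable_on UNIV \<and> (\<forall>i\<in>Basis. Ck k (\<lambda>x. frechet_derivative f (at x) i))"

definition test_functions :: "'a::euclidean_space set \<Rightarrow> ('a \<Rightarrow> real) set" where
  "test_functions E =
     {\<phi>. (\<forall>k. Ck k \<phi>) \<and> (\<exists>K. compact K \<and> K \<subseteq> E \<and> (\<forall>x. x \<notin> K \<longrightarrow> \<phi> x = 0))}"

definition has_weak_gradient ::
  "'a::euclidean_space set \<Rightarrow> ('a \<Rightarrow> real) \<Rightarrow> ('a \<Rightarrow> 'a) \<Rightarrow> bool" where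
  "has_weak_gradient E u G \<longleftrightarrow>
     (\<forall>K. compact K \<and> K \<subseteq> E \<longrightarrow> u absolutely_integrable_on K \<and> G absolutely_integrable_on K) \<and>
     (\<forall>\<phi>\<in>test_functions E. \<forall>i\<in>Basis.
        (\<integral>x. u x * frechet_derivative \<phi> (at x) i \<partial>lebesgue_on E) =
        - (\<integral>x. (G x \<bullet> i) * \<phi> x \<partial>lebesgue_on E))"

text \<open>Weak gradients are unique up to null sets, so the choice below is immaterial.\<close>

definition weak_gradient ::
  "'a::euclidean_space set \<Rightarrow> ('a \<Rightarrow> real) \<Rightarrow> ('a \<Rightarrow> 'a)" where
  "weak_gradient E u = (SOME G. has_weak_gradient E u G)"

definition W1p :: "'a::euclidean_space set \<Rightarrow> real \<Rightarrow> ('a \<Rightarrow> real) set" where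
  "W1p E p =
     {u \<in> Lp_space (lebesgue_on E) p.
        \<exists>G \<in> Lp_space (lebesgue_on E) p. has_weak_gradient E u G}"

definition W1p_norm :: "'a::euclidean_space set \<Rightarrow> real \<Rightarrow> ('a \<Rightarrow> real) \<Rightarrow> real" where
  "W1p_norm E p u =
     (Lp_norm (lebesgue_on E) p u powr p
        + Lp_norm (lebesgue_on E) p (weak_gradient E u) powr p) powr (1 / p)"

definition W1p0 :: "'a::euclidean_space set \<Rightarrow> real \<Rightarrow> ('a \<Rightarrow> real) set" where
  "W1p0 E p =
     {u \<in> W1p E p. \<exists>\<phi> :: nat \<Rightarrow> 'a \<Rightarrow> real.
        (\<forall>n. \<phi> n \<in> test_functions E) \<and>
        (\<lambda>n. W1p_norm E p (\<lambda>x. \<phi> n x - u x)) \<longlonglongrightarrow> 0}"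

subsection \<open>Spaces of functions of time with values in a function space\<close>

text \<open>
  \<open>X\<close> is a linear space of functions on \<open>E\<close> with seminorm \<open>nrm\<close>, and \<open>I\<close> is a
  time interval. Joint measurability only restricts the choice of
  representatives: every curve in the spaces $L^r(I;X)$ and $C(I;X)$ occurring
  here has a jointly measurable representative, in the second case with the
  prescribed class at every time. It makes ``a.e. in $E \times I$'' and
  integrals over $E \times I$ meaningful.
\<close>

definition strongly_measurable ::
  "real set \<Rightarrow> ('a \<Rightarrow> real) set \<Rightarrow> (('a \<Rightarrow> real) \<Rightarrow> real) \<Rightarrow> ('a \<times> real \<Rightarrow> real) \<Rightarrow> bool" where
  "strongly_measurable I X nrm u \<longleftrightarrow>
     (\<exists>s :: nat \<Rightarrow> real \<Rightarrow> 'a \<Rightarrow> real.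
        (\<forall>n. simple_function (lebesgue_on I) (s n) \<and> s n ` I \<subseteq> X) \<and>
        (AE t in lebesgue_on I. (\<lambda>n. nrm (\<lambda>x. s n t x - u (x, t))) \<longlonglongrightarrow> 0))"

definition bochner_Lp ::
  "real \<Rightarrow> real set \<Rightarrow> 'a::euclidean_space set \<Rightarrow> ('a \<Rightarrow> real) set \<Rightarrow> (('a \<Rightarrow> real) \<Rightarrow> real)
     \<Rightarrow> ('a \<times> real \<Rightarrow> real) set" where
  "bochner_Lp r I E X nrm =
     {u \<in> borel_measurable (lebesgue_on (E \<times> I)).
        (AE t in lebesgue_on I. (\<lambda>x. u (x, t)) \<in> X) \<and>
        strongly_measurable I X nrm u \<and>
        integrable (lebesgue_on I) (\<lambda>t. nrm (\<lambda>x. u (x, t)) powr r)}"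

definition continuous_curves ::
  "real set \<Rightarrow> 'a::euclidean_space set \<Rightarrow> ('a \<Rightarrow> real) set \<Rightarrow> (('a \<Rightarrow> real) \<Rightarrow> real)
     \<Rightarrow> ('a \<times> real \<Rightarrow> real) set" where
  "continuous_curves I E X nrm =
     {u \<in> borel_measurable (lebesgue_on (E \<times> I)).
        (\<forall>t\<in>I. (\<lambda>x. u (x, t)) \<in> X) \<and>
        (\<forall>t\<in>I. ((\<lambda>s. nrm (\<lambda>x. u (x, s) - u (x, t))) \<longlongrightarrow> 0) (at t within I))}"

definition L_L :: "real \<Rightarrow> real \<Rightarrow> 'a::euclidean_space set \<Rightarrow> ('a \<times> real \<Rightarrow> real) set" where
  "L_L r T E =
     bochner_Lp r {0<..<T} E (Lp_space (lebesgue_on E) r) (Lp_norm (lebesgue_on E) r)"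

definition L_W :: "real \<Rightarrow> real \<Rightarrow> 'a::euclidean_space set \<Rightarrow> ('a \<times> real \<Rightarrow> real) set" where
  "L_W p T E = bochner_Lp p {0<..<T} E (W1p E p) (W1p_norm E p)"

definition L_W0 :: "real \<Rightarrow> real \<Rightarrow> 'a::euclidean_space set \<Rightarrow> ('a \<times> real \<Rightarrow> real) set" where
  "L_W0 p T E = bochner_Lp p {0<..<T} E (W1p0 E p) (W1p_norm E p)"

definition C_L :: "real \<Rightarrow> real \<Rightarrow> 'a::euclidean_space set \<Rightarrow> ('a \<times> real \<Rightarrow> real) set" where
  "C_L r T E =
     continuous_curves {0..T} E (Lp_space (lebesgue_on E) r) (Lp_norm (lebesgue_on E) r)"

definition has_spatial_gradient ::
  "real \<Rightarrow> 'a::euclidean_space set \<Rightarrow> ('a \<times> real \<Rightarrow> real) \<Rightarrow> ('a \<times> real \<Rightarrow> 'a) \<Rightarrow> bool" where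
  "has_spatial_gradient T E u G \<longleftrightarrow>
     G \<in> borel_measurable (lebesgue_on (E \<times> {0<..<T})) \<and>
     (AE t in lebesgue_on {0<..<T}. has_weak_gradient E (\<lambda>x. u (x, t)) (\<lambda>x. G (x, t)))"

text \<open>
  The vector-valued weak derivative in time; the integrals over $(0,T)$ with
  values in $L^r(E)$ are evaluated pointwise, for a.e. \<open>x\<close>.
\<close>

definition has_weak_time_derivative ::
  "real \<Rightarrow> 'a::euclidean_space set \<Rightarrow> ('a \<times> real \<Rightarrow> real) \<Rightarrow> ('a \<times> real \<Rightarrow> real) \<Rightarrow> bool" where
  "has_weak_time_derivative T E u v \<longleftrightarrow>
     (\<forall>\<phi>\<in>test_functions {0<..<T}. AE x in lebesgue_on E.
        (\<integral>t. u (x, t) * deriv \<phi> t \<partial>lebesgue_on {0<..<T}) =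
        - (\<integral>t. v (x, t) * \<phi> t \<partial>lebesgue_on {0<..<T}))"

definition W_L :: "real \<Rightarrow> real \<Rightarrow> 'a::euclidean_space set \<Rightarrow> ('a \<times> real \<Rightarrow> real) set" where
  "W_L r T E = {u \<in> L_L r T E. \<exists>v \<in> L_L r T E. has_weak_time_derivative T E u v}"

subsection \<open>Weak solutions\<close>

definition caratheodory ::
  "'a::euclidean_space set \<Rightarrow> ('a \<Rightarrow> real \<Rightarrow> 'a \<Rightarrow> 'a) \<Rightarrow> bool" where
  "caratheodory E A \<longleftrightarrow>
     (\<forall>u \<xi>. (\<lambda>x. A x u \<xi>) \<in> borel_measurable (lebesgue_on E)) \<and>
     (AE x in lebesgue_on E. continuous_on UNIV (\<lambda>(u, \<xi>). A x u \<xi>))"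

text \<open>$|s|^{q-1}s$; its value at $s=0$ is $0$ for every $q$, as \<open>0 powr a = 0\<close>.\<close>

definition signed_power :: "real \<Rightarrow> real \<Rightarrow> real" where
  "signed_power q s = \<bar>s\<bar> powr (q - 1) * s"

text \<open>
  Every element of $W^{1,q+1}(0,T;L^{q+1}(E))$ has a representative in
  $C([0,T];L^{q+1}(E))$; the condition $\zeta(\cdot,T)=0$ refers to it, so test
  functions are taken to be given by this representative.
\<close>

definition parabolic_tests ::
  "'a::euclidean_space set \<Rightarrow> real \<Rightarrow> real \<Rightarrow> real \<Rightarrow> ('a \<times> real \<Rightarrow> real) set" where
  "parabolic_tests E T p q =
     {\<zeta> \<in> W_L (q + 1) T E \<inter> L_W0 p T E.
        \<zeta> \<in> C_L (q + 1) T E \<and> (AE x in lebesgue_on E. \<zeta> (x, T) = 0)}"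

definition weak_identity ::
  "'a::euclidean_space set \<Rightarrow> real \<Rightarrow> real \<Rightarrow> real \<Rightarrow> ('a \<Rightarrow> real \<Rightarrow> 'a \<Rightarrow> 'a)
     \<Rightarrow> ('a \<Rightarrow> real) \<Rightarrow> ('a \<times> real \<Rightarrow> real) \<Rightarrow> bool" where
  "weak_identity E T p q A u\<^sub>o u \<longleftrightarrow>
     (\<exists>Du. has_spatial_gradient T E u Du \<and>
       (\<forall>\<zeta> \<zeta>\<^sub>t D\<zeta>.
          \<zeta> \<in> parabolic_tests E T p q \<and>
          \<zeta>\<^sub>t \<in> L_L (q + 1) T E \<and> has_weak_time_derivative T E \<zeta> \<zeta>\<^sub>t \<and>
          has_spatial_gradient T E \<zeta> D\<zeta> \<longrightarrow>
          (\<integral>(x, t). (signed_power q (u\<^sub>o x) - signed_power q (u (x, t))) * \<zeta>\<^sub>t (x, t)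
                    + A x (u (x, t)) (Du (x, t)) \<bullet> D\<zeta> (x, t)
             \<partial>lebesgue_on (E \<times> {0<..T})) = 0))"

definition weak_solution_CD ::
  "'a::euclidean_space set \<Rightarrow> real \<Rightarrow> real \<Rightarrow> real \<Rightarrow> ('a \<Rightarrow> real \<Rightarrow> 'a \<Rightarrow> 'a)
     \<Rightarrow> ('a \<times> real \<Rightarrow> real) \<Rightarrow> ('a \<Rightarrow> real) \<Rightarrow> ('a \<times> real \<Rightarrow> real) \<Rightarrow> bool" where
  "weak_solution_CD E T p q A g u\<^sub>o u \<longleftrightarrow>
     u\<^sub>o \<in> Lp_space (lebesgue_on E) (q + 1) \<and> g \<in> L_W p T E \<and>
     u \<in> C_L (q + 1) T E \<and> (\<lambda>z. u z - g z) \<in> L_W0 p T E \<and>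
     weak_identity E T p q A u\<^sub>o u"

definition weak_solution ::
  "'a::euclidean_space set \<Rightarrow> real \<Rightarrow> real \<Rightarrow> real \<Rightarrow> ('a \<Rightarrow> real \<Rightarrow> 'a \<Rightarrow> 'a)
     \<Rightarrow> ('a \<times> real \<Rightarrow> real) \<Rightarrow> bool" where
  "weak_solution E T p q A u \<longleftrightarrow>
     u \<in> C_L (q + 1) T E \<and> u \<in> L_W p T E \<and> weak_identity E T p q A (\<lambda>x. u (x, 0)) u"

end

theory Submission
  imports Defs
begin

text \<open>
  Write $b(s) = |s|^{q-1}s$. Weak solutions have no time derivative, so $v(\cdot,t)$ and $w(\cdot,s)$ are
  compared at independent times $t$, $s$ (Kruzhkov's doubling). For fixed $s$ the equation of $v$ is
  tested with $H_\delta(v(\cdot,t) - w(\cdot,s))$, and for fixed $t$ the equation of $w$ with the same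
  function, where $H_\delta$ is a smooth approximation of the Heaviside function. This function is
  admissible because $w \ge 0$ and $v$ vanishes on the lateral boundary; the missing time regularity is
  replaced by convexity of the primitive of $y \mapsto H_\delta(b^{-1}(y) - k)$. In the sum of the two
  energy inequalities, integrated over a square of times, the gradient terms have a sign by
  monotonicity, and the error from the dependence of the field on $u$ is bounded by
  $|r| H_\delta'(r)$ with $r = v - w$, which is bounded and tends to $0$ with $\delta$. In the limit
  $F(t,s) = \int_E (b(v(x,t)) - b(w(x,s)))_+\,dx$ satisfies $\partial_t F + \partial_s F \le 0$ in an
  integrated sense, so $F(\tau,\tau) \le F(0,0) = 0$.
\<close>

subsection \<open>Smooth functions\<close>

text \<open>At a common time, testing with H(v - w) would need a time derivative of the test
  function itself. With the other solution frozen, the level k in H(v(.,t) - k) does not depend on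
  t, and a one-sided difference inequality replaces the chain rule in time. Freezing at different
  times costs nothing in the space terms: the field does not depend on t, so both fluxes are values
  of the same field at the same x.

  The cutoff is H(r) = m^2 / (d + m^2) with m = max 0 r. It is C^1 with bounded derivative, so the
  chain rule for weak gradients applies, and |r| H'(r) <= 1/2 for every d. The flux difference is
  split so that the Lipschitz condition is used at the gradient of w only; up to a constant the
  error then has the d-independent majorant (1 + |Dw|^(p-1)) |Dv - Dw|, integrable by Young's
  inequality.

  Since 0 <= H <= 1 and E is bounded, the test functions lie in L^(q+1) without any relation between
  p and q. Fubini arguments run on Borel representatives extended by zero, because slices of
  Lebesgue measurable functions need not be measurable.\<close>

lemma Ck_Suc_I:
  fixes f :: "'a::euclidean_space \<Rightarrow> real"
  assumes "\<And>x. (f has_derivative f' x) (at x)" and "\<And>i. i \<in> Basis \<Longrightarrow> Ck k (\<lambda>x. f' x i)"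
  shows "Ck (Suc k) f"
proof -
  have "frechet_derivative f (at x) = f' x" for x
    using frechet_derivative_at[OF assms(1)] by simp
  moreover have "f differentiable_on UNIV"
    using assms(1) by (auto simp: differentiable_on_def differentiable_def)
  ultimately show ?thesis using assms(2) by simp
qed

lemma Ck_Suc_D:
  fixes f :: "'a::euclidean_space \<Rightarrow> real"
  assumes "Ck (Suc k) f"
  shows "(f has_derivative frechet_derivative f (at x)) (at x)"
    and "\<And>i. i \<in> Basis \<Longrightarrow> Ck k (\<lambda>x. frechet_derivative f (at x) i)"
  using assms by (auto simp: differentiable_on_def frechet_derivative_works)

lemma Ck_continuous: "Ck k f \<Longrightarrow> continuous_on UNIV f"
  by (cases k) (auto intro: differentiable_imp_continuous_on)

lemma Ck_Suc_imp: "Ck (Suc k) f \<Longrightarrow> Ck k f"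
proof (induction k arbitrary: f)
  case 0 then show ?case using Ck_continuous[OF 0] by simp
next
  case (Suc k)
  show ?case
    by (rule Ck_Suc_I[OF Ck_Suc_D(1)[OF Suc.prems]]) (use Suc.IH Ck_Suc_D(2)[OF Suc.prems] in blast)
qed

lemma Ck_const: "Ck k (\<lambda>_::'a::euclidean_space. c)"
proof (induction k arbitrary: c)
  case (Suc k)
  show ?case
    by (rule Ck_Suc_I[where f'="\<lambda>_ _. 0"]) (rule has_derivative_const, rule Suc)
qed simp

lemma Ck_inner: "Ck k (\<lambda>x::'a::euclidean_space. x \<bullet> a)"
proof (cases k)
  case (Suc m)
  show ?thesis unfolding Suc
    by (rule Ck_Suc_I[where f'="\<lambda>_ h. h \<bullet> a"])
      (rule bounded_linear_imp_has_derivative[OF bounded_linear_inner_left], rule Ck_const)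
qed (auto intro!: continuous_intros)

lemma Ck_add: "Ck k f \<Longrightarrow> Ck k g \<Longrightarrow> Ck k (\<lambda>x. f x + g x)"
proof (induction k arbitrary: f g)
  case (Suc k)
  show ?case
    by (rule Ck_Suc_I[OF has_derivative_add[OF Ck_Suc_D(1)[OF Suc.prems(1)] Ck_Suc_D(1)[OF Suc.prems(2)]]])
      (intro Suc.IH Ck_Suc_D(2)[OF Suc.prems(1)] Ck_Suc_D(2)[OF Suc.prems(2)])
qed (auto intro!: continuous_intros)

lemma Ck_mult: "Ck k f \<Longrightarrow> Ck k g \<Longrightarrow> Ck k (\<lambda>x. f x * g x)"
proof (induction k arbitrary: f g)
  case (Suc k)
  show ?case
    by (rule Ck_Suc_I[OF has_derivative_mult[OF Ck_Suc_D(1)[OF Suc.prems(1)] Ck_Suc_D(1)[OF Suc.prems(2)]]])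
      (intro Ck_add Suc.IH Ck_Suc_D(2)[OF Suc.prems(1)] Ck_Suc_D(2)[OF Suc.prems(2)]
        Ck_Suc_imp[OF Suc.prems(1)] Ck_Suc_imp[OF Suc.prems(2)])
qed (auto intro!: continuous_intros)

lemma Ck_cmult: "Ck k f \<Longrightarrow> Ck k (\<lambda>x. c * f x)"
  by (intro Ck_mult Ck_const)

lemma has_derivative_affine:
  fixes f :: "'a::euclidean_space \<Rightarrow> real"
  assumes "(f has_derivative f') (at (c *\<^sub>R x + a))"
  shows "((\<lambda>x. f (c *\<^sub>R x + a)) has_derivative (\<lambda>h. c * f' h)) (at x)"
proof -
  have "((\<lambda>x. c *\<^sub>R x + a) has_derivative (\<lambda>h. c *\<^sub>R h)) (at x)"
    by (auto intro!: derivative_eq_intros)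
  from has_derivative_compose[OF this assms]
  show ?thesis
    using linear_scale[OF has_derivative_linear[OF assms]] by simp
qed

lemma Ck_affine: "Ck k f \<Longrightarrow> Ck k (\<lambda>x. f (c *\<^sub>R x + a))"
proof (induction k arbitrary: f)
  case 0
  then have "continuous_on UNIV f" by simp
  then show ?case
    by (auto intro!: continuous_on_compose2[of UNIV f] continuous_intros)
next
  case (Suc k)
  show ?case
    by (rule Ck_Suc_I[OF has_derivative_affine[OF Ck_Suc_D(1)[OF Suc.prems(1)]]])
      (intro Ck_cmult Suc.IH Ck_Suc_D(2)[OF Suc.prems(1)])
qed

subsection \<open>A smooth bump function\<close>

text \<open>The negative powers of s are included because the family is closed under
  differentiation: by \<open>flat_deriv\<close> each derivative is a combination of two other
  members.\<close>

definition flat :: "nat \<Rightarrow> real \<Rightarrow> real" where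
  "flat m s = (if s > 0 then exp (- 1 / s) / s ^ m else 0)"

lemma flat_over_tendsto: "((\<lambda>h. flat m h / h) \<longlongrightarrow> 0) (at 0)"
proof -
  have l: "((\<lambda>h. flat m h / h) \<longlongrightarrow> 0) (at_left 0)"
    by (rule tendsto_eventually) (auto simp: flat_def eventually_at_filter)
  \<comment> \<open>The limit from the right is reduced to this one by u = 1/h.\<close>
  have e: "((\<lambda>u::real. u ^ (Suc m) / exp u) \<longlongrightarrow> 0) at_top"
    by (rule tendsto_power_div_exp_0)
  have "((\<lambda>h::real. (1/h) ^ (Suc m) / exp (1/h)) \<longlongrightarrow> 0) (at_right 0)"
    by (rule filterlim_compose[OF e]) (simp add: filterlim_inverse_at_top_right flip: inverse_eq_divide)
  moreover have "eventually (\<lambda>h. (1/h) ^ (Suc m) / exp (1/h) = flat m h / h) (at_right 0)"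
    unfolding eventually_at_filter
    by (rule always_eventually) (auto simp: flat_def exp_minus field_simps)
  ultimately have "((\<lambda>h. flat m h / h) \<longlongrightarrow> 0) (at_right 0)"
    by (rule Lim_transform_eventually)
  with l show ?thesis by (simp add: filterlim_split_at)
qed

lemma flat_deriv: "(flat m has_real_derivative (flat (m + 2) s - m * flat (m + 1) s)) (at s)"
proof (cases s "0::real" rule: linorder_cases)
  case less
  have "((\<lambda>_. 0) has_real_derivative (flat (m + 2) s - m * flat (m + 1) s)) (at s)"
    using less by (auto simp: flat_def)
  then show ?thesis
    by (rule has_field_derivative_transform_within_open[where S="{..<0}"]) (use less in \<open>auto simp: flat_def\<close>)
next
  case equal
  then show ?thesis
    using flat_over_tendsto[of m] by (simp add: has_field_derivative_iff flat_def)
next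
  case greater
  have "((\<lambda>s. exp (- 1 / s) / s ^ m) has_real_derivative (flat (m + 2) s - m * flat (m + 1) s)) (at s)"
    using greater
    apply (auto intro!: derivative_eq_intros simp: flat_def)
    apply (cases m)
     apply (auto simp: field_simps power2_eq_square)
    done
  then show ?thesis
    by (rule has_field_derivative_transform_within_open[where S="{0<..}"]) (use greater in \<open>auto simp: flat_def\<close>)
qed

text \<open>Induction on k with m arbitrary, since differentiation replaces m by m + 1 and m + 2;
  the remaining factor -2 (x . i) is linear in x.\<close>

lemma Ck_flat: "Ck k (\<lambda>x::'a::euclidean_space. flat m (1 - x \<bullet> x))"
proof (induction k arbitrary: m)
  case 0
  have "continuous_on UNIV (flat m)"
    using flat_deriv by (meson DERIV_isCont continuous_at_imp_continuous_on)
  then show ?case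
    by (auto intro!: continuous_on_compose2[of UNIV "flat m"] continuous_intros)
next
  case (Suc k)
  let ?d = "\<lambda>x::'a. flat (m + 2) (1 - x \<bullet> x) - m * flat (m + 1) (1 - x \<bullet> x)"
  have "((\<lambda>x::'a. flat m (1 - x \<bullet> x)) has_derivative (\<lambda>h. ?d x * (-2 * (x \<bullet> h)))) (at x)" for x
  proof -
    have "((\<lambda>x::'a. 1 - x \<bullet> x) has_derivative (\<lambda>h. -2 * (x \<bullet> h))) (at x)"
      by (auto intro!: derivative_eq_intros simp: inner_commute)
    from has_derivative_compose[OF this flat_deriv[THEN has_field_derivative_imp_has_derivative]]
    show ?thesis .
  qed
  then show ?case
  proof (rule Ck_Suc_I)
    fix i :: 'a assume "i \<in> Basis"
    have "Ck k (\<lambda>x. (flat (m + 2) (1 - x \<bullet> x) + (- m) * flat (m + 1) (1 - x \<bullet> x)) * (-2 * (x \<bullet> i)))"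
      by (intro Ck_mult Ck_add Ck_const Suc Ck_inner)
    then show "Ck k (\<lambda>x. ?d x * (-2 * (x \<bullet> i)))" by simp
  qed
qed

definition mollifier :: "'a::euclidean_space \<Rightarrow> real" where
  "mollifier x = flat 0 (1 - x \<bullet> x) / (LINT (x::'a)|lborel. flat 0 (1 - x \<bullet> x))"

lemma flat_nonneg: "flat m s \<ge> 0"
  by (simp add: flat_def)

lemma flat_bump_integral_pos: "(LINT (x::'a::euclidean_space)|lborel. flat 0 (1 - x \<bullet> x)) > 0"
  and flat_bump_integrable: "integrable lborel (\<lambda>x::'a::euclidean_space. flat 0 (1 - x \<bullet> x))"
proof -
  let ?f = "\<lambda>x::'a. flat 0 (1 - x \<bullet> x)"
  have c: "continuous_on UNIV ?f" using Ck_flat Ck_continuous by blast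
  have z: "?f x = 0" if "x \<notin> cball 0 1" for x
  proof -
    have "1 < norm x" using that by auto
    then have "1 < (norm x)\<^sup>2" by (simp add: one_less_power)
    then show ?thesis by (simp add: flat_def dot_square_norm)
  qed
  have "integrable lborel (\<lambda>x. indicator (cball 0 1) x *\<^sub>R ?f x)"
    by (rule borel_integrable_compact) (auto intro: continuous_on_subset[OF c])
  moreover have "(\<lambda>x. indicator (cball 0 1) x *\<^sub>R ?f x) = ?f"
    using z by (auto simp: indicator_def fun_eq_iff)
  ultimately show i: "integrable lborel ?f" by simp
  \<comment> \<open>A vanishing integral would make the bump vanish almost everywhere, although it
    is positive on the open unit ball, which is not a null set.\<close>
  have "(LINT x|lborel. ?f x) \<noteq> 0"
  proof
    assume "(LINT x|lborel. ?f x) = 0"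
    then have "AE x in lborel. ?f x = 0"
      using integral_nonneg_eq_0_iff_AE[OF i] flat_nonneg by auto
    then have "AE x in lborel. x \<notin> ball (0::'a) 1"
    proof eventually_elim
      case (elim x)
      show ?case
      proof
        assume "x \<in> ball 0 1"
        then have "(norm x)\<^sup>2 < 1" by (simp add: abs_square_less_1)
        with elim show False by (simp add: flat_def dot_square_norm)
      qed
    qed
    then have "ball (0::'a) 1 \<in> null_sets lborel"
      by (subst (asm) AE_iff_null_sets[symmetric]) auto
    moreover have "ball (0::'a) 1 \<notin> null_sets lborel"
      using open_not_negligible[of "ball (0::'a) 1"]
      by (auto simp: negligible_iff_null_sets null_sets_completionI)
    ultimately show False by simp
  qed
  moreover have "(LINT x|lborel. ?f x) \<ge> 0" by (simp add: flat_nonneg)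
  ultimately show "(LINT x|lborel. ?f x) > 0" by simp
qed

lemma mollifier_nonneg: "mollifier x \<ge> 0"
  unfolding mollifier_def using flat_bump_integral_pos flat_nonneg by (simp add: less_imp_le)

lemma mollifier_integral: "(LINT x|(lborel :: 'a::euclidean_space measure). mollifier x) = 1"
  and mollifier_integrable: "integrable (lborel :: 'a::euclidean_space measure) mollifier"
  unfolding mollifier_def using flat_bump_integral_pos[where 'a='a] integrable_divide[OF flat_bump_integrable[where 'a='a]] by auto

lemma mollifier_Ck: "Ck k mollifier"
  using Ck_cmult[OF Ck_flat, of k "1 / (LINT (x::'a)|lborel. flat 0 (1 - x \<bullet> x))" 0]
  by (simp add: mollifier_def[abs_def])

lemma mollifier_zero: "norm x \<ge> 1 \<Longrightarrow> mollifier x = 0"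
  by (simp add: mollifier_def flat_def dot_square_norm abs_square_less_1)

definition mol :: "real \<Rightarrow> 'a::euclidean_space \<Rightarrow> real" where
  "mol e x = mollifier (x /\<^sub>R e) / e ^ DIM('a)"

lemma mol_nonneg: "e > 0 \<Longrightarrow> mol e x \<ge> 0"
  by (simp add: mol_def mollifier_nonneg)

lemma mol_Ck: "Ck k (mol e)"
  using Ck_cmult[OF Ck_affine[OF mollifier_Ck], of k "1 / e ^ DIM('a)" "inverse e" 0]
  by (simp add: mol_def[abs_def])

lemma mol_zero: "e > 0 \<Longrightarrow> norm x \<ge> e \<Longrightarrow> mol e x = 0"
  unfolding mol_def by (subst mollifier_zero) (auto simp: divide_inverse_commute[symmetric])

text \<open>The dilation x -> e x scales Lebesgue measure by exactly the factor e^N that the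
  definition of \<open>mol\<close> divides out.\<close>

lemma mol_integral:
  fixes e :: real
  assumes "e > 0" shows "(LINT (x::'a::euclidean_space)|lborel. mol e x) = 1"
    and "integrable lborel (mol e :: 'a \<Rightarrow> real)"
proof -
  have L: "lborel = density (distr lborel borel (\<lambda>x::'a. e *\<^sub>R x)) (\<lambda>_. ennreal (e ^ DIM('a)))"
    using lborel_affine[of e "0::'a"] assms by simp
  have m[measurable]: "mollifier \<in> borel_measurable (borel :: 'a measure)"
    using Ck_continuous[OF mollifier_Ck] borel_measurable_continuous_onI by blast
  have mm[measurable]: "mol e \<in> borel_measurable (borel :: 'a measure)"
    using Ck_continuous[OF mol_Ck] borel_measurable_continuous_onI by blast
  have eq: "(\<lambda>x::'a. e ^ DIM('a) *\<^sub>R mol e (e *\<^sub>R x)) = mollifier"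
    using assms by (auto simp: mol_def fun_eq_iff)
  note I = mollifier_integrable[where 'a='a, folded eq] mollifier_integral[where 'a='a, folded eq]
  have "integrable lborel (mol e :: 'a \<Rightarrow> real) \<longleftrightarrow> integrable lborel (\<lambda>x::'a. e ^ DIM('a) *\<^sub>R mol e (e *\<^sub>R x))"
    by (subst (1) L, subst integrable_density)
      (use assms in \<open>simp_all add: integrable_distr_eq del: integrable_mult_right_iff\<close>)
  then show "integrable lborel (mol e :: 'a \<Rightarrow> real)" using I(1) by (simp only:)
  have "(LINT (x::'a)|lborel. mol e x) = (LINT (x::'a)|lborel. e ^ DIM('a) *\<^sub>R mol e (e *\<^sub>R x))"
    by (subst (1) L, subst integral_density)
      (use assms in \<open>simp_all add: integral_distr del: integral_mult_right_zero\<close>)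
  then show "(LINT (x::'a)|lborel. mol e x) = 1" using I(2) by (simp only:)
qed

subsection \<open>Compactly supported functions and convolution\<close>

lemma linear_basis_expansion:
  fixes L :: "'a::euclidean_space \<Rightarrow> 'b::real_vector"
  assumes "linear L"
  shows "L h = (\<Sum>i\<in>Basis. (h \<bullet> i) *\<^sub>R L i)"
proof -
  have "L h = L (\<Sum>i\<in>Basis. (h \<bullet> i) *\<^sub>R i)"
    by (simp add: euclidean_representation)
  also have "\<dots> = (\<Sum>i\<in>Basis. (h \<bullet> i) *\<^sub>R L i)"
    by (simp add: linear_sum[OF assms] linear_scale[OF assms])
  finally show ?thesis .
qed

text \<open>The union is the Minkowski sum of \<open>K\<close> and a closed ball, hence
  compact.\<close>

lemma compact_neighbourhood:
  fixes K :: "'a::euclidean_space set"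
  assumes "compact K"
  shows "compact (\<Union>x\<in>K. cball x r)"
proof -
  have "(\<Union>x\<in>K. cball x r) = {x + y |x y. x \<in> K \<and> y \<in> cball 0 r}"
  proof safe
    fix x y assume "x \<in> K" "y \<in> cball x r"
    then show "\<exists>a b. y = a + b \<and> a \<in> K \<and> b \<in> cball 0 r"
      by (intro exI[of _ x] exI[of _ "y - x"]) (auto simp: dist_norm norm_minus_commute)
  next
    fix x y :: 'a assume "x \<in> K" "y \<in> cball 0 r"
    then show "x + y \<in> (\<Union>x\<in>K. cball x r)"
      by (intro UN_I[of x]) (auto simp: dist_norm)
  qed
  then show ?thesis using compact_sums[OF assms compact_cball[of 0 r]] by simp
qed

lemma subset_neighbourhood: "r \<ge> 0 \<Longrightarrow> K \<subseteq> (\<Union>x\<in>K. cball x r)"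
  by force

lemma neighbourhood_in_open:
  fixes K :: "'a::euclidean_space set"
  assumes "compact K" "open E" "K \<subseteq> E"
  obtains r where "r > 0" "(\<Union>x\<in>K. cball x r) \<subseteq> E"
proof -
  obtain e where e: "e > 0" "(\<Union>x\<in>K. ball x e) \<subseteq> E"
    using compact_subset_open_imp_ball_epsilon_subset[OF assms] by blast
  have "(\<Union>x\<in>K. cball x (e / 2)) \<subseteq> (\<Union>x\<in>K. ball x e)"
  proof (rule UN_mono)
    show "cball x (e / 2) \<subseteq> ball x e" for x :: 'a using e(1) by auto
  qed simp
  with e that[of "e / 2"] show ?thesis by auto
qed

lemma compact_support_bounded:
  fixes f :: "'a::euclidean_space \<Rightarrow> 'b::real_normed_vector"
  assumes "continuous_on UNIV f" "compact K" "\<And>x. x \<notin> K \<Longrightarrow> f x = 0"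
  obtains B where "B > 0" "\<And>x. norm (f x) \<le> B"
proof -
  have "bounded (f ` K)"
    using assms by (intro compact_imp_bounded compact_continuous_image continuous_on_subset[OF assms(1)]) auto
  then obtain B where "B > 0" "\<And>x. x \<in> K \<Longrightarrow> norm (f x) \<le> B"
    unfolding bounded_pos by auto
  then show ?thesis using that[of B] assms(3) by (metis less_imp_le norm_zero)
qed

lemma compact_support_integrable:
  fixes f :: "'a::euclidean_space \<Rightarrow> 'b::{banach, second_countable_topology}"
  assumes "continuous_on UNIV f" "compact K" "\<And>x. x \<notin> K \<Longrightarrow> f x = 0"
  shows "integrable lborel f"
proof -
  have "(\<lambda>x. indicator K x *\<^sub>R f x) = f"
    using assms(3) by (auto simp: fun_eq_iff indicator_def)
  then show ?thesis
    using borel_integrable_compact[OF assms(2) continuous_on_subset[OF assms(1)]] by simp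
qed

lemma compact_support_uniform:
  fixes f :: "'a::euclidean_space \<Rightarrow> 'b::real_normed_vector"
  assumes c: "continuous_on UNIV f" and K: "compact K" "\<And>x. x \<notin> K \<Longrightarrow> f x = 0" and e: "e > 0"
  obtains d where "d > 0" "\<And>x y. dist x y < d \<Longrightarrow> norm (f x - f y) < e"
proof -
  let ?K = "\<Union>x\<in>K. cball x 1"
  have "uniformly_continuous_on ?K f"
    by (intro compact_uniformly_continuous compact_neighbourhood K continuous_on_subset[OF c]) auto
  then obtain d where d: "d > 0" "\<And>x y. x \<in> ?K \<Longrightarrow> y \<in> ?K \<Longrightarrow> dist y x < d \<Longrightarrow> dist (f y) (f x) < e"
    using e unfolding uniformly_continuous_on_def by meson
  have "norm (f x - f y) < e" if "dist x y < min d 1" for x y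
  proof (cases "x \<in> K \<or> y \<in> K")
    case True
    then have "x \<in> ?K" "y \<in> ?K"
    proof -
      have "dist x y \<le> 1" "dist y x \<le> 1" using that by (auto simp: dist_commute)
      with True show "x \<in> ?K" "y \<in> ?K" by (metis UN_iff mem_cball dist_self zero_le_one)+
    qed
    then show ?thesis using d(2)[of y x] that by (simp add: dist_norm)
  next
    case False then show ?thesis using K(2) e by simp
  qed
  then show ?thesis using that[of "min d 1"] d(1) by simp
qed

text \<open>The complement of a compact set is open, so f vanishes in a whole neighbourhood of
  x.\<close>

lemma derivative_zero_off_support:
  fixes f :: "'a::euclidean_space \<Rightarrow> real"
  assumes d: "(f has_derivative f') (at x)" and K: "compact K" "\<And>x. x \<notin> K \<Longrightarrow> f x = 0" and x: "x \<notin> K"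
  shows "f' h = 0"
proof -
  have "(f has_derivative (\<lambda>_. 0)) (at x)"
    by (rule has_derivative_transform_within_open[of "\<lambda>_. 0" _ _ UNIV "- K"])
      (use K x in \<open>auto intro: compact_imp_closed\<close>)
  then show ?thesis using has_derivative_unique[OF d] by (simp add: fun_eq_iff)
qed

text \<open>Compact support makes the partial derivatives uniformly continuous, hence the remainder
  of the first-order expansion is small uniformly in x. This uniformity is what allows difference
  quotients to be integrated.\<close>

lemma uniform_taylor:
  fixes f :: "'a::euclidean_space \<Rightarrow> real"
  assumes d: "\<And>x. (f has_derivative f' x) (at x)"
    and c: "\<And>i. i \<in> Basis \<Longrightarrow> continuous_on UNIV (\<lambda>x. f' x i)"
    and K: "compact K" "\<And>x. x \<notin> K \<Longrightarrow> f x = 0" and e: "e > 0"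
  obtains \<delta> where "\<delta> > 0" "\<And>x h. norm h < \<delta> \<Longrightarrow> \<bar>f (x + h) - f x - f' x h\<bar> \<le> e * norm h"
proof -
  \<comment> \<open>Each partial derivative may contribute this share to the operator norm of the
    difference of two derivatives.\<close>
  let ?e = "e / DIM('a)"
  have e': "?e > 0" using e by simp
  have "\<exists>\<delta>>0. \<forall>x y. dist x y < \<delta> \<longrightarrow> norm (f' x i - f' y i) < ?e" if "i \<in> Basis" for i
    using compact_support_uniform[OF c[OF that] K(1) _ e'] derivative_zero_off_support[OF d K] by metis
  then obtain \<delta> where \<delta>: "\<And>i. i \<in> Basis \<Longrightarrow> \<delta> i > 0"
    "\<And>i x y. i \<in> Basis \<Longrightarrow> dist x y < \<delta> i \<Longrightarrow> norm (f' x i - f' y i) < ?e"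
    by metis
  define D where "D = Min (\<delta> ` (Basis :: 'a set))"
  have D: "D > 0" "\<And>i. i \<in> Basis \<Longrightarrow> D \<le> \<delta> i"
    unfolding D_def using \<delta>(1) by (auto simp: Min_gr_iff)
  have "\<bar>f (x + h) - f x - f' x h\<bar> \<le> e * norm h" if h: "norm h < D" for x h
  proof -
    have "norm (f (x + h) - f x - f' x (x + h - x)) \<le> norm (x + h - x) * e"
    proof (rule differentiable_bound_linearization[where S="cball x (norm h)"])
      show "x + t *\<^sub>R (x + h - x) \<in> cball x (norm h)" if "t \<in> {0..1}" for t
        using that by (auto simp: dist_norm intro: mult_left_le_one_le)
      show "(f has_derivative f' y) (at y within cball x (norm h))" for y
        using d by (rule has_derivative_at_withinI)
      show "x \<in> cball x (norm h)" by simp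
      fix y assume y: "y \<in> cball x (norm h)"
      show "onorm (f' y - f' x) \<le> e"
      proof (rule onorm_le)
        fix k
        have "norm ((f' y - f' x) k) = norm (\<Sum>i\<in>Basis. (k \<bullet> i) * (f' y i - f' x i))"
          using linear_basis_expansion[OF has_derivative_linear[OF d], of y k]
            linear_basis_expansion[OF has_derivative_linear[OF d], of x k]
          by (simp add: sum_subtractf[symmetric] right_diff_distrib)
        also have "\<dots> \<le> (\<Sum>i\<in>(Basis::'a set). norm k * ?e)"
        proof (rule sum_norm_le)
          fix i :: 'a assume i: "i \<in> Basis"
          have "dist y x < \<delta> i" using y h D(2)[OF i] by (auto simp: dist_commute)
          from \<delta>(2)[OF i this] show "norm ((k \<bullet> i) * (f' y i - f' x i)) \<le> norm k * ?e"
            using Basis_le_norm[OF i, of k] unfolding norm_mult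
            by (intro mult_mono) auto
        qed
        also have "\<dots> = e * norm k" by simp
        finally show "norm ((f' y - f' x) k) \<le> e * norm k" .
      qed
    qed
    then show ?thesis by (simp add: mult.commute)
  qed
  with D(1) that show ?thesis by blast
qed

section \<open>Translation and reflection invariance, and integrals of partial derivatives\<close>

lemma lborel_shift:
  fixes f :: "'a::euclidean_space \<Rightarrow> 'b::{banach, second_countable_topology}"
  assumes [measurable]: "f \<in> borel_measurable borel"
  shows lborel_integral_shift: "(LINT x|lborel. f (x + c)) = (LINT x|lborel. f x)"
    and lborel_integrable_shift: "integrable lborel (\<lambda>x. f (x + c)) \<longleftrightarrow> integrable lborel f"
proof -
  have L: "distr lborel borel (\<lambda>x. x + c) = lborel"
  proof -
    have "(\<lambda>x. x + c) = (+) c" by (rule ext) (rule add.commute)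
    then show ?thesis by (simp only: lborel_distr_plus)
  qed
  show "(LINT x|lborel. f (x + c)) = (LINT x|lborel. f x)"
    using integral_distr[of "\<lambda>x. x + c" lborel borel f] by (simp add: L)
  show "integrable lborel (\<lambda>x. f (x + c)) \<longleftrightarrow> integrable lborel f"
    using integrable_distr_eq[of "\<lambda>x. x + c" lborel borel f] by (simp add: L)
qed

lemma lborel_distr_reflect: "distr lborel borel (\<lambda>x::'a::euclidean_space. c - x) = lborel"
proof -
  have "(lborel :: 'a measure) = density (distr lborel borel (\<lambda>x. c - x)) (\<lambda>_. 1)"
    using lborel_affine[of "-1" c] by simp
  then show ?thesis by (simp add: density_1)
qed

lemma lborel_reflect:
  fixes f :: "'a::euclidean_space \<Rightarrow> 'b::{banach, second_countable_topology}"
  assumes [measurable]: "f \<in> borel_measurable borel"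
  shows lborel_integral_reflect: "(LINT x|lborel. f (c - x)) = (LINT x|lborel. f x)"
    and lborel_integrable_reflect: "integrable lborel (\<lambda>x. f (c - x)) \<longleftrightarrow> integrable lborel f"
  using integral_distr[of "\<lambda>x. c - x" lborel borel f] integrable_distr_eq[of "\<lambda>x. c - x" lborel borel f]
  by (simp_all add: lborel_distr_reflect)

text \<open>By translation invariance the difference quotients of f have integral zero; they
  converge to the derivative uniformly and are supported in a fixed compact set.\<close>

lemma integral_partial_derivative_zero:
  fixes f :: "'a::euclidean_space \<Rightarrow> real"
  assumes d: "\<And>x. (f has_derivative f' x) (at x)"
    and c: "\<And>i. i \<in> Basis \<Longrightarrow> continuous_on UNIV (\<lambda>x. f' x i)"
    and K: "compact K" "\<And>x. x \<notin> K \<Longrightarrow> f x = 0" and i: "i \<in> Basis"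
  shows "(LINT x|lborel. f' x i) = 0"
proof -
  let ?K = "\<Union>x\<in>K. cball x 1"
  have cf: "continuous_on UNIV f"
    using d by (meson continuous_at_imp_continuous_on has_derivative_continuous)
  have [measurable]: "f \<in> borel_measurable borel" using cf borel_measurable_continuous_onI by blast
  have int: "integrable lborel f" by (rule compact_support_integrable[OF cf K])
  have int': "integrable lborel (\<lambda>x. f' x i)"
    by (rule compact_support_integrable[OF c[OF i] K(1)]) (rule derivative_zero_off_support[OF d K])
  have mK: "emeasure lborel ?K < \<infinity>" by (intro emeasure_compact_finite compact_neighbourhood K)
  have sK: "?K \<in> sets lborel" using compact_imp_closed[OF compact_neighbourhood[OF K(1), of 1]] by simp
  have *: "\<bar>\<integral>x. f' x i \<partial>lborel\<bar> \<le> e * measure lborel ?K" if e: "e > 0" for e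
  proof -
    obtain \<delta> where \<delta>: "\<delta> > 0" "\<And>x h. norm h < \<delta> \<Longrightarrow> \<bar>f (x + h) - f x - f' x h\<bar> \<le> e * norm h"
      using uniform_taylor[OF d c K e] by blast
    \<comment> \<open>The bound s <= 1 keeps the support of the shifted function inside
      \<open>?K\<close>, the neighbourhood of radius 1.\<close>
    define s where "s = min (\<delta> / 2) 1"
    have s: "s > 0" "s < \<delta>" "s \<le> 1" using \<delta>(1) by (auto simp: s_def)
    have n: "norm (s *\<^sub>R i) = s" using s i by simp
    have fl: "f' x (s *\<^sub>R i) = s * f' x i" for x
      using linear_scale[OF has_derivative_linear[OF d]] by simp
    have b: "\<bar>f (x + s *\<^sub>R i) - f x - s * f' x i\<bar> \<le> indicator ?K x * (e * s)" for x
    proof (cases "x \<in> ?K")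
      case True then show ?thesis using \<delta>(2)[of "s *\<^sub>R i" x] n s fl by simp
    next
      case False
      have "x + s *\<^sub>R i \<notin> K"
      proof
        assume "x + s *\<^sub>R i \<in> K"
        moreover have "x \<in> cball (x + s *\<^sub>R i) 1" using n s by (simp add: dist_norm)
        ultimately show False using False by blast
      qed
      moreover have "x \<notin> K" using False by force
      ultimately show ?thesis using K(2) derivative_zero_off_support[OF d K] False by simp
    qed
    have eq: "s * (LINT x|lborel. f' x i) = - (LINT x|lborel. f (x + s *\<^sub>R i) - f x - s * f' x i)"
      using int int' by (simp add: lborel_integral_shift lborel_integrable_shift)
    have "s * \<bar>\<integral>x. f' x i \<partial>lborel\<bar> = \<bar>s * (LINT x|lborel. f' x i)\<bar>"
      using s by (simp add: abs_mult)
    also have "\<dots> = \<bar>\<integral>x. f (x + s *\<^sub>R i) - f x - s * f' x i \<partial>lborel\<bar>"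
      unfolding eq by (rule abs_minus_cancel)
    also have "\<dots> \<le> (LINT x|lborel. indicator ?K x * (e * s))"
      using sK mK int int' b unfolding real_norm_def[symmetric]
      by (intro order_trans[OF integral_norm_bound] integral_mono)
        (auto simp: lborel_integrable_shift)
    also have "\<dots> = s * (e * measure lborel ?K)" using sK mK by simp
    finally show ?thesis using s by simp
  qed
  show ?thesis
  proof (rule ccontr)
    assume ne: "\<not> ?thesis"
    let ?m = "measure lborel ?K" and ?a = "\<bar>\<integral>x. f' x i \<partial>lborel\<bar>"
    have "?a \<le> ?a / (2 * (?m + 1)) * ?m"
      using ne by (intro *) (auto intro!: divide_pos_pos add_nonneg_pos)
    also have "\<dots> < ?a" using ne measure_nonneg[of lborel ?K]
      by (simp add: field_simps add_pos_nonneg)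
    finally show False by simp
  qed
qed

text \<open>The kernel is scalar while f may be vector-valued, so that a function and its weak
  gradient are mollified by one and the same operation.\<close>

definition conv :: "('a::euclidean_space \<Rightarrow> real) \<Rightarrow> ('a \<Rightarrow> 'b::euclidean_space) \<Rightarrow> 'a \<Rightarrow> 'b" where
  "conv J f x = (LINT y|lborel. J (x - y) *\<^sub>R f y)"

lemma conv_integrable:
  fixes f :: "'a::euclidean_space \<Rightarrow> 'b::euclidean_space"
  assumes c: "continuous_on UNIV J" and K: "compact K" "\<And>x. x \<notin> K \<Longrightarrow> J x = 0" and f: "integrable lborel f"
  shows "integrable lborel (\<lambda>y. J (x - y) *\<^sub>R f y)"
proof -
  obtain B where B: "B > 0" "\<And>x. norm (J x) \<le> B" using compact_support_bounded[OF c K] by blast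
  have [measurable]: "J \<in> borel_measurable borel" using c borel_measurable_continuous_onI by blast
  show ?thesis
    by (rule Bochner_Integration.integrable_bound[OF integrable_scaleR_right[OF integrable_norm[OF f], of B]])
      (use B f in \<open>auto intro!: mult_right_mono borel_measurable_integrable\<close>)
qed

text \<open>The derivative falls on the kernel: by \<open>uniform_taylor\<close> the remainder is at
  most a small multiple of |h| times the integral of |f|, so mere integrability of f
  suffices.\<close>

lemma conv_has_derivative:
  fixes f J :: "'a::euclidean_space \<Rightarrow> real"
  assumes d: "\<And>x. (J has_derivative J' x) (at x)"
    and c: "\<And>i. i \<in> Basis \<Longrightarrow> continuous_on UNIV (\<lambda>x. J' x i)"
    and K: "compact K" "\<And>x. x \<notin> K \<Longrightarrow> J x = 0" and f: "integrable lborel f"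
  shows "(conv J f has_derivative (\<lambda>h. \<Sum>i\<in>Basis. (h \<bullet> i) * conv (\<lambda>z. J' z i) f x)) (at x)"
proof -
  have cJ: "continuous_on UNIV J"
    using d by (meson continuous_at_imp_continuous_on has_derivative_continuous)
  have i0: "integrable lborel (\<lambda>y. J (x - y) * f y)" for x using conv_integrable[OF cJ K f] by simp
  have i1: "integrable lborel (\<lambda>y. J' (x - y) i * f y)" if "i \<in> Basis" for x i
    using conv_integrable[OF c[OF that] K(1) _ f] derivative_zero_off_support[OF d K] by simp
  have eq: "(\<Sum>i\<in>Basis. (h \<bullet> i) * conv (\<lambda>z. J' z i) f x) = (LINT y|lborel. J' (x - y) h * f y)"
    and i2: "integrable lborel (\<lambda>y. J' (x - y) h * f y)" for x h
  proof -
    have e: "(\<lambda>y. J' (x - y) h * f y) = (\<lambda>y. \<Sum>i\<in>Basis. (h \<bullet> i) * (J' (x - y) i * f y))"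
      by (subst linear_basis_expansion[OF has_derivative_linear[OF d]])
        (simp add: sum_distrib_right mult.assoc)
    show "integrable lborel (\<lambda>y. J' (x - y) h * f y)"
      unfolding e by (intro Bochner_Integration.integrable_sum integrable_mult_right i1)
    show "(\<Sum>i\<in>Basis. (h \<bullet> i) * conv (\<lambda>z. J' z i) f x) = (LINT y|lborel. J' (x - y) h * f y)"
      unfolding e by (subst Bochner_Integration.integral_sum) (auto simp: conv_def i1)
  qed
  show ?thesis unfolding has_derivative_at'
  proof safe
    show "bounded_linear (\<lambda>h. \<Sum>i\<in>Basis. h \<bullet> i * conv (\<lambda>z. J' z i) f x)"
      by (intro bounded_linear_sum bounded_linear_mult_left[THEN bounded_linear_compose]
          bounded_linear_inner_left)
    fix e :: real assume e: "e > 0"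
    let ?N = "LINT y|lborel. \<bar>f y\<bar>"
    have N: "?N \<ge> 0" by simp
    let ?e = "e / (2 * (?N + 1))"
    have e': "?e > 0" using e N by (intro divide_pos_pos mult_pos_pos add_nonneg_pos) simp_all
    obtain \<delta> where \<delta>: "\<delta> > 0" "\<And>x h. norm h < \<delta> \<Longrightarrow> \<bar>J (x + h) - J x - J' x h\<bar> \<le> ?e * norm h"
      using uniform_taylor[OF d c K e'] by blast
    show "\<exists>d>0. \<forall>x'. 0 < norm (x' - x) \<and> norm (x' - x) < d \<longrightarrow>
      norm (conv J f x' - conv J f x - (\<Sum>i\<in>Basis. (x' - x) \<bullet> i * conv (\<lambda>z. J' z i) f x)) / norm (x' - x) < e"
    proof (intro exI[of _ \<delta>] conjI allI impI \<delta>(1))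
      fix x' assume x': "0 < norm (x' - x) \<and> norm (x' - x) < \<delta>"
      let ?h = "x' - x"
      have "conv J f x' - conv J f x - (\<Sum>i\<in>Basis. ?h \<bullet> i * conv (\<lambda>z. J' z i) f x)
        = (LINT y|lborel. (J (x' - y) - J (x - y) - J' (x - y) ?h) * f y)"
        using i0 i2 unfolding eq by (simp add: conv_def left_diff_distrib)
      also have "norm \<dots> \<le> (LINT y|lborel. ?e * norm ?h * \<bar>f y\<bar>)"
      proof (intro order_trans[OF integral_norm_bound] integral_mono)
        show "integrable lborel (\<lambda>y. norm ((J (x' - y) - J (x - y) - J' (x - y) ?h) * f y))"
          using i0 i2 by (intro integrable_norm) (simp add: left_diff_distrib)
        show "integrable lborel (\<lambda>y. ?e * norm ?h * \<bar>f y\<bar>)" using f by simp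
        show "norm ((J (x' - y) - J (x - y) - J' (x - y) ?h) * f y) \<le> ?e * norm ?h * \<bar>f y\<bar>" for y
        proof -
          have "\<bar>J (x' - y) - J (x - y) - J' (x - y) ?h\<bar> \<le> ?e * norm ?h"
            using \<delta>(2)[of ?h "x - y"] x' by simp
          from mult_right_mono[OF this, of "\<bar>f y\<bar>"] show ?thesis by (simp add: abs_mult)
        qed
      qed
      also have "\<dots> = ?e * ?N * norm ?h" by simp
      also have "\<dots> < e * norm ?h"
      proof (rule mult_strict_right_mono)
        have "?N / (2 * (?N + 1)) < 1" using N by (simp add: divide_less_eq add_nonneg_pos)
        from mult_strict_left_mono[OF this e] show "?e * ?N < e" by simp
      qed (use x' in simp)
      finally show "norm (conv J f x' - conv J f x - (\<Sum>i\<in>Basis. ?h \<bullet> i * conv (\<lambda>z. J' z i) f x)) / norm ?h < e"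
        using x' by (simp add: divide_less_eq)
    qed
  qed
qed

text \<open>Partial derivatives of the convolution are convolutions with the partial derivatives of
  J, which vanish off the same compact set; hence the induction runs over all kernels J at
  once.\<close>

lemma conv_Ck:
  fixes f :: "'a::euclidean_space \<Rightarrow> real"
  assumes "\<And>k. Ck k J" "compact K" "\<And>x. x \<notin> K \<Longrightarrow> J x = 0" and f: "integrable lborel f"
  shows "Ck k (conv J f)"
  using assms(1-3)
proof (induction k arbitrary: J)
  have step: "(conv J f has_derivative (\<lambda>h. \<Sum>i\<in>Basis. (h \<bullet> i) * conv (\<lambda>z. frechet_derivative J (at z) i) f x)) (at x)"
    if "\<And>k. Ck k J" "\<And>x. x \<notin> K \<Longrightarrow> J x = 0" for J x
    by (rule conv_has_derivative[OF Ck_Suc_D(1)[OF that(1)] Ck_continuous[OF Ck_Suc_D(2)[OF that(1)]] \<open>compact K\<close> that(2) f])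
  {
    case 0
    have "continuous (at x) (conv J f)" for x
      by (rule has_derivative_continuous[OF step[OF 0(1) 0(3)]])
    then show ?case by (simp add: continuous_at_imp_continuous_on)
  next
    case (Suc k)
    show ?case
    proof (rule Ck_Suc_I[OF step[OF Suc.prems(1) Suc.prems(3)]], assumption)
      fix i :: 'a assume i: "i \<in> Basis"
      have "(\<Sum>j\<in>Basis. i \<bullet> j * conv (\<lambda>z. frechet_derivative J (at z) j) f x) =
        conv (\<lambda>z. frechet_derivative J (at z) i) f x" for x
        using i by (simp add: inner_Basis if_distrib[of "\<lambda>a. a * _"] sum.delta cong: if_cong)
      moreover have "Ck k (conv (\<lambda>z. frechet_derivative J (at z) i) f)"
        by (rule Suc.IH[OF Ck_Suc_D(2)[OF Suc.prems(1) i] Suc.prems(2)])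
          (rule derivative_zero_off_support[OF Ck_Suc_D(1)[OF Suc.prems(1)] Suc.prems(2-3)])
      ultimately show "Ck k (\<lambda>x. \<Sum>j\<in>Basis. i \<bullet> j * conv (\<lambda>z. frechet_derivative J (at z) j) f x)"
        by simp
    qed
  }
qed

subsection \<open>Translations and mollification in Lebesgue spaces\<close>

abbreviation Lp_integrable :: "real \<Rightarrow> ('a::euclidean_space \<Rightarrow> 'b::real_normed_vector) \<Rightarrow> bool" where
  "Lp_integrable p f \<equiv> integrable lborel (\<lambda>x. norm (f x) powr p)"

abbreviation Lp_integral :: "real \<Rightarrow> ('a::euclidean_space \<Rightarrow> 'b::real_normed_vector) \<Rightarrow> real" where
  "Lp_integral p f \<equiv> LINT x|lborel. norm (f x) powr p"

text \<open>The crude factor 2^r is valid for every r > 0, which avoids Minkowski's inequality and a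
  distinction between r < 1 and r >= 1.\<close>

lemma powr_add_le:
  fixes a b r :: real
  assumes "a \<ge> 0" "b \<ge> 0" "r > 0"
  shows "(a + b) powr r \<le> 2 powr r * (a powr r + b powr r)"
proof -
  have "(a + b) powr r \<le> (2 * max a b) powr r"
    using assms by (intro powr_mono2) auto
  also have "\<dots> = 2 powr r * (max a b) powr r" using assms by (simp add: powr_mult)
  also have "(max a b) powr r \<le> a powr r + b powr r" by (auto simp: max_def)
  finally show ?thesis by simp
qed

lemma norm_add_powr_le:
  fixes a b :: "'a::real_normed_vector"
  assumes "r > 0"
  shows "norm (a + b) powr r \<le> 2 powr r * (norm a powr r + norm b powr r)"
proof -
  have "norm (a + b) powr r \<le> (norm a + norm b) powr r"
    using assms by (intro powr_mono2 norm_triangle_ineq) auto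
  also have "\<dots> \<le> 2 powr r * (norm a powr r + norm b powr r)"
    using assms by (intro powr_add_le) auto
  finally show ?thesis .
qed

lemma norm_diff_powr_le:
  fixes a b :: "'a::real_normed_vector"
  assumes "r > 0"
  shows "norm (a - b) powr r \<le> 2 powr r * (norm a powr r + norm b powr r)"
  using norm_add_powr_le[of r a "- b"] assms by simp

lemma integrable_powr_bound:
  fixes f :: "'a \<Rightarrow> 'b::{banach, second_countable_topology}" and g :: "'a \<Rightarrow> 'c::{banach, second_countable_topology}"
  assumes "integrable M (\<lambda>x. norm (g x) powr r)" "f \<in> borel_measurable M" "r > 0"
    and "AE x in M. norm (f x) \<le> norm (g x)"
  shows "integrable M (\<lambda>x. norm (f x) powr r)"
proof (rule Bochner_Integration.integrable_bound[OF assms(1)])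
  show "AE x in M. norm (norm (f x) powr r) \<le> norm (norm (g x) powr r)"
    using assms(4) by eventually_elim (use assms(3) in \<open>auto intro: powr_mono2\<close>)
qed (use assms(2) in measurable)

lemma integrable_powr_add:
  fixes f g :: "'a \<Rightarrow> 'b::{banach, second_countable_topology}"
  assumes "integrable M (\<lambda>x. norm (f x) powr r)" "integrable M (\<lambda>x. norm (g x) powr r)" "r > 0"
    and [measurable]: "f \<in> borel_measurable M" "g \<in> borel_measurable M"
  shows "integrable M (\<lambda>x. norm (f x + g x) powr r)"
proof (rule Bochner_Integration.integrable_bound)
  show "integrable M (\<lambda>x. 2 powr r * (norm (f x) powr r + norm (g x) powr r))"
    using assms by simp
  show "AE x in M. norm (norm (f x + g x) powr r) \<le> norm (2 powr r * (norm (f x) powr r + norm (g x) powr r))"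
    using norm_add_powr_le[OF assms(3)] by (intro AE_I2) simp
qed measurable

lemma integrable_powr_diff:
  fixes f g :: "'a \<Rightarrow> 'b::{banach, second_countable_topology}"
  assumes "integrable M (\<lambda>x. norm (f x) powr r)" "integrable M (\<lambda>x. norm (g x) powr r)" "r > 0"
    and [measurable]: "f \<in> borel_measurable M" "g \<in> borel_measurable M"
  shows "integrable M (\<lambda>x. norm (f x - g x) powr r)"
  using integrable_powr_add[of M f r "\<lambda>x. - g x"] assms by simp

lemma tendsto_integral_powr_diff:
  fixes f :: "'a \<Rightarrow> 'b::{banach, second_countable_topology}" and s :: "nat \<Rightarrow> 'a \<Rightarrow> 'b"
  assumes [measurable]: "f \<in> borel_measurable M" "\<And>n. s n \<in> borel_measurable M" "g \<in> borel_measurable M"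
    and r: "r > 0" and g: "integrable M (\<lambda>x. \<bar>g x\<bar> powr r)"
    and b: "\<And>n. AE x in M. norm (s n x) \<le> g x" and lim: "AE x in M. (\<lambda>n. s n x) \<longlonglongrightarrow> f x"
  shows "(\<lambda>n. LINT x|M. norm (f x - s n x) powr r) \<longlonglongrightarrow> 0"
proof -
  have "AE x in M. \<forall>n. norm (s n x) \<le> g x" using b by (simp add: AE_all_countable)
  with lim have bf: "AE x in M. norm (f x) \<le> g x"
  proof eventually_elim
    case (elim x)
    show ?case using elim(2) by (intro LIMSEQ_le_const2[OF tendsto_norm[OF elim(1)]]) auto
  qed
  have "(\<lambda>n. LINT x|M. norm (f x - s n x) powr r) \<longlonglongrightarrow> (LINT x|M. 0)"
  proof (rule integral_dominated_convergence[where w="\<lambda>x. 2 powr r * (\<bar>g x\<bar> powr r + \<bar>g x\<bar> powr r)"])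
    show "integrable M (\<lambda>x. 2 powr r * (\<bar>g x\<bar> powr r + \<bar>g x\<bar> powr r))" using g by simp
    show "AE x in M. (\<lambda>n. norm (f x - s n x) powr r) \<longlonglongrightarrow> 0" using lim
    proof eventually_elim
      case (elim x)
      have "(\<lambda>n. norm (f x - s n x)) \<longlonglongrightarrow> norm (f x - f x)"
        by (intro tendsto_intros elim)
      then have "(\<lambda>n. norm (f x - s n x)) \<longlonglongrightarrow> 0" by simp
      from tendsto_powr'[OF this tendsto_const[of r]] show ?case using r by simp
    qed
    show "AE x in M. norm (norm (f x - s n x) powr r) \<le> 2 powr r * (\<bar>g x\<bar> powr r + \<bar>g x\<bar> powr r)" for n
      using b[of n] bf
    proof eventually_elim
      case (elim x)
      have "norm (f x - s n x) powr r \<le> 2 powr r * (norm (f x) powr r + norm (s n x) powr r)"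
        by (rule norm_diff_powr_le[OF r])
      also have "\<dots> \<le> 2 powr r * (\<bar>g x\<bar> powr r + \<bar>g x\<bar> powr r)"
        using elim r by (intro mult_left_mono add_mono powr_mono2) auto
      finally show ?case by simp
    qed
  qed measurable
  then show ?thesis by simp
qed

text \<open>The radial retraction onto the closed ball of radius R. Being continuous, it turns
  continuous approximations into bounded continuous ones.\<close>

definition clamp_norm :: "real \<Rightarrow> 'b::euclidean_space \<Rightarrow> 'b" where
  "clamp_norm R y = (R / max R (norm y)) *\<^sub>R y"

lemma clamp_norm_continuous: "R > 0 \<Longrightarrow> continuous_on UNIV (clamp_norm R)"
  unfolding clamp_norm_def[abs_def] by (intro continuous_intros) (auto simp: max_def)

lemma clamp_norm_bounds:
  assumes "R > 0"
  shows "norm (clamp_norm R y) \<le> R" "norm (clamp_norm R y) \<le> norm y" "norm y \<le> R \<Longrightarrow> clamp_norm R y = y"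
proof -
  have m: "max R (norm y) > 0" using assms by simp
  show "norm (clamp_norm R y) \<le> R"
  proof -
    have "R * (norm y / max R (norm y)) \<le> R * 1" using assms m by (intro mult_left_mono) auto
    then show ?thesis using assms m by (simp add: clamp_norm_def)
  qed
  have "R / max R (norm y) \<le> 1" using m by simp
  then show "norm (clamp_norm R y) \<le> norm y"
    using mult_right_mono[of "R / max R (norm y)" 1 "norm y"] assms m by (simp add: clamp_norm_def)
  show "clamp_norm R y = y" if "norm y \<le> R" using that assms by (simp add: clamp_norm_def max_absorb1)
qed

definition cutoff :: "real \<Rightarrow> 'a::euclidean_space \<Rightarrow> real" where
  "cutoff R x = max 0 (min 1 (R + 1 - norm x))"

lemma cutoff_props:
  "continuous_on UNIV (cutoff R)" "0 \<le> cutoff R x" "cutoff R x \<le> 1"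
  "norm x \<le> R \<Longrightarrow> cutoff R x = 1" "x \<notin> cball 0 (R + 1) \<Longrightarrow> cutoff R x = 0"
  unfolding cutoff_def[abs_def] by (auto intro!: continuous_intros)

lemma integrable_cball: "integrable lborel (\<lambda>x::'a::euclidean_space. (c::real) * indicator (cball a R) x)"
  by (intro integrable_mult_right integrable_real_indicator) (use emeasure_compact_finite[OF compact_cball] in auto)

text \<open>The same pair of clamp and cutoff is applied twice: first to f, which costs little in
  L^r by dominated convergence, then to continuous functions converging to f almost everywhere. The
  latter acquire a common bounded majorant with compact support, and convergence in L^r
  follows.\<close>

lemma Lr_dense_continuous:
  fixes f :: "'a::euclidean_space \<Rightarrow> 'b::euclidean_space"
  assumes f[measurable]: "f \<in> borel_measurable borel" and int: "Lp_integrable r f"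
    and r: "r > 0" and e: "e > 0"
  obtains g K where "continuous_on UNIV g" "compact K" "\<And>x. x \<notin> K \<Longrightarrow> g x = 0"
    "(Lp_integral r (\<lambda>x. f x - g x)) < e"
proof -
  let ?c = "2 powr r * 2"
  have c: "?c > 0" by simp
  define fr where "fr n x = cutoff (real (Suc n)) x *\<^sub>R clamp_norm (real (Suc n)) (f x)" for n x
  have [measurable]: "clamp_norm (real (Suc n)) \<in> borel_measurable (borel :: 'b measure)" for n
    by (intro borel_measurable_continuous_onI clamp_norm_continuous) simp
  have [measurable]: "cutoff (real (Suc n)) \<in> borel_measurable (borel :: 'a measure)" for n
    by (intro borel_measurable_continuous_onI cutoff_props)
  have fr[measurable]: "fr n \<in> borel_measurable borel" for n unfolding fr_def[abs_def] by measurable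
  have frb: "norm (fr n x) \<le> norm (f x)" for n x
    using mult_mono[OF cutoff_props(3)[of "real (Suc n)" x] clamp_norm_bounds(2)[of "real (Suc n)" "f x"]]
    by (simp add: fr_def cutoff_props(2))
  have "(\<lambda>n. Lp_integral r (\<lambda>x. f x - fr n x)) \<longlonglongrightarrow> 0"
  proof (rule tendsto_integral_powr_diff[where g="\<lambda>x. norm (f x)"])
    show "AE x in lborel. (\<lambda>n. fr n x) \<longlonglongrightarrow> f x"
    proof (rule AE_I2, rule tendsto_eventually)
      fix x
      obtain m where m: "norm (f x) \<le> real m" using real_arch_simple by blast
      obtain m' where m': "norm x \<le> real m'" using real_arch_simple by blast
      have "fr n x = f x" if "n \<ge> max m m'" for n
        using that m m' by (simp add: fr_def clamp_norm_bounds(3) cutoff_props(4))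
      then show "\<forall>\<^sub>F n in sequentially. fr n x = f x" unfolding eventually_sequentially by blast
    qed
  qed (use int r frb in auto)
  then have "\<forall>\<^sub>F n in sequentially. (Lp_integral r (\<lambda>x. f x - fr n x)) < e / ?c"
    using e c by (intro order_tendstoD(2)[of _ 0]) (auto intro!: divide_pos_pos)
  then obtain n where n: "(Lp_integral r (\<lambda>x. f x - fr n x)) < e / ?c"
    by (auto simp: eventually_sequentially)
  let ?R = "real (Suc n)"
  have "f measurable_on UNIV"
    by (rule lebesgue_measurable_imp_measurable_on) (auto intro: measurable_completion)
  then obtain N g where N: "negligible N" and g: "\<And>m. continuous_on UNIV (g m)"
    "\<And>x. x \<notin> N \<Longrightarrow> (\<lambda>m. g m x) \<longlonglongrightarrow> f x"
    unfolding measurable_on_def by auto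
  define h where "h m x = cutoff ?R x *\<^sub>R clamp_norm ?R (g m x)" for m x
  have hc: "continuous_on UNIV (h m)" for m
    unfolding h_def[abs_def]
    by (intro continuous_intros cutoff_props continuous_on_compose2[OF clamp_norm_continuous g(1)]) auto
  have [measurable]: "h m \<in> borel_measurable borel" for m using hc borel_measurable_continuous_onI by blast
  have hb: "norm (h m x) \<le> ?R * indicator (cball 0 (?R + 1)) x" for m x
  proof (cases "x \<in> cball 0 (?R + 1)")
    case True
    have "cutoff ?R x * norm (clamp_norm ?R (g m x)) \<le> 1 * ?R"
      by (intro mult_mono cutoff_props clamp_norm_bounds) auto
    then show ?thesis using True by (simp add: h_def cutoff_props(2))
  next
    case False then show ?thesis by (simp add: h_def cutoff_props(5))
  qed
  have "(\<lambda>m. Lp_integral r (\<lambda>x. fr n x - h m x)) \<longlonglongrightarrow> 0"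
  proof (rule tendsto_integral_powr_diff[where g="\<lambda>x. ?R * indicator (cball 0 (?R + 1)) x"])
    have "(\<lambda>x::'a. \<bar>?R * indicator (cball 0 (?R + 1)) x\<bar> powr r) = (\<lambda>x. ?R powr r * indicator (cball 0 (?R + 1)) x)"
      using r by (auto simp: fun_eq_iff indicator_def)
    then show "integrable lborel (\<lambda>x::'a. \<bar>?R * indicator (cball 0 (?R + 1)) x\<bar> powr r)"
      by (simp only: integrable_cball)
    have "AE x in lebesgue. x \<notin> N"
      using N by (simp add: negligible_iff_null_sets AE_not_in)
    then have "AE x in lebesgue. (\<lambda>m. h m x) \<longlonglongrightarrow> fr n x"
    proof eventually_elim
      case (elim x)
      have "isCont (clamp_norm ?R) (f x)"
        using clamp_norm_continuous[of ?R, where 'a='b] by (simp add: continuous_on_eq_continuous_at)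
      from isCont_tendsto_compose[OF this g(2)[OF elim]]
      show ?case unfolding h_def fr_def by (intro tendsto_intros)
    qed
    then show "AE x in lborel. (\<lambda>m. h m x) \<longlonglongrightarrow> fr n x"
      by (simp add: AE_completion_iff)
    show "(\<lambda>x::'a. ?R * indicator (cball 0 (?R + 1)) x) \<in> borel_measurable lborel"
      by (intro borel_measurable_times borel_measurable_const borel_measurable_indicator) simp
  qed (use r hb in auto)
  then have "\<forall>\<^sub>F m in sequentially. (Lp_integral r (\<lambda>x. fr n x - h m x)) < e / ?c"
    using e c by (intro order_tendstoD(2)[of _ 0]) (auto intro!: divide_pos_pos)
  then obtain m where m: "(Lp_integral r (\<lambda>x. fr n x - h m x)) < e / ?c"
    by (auto simp: eventually_sequentially)
  have ifr: "Lp_integrable r (\<lambda>x. fr n x)"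
    by (rule integrable_powr_bound[OF int _ r]) (use frb in auto)
  have ih: "Lp_integrable r (\<lambda>x. h m x)"
  proof (rule integrable_powr_bound[where g="\<lambda>x. ?R * indicator (cball 0 (?R + 1)) x"])
    have "(\<lambda>x::'a. norm (?R * indicator (cball 0 (?R + 1)) x) powr r) = (\<lambda>x. ?R powr r * indicator (cball 0 (?R + 1)) x)"
      using r by (auto simp: fun_eq_iff indicator_def)
    then show "integrable lborel (\<lambda>x::'a. norm (?R * indicator (cball 0 (?R + 1)) x) powr r)"
      by (simp only: integrable_cball)
    show "AE x in lborel. norm (h m x) \<le> norm (?R * indicator (cball 0 (?R + 1)) x)"
      using hb by (intro AE_I2 order_trans[OF hb]) auto
  qed (use r in auto)
  have i1: "Lp_integrable r (\<lambda>x. f x - fr n x)"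
    and i2: "Lp_integrable r (\<lambda>x. fr n x - h m x)"
    by (intro integrable_powr_diff int ifr ih r; measurable)+
  have "(Lp_integral r (\<lambda>x. f x - h m x)) \<le>
    (LINT x|lborel. 2 powr r * (norm (f x - fr n x) powr r + norm (fr n x - h m x) powr r))"
  proof (rule integral_mono)
    show "Lp_integrable r (\<lambda>x. f x - h m x)"
      by (intro integrable_powr_diff int ih r; measurable)
    show "norm (f x - h m x) powr r \<le> 2 powr r * (norm (f x - fr n x) powr r + norm (fr n x - h m x) powr r)" for x
      using norm_add_powr_le[OF r, of "f x - fr n x" "fr n x - h m x"] by simp
  qed (use i1 i2 in simp)
  also have "\<dots> = 2 powr r * ((Lp_integral r (\<lambda>x. f x - fr n x)) + (Lp_integral r (\<lambda>x. fr n x - h m x)))"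
    using i1 i2 by simp
  also have "\<dots> < 2 powr r * (e / ?c + e / ?c)"
    using n m by (intro mult_strict_left_mono add_strict_mono) auto
  also have "\<dots> = e" by simp
  finally have "(Lp_integral r (\<lambda>x. f x - h m x)) < e" .
  then show ?thesis
  proof (rule that[OF hc[of m] compact_cball[of 0 "?R + 1"], rotated])
    show "h m x = 0" if "x \<notin> cball 0 (?R + 1)" for x
      using cutoff_props(5)[OF that] by (simp only: h_def scaleR_zero_left)
  qed
qed

text \<open>For continuous functions with compact support this is uniform continuity; density
  carries it over to L^r.\<close>

lemma Lr_translation_continuous:
  fixes f :: "'a::euclidean_space \<Rightarrow> 'b::euclidean_space"
  assumes f[measurable]: "f \<in> borel_measurable borel" and int: "Lp_integrable r f"
    and r: "r > 0" and e: "e > 0"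
  obtains d where "d > 0" "\<And>z. norm z < d \<Longrightarrow> (Lp_integral r (\<lambda>x. f (x + z) - f x)) \<le> e"
proof -
  \<comment> \<open>The constant of two nested triangle inequalities with factor 2^r, in which each
    of three integrals is at most e / k.\<close>
  define k where "k = 2 powr r * (1 + 2 * 2 powr r)"
  have k: "k > 0" by (simp add: add_pos_pos k_def)
  then have ek: "e / k > 0" using e by simp
  obtain g K where g: "continuous_on UNIV g" "compact K" "\<And>x. x \<notin> K \<Longrightarrow> g x = 0"
    and fg: "(Lp_integral r (\<lambda>x. f x - g x)) < e / k"
    using Lr_dense_continuous[OF f int r ek] by blast
  have [measurable]: "g \<in> borel_measurable borel" using g(1) borel_measurable_continuous_onI by blast
  have ig: "Lp_integrable r g"
    by (rule compact_support_integrable[OF _ g(2)]) (use g r in \<open>auto intro!: continuous_on_powr' continuous_on_norm continuous_on_const\<close>)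
  have ifg: "Lp_integrable r (\<lambda>x. f x - g x)"
    by (intro integrable_powr_diff int ig r; measurable)
  let ?K = "\<Union>x\<in>K. cball x 1"
  have mK: "emeasure lborel ?K < \<infinity>" by (intro emeasure_compact_finite compact_neighbourhood g)
  have sK[measurable]: "?K \<in> sets borel" using compact_imp_closed[OF compact_neighbourhood[OF g(2), of 1]] by simp
  let ?M = "measure lborel ?K"
  \<comment> \<open>Chosen so that the r-th power times the measure of \<open>?K\<close> is at most
    e / k; the summand 1 covers measure zero.\<close>
  define \<epsilon> where "\<epsilon> = (e / k / (?M + 1)) powr (1 / r)"
  have M1: "?M + 1 > 0" using measure_nonneg[of lborel ?K] by linarith
  have ep: "\<epsilon> > 0" using e k M1 by (simp add: \<epsilon>_def)
  have epr: "\<epsilon> powr r * ?M \<le> e / k"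
  proof -
    have "\<epsilon> powr r = e / k / (?M + 1)" using e k M1 r by (simp add: \<epsilon>_def powr_powr)
    moreover have "?M / (?M + 1) \<le> 1" using M1 by (simp add: divide_le_eq)
    ultimately show ?thesis
      using mult_left_mono[of "?M / (?M + 1)" 1 "e / k"] e k by simp
  qed
  obtain d where d: "d > 0" "\<And>x y. dist x y < d \<Longrightarrow> norm (g x - g y) < \<epsilon>"
    using compact_support_uniform[OF g ep] by blast
  show ?thesis
  proof (rule that[of "min d 1"])
    fix z :: 'a assume z: "norm z < min d 1"
    have gz: "norm (g (x + z) - g x) powr r \<le> \<epsilon> powr r * indicator ?K x" for x
    proof (cases "x \<in> ?K")
      case True
      have "norm (g (x + z) - g x) \<le> \<epsilon>" using d(2)[of "x + z" x] z by (simp add: dist_norm less_imp_le)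
      then show ?thesis using True r by (simp add: powr_mono2)
    next
      case False
      have "x + z \<notin> K"
      proof
        assume "x + z \<in> K"
        moreover have "x \<in> cball (x + z) 1" using z by (simp add: dist_norm)
        ultimately show False using False by blast
      qed
      moreover have "x \<notin> K" using False by force
      ultimately show ?thesis using g(3) r by simp
    qed
    have ifz: "Lp_integrable r (\<lambda>x. f (x + z))"
      using int by (simp add: lborel_integrable_shift[of "\<lambda>x. norm (f x) powr r"])
    have igz: "Lp_integrable r (\<lambda>x. g (x + z))"
      using ig by (simp add: lborel_integrable_shift[of "\<lambda>x. norm (g x) powr r"])
    have ifgz: "Lp_integrable r (\<lambda>x. f (x + z) - g (x + z))"
      using ifg by (simp add: lborel_integrable_shift[of "\<lambda>x. norm (f x - g x) powr r"])
    have iK: "integrable lborel (\<lambda>x. \<epsilon> powr r * indicator ?K x)" using mK by simp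
    have "(Lp_integral r (\<lambda>x. f (x + z) - f x)) \<le>
      (LINT x|lborel. 2 powr r * (norm (f (x + z) - g (x + z)) powr r + 2 powr r * (\<epsilon> powr r * indicator ?K x + norm (f x - g x) powr r)))"
    proof (rule integral_mono)
      show "Lp_integrable r (\<lambda>x. f (x + z) - f x)"
        by (intro integrable_powr_diff int ifz r; measurable)
      show "norm (f (x + z) - f x) powr r \<le> 2 powr r * (norm (f (x + z) - g (x + z)) powr r + 2 powr r * (\<epsilon> powr r * indicator ?K x + norm (f x - g x) powr r))" for x
      proof -
        have "norm (f (x + z) - f x) powr r \<le> 2 powr r * (norm (f (x + z) - g (x + z)) powr r + norm (g (x + z) - f x) powr r)"
          using norm_add_powr_le[OF r, of "f (x + z) - g (x + z)" "g (x + z) - f x"] by simp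
        moreover have "norm (g (x + z) - f x) powr r \<le> 2 powr r * (norm (g (x + z) - g x) powr r + norm (f x - g x) powr r)"
          using norm_add_powr_le[OF r, of "g (x + z) - g x" "g x - f x"] by (simp add: norm_minus_commute)
        moreover have "\<dots> \<le> 2 powr r * (\<epsilon> powr r * indicator ?K x + norm (f x - g x) powr r)"
          using gz by (intro mult_left_mono add_mono) auto
        ultimately show ?thesis
          by (meson add_left_mono mult_left_mono order_trans powr_ge_zero)
      qed
    qed (intro integrable_mult_right Bochner_Integration.integrable_add ifgz iK ifg)
    also have "\<dots> = 2 powr r * ((Lp_integral r (\<lambda>x. f (x + z) - g (x + z))) + 2 powr r * (\<epsilon> powr r * ?M + (Lp_integral r (\<lambda>x. f x - g x))))"
      using ifgz iK ifg mK by simp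
    also have "(Lp_integral r (\<lambda>x. f (x + z) - g (x + z))) = (Lp_integral r (\<lambda>x. f x - g x))"
      by (simp add: lborel_integral_shift[of "\<lambda>x. norm (f x - g x) powr r"])
    also have "2 powr r * ((Lp_integral r (\<lambda>x. f x - g x)) + 2 powr r * (\<epsilon> powr r * ?M + (Lp_integral r (\<lambda>x. f x - g x))))
      \<le> 2 powr r * (e / k + 2 powr r * (e / k + e / k))"
      using fg epr by (intro mult_left_mono add_mono) auto
    also have "\<dots> = k * (e / k)"
    proof -
      have "2 powr r * (a + 2 powr r * (a + a)) = k * a" for a by (simp add: k_def algebra_simps)
      then show ?thesis .
    qed
    also have "\<dots> = e" using k by simp
    finally show "(Lp_integral r (\<lambda>x. f (x + z) - f x)) \<le> e" .
  qed (use d in simp)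
qed

text \<open>Jensen's inequality for the probability density J. The right-hand side is an extended
  integral, so that the lemma can be used before integrability is known.\<close>

lemma jensen_powr:
  fixes J g :: "'a \<Rightarrow> real"
  assumes J: "integrable M J" "(LINT y|M. J y) = 1" "\<And>y. J y \<ge> 0" and r: "r \<ge> 1" and g: "\<And>y. g y \<ge> 0"
    and [measurable]: "g \<in> borel_measurable M" and Jg: "integrable M (\<lambda>y. J y * g y)"
  shows "ennreal ((LINT y|M. J y * g y) powr r) \<le> (\<integral>\<^sup>+y. ennreal (J y * g y powr r) \<partial>M)"
proof (cases "(\<integral>\<^sup>+y. ennreal (J y * g y powr r) \<partial>M) = \<infinity>")
  case False
  have [measurable]: "J \<in> borel_measurable M" using J(1) by simp
  have i: "integrable M (\<lambda>y. J y * g y powr r)"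
    by (rule integrableI_nonneg) (use False J g in \<open>auto simp: top.not_eq_extremum\<close>)
  let ?m = "LINT y|M. J y * g y"
  have m: "?m \<ge> 0" using J g by simp
  \<comment> \<open>The tangent line of a^r at the mean \<open>?m\<close> lies below the graph;
    Young's inequality says exactly this. Integration against J gives the claim.\<close>
  have y: "r * ?m powr (r - 1) * a \<le> a powr r + (r - 1) * ?m powr r" if a: "a \<ge> 0" for a
  proof (cases "r = 1")
    case True then show ?thesis using a by (cases "?m = 0") auto
  next
    case False
    then have r1: "r > 1" using r by simp
    have "a * ?m powr (r - 1) \<le> a powr r / r + (?m powr (r - 1)) powr (r / (r - 1)) / (r / (r - 1))"
      using r1 a m by (intro Youngs_inequality) (auto simp: field_simps)
    also have "(?m powr (r - 1)) powr (r / (r - 1)) = ?m powr r" using r1 by (simp add: powr_powr)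
    finally have "r * (a * ?m powr (r - 1)) \<le> r * (a powr r / r + ?m powr r / (r / (r - 1)))"
      using r1 by (intro mult_left_mono) auto
    also have "\<dots> = a powr r + (r - 1) * ?m powr r" using r1 by (simp add: field_simps)
    finally show ?thesis by (simp add: mult_ac)
  qed
  have "(LINT y|M. r * ?m powr (r - 1) * (J y * g y)) \<le> (LINT y|M. J y * g y powr r + (r - 1) * ?m powr r * J y)"
  proof (rule integral_mono)
    show "r * ?m powr (r - 1) * (J y * g y) \<le> J y * g y powr r + (r - 1) * ?m powr r * J y" for y
      using mult_left_mono[OF y[OF g[of y]] J(3)[of y]] by (simp add: algebra_simps)
  qed (use Jg i J in auto)
  then have "r * (?m powr (r - 1) * ?m) \<le> (LINT y|M. J y * g y powr r) + (r - 1) * ?m powr r"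
    using Jg i J by simp
  moreover have "?m powr (r - 1) * ?m = ?m powr r"
    using m by (cases "?m = 0") (auto simp: powr_diff)
  ultimately have "?m powr r \<le> (LINT y|M. J y * g y powr r)" by (simp add: algebra_simps)
  also have "ennreal \<dots> = (\<integral>\<^sup>+y. ennreal (J y * g y powr r) \<partial>M)"
    using i J g by (intro nn_integral_eq_integral[symmetric]) auto
  finally show ?thesis by (simp add: ennreal_leI)
qed simp

text \<open>By Jensen the error is bounded by the average, with weight \<open>mol s\<close>, of the
  translation errors |f(x - y) - f(x)|^r over |y| < s; Tonelli and continuity of translations finish
  the estimate.\<close>

lemma mollify_Lr:
  fixes f :: "'a::euclidean_space \<Rightarrow> 'b::euclidean_space"
  assumes f[measurable]: "f \<in> borel_measurable borel" and int: "Lp_integrable r f"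
    and f1: "integrable lborel f" and r: "r \<ge> 1" and e: "e > 0"
  obtains d where "d > 0" "\<And>s. 0 < s \<Longrightarrow> s < d \<Longrightarrow> (Lp_integral r (\<lambda>x. conv (mol s) f x - f x)) \<le> e"
    "\<And>s. 0 < s \<Longrightarrow> s < d \<Longrightarrow> Lp_integrable r (\<lambda>x. conv (mol s) f x - f x)"
proof -
  have r0: "r > 0" using r by simp
  obtain d where d: "d > 0" "\<And>z. norm z < d \<Longrightarrow> (Lp_integral r (\<lambda>x. f (x + z) - f x)) \<le> e"
    using Lr_translation_continuous[OF f int r0 e] by blast
  have *: "(\<integral>\<^sup>+x. ennreal (norm (conv (mol s) f x - f x) powr r) \<partial>lborel) \<le> ennreal e"
    and cm[measurable]: "conv (mol s) f \<in> borel_measurable borel"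
    if s: "0 < s" "s < d" for s
  proof -
    have mc: "continuous_on UNIV (mol s :: 'a \<Rightarrow> real)" by (rule Ck_continuous[OF mol_Ck])
    have [measurable]: "(mol s :: 'a \<Rightarrow> real) \<in> borel_measurable borel" using mc borel_measurable_continuous_onI by blast
    have K: "compact (cball 0 s :: 'a set)" by simp
    have K0: "x \<notin> cball 0 s \<Longrightarrow> mol s x = 0" for x :: 'a by (intro mol_zero[OF s(1)]) simp
    show "conv (mol s) f \<in> borel_measurable borel" unfolding conv_def[abs_def] by measurable
    have iy: "integrable lborel (\<lambda>y. mol s y *\<^sub>R f (x - y))"
      and cy: "conv (mol s) f x = (LINT y|lborel. mol s y *\<^sub>R f (x - y))" for x
      using conv_integrable[OF mc K K0 f1, of x]
        lborel_integrable_reflect[of "\<lambda>y. mol s y *\<^sub>R f (x - y)" x] lborel_integral_reflect[of "\<lambda>y. mol s y *\<^sub>R f (x - y)" x]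
      by (simp_all add: conv_def)
    have cd: "conv (mol s) f x - f x = (LINT y|lborel. mol s y *\<^sub>R (f (x - y) - f x))"
      and id: "integrable lborel (\<lambda>y. mol s y *\<^sub>R (f (x - y) - f x))" for x
      using iy[of x] mol_integral[OF s(1), where 'a='a] by (simp_all add: cy scaleR_diff_right)
    have jb: "ennreal (norm (conv (mol s) f x - f x) powr r) \<le> (\<integral>\<^sup>+y. ennreal (mol s y * norm (f (x - y) - f x) powr r) \<partial>lborel)" for x
    proof -
      have n: "norm (mol s y *\<^sub>R (f (x - y) - f x)) = mol s y * norm (f (x - y) - f x)" for y
        using mol_nonneg[OF s(1), of y] by simp
      have "norm (conv (mol s) f x - f x) \<le> (LINT y|lborel. mol s y * norm (f (x - y) - f x))"
        unfolding cd by (rule order_trans[OF integral_norm_bound]) (simp only: n order.refl)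
      then have "norm (conv (mol s) f x - f x) powr r \<le> (LINT y|lborel. mol s y * norm (f (x - y) - f x)) powr r"
        using r by (intro powr_mono2) auto
      then have "ennreal (norm (conv (mol s) f x - f x) powr r) \<le> ennreal ((LINT y|lborel. mol s y * norm (f (x - y) - f x)) powr r)"
        by (rule ennreal_leI)
      also have "\<dots> \<le> (\<integral>\<^sup>+y. ennreal (mol s y * norm (f (x - y) - f x) powr r) \<partial>lborel)"
      proof (rule jensen_powr)
        show "integrable lborel (\<lambda>y. mol s y * norm (f (x - y) - f x))"
          using integrable_norm[OF id[of x]] by (simp only: n)
      qed (use mol_integral[OF s(1), where 'a='a] mol_nonneg[OF s(1)] r in auto)
      finally show ?thesis .
    qed
    have "(\<integral>\<^sup>+x. ennreal (norm (conv (mol s) f x - f x) powr r) \<partial>lborel) \<le>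
      (\<integral>\<^sup>+x. (\<integral>\<^sup>+y. ennreal (mol s y * norm (f (x - y) - f x) powr r) \<partial>lborel) \<partial>lborel)"
      by (intro nn_integral_mono jb)
    also have "\<dots> = (\<integral>\<^sup>+y. (\<integral>\<^sup>+x. ennreal (mol s y * norm (f (x - y) - f x) powr r) \<partial>lborel) \<partial>lborel)"
      by (rule lborel_pair.Fubini'[symmetric]) simp
    also have "\<dots> \<le> (\<integral>\<^sup>+(y::'a). ennreal (mol s y) * ennreal e \<partial>lborel)"
    proof (rule nn_integral_mono)
      fix y :: 'a
      show "(\<integral>\<^sup>+x. ennreal (mol s y * norm (f (x - y) - f x) powr r) \<partial>lborel) \<le> ennreal (mol s y) * ennreal e"
      proof (cases "norm y < s")
        case False then show ?thesis using mol_zero[OF s(1), of y] by simp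
      next
        case True
        have i: "Lp_integrable r (\<lambda>x. f (x - y) - f x)"
        proof (rule integrable_powr_diff[OF _ int r0])
          show "Lp_integrable r (\<lambda>x. f (x - y))"
            using int lborel_integrable_shift[of "\<lambda>x. norm (f x) powr r" "- y"] by simp
        qed measurable
        have "(\<integral>\<^sup>+x. ennreal (mol s y * norm (f (x - y) - f x) powr r) \<partial>lborel) =
          ennreal (mol s y) * (\<integral>\<^sup>+x. ennreal (norm (f (x - y) - f x) powr r) \<partial>lborel)"
          using mol_nonneg[OF s(1), of y] by (simp add: ennreal_mult nn_integral_cmult)
        also have "(\<integral>\<^sup>+x. ennreal (norm (f (x - y) - f x) powr r) \<partial>lborel) = ennreal (Lp_integral r (\<lambda>x. f (x - y) - f x))"
          using i by (intro nn_integral_eq_integral) auto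
        also have "\<dots> \<le> ennreal e" using d(2)[of "- y"] True s by (intro ennreal_leI) simp
        finally show ?thesis by (simp add: mult_left_mono)
      qed
    qed
    also have "\<dots> = (\<integral>\<^sup>+(y::'a). ennreal (mol s y) \<partial>lborel) * ennreal e" by (simp add: nn_integral_multc)
    also have "(\<integral>\<^sup>+(y::'a). ennreal (mol s y) \<partial>lborel) = 1"
      using mol_integral[OF s(1), where 'a='a] mol_nonneg[OF s(1)] by (subst nn_integral_eq_integral) auto
    finally show "(\<integral>\<^sup>+x. ennreal (norm (conv (mol s) f x - f x) powr r) \<partial>lborel) \<le> ennreal e" by simp
  qed
  have i: "Lp_integrable r (\<lambda>x. conv (mol s) f x - f x)" if s: "0 < s" "s < d" for s
    by (rule integrableI_nonneg) (use *[OF s] cm[OF s] in \<open>auto intro: le_less_trans\<close>)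
  have "(Lp_integral r (\<lambda>x. conv (mol s) f x - f x)) \<le> e" if s: "0 < s" "s < d" for s
    using *(1)[OF s] nn_integral_eq_integral[OF i[OF s]] e by simp
  with d(1) i that show ?thesis by blast
qed

subsection \<open>Borel representatives\<close>

text \<open>Lebesgue measurable functions of space and time may have non-measurable slices. A Borel
  version, extended by zero, has measurable slices, admits Fubini for \<open>lborel\<close>, and
  turns integrals over S into integrals over the whole space.\<close>

definition borel_rep :: "'a::euclidean_space set \<Rightarrow> ('a \<Rightarrow> 'b::euclidean_space) \<Rightarrow> ('a \<Rightarrow> 'b) \<Rightarrow> bool" where
  "borel_rep S f g \<longleftrightarrow> g \<in> borel_measurable borel \<and> (\<forall>x. x \<notin> S \<longrightarrow> g x = 0) \<and>
     (AE x in lborel. x \<in> S \<longrightarrow> f x = g x)"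

lemma AE_lebesgue_on_iff:
  assumes "S \<in> sets borel"
  shows "(AE x in lebesgue_on S. P x) \<longleftrightarrow> (AE x in lborel. x \<in> S \<longrightarrow> P x)"
  using assms by (simp add: AE_restrict_space_iff AE_completion_iff)

text \<open>Each coordinate of the extension by zero has a Borel version; finitely many null sets
  are combined.\<close>

lemma borel_rep_exists:
  fixes f :: "'a::euclidean_space \<Rightarrow> 'b::euclidean_space"
  assumes "f \<in> borel_measurable (lebesgue_on S)" "S \<in> sets borel"
  obtains g where "borel_rep S f g"
proof -
  let ?f = "\<lambda>x. if x \<in> S then f x else 0"
  have "?f \<in> borel_measurable lebesgue" using assms by (intro borel_measurable_if_I) auto
  then have "\<exists>g\<in>borel_measurable lborel. AE x in lborel. ?f x \<bullet> i = g x" for i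
    using completion_ex_borel_measurable_real[of "\<lambda>x. ?f x \<bullet> i" lborel] by (simp add: borel_measurable_inner)
  then obtain g where g: "\<And>i. g i \<in> borel_measurable lborel" "\<And>i. AE x in lborel. ?f x \<bullet> i = g i x"
    by metis
  then have [measurable]: "g i \<in> borel_measurable borel" for i by simp
  let ?g = "\<lambda>x. indicator S x *\<^sub>R (\<Sum>i\<in>Basis. g i x *\<^sub>R i)"
  have "AE x in lborel. \<forall>i\<in>(Basis::'b set). ?f x \<bullet> i = g i x"
    using g(2) by (subst AE_ball_countable) (auto intro: countable_finite)
  then have "AE x in lborel. x \<in> S \<longrightarrow> f x = ?g x"
  proof eventually_elim
    case (elim x)
    then show ?case by (auto simp: euclidean_eq_iff[of "f x"])
  qed
  moreover have "?g \<in> borel_measurable borel" using assms(2) by measurable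
  ultimately have "borel_rep S f ?g" by (simp add: borel_rep_def)
  then show ?thesis using that by blast
qed

lemma borel_rep_measurable:
  assumes "borel_rep S f g" "S \<in> sets borel"
  shows "f \<in> borel_measurable (lebesgue_on S)"
proof (rule borel_measurable_if_D, rule borel_measurable_AE)
  show "g \<in> borel_measurable lebesgue"
    using assms by (auto simp: borel_rep_def intro: measurable_completion)
  have "AE x in lborel. g x = (if x \<in> S then f x else 0)"
    using assms by (auto simp: borel_rep_def)
  then show "AE x in lebesgue. g x = (if x \<in> S then f x else 0)"
    by (simp add: AE_completion_iff)
qed

lemma
  assumes "borel_rep S f g" "S \<in> sets borel"
  shows borel_rep_integral: "(LINT x|lebesgue_on S. f x) = (LINT x|lborel. g x)"
    and borel_rep_integrable: "integrable (lebesgue_on S) f \<longleftrightarrow> integrable lborel g"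
proof -
  have g[measurable]: "g \<in> borel_measurable borel" and z: "\<And>x. x \<notin> S \<Longrightarrow> g x = 0"
    and ae: "AE x in lborel. x \<in> S \<longrightarrow> f x = g x" using assms by (auto simp: borel_rep_def)
  have S: "S \<inter> space lebesgue \<in> sets lebesgue" using assms by simp
  have m: "f \<in> borel_measurable (lebesgue_on S)" by (rule borel_rep_measurable[OF assms])
  have m': "(\<lambda>x. indicator S x *\<^sub>R f x) \<in> borel_measurable lebesgue"
    using m borel_measurable_restrict_space_iff[OF S] by blast
  have gl: "g \<in> borel_measurable lebesgue" using g by (auto intro: measurable_completion)
  have ae': "AE x in lebesgue. indicator S x *\<^sub>R f x = g x"
    using ae z by (auto simp: AE_completion_iff indicator_def)
  show "(LINT x|lebesgue_on S. f x) = (LINT x|lborel. g x)"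
    using integral_cong_AE[OF m' gl ae'] by (simp add: integral_restrict_space[OF S] integral_completion)
  show "integrable (lebesgue_on S) f \<longleftrightarrow> integrable lborel g"
    using integrable_cong_AE[OF m' gl ae'] by (simp add: integrable_restrict_space[OF S] integrable_completion)
qed

lemma borel_rep_map:
  assumes "borel_rep S f g" "\<Phi> \<in> borel_measurable borel" "\<Phi> 0 = 0"
  shows "borel_rep S (\<lambda>x. \<Phi> (f x)) (\<lambda>x. \<Phi> (g x))"
  using assms unfolding borel_rep_def by (auto intro: measurable_compose)

lemma borel_rep_restrict:
  assumes "borel_rep S f g" "K \<subseteq> S" "K \<in> sets borel"
  shows "borel_rep K f (\<lambda>x. indicator K x *\<^sub>R g x)"
  using assms unfolding borel_rep_def by (auto intro!: borel_measurable_scaleR borel_measurable_indicator)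

lemma borel_rep_diff:
  assumes "borel_rep S f g" "borel_rep S f' g'"
  shows "borel_rep S (\<lambda>x. f x - f' x) (\<lambda>x. g x - g' x)"
  using assms unfolding borel_rep_def by auto

lemma borel_rep_uminus:
  assumes "borel_rep S f g"
  shows "borel_rep S (\<lambda>x. - f x) (\<lambda>x. - g x)"
  using assms unfolding borel_rep_def by auto

lemma borel_rep_AE_cong:
  assumes "borel_rep S f g" "AE x in lborel. x \<in> S \<longrightarrow> f x = f' x"
  shows "borel_rep S f' g"
  using assms unfolding borel_rep_def by auto

lemma borel_rep_unique:
  assumes "borel_rep S f g" "borel_rep S f g'"
  shows "AE x in lborel. g x = g' x"
  using assms unfolding borel_rep_def by auto

lemma borel_rep_powr:
  assumes "borel_rep S f g"
  shows "borel_rep S (\<lambda>x. norm (f x) powr r) (\<lambda>x. norm (g x) powr r)"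
  by (rule borel_rep_map[OF assms]) auto

lemma Lp_space_iff_rep:
  assumes "borel_rep S f g" "S \<in> sets borel"
  shows "f \<in> Lp_space (lebesgue_on S) r \<longleftrightarrow> Lp_integrable r g"
  using borel_rep_integrable[OF borel_rep_powr[OF assms(1)] assms(2)] borel_rep_measurable[OF assms]
  by (simp add: Lp_space_def)

subsection \<open>Weak gradients of Borel representatives\<close>

definition grad :: "('a::euclidean_space \<Rightarrow> real) \<Rightarrow> 'a \<Rightarrow> 'a" where
  "grad f x = (\<Sum>i\<in>Basis. frechet_derivative f (at x) i *\<^sub>R i)"

text \<open>The counterpart of \<open>has_weak_gradient\<close> for Borel functions that vanish off
  E; all integrals are over the whole space, where translations and convolutions act.\<close>

definition wgrad :: "'a::euclidean_space set \<Rightarrow> ('a \<Rightarrow> real) \<Rightarrow> ('a \<Rightarrow> 'a) \<Rightarrow> bool" where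
  "wgrad E u G \<longleftrightarrow> u \<in> borel_measurable borel \<and> G \<in> borel_measurable borel \<and>
     (\<forall>x. x \<notin> E \<longrightarrow> u x = 0 \<and> G x = 0) \<and>
     (\<forall>K. compact K \<and> K \<subseteq> E \<longrightarrow> integrable lborel (\<lambda>x. indicator K x *\<^sub>R u x) \<and>
        integrable lborel (\<lambda>x. indicator K x *\<^sub>R G x)) \<and>
     (\<forall>\<phi>\<in>test_functions E. \<forall>i\<in>Basis.
        (LINT x|lborel. u x * frechet_derivative \<phi> (at x) i) = - (LINT x|lborel. (G x \<bullet> i) * \<phi> x))"

lemma grad_inner: "i \<in> Basis \<Longrightarrow> grad f x \<bullet> i = frechet_derivative f (at x) i"
  by (simp add: grad_def inner_sum_left inner_Basis if_distrib cong: if_cong)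

lemma test_functions_D:
  assumes "\<phi> \<in> test_functions E"
  shows "Ck k \<phi>" "continuous_on UNIV \<phi>" "(\<phi> has_derivative frechet_derivative \<phi> (at x)) (at x)"
    "i \<in> Basis \<Longrightarrow> continuous_on UNIV (\<lambda>x. frechet_derivative \<phi> (at x) i)"
    "\<phi> \<in> borel_measurable borel"
    "i \<in> Basis \<Longrightarrow> (\<lambda>x. frechet_derivative \<phi> (at x) i) \<in> borel_measurable borel"
    "continuous_on UNIV (grad \<phi>)"
    "grad \<phi> \<in> borel_measurable borel"
proof -
  have C: "\<And>k. Ck k \<phi>" using assms by (auto simp: test_functions_def)
  then show "Ck k \<phi>" by blast
  show c: "continuous_on UNIV \<phi>" using C Ck_continuous by blast
  show "(\<phi> has_derivative frechet_derivative \<phi> (at x)) (at x)" using C Ck_Suc_D(1) by blast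
  show c': "continuous_on UNIV (\<lambda>x. frechet_derivative \<phi> (at x) i)" if "i \<in> Basis" for i
    using Ck_continuous[OF Ck_Suc_D(2)[OF C that]] .
  show "\<phi> \<in> borel_measurable borel" using c by (rule borel_measurable_continuous_onI)
  show "i \<in> Basis \<Longrightarrow> (\<lambda>x. frechet_derivative \<phi> (at x) i) \<in> borel_measurable borel"
    using c' by (intro borel_measurable_continuous_onI)
  show cg: "continuous_on UNIV (grad \<phi>)" unfolding grad_def[abs_def]
    using c' by (intro continuous_intros) auto
  then show "grad \<phi> \<in> borel_measurable borel" by (rule borel_measurable_continuous_onI)
qed

lemma test_functions_support:
  assumes "\<phi> \<in> test_functions E"
  obtains K where "compact K" "K \<subseteq> E" "\<And>x. x \<notin> K \<Longrightarrow> \<phi> x = 0"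
    "\<And>x h. x \<notin> K \<Longrightarrow> frechet_derivative \<phi> (at x) h = 0" "\<And>x. x \<notin> K \<Longrightarrow> grad \<phi> x = 0"
proof -
  obtain K where K: "compact K" "K \<subseteq> E" "\<And>x. x \<notin> K \<Longrightarrow> \<phi> x = 0"
    using assms by (auto simp: test_functions_def)
  have "frechet_derivative \<phi> (at x) h = 0" if "x \<notin> K" for x h
    by (rule derivative_zero_off_support[OF test_functions_D(3)[OF assms] K(1,3) that])
  with K that show ?thesis by (simp add: grad_def)
qed

lemma compact_sets_borel:
  assumes "compact (K :: 'a::euclidean_space set)"
  shows "K \<in> sets borel" "K \<in> sets lebesgue"
  using borel_compact[OF assms] by auto

lemma compact_integrable_mult:
  fixes f :: "'a::euclidean_space \<Rightarrow> 'b::euclidean_space" and c :: "'a \<Rightarrow> real"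
  assumes c: "continuous_on UNIV c" and K: "compact K" "\<And>x. x \<notin> K \<Longrightarrow> c x = 0"
    and f: "integrable lborel (\<lambda>x. indicator K x *\<^sub>R f x)"
  shows "integrable lborel (\<lambda>x. c x *\<^sub>R f x)"
proof -
  obtain B where B: "B > 0" "\<And>x. norm (c x) \<le> B" using compact_support_bounded[OF c K] by blast
  have [measurable]: "c \<in> borel_measurable borel" using c by (rule borel_measurable_continuous_onI)
  have eq: "(\<lambda>x. c x *\<^sub>R f x) = (\<lambda>x. c x *\<^sub>R (indicator K x *\<^sub>R f x))"
    using K(2) by (auto simp: fun_eq_iff indicator_def)
  show ?thesis unfolding eq
  proof (rule Bochner_Integration.integrable_bound[OF integrable_scaleR_right[OF integrable_norm[OF f], of B]])
    show "(\<lambda>x. c x *\<^sub>R (indicator K x *\<^sub>R f x)) \<in> borel_measurable lborel"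
      by (rule borel_measurable_scaleR[OF _ borel_measurable_integrable[OF f]]) simp
    show "AE x in lborel. norm (c x *\<^sub>R (indicator K x *\<^sub>R f x)) \<le> norm (B *\<^sub>R norm (indicator K x *\<^sub>R f x))"
    proof (rule AE_I2)
      fix x
      have "\<bar>c x\<bar> * norm (indicator K x *\<^sub>R f x) \<le> B * norm (indicator K x *\<^sub>R f x)"
        using B(2)[of x] by (intro mult_right_mono) auto
      then show "norm (c x *\<^sub>R (indicator K x *\<^sub>R f x)) \<le> norm (B *\<^sub>R norm (indicator K x *\<^sub>R f x))"
        using B(1) by (simp add: abs_mult mult.assoc)
    qed
  qed
qed

text \<open>A countable exhaustion of E by compact sets merges the local null sets into one.\<close>

lemma compact_cover_AE:
  fixes E :: "'a::euclidean_space set"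
  assumes "open E" "\<And>K. compact K \<Longrightarrow> K \<subseteq> E \<Longrightarrow> AE x in lborel. x \<in> K \<longrightarrow> P x"
  shows "AE x in lborel. x \<in> E \<longrightarrow> P x"
proof -
  obtain C where C: "\<And>n. compact (C n)" "\<And>n. C n \<subseteq> E" "\<And>n. C n \<subseteq> interior (C (Suc n))" "\<Union>(range C) = E"
    by (rule open_Union_compact_subsets[OF assms(1)]) (rule that)
  have "AE x in lborel. \<forall>n. x \<in> C n \<longrightarrow> P x"
    unfolding AE_all_countable using assms(2) C by blast
  then show ?thesis by eventually_elim (use C(4) in blast)
qed

text \<open>G is measurable on every set of a compact exhaustion and is the pointwise limit of these
  restrictions.\<close>

lemma has_weak_gradient_measurable:
  assumes "open E" and G: "\<And>K. compact K \<Longrightarrow> K \<subseteq> E \<Longrightarrow> G absolutely_integrable_on K"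
  shows "(G :: 'a::euclidean_space \<Rightarrow> 'b::euclidean_space) \<in> borel_measurable (lebesgue_on E)"
proof -
  obtain C where C: "\<And>n. compact (C n)" "\<And>n. C n \<subseteq> E" "\<And>n. C n \<subseteq> interior (C (Suc n))" "\<Union>(range C) = E"
    by (rule open_Union_compact_subsets[OF assms(1)]) (rule that)
  have [measurable]: "(\<lambda>x. indicator (C n) x *\<^sub>R G x) \<in> borel_measurable lebesgue" for n
    using G[OF C(1) C(2)] by (auto simp: set_integrable_def intro: borel_measurable_integrable)
  have "(\<lambda>x. if x \<in> E then G x else 0) \<in> borel_measurable lebesgue"
  proof (rule borel_measurable_LIMSEQ_metric)
    fix x
    show "(\<lambda>n. indicator (C n) x *\<^sub>R G x) \<longlonglongrightarrow> (if x \<in> E then G x else 0)"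
    proof (cases "x \<in> E")
      case True
      then obtain m where m: "x \<in> C m" using C(4) by blast
      have "x \<in> C n" if "n \<ge> m" for n
        using m interior_subset C(3) lift_Suc_mono_le[of C, OF _ that] by blast
      then show ?thesis using True
        by (intro tendsto_eventually) (auto simp: eventually_sequentially intro!: exI[of _ m])
    next
      case False
      then have "x \<notin> C n" for n using C(2) by blast
      then show ?thesis using False by simp
    qed
  qed measurable
  then show ?thesis by (rule borel_measurable_if_D)
qed

lemma has_weak_gradient_rep:
  assumes E: "open E" and h: "has_weak_gradient E u G"
  obtains u' G' where "wgrad E u' G'" "borel_rep E u u'" "borel_rep E G G'"
proof -
  have E': "E \<in> sets borel" using E by simp
  have ai: "\<And>K. compact K \<Longrightarrow> K \<subseteq> E \<Longrightarrow> u absolutely_integrable_on K"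
    "\<And>K. compact K \<Longrightarrow> K \<subseteq> E \<Longrightarrow> G absolutely_integrable_on K"
    using h by (auto simp: has_weak_gradient_def)
  obtain u' where u: "borel_rep E u u'"
    using borel_rep_exists[OF has_weak_gradient_measurable[OF E ai(1)] E'] by blast
  obtain G' where G: "borel_rep E G G'"
    using borel_rep_exists[OF has_weak_gradient_measurable[OF E ai(2)] E'] by blast
  have m[measurable]: "u' \<in> borel_measurable borel" "G' \<in> borel_measurable borel"
    using u G by (auto simp: borel_rep_def)
  have "wgrad E u' G'" unfolding wgrad_def
  proof (intro conjI ballI allI impI m; (elim conjE)?)
    fix x assume "x \<notin> E" then show "u' x = 0" "G' x = 0" using u G by (auto simp: borel_rep_def)
  next
    fix K assume K: "compact K" "K \<subseteq> E"
    note sK = compact_sets_borel[OF K(1)]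
    show "integrable lborel (\<lambda>x. indicator K x *\<^sub>R u' x)"
      using borel_rep_integrable[OF borel_rep_restrict[OF u K(2) sK(1)] sK(1)] ai(1)[OF K] sK
      by (simp add: set_integrable_def integrable_restrict_space)
    show "integrable lborel (\<lambda>x. indicator K x *\<^sub>R G' x)"
      using borel_rep_integrable[OF borel_rep_restrict[OF G K(2) sK(1)] sK(1)] ai(2)[OF K] sK
      by (simp add: set_integrable_def integrable_restrict_space)
  next
    fix \<phi> and i :: 'a assume p: "\<phi> \<in> test_functions E" "i \<in> Basis"
    note [measurable] = test_functions_D(5)[OF p(1)] test_functions_D(6)[OF p]
    have r1: "borel_rep E (\<lambda>x. u x * frechet_derivative \<phi> (at x) i) (\<lambda>x. u' x * frechet_derivative \<phi> (at x) i)"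
      using u unfolding borel_rep_def by auto
    have r2: "borel_rep E (\<lambda>x. (G x \<bullet> i) * \<phi> x) (\<lambda>x. (G' x \<bullet> i) * \<phi> x)"
      using G unfolding borel_rep_def by auto
    show "(LINT x|lborel. u' x * frechet_derivative \<phi> (at x) i) = - (LINT x|lborel. (G' x \<bullet> i) * \<phi> x)"
      using h p by (simp add: has_weak_gradient_def flip: borel_rep_integral[OF r1 E'] borel_rep_integral[OF r2 E'])
  qed
  with u G that show ?thesis by blast
qed

lemma has_weak_gradient_of_rep:
  assumes E: "open E" and h: "wgrad E u' G'" and u: "borel_rep E u u'" and G: "borel_rep E G G'"
  shows "has_weak_gradient E u G"
  unfolding has_weak_gradient_def
proof (intro conjI ballI allI impI; (elim conjE)?)
  have E': "E \<in> sets borel" using E by simp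
  have m[measurable]: "u' \<in> borel_measurable borel" "G' \<in> borel_measurable borel"
    using u G by (auto simp: borel_rep_def)
  {
    fix K assume K: "compact K" "K \<subseteq> E"
    note sK = compact_sets_borel[OF K(1)]
    show "u absolutely_integrable_on K"
      using borel_rep_integrable[OF borel_rep_restrict[OF u K(2) sK(1)] sK(1)] h K sK
      by (simp add: set_integrable_def integrable_restrict_space wgrad_def)
    show "G absolutely_integrable_on K"
      using borel_rep_integrable[OF borel_rep_restrict[OF G K(2) sK(1)] sK(1)] h K sK
      by (simp add: set_integrable_def integrable_restrict_space wgrad_def)
  }
  fix \<phi> and i :: 'a assume p: "\<phi> \<in> test_functions E" "i \<in> Basis"
  note [measurable] = test_functions_D(5)[OF p(1)] test_functions_D(6)[OF p]
  have r1: "borel_rep E (\<lambda>x. u x * frechet_derivative \<phi> (at x) i) (\<lambda>x. u' x * frechet_derivative \<phi> (at x) i)"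
    using u unfolding borel_rep_def by auto
  have r2: "borel_rep E (\<lambda>x. (G x \<bullet> i) * \<phi> x) (\<lambda>x. (G' x \<bullet> i) * \<phi> x)"
    using G unfolding borel_rep_def by auto
  show "(LINT x|lebesgue_on E. u x * frechet_derivative \<phi> (at x) i) = - (LINT x|lebesgue_on E. (G x \<bullet> i) * \<phi> x)"
    using h p by (simp add: wgrad_def borel_rep_integral[OF r1 E'] borel_rep_integral[OF r2 E'])
qed

lemma wgrad_D:
  assumes "wgrad E u G"
  shows "u \<in> borel_measurable borel" "G \<in> borel_measurable borel" "x \<notin> E \<Longrightarrow> u x = 0" "x \<notin> E \<Longrightarrow> G x = 0"
    "compact K \<Longrightarrow> K \<subseteq> E \<Longrightarrow> integrable lborel (\<lambda>x. indicator K x *\<^sub>R u x)"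
    "compact K \<Longrightarrow> K \<subseteq> E \<Longrightarrow> integrable lborel (\<lambda>x. indicator K x *\<^sub>R G x)"
    "\<phi> \<in> test_functions E \<Longrightarrow> i \<in> Basis \<Longrightarrow>
      (LINT x|lborel. u x * frechet_derivative \<phi> (at x) i) = - (LINT x|lborel. (G x \<bullet> i) * \<phi> x)"
  using assms by (auto simp: wgrad_def)

lemma wgrad_test_integrable:
  assumes h: "wgrad E u G" and p: "\<phi> \<in> test_functions E" "i \<in> Basis"
  shows "integrable lborel (\<lambda>x. u x * frechet_derivative \<phi> (at x) i)"
    "integrable lborel (\<lambda>x. (G x \<bullet> i) * \<phi> x)"
proof -
  obtain K where K: "compact K" "K \<subseteq> E" "\<And>x. x \<notin> K \<Longrightarrow> \<phi> x = 0"
    "\<And>x h. x \<notin> K \<Longrightarrow> frechet_derivative \<phi> (at x) h = 0"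
    using test_functions_support[OF p(1)] by metis
  show "integrable lborel (\<lambda>x. u x * frechet_derivative \<phi> (at x) i)"
    using compact_integrable_mult[OF test_functions_D(4)[OF p] K(1) K(4) wgrad_D(5)[OF h K(1,2)]]
    by (simp add: mult.commute)
  have "integrable lborel (\<lambda>x. (\<phi> x *\<^sub>R G x) \<bullet> i)"
    by (intro integrable_inner_left compact_integrable_mult[OF test_functions_D(2)[OF p(1)] K(1) K(3) wgrad_D(6)[OF h K(1,2)]])
  then show "integrable lborel (\<lambda>x. (G x \<bullet> i) * \<phi> x)" by (simp add: mult.commute)
qed

lemma mol_test:
  fixes x :: "'a::euclidean_space"
  assumes s: "s > 0" and c: "cball x s \<subseteq> E"
  shows "(\<lambda>y. mol s (x - y)) \<in> test_functions E"
    and "frechet_derivative (\<lambda>y. mol s (x - y)) (at y) i = - frechet_derivative (mol s) (at (x - y)) i"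
proof -
  have "Ck k (\<lambda>y. mol s ((-1) *\<^sub>R y + x))" for k by (rule Ck_affine[OF mol_Ck])
  then have "Ck k (\<lambda>y. mol s (x - y))" for k by simp
  moreover have "mol s (x - y) = 0" if "y \<notin> cball x s" for y
    using that by (intro mol_zero[OF s]) (auto simp: dist_norm)
  ultimately show "(\<lambda>y. mol s (x - y)) \<in> test_functions E"
    using c unfolding test_functions_def by (auto intro!: exI[of _ "cball x s"])
  have "((\<lambda>y. mol s ((-1) *\<^sub>R y + x)) has_derivative (\<lambda>h. (-1) * frechet_derivative (mol s) (at ((-1) *\<^sub>R y + x)) h)) (at y)"
    by (rule has_derivative_affine, rule Ck_Suc_D(1)[OF mol_Ck])
  from frechet_derivative_at[OF this]
  show "frechet_derivative (\<lambda>y. mol s (x - y)) (at y) i = - frechet_derivative (mol s) (at (x - y)) i"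
    by (simp add: fun_eq_iff)
qed

text \<open>For x in a compact K and small s, the function y -> \<open>mol s (x - y)\<close> is
  itself a test function. So the mollification of g, cut off near K, vanishes on K, while it
  converges to g there in L^1.\<close>

lemma fundamental_lemma_variations:
  fixes g :: "'a::euclidean_space \<Rightarrow> real"
  assumes E: "open E" and g[measurable]: "g \<in> borel_measurable borel"
    and loc: "\<And>K. compact K \<Longrightarrow> K \<subseteq> E \<Longrightarrow> integrable lborel (\<lambda>x. indicator K x *\<^sub>R g x)"
    and z: "\<And>\<phi>. \<phi> \<in> test_functions E \<Longrightarrow> (LINT x|lborel. g x * \<phi> x) = 0"
  shows "AE x in lborel. x \<in> E \<longrightarrow> g x = 0"
proof (rule compact_cover_AE[OF E])
  fix K assume K: "compact K" "K \<subseteq> E"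
  obtain r where r: "r > 0" "(\<Union>x\<in>K. cball x r) \<subseteq> E" using neighbourhood_in_open[OF K(1) E K(2)] by blast
  let ?K = "\<Union>x\<in>K. cball x r"
  have K': "compact ?K" by (rule compact_neighbourhood[OF K(1)])
  note [measurable] = compact_sets_borel(1)[OF K'] compact_sets_borel(1)[OF K(1)]
  let ?g = "\<lambda>x. indicator ?K x *\<^sub>R g x"
  have ig: "integrable lborel ?g" by (rule loc[OF K' r(2)])
  have kg: "\<bar>indicator K x * g x\<bar> \<le> \<bar>?g x\<bar>" for x using subset_neighbourhood[of r K] r(1) by (auto simp: indicator_def)
  have i: "integrable lborel (\<lambda>x. \<bar>indicator K x * g x\<bar>)"
    using loc[OF K] by simp
  have le: "(LINT x|lborel. \<bar>indicator K x * g x\<bar>) \<le> e" if e: "e > 0" for e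
  proof -
    obtain d where d: "d > 0" "\<And>s. 0 < s \<Longrightarrow> s < d \<Longrightarrow> (Lp_integral 1 (\<lambda>x. conv (mol s) ?g x - ?g x)) \<le> e"
      "\<And>s. 0 < s \<Longrightarrow> s < d \<Longrightarrow> Lp_integrable 1 (\<lambda>x. conv (mol s) ?g x - ?g x)"
      using mollify_Lr[of ?g 1 e] ig e by (auto simp: )
    define s where "s = min (d / 2) r"
    have s: "0 < s" "s < d" "s \<le> r" using d(1) r(1) by (auto simp: s_def)
    have c0: "conv (mol s) ?g x = 0" if x: "x \<in> K" for x
    proof -
      have cb: "cball x s \<subseteq> ?K" using x s(3) by (auto intro!: bexI[of _ x])
      have eq: "mol s (x - y) *\<^sub>R ?g y = g y * mol s (x - y)" for y
      proof (cases "y \<in> ?K")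
        case False
        then have "y \<notin> cball x s" using cb by blast
        then have "mol s (x - y) = 0" by (intro mol_zero[OF s(1)]) (auto simp: dist_norm)
        then show ?thesis by simp
      qed simp
      then have "conv (mol s) ?g x = (LINT y|lborel. g y * mol s (x - y))" unfolding conv_def by (simp only: eq)
      also have "\<dots> = 0" using cb r(2) by (intro z mol_test s) auto
      finally show ?thesis .
    qed
    have "(LINT x|lborel. \<bar>indicator K x * g x\<bar>) \<le> (Lp_integral 1 (\<lambda>x. conv (mol s) ?g x - ?g x))"
    proof (rule integral_mono[OF i d(3)[OF s(1,2)]])
      show "\<bar>indicator K x * g x\<bar> \<le> norm (conv (mol s) ?g x - ?g x) powr 1" for x
        using c0[of x] kg[of x] by (cases "x \<in> K") auto
    qed
    with d(2)[OF s(1,2)] show ?thesis by linarith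
  qed
  have "(LINT x|lborel. \<bar>indicator K x * g x\<bar>) \<le> 0"
    by (rule field_le_epsilon) (use le in simp)
  then have "(LINT x|lborel. \<bar>indicator K x * g x\<bar>) = 0"
    by (intro antisym) auto
  then have "AE x in lborel. \<bar>indicator K x * g x\<bar> = 0"
    using integral_nonneg_eq_0_iff_AE[OF i] by auto
  then show "AE x in lborel. x \<in> K \<longrightarrow> g x = 0" by eventually_elim auto
qed

lemma wgrad_unique:
  assumes E: "open E" and 1: "wgrad E u G" and 2: "wgrad E u' G'" and ae: "AE x in lborel. u x = u' x"
  shows "AE x in lborel. G x = G' x"
proof -
  note [measurable] = wgrad_D(1,2)[OF 1] wgrad_D(1,2)[OF 2]
  have "AE x in lborel. x \<in> E \<longrightarrow> (G x - G' x) \<bullet> i = 0" if i: "i \<in> Basis" for i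
  proof (rule fundamental_lemma_variations[OF E])
    fix K assume K: "compact K" "K \<subseteq> E"
    have "integrable lborel (\<lambda>x. (indicator K x *\<^sub>R G x - indicator K x *\<^sub>R G' x) \<bullet> i)"
      by (intro integrable_inner_left Bochner_Integration.integrable_diff wgrad_D(6)[OF 1 K] wgrad_D(6)[OF 2 K])
    then show "integrable lborel (\<lambda>x. indicator K x *\<^sub>R ((G x - G' x) \<bullet> i))"
      by (simp add: inner_diff_left algebra_simps)
  next
    fix \<phi> assume p: "\<phi> \<in> test_functions E"
    note [measurable] = test_functions_D(6)[OF p i]
    have "(LINT x|lborel. u x * frechet_derivative \<phi> (at x) i) = (LINT x|lborel. u' x * frechet_derivative \<phi> (at x) i)"
      using ae by (intro integral_cong_AE) auto
    then show "(LINT x|lborel. ((G x - G' x) \<bullet> i) * \<phi> x) = 0"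
      using wgrad_D(7)[OF 1 p i] wgrad_D(7)[OF 2 p i] wgrad_test_integrable(2)[OF 1 p i] wgrad_test_integrable(2)[OF 2 p i]
      by (simp add: inner_diff_left left_diff_distrib)
  qed measurable
  then have "AE x in lborel. \<forall>i\<in>Basis. x \<in> E \<longrightarrow> (G x - G' x) \<bullet> i = 0"
    by (subst AE_ball_countable) (auto intro: countable_finite)
  then show ?thesis
  proof eventually_elim
    case (elim x)
    show ?case
    proof (cases "x \<in> E")
      case True
      then have "\<And>i. i \<in> Basis \<Longrightarrow> G x \<bullet> i = G' x \<bullet> i" using elim by (auto simp: inner_diff_left)
      then show ?thesis by (rule euclidean_eqI)
    next
      case False then show ?thesis using wgrad_D(4)[OF 1] wgrad_D(4)[OF 2] by simp
    qed
  qed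
qed

lemma wgrad_AE_cong:
  assumes h: "wgrad E u G" and m[measurable]: "u' \<in> borel_measurable borel" "G' \<in> borel_measurable borel"
    and z: "\<And>x. x \<notin> E \<Longrightarrow> u' x = 0" "\<And>x. x \<notin> E \<Longrightarrow> G' x = 0"
    and ae: "AE x in lborel. u x = u' x" "AE x in lborel. G x = G' x"
  shows "wgrad E u' G'"
  unfolding wgrad_def
proof (intro conjI ballI allI impI m z; (elim conjE)?)
  note [measurable] = wgrad_D(1,2)[OF h]
  {
    fix K assume K: "compact K" "K \<subseteq> E"
    note [measurable] = compact_sets_borel(1)[OF K(1)]
    show "integrable lborel (\<lambda>x. indicator K x *\<^sub>R u' x)"
      using wgrad_D(5)[OF h K] by (rule integrable_cong_AE_imp) (use ae(1) in auto)
    show "integrable lborel (\<lambda>x. indicator K x *\<^sub>R G' x)"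
      using wgrad_D(6)[OF h K] by (rule integrable_cong_AE_imp) (use ae(2) in auto)
  }
  fix \<phi> and i :: 'a assume p: "\<phi> \<in> test_functions E" "i \<in> Basis"
  note [measurable] = test_functions_D(5)[OF p(1)] test_functions_D(6)[OF p]
  have "(LINT x|lborel. u' x * frechet_derivative \<phi> (at x) i) = (LINT x|lborel. u x * frechet_derivative \<phi> (at x) i)"
    using ae(1) by (intro integral_cong_AE) auto
  moreover have "(LINT x|lborel. (G' x \<bullet> i) * \<phi> x) = (LINT x|lborel. (G x \<bullet> i) * \<phi> x)"
    using ae(2) by (intro integral_cong_AE) auto
  ultimately show "(LINT x|lborel. u' x * frechet_derivative \<phi> (at x) i) = - (LINT x|lborel. (G' x \<bullet> i) * \<phi> x)"
    using wgrad_D(7)[OF h p] by simp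
qed

lemma wgrad_linear:
  assumes 1: "wgrad E u G" and 2: "wgrad E u' G'"
  shows "wgrad E (\<lambda>x. a * u x + b * u' x) (\<lambda>x. a *\<^sub>R G x + b *\<^sub>R G' x)"
  unfolding wgrad_def
proof (intro conjI ballI allI impI; (elim conjE)?)
  note [measurable] = wgrad_D(1,2)[OF 1] wgrad_D(1,2)[OF 2]
  show "(\<lambda>x. a * u x + b * u' x) \<in> borel_measurable borel" "(\<lambda>x. a *\<^sub>R G x + b *\<^sub>R G' x) \<in> borel_measurable borel"
    by measurable
  fix x assume "x \<notin> E" then show "a * u x + b * u' x = 0" "a *\<^sub>R G x + b *\<^sub>R G' x = 0"
    using wgrad_D(3,4)[OF 1] wgrad_D(3,4)[OF 2] by auto
next
  fix K assume K: "compact K" "K \<subseteq> E"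
  have "integrable lborel (\<lambda>x. a * (indicator K x *\<^sub>R u x) + b * (indicator K x *\<^sub>R u' x))"
    by (intro Bochner_Integration.integrable_add integrable_mult_right wgrad_D(5)[OF 1 K] wgrad_D(5)[OF 2 K])
  then show "integrable lborel (\<lambda>x. indicator K x *\<^sub>R (a * u x + b * u' x))" by (simp add: algebra_simps)
  have "integrable lborel (\<lambda>x. a *\<^sub>R (indicator K x *\<^sub>R G x) + b *\<^sub>R (indicator K x *\<^sub>R G' x))"
    by (intro Bochner_Integration.integrable_add integrable_scaleR_right wgrad_D(6)[OF 1 K] wgrad_D(6)[OF 2 K])
  then show "integrable lborel (\<lambda>x. indicator K x *\<^sub>R (a *\<^sub>R G x + b *\<^sub>R G' x))" by (simp add: algebra_simps)
next
  fix \<phi> and i :: 'a assume p: "\<phi> \<in> test_functions E" "i \<in> Basis"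
  have "(LINT x|lborel. (a * u x + b * u' x) * frechet_derivative \<phi> (at x) i) =
    a * (LINT x|lborel. u x * frechet_derivative \<phi> (at x) i) + b * (LINT x|lborel. u' x * frechet_derivative \<phi> (at x) i)"
    using wgrad_test_integrable(1)[OF 1 p] wgrad_test_integrable(1)[OF 2 p] by (simp add: distrib_right mult.assoc)
  moreover have "(LINT x|lborel. ((a *\<^sub>R G x + b *\<^sub>R G' x) \<bullet> i) * \<phi> x) =
    a * (LINT x|lborel. (G x \<bullet> i) * \<phi> x) + b * (LINT x|lborel. (G' x \<bullet> i) * \<phi> x)"
    using wgrad_test_integrable(2)[OF 1 p] wgrad_test_integrable(2)[OF 2 p] by (simp add: inner_add_left distrib_right mult.assoc)
  ultimately show "(LINT x|lborel. (a * u x + b * u' x) * frechet_derivative \<phi> (at x) i) =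
     - (LINT x|lborel. ((a *\<^sub>R G x + b *\<^sub>R G' x) \<bullet> i) * \<phi> x)"
    using wgrad_D(7)[OF 1 p] wgrad_D(7)[OF 2 p] by simp
qed

text \<open>Integration by parts is the vanishing of the integral of a partial derivative of the
  compactly supported product of the two functions.\<close>

lemma wgrad_test:
  assumes p: "\<psi> \<in> test_functions E"
  shows "wgrad E \<psi> (grad \<psi>)"
  unfolding wgrad_def
proof (intro conjI ballI allI impI test_functions_D(5,8)[OF p]; (elim conjE)?)
  obtain K where K: "compact K" "K \<subseteq> E" "\<And>x. x \<notin> K \<Longrightarrow> \<psi> x = 0" "\<And>x. x \<notin> K \<Longrightarrow> grad \<psi> x = 0"
    using test_functions_support[OF p] by metis
  fix x assume "x \<notin> E" then show "\<psi> x = 0" "grad \<psi> x = 0" using K by auto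
next
  fix K assume K: "compact K" "K \<subseteq> E"
  show "integrable lborel (\<lambda>x. indicator K x *\<^sub>R \<psi> x)" "integrable lborel (\<lambda>x. indicator K x *\<^sub>R grad \<psi> x)"
    by (rule borel_integrable_compact[OF K(1) continuous_on_subset[OF test_functions_D(2)[OF p] subset_UNIV]],
        rule borel_integrable_compact[OF K(1) continuous_on_subset[OF test_functions_D(7)[OF p] subset_UNIV]])
next
  fix \<phi> and i :: 'a assume q: "\<phi> \<in> test_functions E" "i \<in> Basis"
  obtain K where K: "compact K" "K \<subseteq> E" "\<And>x. x \<notin> K \<Longrightarrow> \<phi> x = 0" "\<And>x h. x \<notin> K \<Longrightarrow> frechet_derivative \<phi> (at x) h = 0"
    using test_functions_support[OF q(1)] by metis
  let ?f = "\<lambda>x h. \<psi> x * frechet_derivative \<phi> (at x) h + frechet_derivative \<psi> (at x) h * \<phi> x"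
  have "(LINT x|lborel. ?f x i) = 0"
  proof (rule integral_partial_derivative_zero[where f="\<lambda>x. \<psi> x * \<phi> x", OF _ _ K(1) _ q(2)])
    show "((\<lambda>x. \<psi> x * \<phi> x) has_derivative ?f x) (at x)" for x
      by (rule has_derivative_mult[OF test_functions_D(3)[OF p] test_functions_D(3)[OF q(1)]])
    show "continuous_on UNIV (\<lambda>x. ?f x i)" if "i \<in> Basis" for i
      using test_functions_D(2,4)[OF p] test_functions_D(2,4)[OF q(1)] that by (intro continuous_intros)
  qed (use K in simp)
  moreover have "integrable lborel (\<lambda>x. \<psi> x * frechet_derivative \<phi> (at x) i)"
    by (rule compact_support_integrable[OF _ K(1)])
      (use K(4) test_functions_D(2)[OF p] test_functions_D(4)[OF q] in \<open>auto intro: continuous_on_mult\<close>)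
  moreover have "integrable lborel (\<lambda>x. frechet_derivative \<psi> (at x) i * \<phi> x)"
    by (rule compact_support_integrable[OF _ K(1)])
      (use K(3) test_functions_D(2)[OF q(1)] test_functions_D(4)[OF p q(2)] in \<open>auto intro: continuous_on_mult\<close>)
  ultimately show "(LINT x|lborel. \<psi> x * frechet_derivative \<phi> (at x) i) = - (LINT x|lborel. (grad \<psi> x \<bullet> i) * \<phi> x)"
    by (simp add: grad_inner[OF q(2)])
qed

text \<open>The weak gradient is tested with the mollifier centred at x, admissible because its ball
  stays in E; the sign of the reflected kernel cancels that of the integration by parts. Thus
  mollification commutes with the weak gradient away from the boundary.\<close>

lemma conv_wgrad:
  assumes h: "wgrad E u G" and s: "s > 0" and K: "compact K" "K \<subseteq> E" "cball x s \<subseteq> K" and i: "i \<in> Basis"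
  shows "conv (\<lambda>z. frechet_derivative (mol s) (at z) i) (\<lambda>x. indicator K x *\<^sub>R u x) x
    = conv (mol s) (\<lambda>x. indicator K x *\<^sub>R G x) x \<bullet> i"
proof -
  note [measurable] = wgrad_D(1,2)[OF h]
  have z: "mol s (x - y) = 0" "frechet_derivative (mol s) (at (x - y)) i = 0" if "y \<notin> K" for y
  proof -
    have "y \<notin> cball x s" using that K(3) by blast
    then have y: "x - y \<notin> cball 0 s" by (simp add: dist_norm norm_minus_commute)
    have z: "mol s w = 0" if "w \<notin> cball 0 s" for w :: 'a using that by (intro mol_zero[OF s]) simp
    show "mol s (x - y) = 0" by (rule z[OF y])
    show "frechet_derivative (mol s) (at (x - y)) i = 0"
      by (rule derivative_zero_off_support[OF Ck_Suc_D(1)[OF mol_Ck] _ z y]) simp_all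
  qed
  have t: "(\<lambda>y. mol s (x - y)) \<in> test_functions E" using K by (intro mol_test s) auto
  have "conv (\<lambda>z. frechet_derivative (mol s) (at z) i) (\<lambda>x. indicator K x *\<^sub>R u x) x =
    - (LINT y|lborel. u y * frechet_derivative (\<lambda>y. mol s (x - y)) (at y) i)"
    unfolding conv_def integral_minus[symmetric]
    by (intro Bochner_Integration.integral_cong refl) (use z(2) in \<open>auto simp: mol_test(2)[OF s subset_trans[OF K(3,2)]] indicator_def\<close>)
  also have "\<dots> = (LINT y|lborel. (G y \<bullet> i) * mol s (x - y))" using wgrad_D(7)[OF h t i] by simp
  also have "\<dots> = (LINT y|lborel. (mol s (x - y) *\<^sub>R indicator K y *\<^sub>R G y) \<bullet> i)"
    by (intro Bochner_Integration.integral_cong refl) (use z(1) in \<open>auto simp: indicator_def\<close>)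
  also have "\<dots> = conv (mol s) (\<lambda>x. indicator K x *\<^sub>R G x) x \<bullet> i"
    unfolding conv_def
  proof (rule integral_inner_left)
    show "integrable lborel (\<lambda>y. mol s (x - y) *\<^sub>R indicator K y *\<^sub>R G y)"
      by (rule conv_integrable[OF Ck_continuous[OF mol_Ck] compact_cball[of 0 s] _ wgrad_D(6)[OF h K(1,2)]])
        (intro mol_zero[OF s], simp)
  qed
  finally show ?thesis .
qed

section \<open>Simultaneous mollification of a function and its weak gradient, and the chain
  rule\<close>

lemma AE_subseq_powr:
  fixes s :: "nat \<Rightarrow> 'a \<Rightarrow> 'b::{banach, second_countable_topology}"
  assumes "\<And>n. integrable M (\<lambda>x. norm (s n x - f x) powr r)" "r > 0"
    and "(\<lambda>n. LINT x|M. norm (s n x - f x) powr r) \<longlonglongrightarrow> 0"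
  obtains k where "strict_mono (k :: nat \<Rightarrow> nat)" "AE x in M. (\<lambda>n. s (k n) x) \<longlonglongrightarrow> f x"
proof -
  obtain k where k: "strict_mono (k :: nat \<Rightarrow> nat)" "AE x in M. (\<lambda>n. norm (s (k n) x - f x) powr r) \<longlonglongrightarrow> 0"
    using tendsto_L1_AE_subseq[of M "\<lambda>n x. norm (s n x - f x) powr r"] assms by auto
  from k(2) have "AE x in M. (\<lambda>n. s (k n) x) \<longlonglongrightarrow> f x"
  proof eventually_elim
    case (elim x)
    have "(\<lambda>n. (norm (s (k n) x - f x) powr r) powr (1 / r)) \<longlonglongrightarrow> 0 powr (1 / r)"
      by (rule tendsto_powr'[OF elim tendsto_const]) (use assms(2) in auto)
    then have "(\<lambda>n. norm (s (k n) x - f x)) \<longlonglongrightarrow> 0" using assms(2) by (simp add: powr_powr)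
    then show ?case by (simp add: tendsto_norm_zero_iff LIM_zero_iff)
  qed
  with k(1) that show ?thesis by blast
qed

lemma tendsto_of_le_inverse:
  fixes a :: "nat \<Rightarrow> real"
  assumes "\<And>n. 0 \<le> a n" "\<And>n. a n \<le> 1 / Suc n"
  shows "a \<longlonglongrightarrow> 0"
proof (rule tendsto_sandwich[OF _ _ tendsto_const])
  show "(\<lambda>n. 1 / real (Suc n)) \<longlonglongrightarrow> 0" using LIMSEQ_inverse_real_of_nat by (simp add: inverse_eq_divide)
qed (use assms in auto)

lemma integrable_powr1:
  fixes f :: "'a \<Rightarrow> 'b::{banach, second_countable_topology}"
  assumes "integrable M f" shows "integrable M (\<lambda>x. norm (f x) powr 1)"
  using integrable_norm[OF assms] by simp

text \<open>One sequence of radii serves both u and G, and the bound r keeps the kernels inside a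
  prescribed neighbourhood.\<close>

lemma mollify_sequence:
  fixes u :: "'a::euclidean_space \<Rightarrow> real" and G :: "'a \<Rightarrow> 'a"
  assumes u: "integrable lborel u" "u \<in> borel_measurable borel" "Lp_integrable p u"
    and G: "integrable lborel G" "G \<in> borel_measurable borel" "Lp_integrable p G" and p: "p \<ge> 1" and r: "r > 0"
  obtains s where "\<And>n. 0 < s n" "\<And>n. s n < r"
    "\<And>n. Lp_integrable p (\<lambda>x. conv (mol (s n)) u x - u x)"
    "\<And>n. Lp_integrable p (\<lambda>x. conv (mol (s n)) G x - G x)"
    "(\<lambda>n. Lp_integral p (\<lambda>x. conv (mol (s n)) u x - u x)) \<longlonglongrightarrow> 0"
    "(\<lambda>n. Lp_integral p (\<lambda>x. conv (mol (s n)) G x - G x)) \<longlonglongrightarrow> 0"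
proof -
  have "\<exists>s. 0 < s \<and> s < r \<and> Lp_integrable p (\<lambda>x. conv (mol s) u x - u x) \<and>
    Lp_integrable p (\<lambda>x. conv (mol s) G x - G x) \<and>
    (Lp_integral p (\<lambda>x. conv (mol s) u x - u x)) \<le> 1 / Suc n \<and>
    (Lp_integral p (\<lambda>x. conv (mol s) G x - G x)) \<le> 1 / Suc n" for n
  proof -
    have e: "1 / real (Suc n) > 0" by simp
    obtain d where d: "d > 0" "\<And>s. 0 < s \<Longrightarrow> s < d \<Longrightarrow> (Lp_integral p (\<lambda>x. conv (mol s) u x - u x)) \<le> 1 / Suc n"
      "\<And>s. 0 < s \<Longrightarrow> s < d \<Longrightarrow> Lp_integrable p (\<lambda>x. conv (mol s) u x - u x)"
      using mollify_Lr[OF u(2,3,1) p e] by blast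
    obtain d' where d': "d' > 0" "\<And>s. 0 < s \<Longrightarrow> s < d' \<Longrightarrow> (Lp_integral p (\<lambda>x. conv (mol s) G x - G x)) \<le> 1 / Suc n"
      "\<And>s. 0 < s \<Longrightarrow> s < d' \<Longrightarrow> Lp_integrable p (\<lambda>x. conv (mol s) G x - G x)"
      using mollify_Lr[OF G(2,3,1) p e] by blast
    define s where "s = min (min d d') r / 2"
    have "0 < s" "s < d" "s < d'" "s < r" unfolding s_def using d(1) d'(1) r by auto
    then show ?thesis by (intro exI[of _ s] conjI d(2,3) d'(2,3))
  qed
  then obtain s where "\<forall>n. 0 < s n \<and>
    s n < r \<and>
    Lp_integrable p (\<lambda>x. conv (mol (s n)) u x - u x) \<and>
    Lp_integrable p (\<lambda>x. conv (mol (s n)) G x - G x) \<and>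
    (Lp_integral p (\<lambda>x. conv (mol (s n)) u x - u x)) \<le> 1 / Suc n \<and>
    (Lp_integral p (\<lambda>x. conv (mol (s n)) G x - G x)) \<le> 1 / Suc n"
    using choice[of "\<lambda>n s. 0 < s \<and>
      s < r \<and>
      Lp_integrable p (\<lambda>x. conv (mol s) u x - u x) \<and>
      Lp_integrable p (\<lambda>x. conv (mol s) G x - G x) \<and>
      (Lp_integral p (\<lambda>x. conv (mol s) u x - u x)) \<le> 1 / Suc n \<and>
      (Lp_integral p (\<lambda>x. conv (mol s) G x - G x)) \<le> 1 / Suc n"] by blast
  then have s: "\<And>n. 0 < s n"
    "\<And>n. s n < r"
    "\<And>n. Lp_integrable p (\<lambda>x. conv (mol (s n)) u x - u x)"
    "\<And>n. Lp_integrable p (\<lambda>x. conv (mol (s n)) G x - G x)"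
    "\<And>n. (Lp_integral p (\<lambda>x. conv (mol (s n)) u x - u x)) \<le> 1 / Suc n"
    "\<And>n. (Lp_integral p (\<lambda>x. conv (mol (s n)) G x - G x)) \<le> 1 / Suc n"
    by blast+
  have "(\<lambda>n. Lp_integral p (\<lambda>x. conv (mol (s n)) u x - u x)) \<longlonglongrightarrow> 0"
    by (rule tendsto_of_le_inverse[OF _ s(5)]) simp
  moreover have "(\<lambda>n. Lp_integral p (\<lambda>x. conv (mol (s n)) G x - G x)) \<longlonglongrightarrow> 0"
    by (rule tendsto_of_le_inverse[OF _ s(6)]) simp
  ultimately show ?thesis by (rule that[OF s(1-4)])
qed

lemma lipschitz_of_deriv_bound:
  fixes H :: "real \<Rightarrow> real"
  assumes "\<And>r. (H has_real_derivative H' r) (at r)" "\<And>r. \<bar>H' r\<bar> \<le> B"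
  shows "\<bar>H a - H b\<bar> \<le> B * \<bar>a - b\<bar>"
  using field_differentiable_bound[of UNIV H H' B a b] assms by (auto simp: DERIV_subset)

text \<open>Near the support of a test function, mollification supplies smooth functions whose
  gradients converge in L^1 and for which the classical chain rule holds. Boundedness of H' controls
  the error of the gradients; its continuity handles the nonlinear factor by dominated
  convergence.\<close>

lemma wgrad_chain_rule:
  assumes E: "open E" and h: "wgrad E u G"
    and H: "\<And>r. (H has_real_derivative H' r) (at r)" "continuous_on UNIV H'" "\<And>r. \<bar>H' r\<bar> \<le> B" "H 0 = 0"
  shows "wgrad E (\<lambda>x. H (u x)) (\<lambda>x. H' (u x) *\<^sub>R G x)"
  unfolding wgrad_def
proof (intro conjI ballI allI impI; (elim conjE)?)
  note [measurable] = wgrad_D(1,2)[OF h]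
  have Hc: "continuous_on UNIV H" using H(1) by (meson DERIV_isCont continuous_at_imp_continuous_on)
  have [measurable]: "H \<in> borel_measurable borel" "H' \<in> borel_measurable borel"
    using Hc H(2) by (auto intro: borel_measurable_continuous_onI)
  have B: "B \<ge> 0" using H(3)[of 0] by linarith
  have lip: "\<bar>H a - H b\<bar> \<le> B * \<bar>a - b\<bar>" for a b by (rule lipschitz_of_deriv_bound[OF H(1,3)])
  have lip0: "\<bar>H a\<bar> \<le> B * \<bar>a\<bar>" for a using lip[of a 0] H(4) by simp
  show "(\<lambda>x. H (u x)) \<in> borel_measurable borel" "(\<lambda>x. H' (u x) *\<^sub>R G x) \<in> borel_measurable borel"
    by measurable
  show "H (u x) = 0" "H' (u x) *\<^sub>R G x = 0" if "x \<notin> E" for x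
    using wgrad_D(3,4)[OF h that] H(4) by auto
  {
    fix K assume K: "compact K" "K \<subseteq> E"
    note [measurable] = compact_sets_borel(1)[OF K(1)]
    show "integrable lborel (\<lambda>x. indicator K x *\<^sub>R H (u x))"
      by (rule Bochner_Integration.integrable_bound[OF integrable_mult_right[OF integrable_abs[OF wgrad_D(5)[OF h K]], of B]])
       (use lip0 B in \<open>auto simp: indicator_def\<close>)
    show "integrable lborel (\<lambda>x. indicator K x *\<^sub>R (H' (u x) *\<^sub>R G x))"
      by (rule Bochner_Integration.integrable_bound[OF integrable_mult_right[OF integrable_norm[OF wgrad_D(6)[OF h K]], of B]])
       (use H(3) B in \<open>auto simp: indicator_def intro!: mult_right_mono\<close>)
  }
  fix \<phi> and i :: 'a assume p: "\<phi> \<in> test_functions E" and i: "i \<in> Basis"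
  note [measurable] = test_functions_D(5)[OF p(1)] test_functions_D(6)[OF p i]
  obtain K where K: "compact K" "K \<subseteq> E" "\<And>x. x \<notin> K \<Longrightarrow> \<phi> x = 0"
    "\<And>x h. x \<notin> K \<Longrightarrow> frechet_derivative \<phi> (at x) h = 0"
    using test_functions_support[OF p(1)] by metis
  obtain r where r: "r > 0" "(\<Union>x\<in>K. cball x r) \<subseteq> E" using neighbourhood_in_open[OF K(1) E K(2)] by blast
  let ?K = "\<Union>x\<in>K. cball x r"
  have K': "compact ?K" by (rule compact_neighbourhood[OF K(1)])
  have KK: "K \<subseteq> ?K" using subset_neighbourhood[of r K] r(1) by simp
  note [measurable] = compact_sets_borel(1)[OF K'] compact_sets_borel(1)[OF K(1)]
  \<comment> \<open>Truncation to \<open>?K\<close> makes u and G integrable on the whole space;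
    mollifications with radius below r, evaluated on K, do not see it.\<close>
  define v where "v x = indicator ?K x *\<^sub>R u x" for x
  define F where "F x = indicator ?K x *\<^sub>R G x" for x
  have vi: "integrable lborel v" and Fi: "integrable lborel F"
    unfolding v_def[abs_def] F_def[abs_def] by (rule wgrad_D(5)[OF h K' r(2)], rule wgrad_D(6)[OF h K' r(2)])
  have vm[measurable]: "v \<in> borel_measurable borel" and Fm[measurable]: "F \<in> borel_measurable borel"
    unfolding v_def[abs_def] F_def[abs_def] by measurable
  have vK: "v x = u x" "F x = G x" if "x \<in> K" for x
  proof -
    have "indicator ?K x = (1::real)" using KK that by (intro indicator_simps(1)) blast
    then show "v x = u x" "F x = G x" by (simp_all only: v_def F_def scaleR_one)
  qed
  obtain Mp where Mp: "Mp > 0" "\<And>x. norm (\<phi> x) \<le> Mp"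
    using compact_support_bounded[OF test_functions_D(2)[OF p] K(1,3)] by blast
  obtain Mq where Mq: "Mq > 0" "\<And>x. norm (frechet_derivative \<phi> (at x) i) \<le> Mq"
    using compact_support_bounded[OF test_functions_D(4)[OF p i] K(1,4)] by blast
  obtain s where s: "\<And>n. 0 < s n" "\<And>n. s n < r"
    and cu: "\<And>n. Lp_integrable 1 (\<lambda>x. conv (mol (s n)) v x - v x)"
      "(\<lambda>n. Lp_integral 1 (\<lambda>x. conv (mol (s n)) v x - v x)) \<longlonglongrightarrow> 0"
    and cG: "\<And>n. Lp_integrable 1 (\<lambda>x. conv (mol (s n)) F x - F x)"
      "(\<lambda>n. Lp_integral 1 (\<lambda>x. conv (mol (s n)) F x - F x)) \<longlonglongrightarrow> 0"
    by (rule mollify_sequence[OF vi vm integrable_powr1[OF vi] Fi Fm integrable_powr1[OF Fi] order.refl r(1)])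
      (rule that; assumption)
  \<comment> \<open>Convergence almost everywhere, hence a subsequence, is needed for the factor
    H'(U n), as H' is merely continuous.\<close>
  obtain k where k: "strict_mono (k :: nat \<Rightarrow> nat)" "AE x in lborel. (\<lambda>n. conv (mol (s (k n))) v x) \<longlonglongrightarrow> v x"
    using AE_subseq_powr[OF cu(1) zero_less_one cu(2)] by blast
  define U where "U n = conv (mol (s (k n))) v" for n
  define V where "V n = conv (mol (s (k n))) F" for n
  have cU: "\<And>n. integrable lborel (\<lambda>x. \<bar>U n x - v x\<bar>)" "(\<lambda>n. LINT x|lborel. \<bar>U n x - v x\<bar>) \<longlonglongrightarrow> 0"
    using cu(1) LIMSEQ_subseq_LIMSEQ[OF cu(2) k(1)] by (simp_all add: U_def o_def)
  have cV: "\<And>n. integrable lborel (\<lambda>x. norm (V n x - F x))" "(\<lambda>n. LINT x|lborel. norm (V n x - F x)) \<longlonglongrightarrow> 0"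
    using cG(1) LIMSEQ_subseq_LIMSEQ[OF cG(2) k(1)] by (simp_all add: V_def o_def)
  have UC: "Ck m (U n)" for m n
    unfolding U_def by (rule conv_Ck[OF mol_Ck compact_cball[of 0 "s (k n)"] _ vi]) (intro mol_zero s, simp)
  have [measurable]: "U n \<in> borel_measurable borel" for n
    using Ck_continuous[OF UC] by (rule borel_measurable_continuous_onI)
  have Vm[measurable]: "V n \<in> borel_measurable borel" for n
  proof -
    have [measurable]: "(mol (s (k n)) :: 'a \<Rightarrow> real) \<in> borel_measurable borel"
      using Ck_continuous[OF mol_Ck] by (rule borel_measurable_continuous_onI)
    show ?thesis unfolding V_def conv_def[abs_def] by measurable
  qed
  have id: "integrable lborel (\<lambda>x. H (U n x) * frechet_derivative \<phi> (at x) i)" for n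
    by (rule compact_support_integrable[OF _ K(1)])
      (use K(4) in \<open>auto intro!: continuous_on_mult test_functions_D(4)[OF p i] continuous_on_compose2[OF Hc Ck_continuous[OF UC]]\<close>)
  have dU: "frechet_derivative (U n) (at x) j = V n x \<bullet> j" if x: "x \<in> K" and j: "j \<in> Basis" for x n j
  proof -
    have "(U n has_derivative (\<lambda>h. \<Sum>i\<in>Basis. (h \<bullet> i) * conv (\<lambda>z. frechet_derivative (mol (s (k n))) (at z) i) v x)) (at x)"
      unfolding U_def
      by (rule conv_has_derivative[OF Ck_Suc_D(1)[OF mol_Ck] Ck_continuous[OF Ck_Suc_D(2)[OF mol_Ck]] compact_cball[of 0 "s (k n)"] _ vi])
        (assumption, intro mol_zero s, simp)
    from frechet_derivative_at[OF this]
    have "frechet_derivative (U n) (at x) j = (\<Sum>i\<in>Basis. (j \<bullet> i) * conv (\<lambda>z. frechet_derivative (mol (s (k n))) (at z) i) v x)"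
      by (metis (no_types, lifting))
    also have "\<dots> = conv (\<lambda>z. frechet_derivative (mol (s (k n))) (at z) j) v x"
      using j by (simp add: inner_Basis if_distrib[of "\<lambda>a. a * _"] sum.delta cong: if_cong)
    also have "\<dots> = V n x \<bullet> j"
      unfolding V_def v_def[abs_def] F_def[abs_def]
    proof (rule conv_wgrad[OF h s(1) K' r(2) _ j])
      show "cball x (s (k n)) \<subseteq> ?K" using x less_imp_le[OF s(2)[of "k n"]] by (auto intro!: bexI[of _ x])
    qed
    finally show ?thesis .
  qed
  \<comment> \<open>The gradient of \<open>U n\<close> is known to be \<open>V n\<close> only on K;
    elsewhere \<open>\<phi>\<close> vanishes.\<close>
  have step: "(LINT x|lborel. H (U n x) * frechet_derivative \<phi> (at x) i) = - (LINT x|lborel. H' (U n x) * (V n x \<bullet> i) * \<phi> x)" for n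
  proof -
    let ?f = "\<lambda>x h. H (U n x) * frechet_derivative \<phi> (at x) h + H' (U n x) * frechet_derivative (U n) (at x) h * \<phi> x"
    have c1: "continuous_on UNIV (\<lambda>x. H (U n x))" by (rule continuous_on_compose2[OF Hc Ck_continuous[OF UC]]) auto
    have c2: "continuous_on UNIV (\<lambda>x. H' (U n x))" by (rule continuous_on_compose2[OF H(2) Ck_continuous[OF UC]]) auto
    have c3: "continuous_on UNIV (\<lambda>x. frechet_derivative (U n) (at x) i)" if "i \<in> Basis" for i
      by (rule Ck_continuous[OF Ck_Suc_D(2)[OF UC that]])
    have "(LINT x|lborel. ?f x i) = 0"
    proof (rule integral_partial_derivative_zero[where f="\<lambda>x. H (U n x) * \<phi> x", OF _ _ K(1) _ i])
      show "((\<lambda>x. H (U n x) * \<phi> x) has_derivative ?f x) (at x)" for x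
        by (rule has_derivative_mult[OF has_derivative_compose[OF Ck_Suc_D(1)[OF UC] has_field_derivative_imp_has_derivative[OF H(1)]] test_functions_D(3)[OF p]])
      show "continuous_on UNIV (\<lambda>x. ?f x i)" if "i \<in> Basis" for i
        by (intro continuous_intros c1 c2 c3 that test_functions_D(2,4)[OF p])
    qed (use K in simp)
    moreover note id
    moreover have "integrable lborel (\<lambda>x. H' (U n x) * frechet_derivative (U n) (at x) i * \<phi> x)"
      by (rule compact_support_integrable[OF _ K(1)])
        (use K(3) in \<open>auto intro!: continuous_on_mult test_functions_D(2)[OF p] c2 c3 i\<close>)
    moreover have "(LINT x|lborel. H' (U n x) * frechet_derivative (U n) (at x) i * \<phi> x) = (LINT x|lborel. H' (U n x) * (V n x \<bullet> i) * \<phi> x)"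
      by (rule Bochner_Integration.integral_cong[OF refl]) (use dU i K(3) in \<open>metis mult_zero_right\<close>)
    ultimately show ?thesis by simp
  qed
  have Hv: "integrable lborel (\<lambda>x. H (v x) * frechet_derivative \<phi> (at x) i)"
  proof (rule Bochner_Integration.integrable_bound[OF integrable_mult_right[OF integrable_abs[OF vi], of "B * Mq"]])
    show "AE x in lborel. norm (H (v x) * frechet_derivative \<phi> (at x) i) \<le> norm (B * Mq * \<bar>v x\<bar>)"
    proof (rule AE_I2)
      fix x
      have "\<bar>H (v x)\<bar> * \<bar>frechet_derivative \<phi> (at x) i\<bar> \<le> (B * \<bar>v x\<bar>) * Mq"
        using lip0 Mq B by (intro mult_mono) auto
      then show "norm (H (v x) * frechet_derivative \<phi> (at x) i) \<le> norm (B * Mq * \<bar>v x\<bar>)"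
        using B Mq by (simp add: abs_mult mult_ac)
    qed
  qed measurable
  have L1: "(\<lambda>n. LINT x|lborel. H (U n x) * frechet_derivative \<phi> (at x) i) \<longlonglongrightarrow> (LINT x|lborel. H (v x) * frechet_derivative \<phi> (at x) i)"
  proof (rule Lim_null_comparison[where g="\<lambda>n. B * Mq * (LINT x|lborel. \<bar>U n x - v x\<bar>)", THEN LIM_zero_cancel])
    show "\<forall>\<^sub>F n in sequentially. norm ((LINT x|lborel. H (U n x) * frechet_derivative \<phi> (at x) i) - (LINT x|lborel. H (v x) * frechet_derivative \<phi> (at x) i))
      \<le> B * Mq * (LINT x|lborel. \<bar>U n x - v x\<bar>)"
    proof (rule always_eventually, rule allI)
      fix n
      have "(LINT x|lborel. H (U n x) * frechet_derivative \<phi> (at x) i) - (LINT x|lborel. H (v x) * frechet_derivative \<phi> (at x) i)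
        = (LINT x|lborel. H (U n x) * frechet_derivative \<phi> (at x) i - H (v x) * frechet_derivative \<phi> (at x) i)"
        using id Hv by simp
      also have "norm \<dots> \<le> (LINT x|lborel. B * Mq * \<bar>U n x - v x\<bar>)"
      proof (intro order_trans[OF integral_norm_bound] integral_mono)
        show "norm (H (U n x) * frechet_derivative \<phi> (at x) i - H (v x) * frechet_derivative \<phi> (at x) i) \<le> B * Mq * \<bar>U n x - v x\<bar>" for x
        proof -
          have "\<bar>H (U n x) - H (v x)\<bar> * \<bar>frechet_derivative \<phi> (at x) i\<bar> \<le> (B * \<bar>U n x - v x\<bar>) * Mq"
            using lip Mq B by (intro mult_mono) auto
          then show ?thesis by (simp add: left_diff_distrib[symmetric] abs_mult mult_ac)
        qed
      qed (use id Hv cU in auto)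
      finally show "norm ((LINT x|lborel. H (U n x) * frechet_derivative \<phi> (at x) i) - (LINT x|lborel. H (v x) * frechet_derivative \<phi> (at x) i))
        \<le> B * Mq * (LINT x|lborel. \<bar>U n x - v x\<bar>)" by simp
    qed
    show "(\<lambda>n. B * Mq * (LINT x|lborel. \<bar>U n x - v x\<bar>)) \<longlonglongrightarrow> 0" using cU(2) by (rule tendsto_mult_right_zero)
  qed
  \<comment> \<open>The first term carries the error of the gradients, the second has a fixed
    gradient and needs only the convergence of H'(U n).\<close>
  let ?T1 = "\<lambda>n x. H' (U n x) * ((V n x - F x) \<bullet> i) * \<phi> x" and ?T2 = "\<lambda>n x. H' (U n x) * (F x \<bullet> i) * \<phi> x"
  have b1: "\<bar>?T1 n x\<bar> \<le> B * Mp * norm (V n x - F x)" for n x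
  proof -
    have "\<bar>H' (U n x)\<bar> * \<bar>(V n x - F x) \<bullet> i\<bar> * \<bar>\<phi> x\<bar> \<le> B * norm (V n x - F x) * Mp"
      using H(3) Mp B Basis_le_norm[OF i] by (intro mult_mono) auto
    then show ?thesis by (simp add: abs_mult mult_ac)
  qed
  have b2: "\<bar>H' a * (F x \<bullet> i) * \<phi> x\<bar> \<le> B * Mp * norm (F x)" for a x
  proof -
    have "\<bar>H' a\<bar> * \<bar>F x \<bullet> i\<bar> * \<bar>\<phi> x\<bar> \<le> B * norm (F x) * Mp"
      using H(3) Mp B Basis_le_norm[OF i] by (intro mult_mono) auto
    then show ?thesis by (simp add: abs_mult mult_ac)
  qed
  have I1: "integrable lborel (?T1 n)" for n
    by (rule Bochner_Integration.integrable_bound[OF integrable_mult_right[OF cV(1)[of n], of "B * Mp"]])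
      (use b1 B Mp in \<open>auto simp: abs_mult intro!: AE_I2\<close>)
  have I2: "integrable lborel (?T2 n)" for n
    by (rule Bochner_Integration.integrable_bound[OF integrable_mult_right[OF integrable_norm[OF Fi], of "B * Mp"]])
      (use b2 B Mp in \<open>auto simp: abs_mult intro!: AE_I2\<close>)
  have L2: "(\<lambda>n. LINT x|lborel. ?T1 n x) \<longlonglongrightarrow> 0"
  proof (rule Lim_null_comparison[where g="\<lambda>n. B * Mp * (LINT x|lborel. norm (V n x - F x))"])
    show "\<forall>\<^sub>F n in sequentially. norm (LINT x|lborel. ?T1 n x) \<le> B * Mp * (LINT x|lborel. norm (V n x - F x))"
    proof (rule always_eventually, rule allI)
      fix n
      have "norm (LINT x|lborel. ?T1 n x) \<le> (LINT x|lborel. B * Mp * norm (V n x - F x))"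
        using I1[of n] cV(1)[of n] b1 by (intro order_trans[OF integral_norm_bound] integral_mono) auto
      then show "norm (LINT x|lborel. ?T1 n x) \<le> B * Mp * (LINT x|lborel. norm (V n x - F x))" by simp
    qed
    show "(\<lambda>n. B * Mp * (LINT x|lborel. norm (V n x - F x))) \<longlonglongrightarrow> 0" using cV(2) by (rule tendsto_mult_right_zero)
  qed
  have L3: "(\<lambda>n. LINT x|lborel. ?T2 n x) \<longlonglongrightarrow> (LINT x|lborel. H' (v x) * (F x \<bullet> i) * \<phi> x)"
  proof (rule integral_dominated_convergence[where w="\<lambda>x. B * Mp * norm (F x)"])
    show "integrable lborel (\<lambda>x. B * Mp * norm (F x))" using Fi by simp
    show "AE x in lborel. (\<lambda>n. ?T2 n x) \<longlonglongrightarrow> H' (v x) * (F x \<bullet> i) * \<phi> x"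
      using k(2)
    proof eventually_elim
      case (elim x)
      have "isCont H' (v x)" using H(2) by (simp add: continuous_on_eq_continuous_at)
      from isCont_tendsto_compose[OF this elim] show ?case
        unfolding U_def by (intro tendsto_intros)
    qed
  qed (use b2 in auto)
  have "(\<lambda>n. - (LINT x|lborel. ?T1 n x + ?T2 n x)) \<longlonglongrightarrow> - (0 + (LINT x|lborel. H' (v x) * (F x \<bullet> i) * \<phi> x))"
    using I1 I2 by (simp only: Bochner_Integration.integral_add) (intro tendsto_minus tendsto_add L2 L3)
  moreover have "?T1 n x + ?T2 n x = H' (U n x) * (V n x \<bullet> i) * \<phi> x" for n x
    by (simp add: inner_diff_left algebra_simps)
  ultimately have "(\<lambda>n. LINT x|lborel. H (U n x) * frechet_derivative \<phi> (at x) i) \<longlonglongrightarrow> - (LINT x|lborel. H' (v x) * (F x \<bullet> i) * \<phi> x)"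
    by (simp add: step)
  from LIMSEQ_unique[OF L1 this]
  have "(LINT x|lborel. H (v x) * frechet_derivative \<phi> (at x) i) = - (LINT x|lborel. H' (v x) * (F x \<bullet> i) * \<phi> x)" .
  moreover have "H (v x) * frechet_derivative \<phi> (at x) i = H (u x) * frechet_derivative \<phi> (at x) i" for x
    using vK K(4) by (cases "x \<in> K") auto
  moreover have "H' (v x) * (F x \<bullet> i) * \<phi> x = (H' (u x) *\<^sub>R G x) \<bullet> i * \<phi> x" for x
    using vK K(3) by (cases "x \<in> K") auto
  ultimately show "(LINT x|lborel. H (u x) * frechet_derivative \<phi> (at x) i) = - (LINT x|lborel. (H' (u x) *\<^sub>R G x) \<bullet> i * \<phi> x)"
    by simp
qed

subsection \<open>Functions with zero boundary values\<close>

text \<open>The closure of the test functions in W^(1,p), with the gradient carried as explicit data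
  so that no choice of a weak gradient enters.\<close>

definition W0 :: "'a::euclidean_space set \<Rightarrow> real \<Rightarrow> ('a \<Rightarrow> real) \<Rightarrow> ('a \<Rightarrow> 'a) \<Rightarrow> bool" where
  "W0 E p u G \<longleftrightarrow> wgrad E u G \<and>
     Lp_integrable p u \<and> Lp_integrable p G \<and>
     (\<forall>e>0. \<exists>\<phi>\<in>test_functions E. (Lp_integral p (\<lambda>x. \<phi> x - u x)) < e \<and>
        (Lp_integral p (\<lambda>x. grad \<phi> x - G x)) < e)"

lemma test_powr_integrable:
  assumes "\<phi> \<in> test_functions E" "p > 0"
  shows "Lp_integrable p \<phi>" "Lp_integrable p (\<lambda>x. grad \<phi> x)"
proof -
  obtain K where K: "compact K" "K \<subseteq> E" "\<And>x. x \<notin> K \<Longrightarrow> \<phi> x = 0" "\<And>x. x \<notin> K \<Longrightarrow> grad \<phi> x = 0"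
    using test_functions_support[OF assms(1)] by metis
  show "Lp_integrable p \<phi>"
  proof (rule compact_support_integrable[OF _ K(1)])
    show "continuous_on UNIV (\<lambda>x. norm (\<phi> x) powr p)"
      by (intro continuous_on_powr' continuous_on_norm continuous_on_const test_functions_D(2)[OF assms(1)])
        (use assms in auto)
  qed (use K in auto)
  show "Lp_integrable p (\<lambda>x. grad \<phi> x)"
    by (rule compact_support_integrable[OF _ K(1)])
      (use K assms test_functions_D(7)[OF assms(1)] in \<open>auto intro!: continuous_on_powr' continuous_on_norm continuous_on_const\<close>)
qed

lemma powr_integral_triangle:
  fixes f g h :: "'a \<Rightarrow> 'b::{banach, second_countable_topology}"
  assumes [measurable]: "f \<in> borel_measurable M" "g \<in> borel_measurable M" "h \<in> borel_measurable M"
    and i: "integrable M (\<lambda>x. norm (f x - g x) powr p)" "integrable M (\<lambda>x. norm (g x - h x) powr p)" and p: "p > 0"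
  shows "(LINT x|M. norm (f x - h x) powr p) \<le>
    2 powr p * ((LINT x|M. norm (f x - g x) powr p) + (LINT x|M. norm (g x - h x) powr p))"
    and "integrable M (\<lambda>x. norm (f x - h x) powr p)"
proof -
  show ii: "integrable M (\<lambda>x. norm (f x - h x) powr p)"
    using integrable_powr_add[OF i p] by simp
  have "(LINT x|M. norm (f x - h x) powr p) \<le> (LINT x|M. 2 powr p * (norm (f x - g x) powr p + norm (g x - h x) powr p))"
  proof (rule integral_mono[OF ii])
    show "norm (f x - h x) powr p \<le> 2 powr p * (norm (f x - g x) powr p + norm (g x - h x) powr p)" for x
      using norm_add_powr_le[OF p, of "f x - g x" "g x - h x"] by simp
  qed (use i in simp)
  then show "(LINT x|M. norm (f x - h x) powr p) \<le>
    2 powr p * ((LINT x|M. norm (f x - g x) powr p) + (LINT x|M. norm (g x - h x) powr p))"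
    using i by simp
qed

lemma W0_closed:
  assumes h: "wgrad E u G" and p: "p > 0"
    and i: "Lp_integrable p u" "Lp_integrable p G"
    and a: "\<And>n. W0 E p (f n) (F n)"
    and lim: "(\<lambda>n. Lp_integral p (\<lambda>x. f n x - u x)) \<longlonglongrightarrow> 0" "(\<lambda>n. Lp_integral p (\<lambda>x. F n x - G x)) \<longlonglongrightarrow> 0"
  shows "W0 E p u G"
  unfolding W0_def
proof (intro conjI h i allI impI)
  fix e :: real assume e: "e > 0"
  let ?c = "2 powr p * 2"
  have e': "e / ?c > 0" using e by simp
  have "\<forall>\<^sub>F n in sequentially. (Lp_integral p (\<lambda>x. f n x - u x)) < e / ?c \<and> (Lp_integral p (\<lambda>x. F n x - G x)) < e / ?c"
    using order_tendstoD(2)[OF lim(1) e'] order_tendstoD(2)[OF lim(2) e'] by eventually_elim simp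
  then obtain n where n: "(Lp_integral p (\<lambda>x. f n x - u x)) < e / ?c" "(Lp_integral p (\<lambda>x. F n x - G x)) < e / ?c"
    by (auto simp: eventually_sequentially)
  note an = a[of n, unfolded W0_def]
  obtain \<phi> where q: "\<phi> \<in> test_functions E" "(Lp_integral p (\<lambda>x. \<phi> x - f n x)) < e / ?c" "(Lp_integral p (\<lambda>x. grad \<phi> x - F n x)) < e / ?c"
    using an e' by blast
  have an': "wgrad E (f n) (F n)" "Lp_integrable p (\<lambda>x. f n x)" "Lp_integrable p (\<lambda>x. F n x)"
    using an by blast+
  note m[measurable] = wgrad_D(1,2)[OF h] wgrad_D(1,2)[OF an'(1)] test_functions_D(5,8)[OF q(1)]
  note ti = test_powr_integrable[OF q(1) p]
  have d: "Lp_integrable p (\<lambda>x. \<phi> x - f n x)" "Lp_integrable p (\<lambda>x. f n x - u x)"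
    "Lp_integrable p (\<lambda>x. grad \<phi> x - F n x)" "Lp_integrable p (\<lambda>x. F n x - G x)"
    by (rule integrable_powr_diff[OF ti(1) an'(2) p], measurable, rule integrable_powr_diff[OF an'(2) i(1) p], measurable,
      rule integrable_powr_diff[OF ti(2) an'(3) p], measurable, rule integrable_powr_diff[OF an'(3) i(2) p], measurable)
  have "(Lp_integral p (\<lambda>x. \<phi> x - u x)) \<le> 2 powr p * ((Lp_integral p (\<lambda>x. \<phi> x - f n x)) + (Lp_integral p (\<lambda>x. f n x - u x)))"
    by (rule powr_integral_triangle(1)[OF _ _ _ d(1,2) p]) measurable
  also have "\<dots> < 2 powr p * (e / ?c + e / ?c)" using n q by (intro mult_strict_left_mono add_strict_mono) auto
  also have "\<dots> = e" by simp
  finally have 1: "(Lp_integral p (\<lambda>x. \<phi> x - u x)) < e" .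
  have "(Lp_integral p (\<lambda>x. grad \<phi> x - G x)) \<le> 2 powr p * ((Lp_integral p (\<lambda>x. grad \<phi> x - F n x)) + (Lp_integral p (\<lambda>x. F n x - G x)))"
    by (rule powr_integral_triangle(1)[OF _ _ _ d(3,4) p]) measurable
  also have "\<dots> < 2 powr p * (e / ?c + e / ?c)" using n q by (intro mult_strict_left_mono add_strict_mono) auto
  also have "\<dots> = e" by simp
  finally show "\<exists>\<phi>\<in>test_functions E. (Lp_integral p (\<lambda>x. \<phi> x - u x)) < e \<and> (Lp_integral p (\<lambda>x. grad \<phi> x - G x)) < e"
    using 1 q(1) by blast
qed

text \<open>On K one has |f| <= 1 + |f|^p, because p >= 1.\<close>

lemma integrable_of_powr_compact:
  fixes f :: "'a::euclidean_space \<Rightarrow> 'b::euclidean_space"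
  assumes f: "f \<in> borel_measurable borel" "Lp_integrable p f" and p: "p \<ge> 1"
    and K: "compact K" "\<And>x. x \<notin> K \<Longrightarrow> f x = 0"
  shows "integrable lborel f"
proof (rule Bochner_Integration.integrable_bound)
  note [measurable] = compact_sets_borel(1)[OF K(1)]
  show "integrable lborel (\<lambda>x. indicator K x + norm (f x) powr p)"
    using emeasure_compact_finite[OF K(1)] f by (intro Bochner_Integration.integrable_add integrable_real_indicator) auto
  show "AE x in lborel. norm (f x) \<le> norm (indicator K x + norm (f x) powr p)"
  proof (rule AE_I2)
    fix x
    show "norm (f x) \<le> norm (indicator K x + norm (f x) powr p)"
    proof (cases "x \<in> K")
      case True
      have "norm (f x) \<le> 1 + norm (f x) powr p"
      proof (cases "norm (f x) \<le> 1")
        case False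
        then have "norm (f x) powr 1 \<le> norm (f x) powr p" using p by (intro powr_mono) auto
        then show ?thesis using False by simp
      qed (simp add: add_increasing2)
      then show ?thesis using True by simp
    qed (simp add: K(2))
  qed
qed (use f in simp)

text \<open>Mollifications with a small radius are test functions in E, and their gradients are the
  mollifications of G on the whole space; both converge in L^p.\<close>

lemma W0_compact_support:
  assumes E: "open E" and h: "wgrad E u G" and p: "p \<ge> 1"
    and i: "Lp_integrable p u" "Lp_integrable p G"
    and K: "compact K" "K \<subseteq> E" "\<And>x. x \<notin> K \<Longrightarrow> u x = 0" "\<And>x. x \<notin> K \<Longrightarrow> G x = 0"
  shows "W0 E p u G"
  unfolding W0_def
proof (intro conjI h i allI impI)
  fix e :: real assume e: "e > 0"
  note m[measurable] = wgrad_D(1,2)[OF h]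
  have ui: "integrable lborel u" by (rule integrable_of_powr_compact[OF m(1) i(1) p K(1,3)])
  have Gi: "integrable lborel G" by (rule integrable_of_powr_compact[OF m(2) i(2) p K(1,4)])
  obtain r where r: "r > 0" "(\<Union>x\<in>K. cball x r) \<subseteq> E" using neighbourhood_in_open[OF K(1) E K(2)] by blast
  let ?L = "\<Union>x\<in>K. cball x r"
  have L: "compact ?L" by (rule compact_neighbourhood[OF K(1)])
  have KL: "K \<subseteq> ?L" using subset_neighbourhood[of r K] r(1) by simp
  have uL: "(\<lambda>x. indicator ?L x *\<^sub>R u x) = u" "(\<lambda>x. indicator ?L x *\<^sub>R G x) = G"
    using KL K(3,4) by (force simp: fun_eq_iff indicator_def)+
  \<comment> \<open>With radii below r / 2, a point within r / 2 of K has its kernel ball inside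
    \<open>?L\<close>, and a point farther away does not see K at all.\<close>
  have r2: "r / 2 > 0" using r by simp
  obtain s where s: "\<And>n. 0 < s n" "\<And>n. s n < r / 2"
    "(\<lambda>n. Lp_integral p (\<lambda>x. conv (mol (s n)) u x - u x)) \<longlonglongrightarrow> 0"
    "(\<lambda>n. Lp_integral p (\<lambda>x. conv (mol (s n)) G x - G x)) \<longlonglongrightarrow> 0"
    by (rule mollify_sequence[OF ui m(1) i(1) Gi m(2) i(2) p r2]) (rule that; assumption)
  have "\<forall>\<^sub>F n in sequentially. (Lp_integral p (\<lambda>x. conv (mol (s n)) u x - u x)) < e \<and> (Lp_integral p (\<lambda>x. conv (mol (s n)) G x - G x)) < e"
    using order_tendstoD(2)[OF s(3) e] order_tendstoD(2)[OF s(4) e] by eventually_elim simp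
  then obtain n where n: "(Lp_integral p (\<lambda>x. conv (mol (s n)) u x - u x)) < e" "(Lp_integral p (\<lambda>x. conv (mol (s n)) G x - G x)) < e"
    by (auto simp: eventually_sequentially)
  define t where "t = s n"
  have t: "t > 0" "t < r / 2" using s by (auto simp: t_def)
  define \<phi> where "\<phi> = conv (mol t) u"
  let ?M = "\<Union>x\<in>K. cball x (r / 2)"
  have tz: "w \<notin> cball 0 t \<Longrightarrow> mol t w = 0" for w :: 'a by (intro mol_zero[OF t(1)]) simp
  have dz: "w \<notin> cball 0 t \<Longrightarrow> frechet_derivative (mol t) (at w) i = 0" for w i :: 'a
    by (rule derivative_zero_off_support[OF Ck_Suc_D(1)[OF mol_Ck] compact_cball[of 0 t] tz])
  have far: "x - y \<notin> cball 0 t" if "x \<notin> ?M" "y \<in> K" for x y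
  proof
    assume "x - y \<in> cball 0 t"
    then have "x \<in> cball y (r / 2)" using t by (simp add: dist_norm norm_minus_commute)
    with that show False by blast
  qed
  have C0: "conv J f x = 0" if x: "x \<notin> ?M" and J: "\<And>w. w \<notin> cball 0 t \<Longrightarrow> J w = 0" and f: "\<And>y. y \<notin> K \<Longrightarrow> f y = 0"
    for J :: "'a \<Rightarrow> real" and f :: "'a \<Rightarrow> 'c::euclidean_space" and x
  proof -
    have eq: "J (x - y) *\<^sub>R f y = 0" for y using J[OF far[OF x]] f by (cases "y \<in> K") auto
    show ?thesis by (simp only: conv_def eq Bochner_Integration.integral_zero)
  qed
  have "\<phi> \<in> test_functions E" unfolding test_functions_def
  proof (intro CollectI conjI allI exI[of _ ?M] impI)
    show "Ck k \<phi>" for k unfolding \<phi>_def by (rule conv_Ck[OF mol_Ck compact_cball[of 0 t] tz ui])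
    show "compact ?M" by (rule compact_neighbourhood[OF K(1)])
    have "?M \<subseteq> ?L"
    proof (rule UN_mono)
      show "cball x (r / 2) \<subseteq> cball x r" for x :: 'a using r(1) by (intro subset_cball) simp
    qed simp
    then show "?M \<subseteq> E" using r(2) by blast
    show "\<phi> x = 0" if "x \<notin> ?M" for x unfolding \<phi>_def by (rule C0[OF that tz K(3)])
  qed
  moreover have "grad \<phi> x = conv (mol t) G x" for x
  proof (rule euclidean_eqI)
    fix j :: 'a assume j: "j \<in> Basis"
    have "(\<phi> has_derivative (\<lambda>h. \<Sum>i\<in>Basis. (h \<bullet> i) * conv (\<lambda>z. frechet_derivative (mol t) (at z) i) u x)) (at x)"
      unfolding \<phi>_def
      by (rule conv_has_derivative[OF Ck_Suc_D(1)[OF mol_Ck] Ck_continuous[OF Ck_Suc_D(2)[OF mol_Ck]] compact_cball[of 0 t] tz ui])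
    from frechet_derivative_at[OF this]
    have "frechet_derivative \<phi> (at x) j = (\<Sum>i\<in>Basis. (j \<bullet> i) * conv (\<lambda>z. frechet_derivative (mol t) (at z) i) u x)"
      by (metis (no_types, lifting))
    also have "\<dots> = conv (\<lambda>z. frechet_derivative (mol t) (at z) j) u x"
      using j by (simp add: inner_Basis if_distrib[of "\<lambda>a. a * _"] sum.delta cong: if_cong)
    also have "\<dots> = conv (mol t) G x \<bullet> j"
    proof (cases "x \<in> ?M")
      case True
      then obtain y where y: "y \<in> K" "dist y x \<le> r / 2" by auto
      have "cball x t \<subseteq> cball y r"
      proof
        fix z assume "z \<in> cball x t"
        then show "z \<in> cball y r" using dist_triangle[of y z x] y t by simp
      qed
      then have "cball x t \<subseteq> ?L" using y by blast
      from conv_wgrad[OF h t(1) L r(2) this j] show ?thesis unfolding uL .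
    next
      case False
      have "conv (mol t) G x = 0" by (rule C0[OF False tz K(4)])
      moreover have "conv (\<lambda>z. frechet_derivative (mol t) (at z) j) u x = 0" by (rule C0[OF False dz K(3)])
      ultimately show ?thesis by simp
    qed
    finally show "grad \<phi> x \<bullet> j = conv (mol t) G x \<bullet> j" by (simp add: grad_inner[OF j])
  qed
  ultimately show "\<exists>\<phi>\<in>test_functions E. (Lp_integral p (\<lambda>x. \<phi> x - u x)) < e \<and> (Lp_integral p (\<lambda>x. grad \<phi> x - G x)) < e"
    using n by (intro bexI[of _ \<phi>]) (simp_all add: \<phi>_def t_def)
qed

text \<open>
  If $w \ge 0$ and $H$ vanishes on the negative half-line, then $H(\varphi - w)$ is supported in the
  support of the test function $\varphi$; no boundary regularity of $E$ is needed.
\<close>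

lemma W0_compose_diff:
  assumes E: "open E" and p: "p \<ge> 1" and v: "W0 E p v Dv"
    and w: "wgrad E w Dw" "Lp_integrable p w" "Lp_integrable p Dw"
    and w0: "\<And>x. w x \<ge> 0"
    and H: "\<And>r. (H has_real_derivative H' r) (at r)" "continuous_on UNIV H'" "\<And>r. \<bar>H' r\<bar> \<le> B"
    and Hz: "\<And>r. r \<le> 0 \<Longrightarrow> H r = 0" "\<And>r. r \<le> 0 \<Longrightarrow> H' r = 0"
  shows "W0 E p (\<lambda>x. H (v x - w x)) (\<lambda>x. H' (v x - w x) *\<^sub>R (Dv x - Dw x))"
proof -
  have p0: "p > 0" using p by simp
  have B: "B \<ge> 0" using H(3)[of 0] by linarith
  have lip: "\<bar>H a - H b\<bar> \<le> B * \<bar>a - b\<bar>" for a b by (rule lipschitz_of_deriv_bound[OF H(1,3)])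
  have lip0: "\<bar>H a\<bar> \<le> B * \<bar>a\<bar>" for a using lip[of a 0] Hz(1)[of 0] by simp
  have H0: "H 0 = 0" using Hz by simp
  have Hc: "continuous_on UNIV H" using H(1) by (meson DERIV_isCont continuous_at_imp_continuous_on)
  have [measurable]: "H \<in> borel_measurable borel" "H' \<in> borel_measurable borel"
    using Hc H(2) by (auto intro: borel_measurable_continuous_onI)
  have v': "wgrad E v Dv" "Lp_integrable p v" "Lp_integrable p Dv"
    using v by (auto simp: W0_def)
  note [measurable] = wgrad_D(1,2)[OF v'(1)] wgrad_D(1,2)[OF w(1)]
  have step: "wgrad E (\<lambda>x. H (f x - w x)) (\<lambda>x. H' (f x - w x) *\<^sub>R (F x - Dw x))"
    "Lp_integrable p (\<lambda>x. H (f x - w x))" "Lp_integrable p (\<lambda>x. H' (f x - w x) *\<^sub>R (F x - Dw x))"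
    if f: "wgrad E f F" "Lp_integrable p f" "Lp_integrable p F" for f F
  proof -
    note [measurable] = wgrad_D(1,2)[OF f(1)]
    have d: "wgrad E (\<lambda>x. f x - w x) (\<lambda>x. F x - Dw x)" using wgrad_linear[OF f(1) w(1), of 1 "-1"] by simp
    show "wgrad E (\<lambda>x. H (f x - w x)) (\<lambda>x. H' (f x - w x) *\<^sub>R (F x - Dw x))"
      by (rule wgrad_chain_rule[OF E d H H0])
    have i1: "Lp_integrable p (\<lambda>x. B * (f x - w x))"
      using integrable_powr_diff[OF f(2) w(2) p0] by (simp add: abs_mult powr_mult)
    have i2: "Lp_integrable p (\<lambda>x. B *\<^sub>R (F x - Dw x))"
      using integrable_powr_diff[OF f(3) w(3) p0] by (simp add: abs_mult powr_mult)
    show "Lp_integrable p (\<lambda>x. H (f x - w x))"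
      by (rule integrable_powr_bound[OF i1 _ p0]) (use lip0 B in \<open>auto simp: abs_mult\<close>)
    show "Lp_integrable p (\<lambda>x. H' (f x - w x) *\<^sub>R (F x - Dw x))"
      by (rule integrable_powr_bound[OF i2 _ p0]) (use H(3) B in \<open>auto intro!: mult_right_mono\<close>)
  qed
  note sv = step[OF v']
  have "\<exists>f0. \<forall>n. f0 n \<in> test_functions E \<and> (Lp_integral p (\<lambda>x. f0 n x - v x)) \<le> 1 / Suc n \<and>
    (Lp_integral p (\<lambda>x. grad (f0 n) x - Dv x)) \<le> 1 / Suc n"
  proof (rule choice, rule allI)
    fix n
    have "1 / real (Suc n) > 0" by simp
    then obtain \<phi> where "\<phi> \<in> test_functions E" "(Lp_integral p (\<lambda>x. \<phi> x - v x)) < 1 / real (Suc n)"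
      "(Lp_integral p (\<lambda>x. grad \<phi> x - Dv x)) < 1 / real (Suc n)"
      using v unfolding W0_def by blast
    then show "\<exists>\<phi>. \<phi> \<in> test_functions E \<and> (Lp_integral p (\<lambda>x. \<phi> x - v x)) \<le> 1 / Suc n \<and>
      (Lp_integral p (\<lambda>x. grad \<phi> x - Dv x)) \<le> 1 / Suc n"
      by (intro exI[of _ \<phi>] conjI less_imp_le)
  qed
  then obtain f0 where f0: "\<And>n. f0 n \<in> test_functions E" "\<And>n. (Lp_integral p (\<lambda>x. f0 n x - v x)) \<le> 1 / Suc n"
    "\<And>n. (Lp_integral p (\<lambda>x. grad (f0 n) x - Dv x)) \<le> 1 / Suc n" by blast
  have l0: "(\<lambda>n. Lp_integral p (\<lambda>x. f0 n x - v x)) \<longlonglongrightarrow> 0" "(\<lambda>n. Lp_integral p (\<lambda>x. grad (f0 n) x - Dv x)) \<longlonglongrightarrow> 0"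
    by (rule tendsto_of_le_inverse[OF _ f0(2)], simp, rule tendsto_of_le_inverse[OF _ f0(3)], simp)
  have t0: "Lp_integrable p (\<lambda>x. f0 n x - v x)" "Lp_integrable p (\<lambda>x. grad (f0 n) x - Dv x)" for n
  proof -
    note [measurable] = test_functions_D(5,8)[OF f0(1)[of n]]
    show "Lp_integrable p (\<lambda>x. f0 n x - v x)" "Lp_integrable p (\<lambda>x. grad (f0 n) x - Dv x)"
      by (rule integrable_powr_diff[OF test_powr_integrable(1)[OF f0(1) p0] v'(2) p0], measurable,
        rule integrable_powr_diff[OF test_powr_integrable(2)[OF f0(1) p0] v'(3) p0], measurable)
  qed
  \<comment> \<open>Convergence almost everywhere is needed for H' in the gradients; the values
    themselves would be handled by the Lipschitz bound alone.\<close>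
  obtain k where k: "strict_mono (k :: nat \<Rightarrow> nat)" "AE x in lborel. (\<lambda>n. f0 (k n) x) \<longlonglongrightarrow> v x"
    using AE_subseq_powr[OF t0(1) p0 l0(1)] by blast
  define f where "f n = f0 (k n)" for n
  have f: "f n \<in> test_functions E" for n using f0 by (simp add: f_def)
  note [measurable] = test_functions_D(5,8)[OF f]
  have ti: "Lp_integrable p (\<lambda>x. f n x - v x)" "Lp_integrable p (\<lambda>x. grad (f n) x - Dv x)" for n
    using t0 by (auto simp: f_def)
  have l: "(\<lambda>n. Lp_integral p (\<lambda>x. f n x - v x)) \<longlonglongrightarrow> 0" "(\<lambda>n. Lp_integral p (\<lambda>x. grad (f n) x - Dv x)) \<longlonglongrightarrow> 0"
    using LIMSEQ_subseq_LIMSEQ[OF l0(1) k(1)] LIMSEQ_subseq_LIMSEQ[OF l0(2) k(1)] by (simp_all add: f_def o_def)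
  note sf = step[OF wgrad_test[OF f] test_powr_integrable[OF f p0]]
  have a: "W0 E p (\<lambda>x. H (f n x - w x)) (\<lambda>x. H' (f n x - w x) *\<^sub>R (grad (f n) x - Dw x))" for n
  proof -
    obtain K where K: "compact K" "K \<subseteq> E" "\<And>x. x \<notin> K \<Longrightarrow> f n x = 0" using test_functions_support[OF f] by metis
    show ?thesis
      by (rule W0_compact_support[OF E sf(1) p sf(2,3) K(1,2)]) (use K(3) w0 Hz in auto)
  qed
  show ?thesis
  proof (rule W0_closed[OF sv(1) p0 sv(2,3) a])
    show "(\<lambda>n. Lp_integral p (\<lambda>x. H (f n x - w x) - H (v x - w x))) \<longlonglongrightarrow> 0"
    proof (rule Lim_null_comparison[where g="\<lambda>n. B powr p * (Lp_integral p (\<lambda>x. f n x - v x))"])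
      show "\<forall>\<^sub>F n in sequentially. norm (Lp_integral p (\<lambda>x. H (f n x - w x) - H (v x - w x))) \<le> B powr p * (Lp_integral p (\<lambda>x. f n x - v x))"
      proof (rule always_eventually, rule allI)
        fix n
        have "(Lp_integral p (\<lambda>x. H (f n x - w x) - H (v x - w x))) \<le> (LINT x|lborel. B powr p * norm (f n x - v x) powr p)"
        proof (rule integral_mono)
          show "Lp_integrable p (\<lambda>x. H (f n x - w x) - H (v x - w x))"
            by (rule integrable_powr_diff[OF sf(2) sv(2) p0]) measurable
          show "norm (H (f n x - w x) - H (v x - w x)) powr p \<le> B powr p * norm (f n x - v x) powr p" for x
            using powr_mono2[OF _ _ lip[of "f n x - w x" "v x - w x"], of p] p0 B by (simp add: powr_mult)
        qed (use ti in simp)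
        then show "norm (Lp_integral p (\<lambda>x. H (f n x - w x) - H (v x - w x))) \<le> B powr p * (Lp_integral p (\<lambda>x. f n x - v x))"
          by simp
      qed
      show "(\<lambda>n. B powr p * (Lp_integral p (\<lambda>x. f n x - v x))) \<longlonglongrightarrow> 0" by (rule tendsto_mult_right_zero[OF l(1)])
    qed
    let ?R = "\<lambda>n. Lp_integral p (\<lambda>x. H' (v x - w x) *\<^sub>R (Dv x - Dw x) - H' (f n x - w x) *\<^sub>R (Dv x - Dw x))"
    have iD: "Lp_integrable p (\<lambda>x. Dv x - Dw x)"
      by (rule integrable_powr_diff[OF v'(3) w(3) p0]) measurable
    have iB: "Lp_integrable p (\<lambda>x. B * norm (Dv x - Dw x))"
      using iD B by (simp add: abs_mult powr_mult)
    have R: "?R \<longlonglongrightarrow> 0"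
    proof (rule tendsto_integral_powr_diff[where g="\<lambda>x. B * norm (Dv x - Dw x)"])
      show "AE x in lborel. (\<lambda>n. H' (f n x - w x) *\<^sub>R (Dv x - Dw x)) \<longlonglongrightarrow> H' (v x - w x) *\<^sub>R (Dv x - Dw x)"
        using k(2)
      proof eventually_elim
        case (elim x)
        have "(\<lambda>n. f n x - w x) \<longlonglongrightarrow> v x - w x" unfolding f_def by (intro tendsto_intros elim)
        moreover have "isCont H' (v x - w x)" using H(2) by (simp add: continuous_on_eq_continuous_at)
        ultimately have "(\<lambda>n. H' (f n x - w x)) \<longlonglongrightarrow> H' (v x - w x)" by (rule isCont_tendsto_compose[rotated])
        then show ?case by (intro tendsto_intros)
      qed
    qed (use iB p0 H(3) in \<open>auto intro!: mult_right_mono\<close>)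
    show "(\<lambda>n. Lp_integral p (\<lambda>x. H' (f n x - w x) *\<^sub>R (grad (f n) x - Dw x) - H' (v x - w x) *\<^sub>R (Dv x - Dw x))) \<longlonglongrightarrow> 0"
    proof (rule Lim_null_comparison[where g="\<lambda>n. 2 powr p * (B powr p * (Lp_integral p (\<lambda>x. grad (f n) x - Dv x)) + ?R n)"])
      show "(\<lambda>n. 2 powr p * (B powr p * (Lp_integral p (\<lambda>x. grad (f n) x - Dv x)) + ?R n)) \<longlonglongrightarrow> 0"
        by (intro tendsto_mult_right_zero tendsto_add_zero l R)
      show "\<forall>\<^sub>F n in sequentially. norm (Lp_integral p (\<lambda>x. H' (f n x - w x) *\<^sub>R (grad (f n) x - Dw x) - H' (v x - w x) *\<^sub>R (Dv x - Dw x)))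
        \<le> 2 powr p * (B powr p * (Lp_integral p (\<lambda>x. grad (f n) x - Dv x)) + ?R n)"
      proof (rule always_eventually, rule allI)
        fix n
        \<comment> \<open>The intermediate function separates the two errors: towards the
          approximation only the gradient changes, with bounded factor; towards the limit only the
          factor changes, which is dominated convergence.\<close>
        let ?g = "\<lambda>x. H' (f n x - w x) *\<^sub>R (Dv x - Dw x)"
        have n1: "norm (H' (f n x - w x) *\<^sub>R (grad (f n) x - Dw x) - ?g x) powr p \<le> B powr p * norm (grad (f n) x - Dv x) powr p" for x
        proof -
          have "norm (H' (f n x - w x) *\<^sub>R (grad (f n) x - Dw x) - ?g x) \<le> B * norm (grad (f n) x - Dv x)"
            using H(3) by (simp add: scaleR_diff_right[symmetric] mult_right_mono)
          from powr_mono2[OF _ _ this, of p] show ?thesis using p0 B by (simp add: powr_mult)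
        qed
        have ig: "Lp_integrable p ?g"
          by (rule integrable_powr_bound[OF iB _ p0]) (use H(3) B in \<open>auto simp: abs_mult intro!: mult_right_mono\<close>)
        have i1: "Lp_integrable p (\<lambda>x. H' (f n x - w x) *\<^sub>R (grad (f n) x - Dw x) - ?g x)"
          by (rule integrable_powr_diff[OF sf(3) ig p0]) measurable
        have i2: "Lp_integrable p (\<lambda>x. ?g x - H' (v x - w x) *\<^sub>R (Dv x - Dw x))"
          by (rule integrable_powr_diff[OF ig sv(3) p0]) measurable
        have "(Lp_integral p (\<lambda>x. H' (f n x - w x) *\<^sub>R (grad (f n) x - Dw x) - H' (v x - w x) *\<^sub>R (Dv x - Dw x)))
          \<le> 2 powr p * ((Lp_integral p (\<lambda>x. H' (f n x - w x) *\<^sub>R (grad (f n) x - Dw x) - ?g x)) + (Lp_integral p (\<lambda>x. ?g x - H' (v x - w x) *\<^sub>R (Dv x - Dw x))))"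
          by (rule powr_integral_triangle(1)[OF _ _ _ i1 i2 p0]) measurable
        also have "(Lp_integral p (\<lambda>x. H' (f n x - w x) *\<^sub>R (grad (f n) x - Dw x) - ?g x)) \<le> B powr p * (Lp_integral p (\<lambda>x. grad (f n) x - Dv x))"
          using integral_mono[OF i1 _ n1] ti(2)[of n] by simp
        also have "(Lp_integral p (\<lambda>x. ?g x - H' (v x - w x) *\<^sub>R (Dv x - Dw x))) = ?R n"
          by (simp add: norm_minus_commute)
        finally show "norm (Lp_integral p (\<lambda>x. H' (f n x - w x) *\<^sub>R (grad (f n) x - Dw x) - H' (v x - w x) *\<^sub>R (Dv x - Dw x)))
          \<le> 2 powr p * (B powr p * (Lp_integral p (\<lambda>x. grad (f n) x - Dv x)) + ?R n)" by simp
      qed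
    qed
  qed
qed

section \<open>Passage between the Sobolev spaces of functions on E and their Borel
  representatives\<close>

lemma W0_D:
  assumes "W0 E p u G"
  shows "wgrad E u G" "Lp_integrable p u" "Lp_integrable p G"
  using assms by (auto simp: W0_def)

lemma has_weak_gradient_wgrad:
  assumes E: "open E" and h: "has_weak_gradient E u G" and u: "borel_rep E u u'" and G: "borel_rep E G G'"
  shows "wgrad E u' G'"
proof -
  obtain u'' G'' where w: "wgrad E u'' G''" "borel_rep E u u''" "borel_rep E G G''"
    using has_weak_gradient_rep[OF E h] by blast
  show ?thesis
    by (rule wgrad_AE_cong[OF w(1)])
      (use u G borel_rep_unique[OF w(2) u] borel_rep_unique[OF w(3) G] in \<open>auto simp: borel_rep_def\<close>)
qed

lemma borel_rep_self:
  assumes "g \<in> borel_measurable borel" "\<And>x. x \<notin> S \<Longrightarrow> g x = 0"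
  shows "borel_rep S g g"
  using assms by (simp add: borel_rep_def)

text \<open>By uniqueness the gradient picked by \<open>weak_gradient\<close> agrees almost
  everywhere with any given one; this makes \<open>W1p_norm\<close> computable from
  representatives.\<close>

lemma weak_gradient_rep:
  assumes E: "open E" and h: "has_weak_gradient E u G" and G: "borel_rep E G G'"
  shows "borel_rep E (weak_gradient E u) G'"
proof -
  have h2: "has_weak_gradient E u (weak_gradient E u)"
    unfolding weak_gradient_def using h by (rule someI[where P="has_weak_gradient E u"])
  obtain u1 G1 where 1: "wgrad E u1 G1" "borel_rep E u u1" "borel_rep E G G1"
    using has_weak_gradient_rep[OF E h] by blast
  obtain u2 G2 where 2: "wgrad E u2 G2" "borel_rep E u u2" "borel_rep E (weak_gradient E u) G2"
    using has_weak_gradient_rep[OF E h2] by blast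
  have a: "AE x in lborel. G1 x = G2 x"
    by (rule wgrad_unique[OF E 1(1) 2(1) borel_rep_unique[OF 1(2) 2(2)]])
  have b: "AE x in lborel. G1 x = G' x" by (rule borel_rep_unique[OF 1(3) G])
  have c: "AE x in lborel. x \<in> E \<longrightarrow> weak_gradient E u x = G2 x" using 2(3) by (simp add: borel_rep_def)
  from a b c have "AE x in lborel. x \<in> E \<longrightarrow> weak_gradient E u x = G' x" by eventually_elim auto
  then show ?thesis using G by (simp add: borel_rep_def)
qed

lemma W1p_norm_eq:
  assumes E: "open E" and p: "p > 0" and h: "has_weak_gradient E u G"
    and u: "borel_rep E u u'" and G: "borel_rep E G G'"
  shows "W1p_norm E p u = ((Lp_integral p u') + (Lp_integral p G')) powr (1 / p)"
proof -
  have E': "E \<in> sets borel" using E by simp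
  have "Lp_norm (lebesgue_on E) p u powr p = (Lp_integral p u')"
    using p by (simp add: Lp_norm_def powr_powr borel_rep_integral[OF borel_rep_powr[OF u] E', unfolded real_norm_def])
  moreover have "Lp_norm (lebesgue_on E) p (weak_gradient E u) powr p = (Lp_integral p G')"
    using p by (simp add: Lp_norm_def powr_powr borel_rep_integral[OF borel_rep_powr[OF weak_gradient_rep[OF E h G]] E'])
  ultimately show ?thesis by (simp add: W1p_norm_def)
qed

lemma W1p_rep:
  assumes E: "open E" and w: "u \<in> W1p E p" and h: "has_weak_gradient E u G"
    and u: "borel_rep E u u'" and G: "borel_rep E G G'"
  shows "wgrad E u' G'" "Lp_integrable p u'" "Lp_integrable p G'"
proof -
  have E': "E \<in> sets borel" using E by simp
  show "wgrad E u' G'" by (rule has_weak_gradient_wgrad[OF E h u G])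
  show "Lp_integrable p u'"
    using w Lp_space_iff_rep[OF u E'] by (simp add: W1p_def)
  obtain F where F: "F \<in> Lp_space (lebesgue_on E) p" "has_weak_gradient E u F" using w by (auto simp: W1p_def)
  obtain F' where F': "borel_rep E F F'"
    using borel_rep_exists[OF _ E', of F] F(1) by (auto simp: Lp_space_def)
  have a: "AE x in lborel. F' x = G' x"
    by (rule borel_rep_unique[OF weak_gradient_rep[OF E F(2) F'] weak_gradient_rep[OF E h G]])
  have "Lp_integrable p F'" using F(1) Lp_space_iff_rep[OF F' E'] by simp
  moreover have [measurable]: "F' \<in> borel_measurable borel" "G' \<in> borel_measurable borel" using F' G by (auto simp: borel_rep_def)
  have "(\<lambda>x. norm (G' x) powr p) \<in> borel_measurable lborel" by measurable
  moreover have "AE x in lborel. norm (F' x) powr p = norm (G' x) powr p" using a by eventually_elim simp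
  ultimately show "Lp_integrable p G'" by (rule integrable_cong_AE_imp)
qed

lemma wgrad_test_diff:
  assumes E: "open E" and h: "wgrad E u' G'" and q: "\<phi> \<in> test_functions E" and u: "borel_rep E u u'"
  shows "has_weak_gradient E (\<lambda>x. \<phi> x - u x) (\<lambda>x. grad \<phi> x - G' x)"
    "borel_rep E (\<lambda>x. \<phi> x - u x) (\<lambda>x. \<phi> x - u' x)"
    "borel_rep E (\<lambda>x. grad \<phi> x - G' x) (\<lambda>x. grad \<phi> x - G' x)"
proof -
  note t = wgrad_test[OF q]
  show d: "borel_rep E (\<lambda>x. \<phi> x - u x) (\<lambda>x. \<phi> x - u' x)"
    by (rule borel_rep_diff[OF borel_rep_self u]) (use wgrad_D[OF t] in auto)
  show r: "borel_rep E (\<lambda>x. grad \<phi> x - G' x) (\<lambda>x. grad \<phi> x - G' x)"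
    by (rule borel_rep_self) (use wgrad_D(2,4)[OF t] wgrad_D(2,4)[OF h] in auto)
  show "has_weak_gradient E (\<lambda>x. \<phi> x - u x) (\<lambda>x. grad \<phi> x - G' x)"
    by (rule has_weak_gradient_of_rep[OF E _ d r]) (use wgrad_linear[OF t h, of 1 "-1"] in simp)
qed

lemma W0_imp_W1p0:
  assumes E: "open E" and p: "p > 0" and h: "W0 E p u' G'" and u: "borel_rep E u u'"
  shows "u \<in> W1p0 E p"
proof -
  have E': "E \<in> sets borel" using E by simp
  note h' = W0_D[OF h]
  have G: "borel_rep E G' G'" using wgrad_D(2,4)[OF h'(1)] by (rule borel_rep_self)
  have "has_weak_gradient E u G'" by (rule has_weak_gradient_of_rep[OF E h'(1) u G])
  moreover have "u \<in> Lp_space (lebesgue_on E) p" "G' \<in> Lp_space (lebesgue_on E) p"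
    using h' Lp_space_iff_rep[OF u E'] Lp_space_iff_rep[OF G E'] by auto
  ultimately have W: "u \<in> W1p E p" by (auto simp: W1p_def)
  have "\<exists>f. \<forall>n. f n \<in> test_functions E \<and> (Lp_integral p (\<lambda>x. f n x - u' x)) \<le> 1 / Suc n \<and>
    (Lp_integral p (\<lambda>x. grad (f n) x - G' x)) \<le> 1 / Suc n"
  proof (rule choice, rule allI)
    fix n
    have "1 / real (Suc n) > 0" by simp
    then obtain \<phi> where "\<phi> \<in> test_functions E" "(Lp_integral p (\<lambda>x. \<phi> x - u' x)) < 1 / real (Suc n)"
      "(Lp_integral p (\<lambda>x. grad \<phi> x - G' x)) < 1 / real (Suc n)"
      using h unfolding W0_def by blast
    then show "\<exists>\<phi>. \<phi> \<in> test_functions E \<and> (Lp_integral p (\<lambda>x. \<phi> x - u' x)) \<le> 1 / Suc n \<and>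
      (Lp_integral p (\<lambda>x. grad \<phi> x - G' x)) \<le> 1 / Suc n"
      by (intro exI[of _ \<phi>] conjI less_imp_le)
  qed
  then obtain f where f: "\<And>n. f n \<in> test_functions E" "\<And>n. (Lp_integral p (\<lambda>x. f n x - u' x)) \<le> 1 / Suc n"
    "\<And>n. (Lp_integral p (\<lambda>x. grad (f n) x - G' x)) \<le> 1 / Suc n" by blast
  have n: "W1p_norm E p (\<lambda>x. f n x - u x) =
    ((Lp_integral p (\<lambda>x. f n x - u' x)) + (Lp_integral p (\<lambda>x. grad (f n) x - G' x))) powr (1 / p)" for n
    using wgrad_test_diff[OF E h'(1) f(1) u] by (rule W1p_norm_eq[OF E p])
  have l: "(\<lambda>n. Lp_integral p (\<lambda>x. f n x - u' x)) \<longlonglongrightarrow> 0" "(\<lambda>n. Lp_integral p (\<lambda>x. grad (f n) x - G' x)) \<longlonglongrightarrow> 0"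
    by (rule tendsto_of_le_inverse[OF _ f(2)], simp, rule tendsto_of_le_inverse[OF _ f(3)], simp)
  have "(\<lambda>n. W1p_norm E p (\<lambda>x. f n x - u x)) \<longlonglongrightarrow> 0 powr (1 / p)"
    unfolding n by (rule tendsto_powr'[OF tendsto_add_zero[OF l] tendsto_const]) (use p in \<open>auto intro!: always_eventually add_nonneg_nonneg\<close>)
  then show ?thesis using W f(1) by (auto simp: W1p0_def)
qed

text \<open>The p-th power of the norm is the sum of two nonnegative integrals, so its convergence
  to 0 makes both small at once.\<close>

lemma W1p0_imp_W0:
  assumes E: "open E" and p: "p > 0" and w: "u \<in> W1p0 E p" and h: "has_weak_gradient E u G"
    and u: "borel_rep E u u'" and G: "borel_rep E G G'"
  shows "W0 E p u' G'"
proof -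
  have "u \<in> W1p E p" using w by (simp add: W1p0_def)
  note h' = W1p_rep[OF E this h u G]
  obtain f where f: "\<And>n. f n \<in> test_functions E" "(\<lambda>n. W1p_norm E p (\<lambda>x. f n x - u x)) \<longlonglongrightarrow> 0"
    using w by (auto simp: W1p0_def)
  let ?a = "\<lambda>n. Lp_integral p (\<lambda>x. f n x - u' x)" and ?b = "\<lambda>n. Lp_integral p (\<lambda>x. grad (f n) x - G' x)"
  have n: "W1p_norm E p (\<lambda>x. f n x - u x) = (?a n + ?b n) powr (1 / p)" for n
    using wgrad_test_diff[OF E h'(1) f(1) u] by (rule W1p_norm_eq[OF E p])
  have ab: "?a n \<ge> 0" "?b n \<ge> 0" for n by simp_all
  have "(\<lambda>n. W1p_norm E p (\<lambda>x. f n x - u x) powr p) \<longlonglongrightarrow> 0 powr p"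
    by (rule tendsto_powr'[OF f(2) tendsto_const]) (use p in \<open>auto simp: n\<close>)
  moreover have "W1p_norm E p (\<lambda>x. f n x - u x) powr p = ?a n + ?b n" for n
    using p ab[of n] unfolding n by (simp add: powr_powr)
  ultimately have l: "(\<lambda>n. ?a n + ?b n) \<longlonglongrightarrow> 0" using p by simp
  show ?thesis unfolding W0_def
  proof (intro conjI h' allI impI)
    fix e :: real assume "e > 0"
    then have "\<forall>\<^sub>F n in sequentially. ?a n + ?b n < e" using order_tendstoD(2)[OF l] by blast
    then obtain n where "?a n + ?b n < e" by (auto simp: eventually_sequentially)
    then have "?a n < e" "?b n < e" using ab[of n] by linarith+
    then show "\<exists>\<phi>\<in>test_functions E. (Lp_integral p (\<lambda>x. \<phi> x - u' x)) < e \<and> (Lp_integral p (\<lambda>x. grad \<phi> x - G' x)) < e"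
      using f(1) by blast
  qed
qed

lemma W0_cmult:
  assumes p: "p > 0" and h: "W0 E p u G"
  shows "W0 E p (\<lambda>x. c * u x) (\<lambda>x. c *\<^sub>R G x)"
  unfolding W0_def
proof (intro conjI allI impI)
  note h' = W0_D[OF h]
  show "wgrad E (\<lambda>x. c * u x) (\<lambda>x. c *\<^sub>R G x)" using wgrad_linear[OF h'(1) h'(1), of c 0] by simp
  show "Lp_integrable p (\<lambda>x. c * u x)" "Lp_integrable p (\<lambda>x. c *\<^sub>R G x)"
    using h'(2,3) by (simp_all add: abs_mult powr_mult)
  fix e :: real assume e: "e > 0"
  \<comment> \<open>Division by 1 + |c|^p instead of |c|^p covers c = 0.\<close>
  have c: "1 + \<bar>c\<bar> powr p > 0" by (simp add: add_pos_nonneg)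
  then have "e / (1 + \<bar>c\<bar> powr p) > 0" using e by simp
  then obtain \<phi> where q: "\<phi> \<in> test_functions E" "(Lp_integral p (\<lambda>x. \<phi> x - u x)) < e / (1 + \<bar>c\<bar> powr p)"
    "(Lp_integral p (\<lambda>x. grad \<phi> x - G x)) < e / (1 + \<bar>c\<bar> powr p)"
    using h unfolding W0_def by blast
  obtain K where K: "compact K" "K \<subseteq> E" "\<And>x. x \<notin> K \<Longrightarrow> \<phi> x = 0" using test_functions_support[OF q(1)] by metis
  have qc: "(\<lambda>x. c * \<phi> x) \<in> test_functions E"
    using K test_functions_D(1)[OF q(1)] by (auto simp: test_functions_def intro!: Ck_cmult exI[of _ K])
  have gc: "grad (\<lambda>x. c * \<phi> x) x = c *\<^sub>R grad \<phi> x" for x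
  proof (rule euclidean_eqI)
    fix i :: 'a assume i: "i \<in> Basis"
    have "frechet_derivative (\<lambda>x. c * \<phi> x) (at x) = (\<lambda>h. c * frechet_derivative \<phi> (at x) h)"
      by (rule frechet_derivative_at[symmetric], rule has_derivative_mult_right[OF test_functions_D(3)[OF q(1)]])
    then show "grad (\<lambda>x. c * \<phi> x) x \<bullet> i = (c *\<^sub>R grad \<phi> x) \<bullet> i" by (simp add: grad_inner[OF i])
  qed
  have le: "\<bar>c\<bar> powr p * a < e" if "a < e / (1 + \<bar>c\<bar> powr p)" "a \<ge> 0" for a
  proof -
    have "\<bar>c\<bar> powr p * a \<le> (1 + \<bar>c\<bar> powr p) * a" using that by (intro mult_right_mono) auto
    also have "\<dots> < e" using that c by (simp add: pos_less_divide_eq mult.commute)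
    finally show ?thesis .
  qed
  show "\<exists>\<phi>\<in>test_functions E. (Lp_integral p (\<lambda>x. \<phi> x - c * u x)) < e \<and> (Lp_integral p (\<lambda>x. grad \<phi> x - c *\<^sub>R G x)) < e"
  proof (intro bexI[OF _ qc] conjI)
    have "norm (c * \<phi> x - c * u x) powr p = \<bar>c\<bar> powr p * norm (\<phi> x - u x) powr p" for x
      by (simp add: right_diff_distrib[symmetric] abs_mult powr_mult)
    then show "(Lp_integral p (\<lambda>x. c * \<phi> x - c * u x)) < e" using le[OF q(2)] by simp
    have "norm (grad (\<lambda>x. c * \<phi> x) x - c *\<^sub>R G x) powr p = \<bar>c\<bar> powr p * norm (grad \<phi> x - G x) powr p" for x
      by (simp add: gc scaleR_diff_right[symmetric] powr_mult)
    then show "(Lp_integral p (\<lambda>x. grad (\<lambda>x. c * \<phi> x) x - c *\<^sub>R G x)) < e" using le[OF q(3)] by simp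
  qed
qed

lemma W1p_norm_cmult:
  assumes E: "open E" and p: "p > 0" and h: "W0 E p u G"
  shows "W1p_norm E p (\<lambda>x. c * u x) = \<bar>c\<bar> * W1p_norm E p u"
proof -
  note h' = W0_D(1)[OF h] W0_D(1)[OF W0_cmult[OF p h, of c]]
  have e: "W1p_norm E p f = ((Lp_integral p f) + (Lp_integral p F)) powr (1 / p)"
    if w: "wgrad E f F" for f F
    using wgrad_D[OF w] by (intro W1p_norm_eq[OF E p, where G=F] has_weak_gradient_of_rep[OF E w] borel_rep_self) auto
  show ?thesis unfolding e[OF h'(1)] e[OF h'(2)]
    using p by (simp add: abs_mult powr_mult powr_powr distrib_left[symmetric])
qed

subsection \<open>Products of functions of time and space\<close>

lemma lborel_AE_fst:
  assumes "AE x in (lborel :: 'a::euclidean_space measure). P x"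
  shows "AE z in (lborel :: ('a \<times> 'b::euclidean_space) measure). P (fst z)"
proof -
  obtain N where N: "\<And>x. x \<in> space lborel - N \<Longrightarrow> P x" "N \<in> null_sets lborel" using AE_E3[OF assms] by blast
  have N1: "x \<in> N" if "\<not> P x" for x using N(1)[of x] that by auto
  have "N \<times> UNIV \<in> null_sets (lborel \<Otimes>\<^sub>M (lborel :: 'b measure))"
    using N(2) by (simp add: null_sets_def lborel.emeasure_pair_measure_Times)
  then have "N \<times> UNIV \<in> null_sets (lborel :: ('a \<times> 'b) measure)" by (simp add: lborel_prod)
  then show ?thesis by (rule AE_I') (use N1 in auto)
qed

lemma lborel_AE_snd:
  assumes "AE x in (lborel :: 'b::euclidean_space measure). P x"
  shows "AE z in (lborel :: ('a::euclidean_space \<times> 'b) measure). P (snd z)"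
proof -
  obtain N where N: "\<And>x. x \<in> space lborel - N \<Longrightarrow> P x" "N \<in> null_sets lborel" using AE_E3[OF assms] by blast
  have N1: "x \<in> N" if "\<not> P x" for x using N(1)[of x] that by auto
  have "UNIV \<times> N \<in> null_sets ((lborel :: 'a measure) \<Otimes>\<^sub>M lborel)"
    using N(2) by (simp add: null_sets_def lborel.emeasure_pair_measure_Times)
  then have "UNIV \<times> N \<in> null_sets (lborel :: ('a \<times> 'b) measure)" by (simp add: lborel_prod)
  then show ?thesis by (rule AE_I') (use N1 in auto)
qed

lemma lborel_AE_slices:
  assumes "AE z in (lborel :: ('a::euclidean_space \<times> 'b::euclidean_space) measure). P z"
  shows "AE t in lborel. AE x in lborel. P (x, t)"
proof -
  obtain N where N: "\<And>x. x \<in> space lborel - N \<Longrightarrow> P x" "N \<in> null_sets lborel" using AE_E3[OF assms] by blast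
  have N1: "x \<in> N" if "\<not> P x" for x using N(1)[of x] that by auto
  have Nm: "N \<in> sets (lborel \<Otimes>\<^sub>M lborel)" using N(2) by (subst lborel_prod) (auto simp: null_sets_def)
  have "AE z in lborel. z \<notin> N" using N(2) by (rule AE_not_in)
  then have "AE z in lborel \<Otimes>\<^sub>M lborel. z \<notin> N" by (subst lborel_prod)
  then have "AE x in lborel. AE t in lborel. (x, t) \<notin> N" by (rule lborel_pair.AE_pair)
  moreover have "{z \<in> space (lborel \<Otimes>\<^sub>M lborel). (fst z, snd z) \<notin> N} \<in> sets (lborel \<Otimes>\<^sub>M lborel)"
    using sets.compl_sets[OF Nm] by (simp add: set_diff_eq)
  ultimately have "AE t in lborel. AE x in lborel. (x, t) \<notin> N"
    by (subst (asm) lborel_pair.AE_commute)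
  then show ?thesis
  proof eventually_elim
    case (elim t) then show ?case by eventually_elim (use N1 in auto)
  qed
qed

lemma borel_rep_separable:
  assumes f: "borel_rep E \<phi> \<phi>'" and I: "I \<in> sets borel" and h: "\<eta> \<in> borel_measurable borel"
  shows "borel_rep (E \<times> I) (\<lambda>(x, t). \<eta> t *\<^sub>R \<phi> x) (\<lambda>(x, t). (indicator I t * \<eta> t) *\<^sub>R \<phi>' x)"
  unfolding borel_rep_def
proof (intro conjI allI impI)
  have [measurable]: "\<phi>' \<in> borel_measurable borel" "\<eta> \<in> borel_measurable borel" "I \<in> sets borel" using f h I by (auto simp: borel_rep_def)
  have "(\<lambda>(x, t). (indicator I t * \<eta> t) *\<^sub>R \<phi>' x) \<in> borel_measurable (borel \<Otimes>\<^sub>M borel)" by measurable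
  then show "(\<lambda>(x, t). (indicator I t * \<eta> t) *\<^sub>R \<phi>' x) \<in> borel_measurable borel" by (simp add: borel_prod)
  show "(case z of (x, t) \<Rightarrow> (indicator I t * \<eta> t) *\<^sub>R \<phi>' x) = 0" if "z \<notin> E \<times> I" for z
    using that f by (auto simp: borel_rep_def split: prod.splits)
  have "AE x in lborel. x \<in> E \<longrightarrow> \<phi> x = \<phi>' x" using f by (simp add: borel_rep_def)
  from lborel_AE_fst[OF this]
  show "AE z in lborel. z \<in> E \<times> I \<longrightarrow> (case z of (x, t) \<Rightarrow> \<eta> t *\<^sub>R \<phi> x) = (case z of (x, t) \<Rightarrow> (indicator I t * \<eta> t) *\<^sub>R \<phi>' x)"
    by eventually_elim auto
qed

lemma separable_measurable:
  assumes "\<phi> \<in> borel_measurable (lebesgue_on E)" "open E" "I \<in> sets borel" "\<eta> \<in> borel_measurable borel"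
  shows "(\<lambda>(x, t). \<eta> t *\<^sub>R (\<phi> x :: 'b::euclidean_space)) \<in> borel_measurable (lebesgue_on (E \<times> I))"
proof -
  have E: "E \<in> sets borel" using assms by simp
  obtain \<phi>' where "borel_rep E \<phi> \<phi>'" using borel_rep_exists[OF assms(1) E] .
  from borel_rep_measurable[OF borel_rep_separable[OF this assms(3,4)]] show ?thesis
    using E assms(3) by (simp add: borel_Times)
qed

text \<open>Stated for an abstract space with a seminorm homogeneous on the multiples of
  \<open>\<phi>\<close>, because it serves both L^(q+1)(E) and W^(1,p)_0(E). Strong measurability
  comes from simple functions approximating the scalar factor \<open>\<eta>\<close>.\<close>

lemma bochner_Lp_separable:
  fixes \<phi> :: "'a::euclidean_space \<Rightarrow> real"
  assumes E: "open E" and m: "\<phi> \<in> borel_measurable (lebesgue_on E)" and h: "\<eta> \<in> borel_measurable borel" "\<And>t. \<bar>\<eta> t\<bar> \<le> B"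
    and X: "\<And>c. (\<lambda>x. c * \<phi> x) \<in> X" and nrm: "\<And>c. nrm (\<lambda>x. c * \<phi> x) = \<bar>c\<bar> * N" and N: "N \<ge> 0" and r: "r > 0"
  shows "(\<lambda>(x, t). \<eta> t * \<phi> x) \<in> bochner_Lp r {0<..<T} E X nrm"
  unfolding bochner_Lp_def
proof (intro CollectI conjI)
  show "(\<lambda>(x, t). \<eta> t * \<phi> x) \<in> borel_measurable (lebesgue_on (E \<times> {0<..<T}))"
    using separable_measurable[OF m E _ h(1), of "{0<..<T}"] by simp
  show "AE t in lebesgue_on {0<..<T}. (\<lambda>x. case (x, t) of (x, t) \<Rightarrow> \<eta> t * \<phi> x) \<in> X"
    using X by simp
  have hm: "\<eta> \<in> borel_measurable (lebesgue_on {0<..<T})"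
    using h(1) by (intro measurable_restrict_space1) (auto intro: measurable_completion)
  obtain F where F: "\<And>i. simple_function (lebesgue_on {0<..<T}) (F i)"
    "\<And>t. t \<in> space (lebesgue_on {0<..<T}) \<Longrightarrow> (\<lambda>i. F i t) \<longlonglongrightarrow> \<eta> t"
    using borel_measurable_implies_sequence_metric[OF hm, of 0] by blast
  have "(\<lambda>n. nrm (\<lambda>x. F n t * \<phi> x - \<eta> t * \<phi> x)) \<longlonglongrightarrow> 0" if "t \<in> space (lebesgue_on {0<..<T})" for t
  proof -
    have "(\<lambda>n. \<bar>F n t - \<eta> t\<bar> * N) \<longlonglongrightarrow> \<bar>\<eta> t - \<eta> t\<bar> * N" by (intro tendsto_intros F(2) that)
    then show ?thesis using nrm by (simp add: left_diff_distrib[symmetric])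
  qed
  moreover have "simple_function (lebesgue_on {0<..<T}) (\<lambda>t x. F n t * \<phi> x)" for n
    using simple_function_compose[OF F(1)[of n], of "\<lambda>c x. c * \<phi> x"] by (simp add: o_def)
  ultimately show "strongly_measurable {0<..<T} X nrm (\<lambda>(x, t). \<eta> t * \<phi> x)"
    unfolding strongly_measurable_def using X
    by (intro exI[of _ "\<lambda>n t x. F n t * \<phi> x"]) (auto intro!: AE_I2)
  show "integrable (lebesgue_on {0<..<T}) (\<lambda>t. nrm (\<lambda>x. case (x, t) of (x, t) \<Rightarrow> \<eta> t * \<phi> x) powr r)"
  proof (rule Bochner_Integration.integrable_bound[where f="\<lambda>t. (B * N) powr r"])
    show "integrable (lebesgue_on {0<..<T}) (\<lambda>t. (B * N) powr r)"
      by (rule finite_measure.integrable_const[OF finite_measure_lebesgue_on]) simp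
    show "AE t in lebesgue_on {0<..<T}. norm (nrm (\<lambda>x. case (x, t) of (x, t) \<Rightarrow> \<eta> t * \<phi> x) powr r) \<le> norm ((B * N) powr r)"
      using h(2) N r by (intro AE_I2) (auto simp: nrm intro!: powr_mono2 mult_right_mono)
    show "(\<lambda>t. nrm (\<lambda>x. case (x, t) of (x, t) \<Rightarrow> \<eta> t * \<phi> x) powr r) \<in> borel_measurable (lebesgue_on {0<..<T})"
      using hm by (simp add: nrm)
  qed
qed

lemma Lp_norm_cmult:
  assumes "r > 0"
  shows "Lp_norm M r (\<lambda>x. c * f x :: real) = \<bar>c\<bar> * Lp_norm M r f"
  using assms by (simp add: Lp_norm_def abs_mult powr_mult powr_powr)

text \<open>The weak formulation is tested only with such products. The bound on
  \<open>\<phi>\<close> and the boundedness of E give membership in L^(q+1)(E), so no Sobolev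
  embedding is required.\<close>

lemma parabolic_test_separable:
  fixes E :: "'a::euclidean_space set"
  assumes E: "open E" "bounded E" and T: "T > 0" and p: "p > 0" and q: "q > 0"
    and h: "W0 E p \<phi> D" "\<And>x. \<bar>\<phi> x\<bar> \<le> 1"
    and e: "continuous_on UNIV \<eta>" "\<And>t. \<bar>\<eta> t\<bar> \<le> 1" "\<eta> T = 0"
    and e': "\<eta>' \<in> borel_measurable borel" "\<And>t. \<bar>\<eta>' t\<bar> \<le> B"
    and d: "\<And>\<psi>. \<psi> \<in> test_functions {0<..<T} \<Longrightarrow>
      (LINT t|lebesgue_on {0<..<T}. \<eta> t * deriv \<psi> t) = - (LINT t|lebesgue_on {0<..<T}. \<eta>' t * \<psi> t)"
  shows "(\<lambda>(x, t). \<eta> t * \<phi> x) \<in> parabolic_tests E T p q"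
    "(\<lambda>(x, t). \<eta>' t * \<phi> x) \<in> L_L (q + 1) T E"
    "has_weak_time_derivative T E (\<lambda>(x, t). \<eta> t * \<phi> x) (\<lambda>(x, t). \<eta>' t * \<phi> x)"
    "has_spatial_gradient T E (\<lambda>(x, t). \<eta> t * \<phi> x) (\<lambda>(x, t). \<eta> t *\<^sub>R D x)"
proof -
  have E': "E \<in> sets borel" using E by simp
  note w = wgrad_D[OF W0_D(1)[OF h(1)]]
  note [measurable] = w(1,2)
  have r: "borel_rep E \<phi> \<phi>" "borel_rep E D D" using w(1-4) by (auto intro: borel_rep_self)
  have m: "\<phi> \<in> borel_measurable (lebesgue_on E)" "D \<in> borel_measurable (lebesgue_on E)"
    by (rule borel_rep_measurable[OF r(1) E'], rule borel_rep_measurable[OF r(2) E'])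
  have em: "\<eta> \<in> borel_measurable borel" using e(1) by (rule borel_measurable_continuous_onI)
  have q1: "q + 1 > 0" using q by simp
  have Lp: "(\<lambda>x. c * \<phi> x) \<in> Lp_space (lebesgue_on E) (q + 1)" for c
  proof -
    have r': "borel_rep E (\<lambda>x. c * \<phi> x) (\<lambda>x. c * \<phi> x)" using w(1-4) by (auto intro: borel_rep_self)
    have "Lp_integrable (q + 1) (\<lambda>x. c * \<phi> x)"
    proof (rule Bochner_Integration.integrable_bound[where f="\<lambda>x. \<bar>c\<bar> powr (q + 1) * indicator E x"])
      show "integrable lborel (\<lambda>x. \<bar>c\<bar> powr (q + 1) * indicator E x)"
        using emeasure_bounded_finite[OF E(2)] E' by (intro integrable_mult_right integrable_real_indicator) auto
      show "AE x in lborel. norm (norm (c * \<phi> x) powr (q + 1)) \<le> norm (\<bar>c\<bar> powr (q + 1) * indicator E x)"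
      proof (rule AE_I2)
        fix x
        have "\<bar>\<phi> x\<bar> powr (q + 1) \<le> 1 powr (q + 1)" using h(2) q by (intro powr_mono2) auto
        then show "norm (norm (c * \<phi> x) powr (q + 1)) \<le> norm (\<bar>c\<bar> powr (q + 1) * indicator E x)"
          using w(3)[of x] q by (cases "x \<in> E") (auto simp: abs_mult powr_mult intro: mult_left_le)
      qed
    qed measurable
    then show ?thesis using Lp_space_iff_rep[OF r' E'] by simp
  qed
  have LN: "Lp_norm (lebesgue_on E) (q + 1) (\<lambda>x. c * \<phi> x) = \<bar>c\<bar> * Lp_norm (lebesgue_on E) (q + 1) \<phi>" for c
    by (rule Lp_norm_cmult[OF q1])
  have N0: "Lp_norm (lebesgue_on E) (q + 1) \<phi> \<ge> 0" "W1p_norm E p \<phi> \<ge> 0" by (simp_all add: Lp_norm_def W1p_norm_def)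
  show LL: "(\<lambda>(x, t). \<eta>' t * \<phi> x) \<in> L_L (q + 1) T E"
    unfolding L_L_def by (rule bochner_Lp_separable[OF E(1) m(1) e' Lp LN N0(1) q1])
  have L1: "(\<lambda>(x, t). \<eta> t * \<phi> x) \<in> L_L (q + 1) T E"
    unfolding L_L_def by (rule bochner_Lp_separable[OF E(1) m(1) em e(2) Lp LN N0(1) q1])
  have L2: "(\<lambda>(x, t). \<eta> t * \<phi> x) \<in> L_W0 p T E"
    unfolding L_W0_def
  proof (rule bochner_Lp_separable[OF E(1) m(1) em e(2) _ W1p_norm_cmult[OF E(1) p h(1)] N0(2) p])
    show "(\<lambda>x. c * \<phi> x) \<in> W1p0 E p" for c
      using w(1,3) by (intro W0_imp_W1p0[OF E(1) p W0_cmult[OF p h(1), of c]] borel_rep_self) auto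
  qed
  show td: "has_weak_time_derivative T E (\<lambda>(x, t). \<eta> t * \<phi> x) (\<lambda>(x, t). \<eta>' t * \<phi> x)"
    unfolding has_weak_time_derivative_def
  proof (intro ballI AE_I2)
    fix \<psi> x assume "\<psi> \<in> test_functions {0<..<T}"
    from arg_cong[OF d[OF this], of "\<lambda>a. \<phi> x * a"]
    show "(LINT t|lebesgue_on {0<..<T}. (case (x, t) of (x, t) \<Rightarrow> \<eta> t * \<phi> x) * deriv \<psi> t) =
      - (LINT t|lebesgue_on {0<..<T}. (case (x, t) of (x, t) \<Rightarrow> \<eta>' t * \<phi> x) * \<psi> t)"
      by (simp add: mult_ac flip: integral_mult_right_zero)
  qed
  have C: "(\<lambda>(x, t). \<eta> t * \<phi> x) \<in> C_L (q + 1) T E"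
    unfolding C_L_def continuous_curves_def
  proof (intro CollectI conjI ballI)
    show "(\<lambda>(x, t). \<eta> t * \<phi> x) \<in> borel_measurable (lebesgue_on (E \<times> {0..T}))"
      using separable_measurable[OF m(1) E(1) _ em, of "{0..T}"] by simp
    fix t assume "t \<in> {0..T}"
    show "(\<lambda>x. case (x, t) of (x, t) \<Rightarrow> \<eta> t * \<phi> x) \<in> Lp_space (lebesgue_on E) (q + 1)" using Lp by simp
    have "(\<eta> \<longlongrightarrow> \<eta> t) (at t within {0..T})"
      using e(1) by (simp add: continuous_on_eq_continuous_at isCont_def tendsto_within_subset[OF _ subset_UNIV])
    then have "((\<lambda>s. \<bar>\<eta> s - \<eta> t\<bar> * Lp_norm (lebesgue_on E) (q + 1) \<phi>) \<longlongrightarrow> \<bar>\<eta> t - \<eta> t\<bar> * Lp_norm (lebesgue_on E) (q + 1) \<phi>) (at t within {0..T})"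
      by (intro tendsto_intros)
    then show "((\<lambda>s. Lp_norm (lebesgue_on E) (q + 1) (\<lambda>x. (case (x, s) of (x, t) \<Rightarrow> \<eta> t * \<phi> x) - (case (x, t) of (x, t) \<Rightarrow> \<eta> t * \<phi> x))) \<longlongrightarrow> 0) (at t within {0..T})"
      by (simp add: left_diff_distrib[symmetric] LN)
  qed
  show "(\<lambda>(x, t). \<eta> t * \<phi> x) \<in> parabolic_tests E T p q"
    unfolding parabolic_tests_def W_L_def using L1 L2 C LL td e(3) by auto
  show "has_spatial_gradient T E (\<lambda>(x, t). \<eta> t * \<phi> x) (\<lambda>(x, t). \<eta> t *\<^sub>R D x)"
    unfolding has_spatial_gradient_def
  proof (intro conjI AE_I2)
    show "(\<lambda>(x, t). \<eta> t *\<^sub>R D x) \<in> borel_measurable (lebesgue_on (E \<times> {0<..<T}))"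
      by (rule separable_measurable[OF m(2) E(1) _ em]) simp
    fix t
    have g: "wgrad E (\<lambda>x. \<eta> t * \<phi> x) (\<lambda>x. \<eta> t *\<^sub>R D x)" by (rule W0_D(1)[OF W0_cmult[OF p h(1)]])
    have "has_weak_gradient E (\<lambda>x. \<eta> t * \<phi> x) (\<lambda>x. \<eta> t *\<^sub>R D x)"
      using wgrad_D(1-4)[OF g] by (intro has_weak_gradient_of_rep[OF E(1) g] borel_rep_self)
    then show "has_weak_gradient E (\<lambda>x. case (x, t) of (x, t) \<Rightarrow> \<eta> t * \<phi> x) (\<lambda>x. case (x, t) of (x, t) \<Rightarrow> \<eta> t *\<^sub>R D x)" by simp
  qed
qed

text \<open>A Lipschitz approximation of the indicator of times up to \<open>a\<close>. Its
  derivative is minus the averaging kernel of (a, a + h), so h -> 0 evaluates the time term of the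
  weak identity at time a.\<close>

definition ramp :: "real \<Rightarrow> real \<Rightarrow> real \<Rightarrow> real" where
  "ramp a h t = max 0 (min 1 ((a + h - t) / h))"

definition ramp' :: "real \<Rightarrow> real \<Rightarrow> real \<Rightarrow> real" where
  "ramp' a h t = (- 1 / h) * indicator {a<..<a + h} t"

lemma ramp_zero:
  assumes "h > 0" "t \<ge> a + h"
  shows "ramp a h t = 0"
proof -
  have "(a + h - t) / h \<le> 0" using assms by (intro divide_nonpos_pos) auto
  then show ?thesis by (simp add: ramp_def max_def min_def)
qed

lemma ramp_props:
  assumes "h > 0"
  shows "continuous_on UNIV (ramp a h)" "\<bar>ramp a h t\<bar> \<le> 1" "t \<ge> a + h \<Longrightarrow> ramp a h t = 0"
    "t \<le> a \<Longrightarrow> ramp a h t = 1" "ramp' a h \<in> borel_measurable borel" "\<bar>ramp' a h t\<bar> \<le> 1 / h"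
  using assms ramp_zero[OF assms, of a t] unfolding ramp_def[abs_def] ramp'_def[abs_def]
  by (auto intro!: continuous_intros simp: indicator_def)

lemma ramp_deriv:
  assumes h: "h > 0" and t: "t \<noteq> a" "t \<noteq> a + h"
  shows "(ramp a h has_real_derivative ramp' a h t) (at t)"
proof -
  consider "t < a" | "a < t" "t < a + h" | "a + h < t" using t by linarith
  then show ?thesis
  proof cases
    case 1
    have "((\<lambda>_. 1) has_real_derivative ramp' a h t) (at t)" using 1 by (simp add: ramp'_def)
    then show ?thesis
      by (rule has_field_derivative_transform_within_open[where S="{..<a}"]) (use 1 h in \<open>auto simp: ramp_def\<close>)
  next
    case 2
    have "((\<lambda>t. (a + h - t) / h) has_real_derivative ramp' a h t) (at t)"
      using 2 h by (auto simp: ramp'_def intro!: derivative_eq_intros)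
    then show ?thesis
      by (rule has_field_derivative_transform_within_open[where S="{a<..<a+h}"]) (use 2 h in \<open>auto simp: ramp_def\<close>)
  next
    case 3
    have "((\<lambda>_. 0) has_real_derivative ramp' a h t) (at t)" using 3 by (simp add: ramp'_def)
    then show ?thesis
      by (rule has_field_derivative_transform_within_open[where S="{a+h<..}"]) (use 3 h in \<open>auto simp: ramp_zero\<close>)
  qed
qed

lemma bounded_integrable_interval:
  fixes f :: "real \<Rightarrow> real"
  assumes "f \<in> borel_measurable borel" "\<And>t. t \<in> {a<..<b} \<Longrightarrow> \<bar>f t\<bar> \<le> B"
  shows "integrable (lebesgue_on {a<..<b}) f"
proof (rule Bochner_Integration.integrable_bound[where f="\<lambda>_. B"])
  show "integrable (lebesgue_on {a<..<b}) (\<lambda>_. B)"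
    by (rule finite_measure.integrable_const[OF finite_measure_lebesgue_on]) simp
  show "f \<in> borel_measurable (lebesgue_on {a<..<b})"
    using assms(1) by (intro measurable_restrict_space1) (auto intro: measurable_completion)
  show "AE t in lebesgue_on {a<..<b}. norm (f t) \<le> norm B"
    using assms(2) by (intro AE_I2) force
qed

text \<open>The fundamental theorem of calculus for the product with the test function, the two
  kinks being exceptional points.\<close>

lemma ramp_weak_derivative:
  assumes h: "h > 0" and T: "T > 0" and p: "\<psi> \<in> test_functions {0<..<T}"
  shows "(LINT t|lebesgue_on {0<..<T}. ramp a h t * deriv \<psi> t) = - (LINT t|lebesgue_on {0<..<T}. ramp' a h t * \<psi> t)"
proof -
  note r = ramp_props[OF h]
  obtain K where K: "compact K" "K \<subseteq> {0<..<T}" "\<And>x. x \<notin> K \<Longrightarrow> \<psi> x = 0"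
    "\<And>x h. x \<notin> K \<Longrightarrow> frechet_derivative \<psi> (at x) h = 0"
    using test_functions_support[OF p] by metis
  have dp: "(\<psi> has_real_derivative frechet_derivative \<psi> (at t) 1) (at t)" for t
  proof -
    note fd = test_functions_D(3)[OF p, of t]
    have e: "frechet_derivative \<psi> (at t) h = frechet_derivative \<psi> (at t) 1 * h" for h
      using linear_scale[OF has_derivative_linear[OF fd], of h 1] by (simp add: mult.commute)
    show ?thesis unfolding has_field_derivative_def
      by (rule has_derivative_eq_rhs[OF fd]) (rule ext, rule e)
  qed
  then have dd: "deriv \<psi> t = frechet_derivative \<psi> (at t) 1" for t by (rule DERIV_imp_deriv)
  have c': "continuous_on UNIV (deriv \<psi>)" unfolding dd[abs_def] using test_functions_D(4)[OF p, of 1] by simp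
  have cp: "continuous_on UNIV \<psi>" by (rule test_functions_D(2)[OF p])
  obtain B1 where B1: "B1 > 0" "\<And>x. norm (\<psi> x) \<le> B1" using compact_support_bounded[OF cp K(1,3)] by blast
  have "\<And>x. x \<notin> K \<Longrightarrow> deriv \<psi> x = 0" using K(4) dd by simp
  then obtain B2 where B2: "B2 > 0" "\<And>x. norm (deriv \<psi> x) \<le> B2" using compact_support_bounded[OF c' K(1)] by metis
  note [measurable] = borel_measurable_continuous_onI[OF r(1)] borel_measurable_continuous_onI[OF c'] borel_measurable_continuous_onI[OF cp] r(5)
  have i1: "integrable (lebesgue_on {0<..<T}) (\<lambda>t. ramp a h t * deriv \<psi> t)"
  proof (rule bounded_integrable_interval)
    show "\<bar>ramp a h t * deriv \<psi> t\<bar> \<le> 1 * B2" for t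
      unfolding abs_mult using r(2) B2 by (intro mult_mono) auto
  qed measurable
  have i2: "integrable (lebesgue_on {0<..<T}) (\<lambda>t. ramp' a h t * \<psi> t)"
  proof (rule bounded_integrable_interval)
    show "\<bar>ramp' a h t * \<psi> t\<bar> \<le> 1 / h * B1" for t
      unfolding abs_mult using r(6) B1 h by (intro mult_mono) auto
  qed measurable
  have this': "((\<lambda>t. ramp a h t * deriv \<psi> t + ramp' a h t * \<psi> t) has_integral (ramp a h T * \<psi> T - ramp a h 0 * \<psi> 0)) {0..T}"
  proof (rule fundamental_theorem_of_calculus_interior_strong[of "{a, a + h}"])
    show "continuous_on {0..T} (\<lambda>t. ramp a h t * \<psi> t)"
      by (intro continuous_on_mult continuous_on_subset[OF r(1)] continuous_on_subset[OF cp]) auto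
    fix t assume "t \<in> {0<..<T} - {a, a + h}"
    then have "((\<lambda>t. ramp a h t * \<psi> t) has_real_derivative (ramp' a h t * \<psi> t + deriv \<psi> t * ramp a h t)) (at t)"
      using dp by (intro DERIV_mult ramp_deriv[OF h]) (auto simp: dd)
    then show "((\<lambda>t. ramp a h t * \<psi> t) has_vector_derivative (ramp a h t * deriv \<psi> t + ramp' a h t * \<psi> t)) (at t)"
      by (simp add: has_real_derivative_iff_has_vector_derivative algebra_simps)
  qed (use T in auto)
  have "integral {0..T} (\<lambda>t. ramp a h t * deriv \<psi> t + ramp' a h t * \<psi> t) = 0"
  proof -
    have "\<psi> 0 = 0" "\<psi> T = 0" using K(2) by (auto intro!: K(3))
    with integral_unique[OF this'] show ?thesis by simp
  qed
  then have "integral {0<..<T} (\<lambda>t. ramp a h t * deriv \<psi> t + ramp' a h t * \<psi> t) = 0"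
    by (simp add: integral_open_interval_real)
  then have "(LINT t|lebesgue_on {0<..<T}. ramp a h t * deriv \<psi> t + ramp' a h t * \<psi> t) = 0"
    using i1 i2 by (subst lebesgue_integral_eq_integral) auto
  then show ?thesis using i1 i2 by simp
qed

subsection \<open>Signed powers\<close>

lemma signed_power_alt: "signed_power q s = sgn s * \<bar>s\<bar> powr q"
proof (cases "s = 0")
  case False
  then have "\<bar>s\<bar> powr (q - 1) = \<bar>s\<bar> powr q / \<bar>s\<bar>" by (simp add: powr_diff)
  then show ?thesis using False by (simp add: signed_power_def sgn_if)
qed (simp add: signed_power_def)

lemma signed_power_uminus: "signed_power q (- s) = - signed_power q s"
  by (simp add: signed_power_def)

lemma signed_power_0 [simp]: "signed_power q 0 = 0"
  by (simp add: signed_power_def)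

lemma abs_signed_power: "\<bar>signed_power q s\<bar> = \<bar>s\<bar> powr q"
  by (simp add: signed_power_alt abs_mult abs_sgn_eq)

lemma signed_power_continuous:
  assumes "q > 0" shows "continuous_on UNIV (signed_power q)"
proof -
  have "signed_power q s = (max s 0) powr q - (max (- s) 0) powr q" for s
    using assms by (auto simp: signed_power_alt sgn_if max_def)
  then have "signed_power q = (\<lambda>s. (max s 0) powr q - (max (- s) 0) powr q)" by (simp add: fun_eq_iff)
  moreover have "continuous_on UNIV (\<lambda>s::real. (max s 0) powr q - (max (- s) 0) powr q)"
    using assms by (intro continuous_intros continuous_on_powr') auto
  ultimately show ?thesis by simp
qed

lemma signed_power_inverse:
  assumes "q > 0" shows "signed_power (1 / q) (signed_power q s) = s"
proof -
  have "sgn (signed_power q s) = sgn s" by (auto simp: signed_power_alt sgn_mult sgn_if)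
  then have "signed_power (1 / q) (signed_power q s) = sgn s * (\<bar>s\<bar> powr q) powr (1 / q)"
    by (simp add: signed_power_alt[of "1 / q"] abs_signed_power)
  also have "\<dots> = s" using assms by (auto simp: powr_powr sgn_if)
  finally show ?thesis .
qed

lemma signed_power_strict_mono:
  assumes "q > 0" shows "strict_mono (signed_power q)"
proof (rule strict_monoI)
  fix x y :: real assume xy: "x < y"
  show "signed_power q x < signed_power q y"
  proof (cases "x \<ge> 0")
    case True
    then show ?thesis using xy assms by (auto simp: signed_power_alt sgn_if intro: powr_less_mono2)
  next
    case x: False
    show ?thesis
    proof (cases "y \<le> 0")
      case True
      have "(- y) powr q < (- x) powr q" using True xy assms by (intro powr_less_mono2) auto
      then show ?thesis using True x by (auto simp: signed_power_alt sgn_if)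
    next
      case False
      then have "y powr q > 0" "(- x) powr q > 0" using x by auto
      then have "- ((- x) powr q) < y powr q" by linarith
      then show ?thesis using False x by (simp add: signed_power_alt sgn_if)
    qed
  qed
qed

lemma signed_power_mult: "l \<ge> 0 \<Longrightarrow> signed_power q (l * s) = l powr q * signed_power q s"
  by (cases "l = 0") (auto simp: signed_power_alt sgn_mult abs_mult powr_mult)

text \<open>
  Replaces a case distinction between $q \le 1$ and $q \ge 1$: by homogeneity, uniform continuity of
  the signed power on a compact interval controls the difference when $|a - c|$ is small compared
  with $1 + |c|$.
\<close>

lemma signed_power_diff_bound:
  assumes q: "q > 0" and e: "e > 0"
  obtains C where "C \<ge> 0" "\<And>a c. \<bar>signed_power q a - signed_power q c\<bar> \<le> e * (1 + \<bar>c\<bar> powr (q + 1)) + C * \<bar>a - c\<bar> powr (q + 1)"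
proof -
  let ?e = "e / 2 powr (q + 1)"
  have e': "?e > 0" using e by simp
  have "uniformly_continuous_on {-2..2} (signed_power q)"
    by (intro compact_uniformly_continuous continuous_on_subset[OF signed_power_continuous[OF q]]) auto
  then obtain d0 where d0: "d0 > 0" "\<And>x y. x \<in> {-2..2} \<Longrightarrow> y \<in> {-2..2} \<Longrightarrow> dist y x < d0 \<Longrightarrow> dist (signed_power q y) (signed_power q x) < ?e"
    using e' unfolding uniformly_continuous_on_def by meson
  \<comment> \<open>As c / \<open>?l\<close> lies in [-1, 1], the bound d <= 1 keeps a /
    \<open>?l\<close> in [-2, 2].\<close>
  define d where "d = min (d0 / 2) 1"
  have d: "d > 0" "d < d0" "d \<le> 1" using d0(1) by (auto simp: d_def)
  \<comment> \<open>If |a - c| > d (1 + |c|), then |a| and |c| are at most (1/d + 1) |a - c|, and |a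
    - c| >= d raises the exponent from q to q + 1 at the price of the factor 1/d.\<close>
  define C where "C = 2 * (1 / d + 1) powr q / d"
  have C0: "C \<ge> 0" using d by (simp add: C_def)
  have "\<bar>signed_power q a - signed_power q c\<bar> \<le> e * (1 + \<bar>c\<bar> powr (q + 1)) + C * \<bar>a - c\<bar> powr (q + 1)" for a c
  proof (cases "\<bar>a - c\<bar> \<le> d * (1 + \<bar>c\<bar>)")
    case True
    let ?l = "1 + \<bar>c\<bar>"
    have l: "?l \<ge> 1" "?l > 0" by simp_all
    have ac: "\<bar>a / ?l - c / ?l\<bar> \<le> d" using True l by (simp add: diff_divide_distrib[symmetric] abs_divide divide_le_eq)
    have c1: "\<bar>c / ?l\<bar> \<le> 1" using l by (simp add: abs_divide divide_le_eq)
    have "y \<in> {-2..2} \<and> x \<in> {-2..2}" if "\<bar>x - y\<bar> \<le> d" "\<bar>y\<bar> \<le> 1" for x y :: real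
      using that d(3) by auto
    from this[OF ac c1] have "\<bar>signed_power q (a / ?l) - signed_power q (c / ?l)\<bar> \<le> ?e"
      using d0(2)[of "c / ?l" "a / ?l"] ac d(2) by (simp add: dist_real_def)
    then have "?l powr q * \<bar>signed_power q (a / ?l) - signed_power q (c / ?l)\<bar> \<le> ?l powr q * ?e"
      by (intro mult_left_mono) auto
    moreover have "?l powr q * \<bar>signed_power q (a / ?l) - signed_power q (c / ?l)\<bar> = \<bar>signed_power q a - signed_power q c\<bar>"
    proof -
      have "signed_power q a = ?l powr q * signed_power q (a / ?l)" "signed_power q c = ?l powr q * signed_power q (c / ?l)"
        using signed_power_mult[of ?l q "a / ?l"] signed_power_mult[of ?l q "c / ?l"] l by simp_all
      then show ?thesis by (simp add: right_diff_distrib[symmetric] abs_mult)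
    qed
    moreover have "?l powr q * ?e \<le> e * (1 + \<bar>c\<bar> powr (q + 1))"
    proof -
      have "?l powr q \<le> ?l powr (q + 1)" using l by (intro powr_mono) auto
      also have "\<dots> \<le> 2 powr (q + 1) * (1 powr (q + 1) + \<bar>c\<bar> powr (q + 1))" using q by (intro powr_add_le) auto
      finally have "?l powr q * ?e \<le> 2 powr (q + 1) * (1 + \<bar>c\<bar> powr (q + 1)) * ?e" using e' by (intro mult_right_mono) auto
      then show ?thesis by (simp add: mult_ac)
    qed
    moreover have "C * \<bar>a - c\<bar> powr (q + 1) \<ge> 0" using C0 by simp
    ultimately show ?thesis by linarith
  next
    case False
    let ?m = "\<bar>a - c\<bar>"
    have m: "?m > d * (1 + \<bar>c\<bar>)" "?m > 0" using False d(1) by (auto intro: le_less_trans[of 0 "d * (1 + \<bar>c\<bar>)"])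
    have c: "\<bar>c\<bar> \<le> (1 / d + 1) * ?m"
    proof -
      have "\<bar>c\<bar> \<le> ?m / d" using m d(1) by (simp add: field_simps)
      also have "\<dots> \<le> (1 / d + 1) * ?m" using m by (simp add: algebra_simps)
      finally show ?thesis .
    qed
    have a: "\<bar>a\<bar> \<le> (1 / d + 1) * ?m"
    proof -
      have "\<bar>c\<bar> \<le> ?m / d" using m d(1) by (simp add: field_simps)
      moreover have "\<bar>a\<bar> \<le> \<bar>c\<bar> + ?m" by linarith
      ultimately show ?thesis by (simp add: algebra_simps)
    qed
    have md: "?m powr q \<le> ?m powr (q + 1) / d"
    proof -
      have "d \<le> ?m"
      proof -
        have "d * 1 \<le> d * (1 + \<bar>c\<bar>)" using d(1) by (intro mult_left_mono) auto
        with m(1) show ?thesis by linarith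
      qed
      then have "?m powr q * d \<le> ?m powr q * ?m" by (intro mult_left_mono) auto
      then show ?thesis using d(1) m(2) by (simp add: powr_add field_simps)
    qed
    have "\<bar>signed_power q a - signed_power q c\<bar> \<le> \<bar>a\<bar> powr q + \<bar>c\<bar> powr q"
      using abs_signed_power[of q a] abs_signed_power[of q c] by linarith
    also have "\<dots> \<le> ((1 / d + 1) * ?m) powr q + ((1 / d + 1) * ?m) powr q"
      using a c q by (intro add_mono powr_mono2) auto
    also have "\<dots> = 2 * (1 / d + 1) powr q * ?m powr q" using d by (simp add: powr_mult)
    also have "\<dots> \<le> 2 * (1 / d + 1) powr q * (?m powr (q + 1) / d)" using md by (intro mult_left_mono) auto
    also have "\<dots> = C * ?m powr (q + 1)" by (simp add: C_def)
    finally show ?thesis using e by (simp add: add_increasing)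
  qed
  with C0 that show ?thesis by blast
qed

text \<open>Membership in C([0,T]; L^1(E)). For z = |u|^(q-1) u this is the form in which the
  continuity of a weak solution in time is used.\<close>

definition L1_curve :: "real \<Rightarrow> 'a::euclidean_space set \<Rightarrow> ('a \<times> real \<Rightarrow> real) \<Rightarrow> bool" where
  "L1_curve T E z \<longleftrightarrow>
     (\<forall>t\<in>{0..T}. integrable (lebesgue_on E) (\<lambda>x. z (x, t))) \<and>
     (\<forall>t\<in>{0..T}. ((\<lambda>s. LINT x|lebesgue_on E. \<bar>z (x, s) - z (x, t)\<bar>) \<longlongrightarrow> 0) (at t within {0..T})) \<and>
     z \<in> borel_measurable (lebesgue_on (E \<times> {0..T}))"

lemma integrable_const_bounded:
  fixes E :: "'a::euclidean_space set"
  assumes "open E" "bounded E"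
  shows "integrable (lebesgue_on E) (\<lambda>_. c :: real)"
  by (rule finite_measure.integrable_const[OF finite_measure_lebesgue_on])
    (use assms in \<open>auto intro: bounded_set_imp_lmeasurable\<close>)

lemma integrable_signed_power:
  assumes E: "open E" "bounded E" and q: "q > 0" and f: "f \<in> Lp_space (lebesgue_on E) (q + 1)"
  shows "integrable (lebesgue_on E) (\<lambda>x. signed_power q (f x))"
proof (rule Bochner_Integration.integrable_bound)
  have [measurable]: "f \<in> borel_measurable (lebesgue_on E)" using f by (simp add: Lp_space_def)
  have [measurable]: "signed_power q \<in> borel_measurable borel"
    by (rule borel_measurable_continuous_onI[OF signed_power_continuous[OF q]])
  show "integrable (lebesgue_on E) (\<lambda>x. 1 + norm (f x) powr (q + 1))"
    using f integrable_const_bounded[OF E] by (auto simp: Lp_space_def)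
  show "(\<lambda>x. signed_power q (f x)) \<in> borel_measurable (lebesgue_on E)" by measurable
  show "AE x in lebesgue_on E. norm (signed_power q (f x)) \<le> norm (1 + norm (f x) powr (q + 1))"
  proof (rule AE_I2)
    fix x
    have "\<bar>f x\<bar> powr q \<le> 1 + \<bar>f x\<bar> powr (q + 1)"
    proof (cases "\<bar>f x\<bar> \<le> 1")
      case True
      then have "\<bar>f x\<bar> powr q \<le> 1 powr q" using q by (intro powr_mono2) auto
      then show ?thesis by (simp add: add_increasing2)
    next
      case False
      then have "\<bar>f x\<bar> powr q \<le> \<bar>f x\<bar> powr (q + 1)" by (intro powr_mono) auto
      then show ?thesis by simp
    qed
    then show "norm (signed_power q (f x)) \<le> norm (1 + norm (f x) powr (q + 1))" by (simp add: abs_signed_power)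
  qed
qed

text \<open>In \<open>signed_power_diff_bound\<close> with c = u(x, t), the first term is made small
  by the choice of its factor, and the second tends to 0 by continuity in L^(q+1).\<close>

lemma C_L_signed_power:
  assumes E: "open E" "bounded E" and q: "q > 0" and u: "u \<in> C_L (q + 1) T E"
  shows "L1_curve T E (\<lambda>z. signed_power q (u z))"
  unfolding L1_curve_def
proof (intro conjI ballI)
  have sm[measurable]: "signed_power q \<in> borel_measurable borel"
    by (rule borel_measurable_continuous_onI[OF signed_power_continuous[OF q]])
  have Lp: "(\<lambda>x. u (x, t)) \<in> Lp_space (lebesgue_on E) (q + 1)" if "t \<in> {0..T}" for t
    using u that by (auto simp: C_L_def continuous_curves_def)
  have um: "u \<in> borel_measurable (lebesgue_on (E \<times> {0..T}))" using u by (auto simp: C_L_def continuous_curves_def)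
  show "(\<lambda>z. signed_power q (u z)) \<in> borel_measurable (lebesgue_on (E \<times> {0..T}))" using um by measurable
  show i: "integrable (lebesgue_on E) (\<lambda>x. signed_power q (u (x, t)))" if "t \<in> {0..T}" for t
    by (rule integrable_signed_power[OF E q Lp[OF that]])
  fix t assume t: "t \<in> {0..T}"
  let ?n = "\<lambda>s. LINT x|lebesgue_on E. norm (u (x, s) - u (x, t)) powr (q + 1)"
  have "((\<lambda>s. Lp_norm (lebesgue_on E) (q + 1) (\<lambda>x. u (x, s) - u (x, t))) \<longlongrightarrow> 0) (at t within {0..T})"
    using u t by (auto simp: C_L_def continuous_curves_def)
  then have "((\<lambda>s. Lp_norm (lebesgue_on E) (q + 1) (\<lambda>x. u (x, s) - u (x, t)) powr (q + 1)) \<longlongrightarrow> 0 powr (q + 1)) (at t within {0..T})"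
    by (rule tendsto_powr'[OF _ tendsto_const]) (use q in \<open>auto simp: Lp_norm_def\<close>)
  moreover have "Lp_norm (lebesgue_on E) (q + 1) (\<lambda>x. u (x, s) - u (x, t)) powr (q + 1) = ?n s" for s
    using q by (simp add: Lp_norm_def powr_powr)
  ultimately have lim: "(?n \<longlongrightarrow> 0) (at t within {0..T})" using q by simp
  let ?N = "LINT x|lebesgue_on E. 1 + norm (u (x, t)) powr (q + 1)"
  have iN: "integrable (lebesgue_on E) (\<lambda>x. 1 + norm (u (x, t)) powr (q + 1))"
    using Lp[OF t] integrable_const_bounded[OF E] by (auto simp: Lp_space_def)
  have N: "?N \<ge> 0" by (intro integral_nonneg_AE AE_I2) (simp add: add_nonneg_nonneg)
  show "((\<lambda>s. LINT x|lebesgue_on E. \<bar>signed_power q (u (x, s)) - signed_power q (u (x, t))\<bar>) \<longlongrightarrow> 0) (at t within {0..T})"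
  proof (rule tendstoI)
    fix e :: real assume e: "e > 0"
    let ?e = "e / (2 * (?N + 1))"
    have e': "?e > 0" using e N by (intro divide_pos_pos mult_pos_pos add_nonneg_pos) simp_all
    obtain C where C: "C \<ge> 0" "\<And>a c. \<bar>signed_power q a - signed_power q c\<bar> \<le> ?e * (1 + \<bar>c\<bar> powr (q + 1)) + C * \<bar>a - c\<bar> powr (q + 1)"
      using signed_power_diff_bound[OF q e'] by metis
    have eN: "?e * ?N < e / 2"
    proof -
      have "?N / (?N + 1) < 1" using N by (simp add: divide_less_eq add_nonneg_pos)
      from mult_strict_left_mono[OF this, of "e / 2"] show ?thesis using e by simp
    qed
    have "((\<lambda>s. C * ?n s) \<longlongrightarrow> 0) (at t within {0..T})" by (rule tendsto_mult_right_zero[OF lim])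
    then have "\<forall>\<^sub>F s in at t within {0..T}. C * ?n s < e / 2" using e by (intro order_tendstoD(2)) auto
    moreover have "\<forall>\<^sub>F s in at t within {0..T}. s \<in> {0..T}" by (simp add: eventually_at_filter)
    ultimately show "\<forall>\<^sub>F s in at t within {0..T}. dist (LINT x|lebesgue_on E. \<bar>signed_power q (u (x, s)) - signed_power q (u (x, t))\<bar>) 0 < e"
    proof eventually_elim
      case (elim s)
      have id: "integrable (lebesgue_on E) (\<lambda>x. norm (u (x, s) - u (x, t)) powr (q + 1))"
        by (rule integrable_powr_diff) (use Lp[OF elim(2)] Lp[OF t] q in \<open>auto simp: Lp_space_def\<close>)
      have "(LINT x|lebesgue_on E. \<bar>signed_power q (u (x, s)) - signed_power q (u (x, t))\<bar>) \<le>
        (LINT x|lebesgue_on E. ?e * (1 + norm (u (x, t)) powr (q + 1)) + C * norm (u (x, s) - u (x, t)) powr (q + 1))"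
      proof (rule integral_mono)
        show "integrable (lebesgue_on E) (\<lambda>x. \<bar>signed_power q (u (x, s)) - signed_power q (u (x, t))\<bar>)"
          using i[OF elim(2)] i[OF t] by simp
        show "integrable (lebesgue_on E) (\<lambda>x. ?e * (1 + norm (u (x, t)) powr (q + 1)) + C * norm (u (x, s) - u (x, t)) powr (q + 1))"
          by (intro Bochner_Integration.integrable_add integrable_mult_right iN id)
        show "\<bar>signed_power q (u (x, s)) - signed_power q (u (x, t))\<bar> \<le> ?e * (1 + norm (u (x, t)) powr (q + 1)) + C * norm (u (x, s) - u (x, t)) powr (q + 1)" for x
          using C(2)[of "u (x, s)" "u (x, t)"] unfolding real_norm_def .
      qed
      also have "\<dots> = ?e * ?N + C * ?n s" using iN id by (subst Bochner_Integration.integral_add) (auto simp only: integrable_mult_right integral_mult_right_zero)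
      also have "\<dots> < e / 2 + e / 2" by (rule add_strict_mono[OF eN elim(1)])
      also have "\<dots> = e" by simp
      finally show ?case by (simp add: dist_real_def)
    qed
  qed
qed

text \<open>For functionals that are Lipschitz in the L^1 distance of the curve, such as pairings
  with bounded functions and the integrals of \<open>excess\<close>.\<close>

lemma L1_curve_integral_continuous:
  assumes z: "L1_curve T E z"
    and f: "\<And>s t. s \<in> {0..T} \<Longrightarrow> t \<in> {0..T} \<Longrightarrow> \<bar>f s - f t\<bar> \<le> C * (LINT x|lebesgue_on E. \<bar>z (x, s) - z (x, t)\<bar>)"
  shows "continuous_on {0..T} f"
  unfolding continuous_on_def
proof (intro ballI)
  fix t assume t: "t \<in> {0..T}"
  have "((\<lambda>s. C * (LINT x|lebesgue_on E. \<bar>z (x, s) - z (x, t)\<bar>)) \<longlongrightarrow> 0) (at t within {0..T})"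
    using z t by (intro tendsto_mult_right_zero) (auto simp: L1_curve_def)
  then have "((\<lambda>s. f s - f t) \<longlongrightarrow> 0) (at t within {0..T})"
    by (rule Lim_null_comparison[rotated]) (use f t in \<open>auto simp: eventually_at_filter\<close>)
  then show "(f \<longlongrightarrow> f t) (at t within {0..T})" by (simp add: LIM_zero_iff)
qed

lemma L1_curve_bounded:
  assumes z: "L1_curve T E z"
  obtains M where "M \<ge> 0" "\<And>t. t \<in> {0..T} \<Longrightarrow> (LINT x|lebesgue_on E. \<bar>z (x, t)\<bar>) \<le> M"
proof -
  let ?f = "\<lambda>t. LINT x|lebesgue_on E. \<bar>z (x, t)\<bar>"
  have i: "integrable (lebesgue_on E) (\<lambda>x. z (x, t))" if "t \<in> {0..T}" for t using z that by (auto simp: L1_curve_def)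
  have "continuous_on {0..T} ?f"
  proof (rule L1_curve_integral_continuous[OF z])
    fix s t assume st: "s \<in> {0..T}" "t \<in> {0..T}"
    have "\<bar>?f s - ?f t\<bar> = \<bar>\<integral>x. \<bar>z (x, s)\<bar> - \<bar>z (x, t)\<bar> \<partial>lebesgue_on E\<bar>" using i[OF st(1)] i[OF st(2)] by simp
    also have "\<dots> \<le> (LINT x|lebesgue_on E. \<bar>z (x, s) - z (x, t)\<bar>)"
      using i[OF st(1)] i[OF st(2)] unfolding real_norm_def[symmetric]
      by (intro order_trans[OF integral_norm_bound] integral_mono) auto
    finally show "\<bar>?f s - ?f t\<bar> \<le> 1 * (LINT x|lebesgue_on E. \<bar>z (x, s) - z (x, t)\<bar>)" by simp
  qed
  then have "bounded (?f ` {0..T})" by (intro compact_imp_bounded compact_continuous_image) auto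
  then obtain M where "M > 0" "\<And>t. t \<in> {0..T} \<Longrightarrow> norm (?f t) \<le> M" unfolding bounded_pos by auto
  then have "?f t \<le> M" if "t \<in> {0..T}" for t using that by force
  with \<open>M > 0\<close> show ?thesis using that[of M] by simp
qed

lemma borel_slice:
  assumes "z \<in> borel_measurable (borel :: ('a::euclidean_space \<times> 'b::euclidean_space) measure)"
  shows "(\<lambda>x. z (x, t)) \<in> borel_measurable borel"
  by (rule measurable_compose[OF _ assms]) (auto intro!: borel_measurable_continuous_onI continuous_intros)

lemma borel_rep_slices:
  assumes r: "borel_rep (E \<times> I) z z'"
  shows "AE t in lborel. t \<in> I \<longrightarrow> borel_rep E (\<lambda>x. z (x, t)) (\<lambda>x. z' (x, t))"
proof -
  have m: "z' \<in> borel_measurable borel" using r by (simp add: borel_rep_def)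
  have "AE z0 in lborel. z0 \<in> E \<times> I \<longrightarrow> z z0 = z' z0" using r by (simp add: borel_rep_def)
  from lborel_AE_slices[OF this] show ?thesis
  proof eventually_elim
    case (elim t)
    show ?case using elim r borel_slice[OF m] by (auto simp: borel_rep_def)
  qed
qed

text \<open>Tonelli with the uniform bound of the L^1 norms on [0, T]. The slices of the
  representative agree with those of z for almost every t only, which is enough.\<close>

lemma L1_curve_integrable:
  assumes E: "open E" and z: "L1_curve T E z" and r: "borel_rep (E \<times> {0..T}) z z'"
  shows "integrable lborel z'"
proof (rule integrableI_bounded)
  have E': "E \<in> sets borel" using E by simp
  have m: "z' \<in> borel_measurable borel" using r by (simp add: borel_rep_def)
  then show "z' \<in> borel_measurable lborel" by simp
  have m': "z' \<in> borel_measurable (lborel \<Otimes>\<^sub>M lborel)" unfolding lborel_prod using m by simp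
  obtain M where M: "M \<ge> 0" "\<And>t. t \<in> {0..T} \<Longrightarrow> (LINT x|lebesgue_on E. \<bar>z (x, t)\<bar>) \<le> M"
    using L1_curve_bounded[OF z] by blast
  have "(\<integral>\<^sup>+w. ennreal (norm (z' w)) \<partial>lborel) = (\<integral>\<^sup>+w. ennreal (norm (z' w)) \<partial>(lborel \<Otimes>\<^sub>M lborel))"
    by (simp add: lborel_prod)
  also have "\<dots> = (\<integral>\<^sup>+t. (\<integral>\<^sup>+x. ennreal (norm (z' (x, t))) \<partial>lborel) \<partial>lborel)"
    using lborel_pair.nn_integral_snd[of "\<lambda>w. ennreal (norm (z' w))"] m' by simp
  also have "\<dots> \<le> (\<integral>\<^sup>+t. ennreal (M * indicator {0..T} t) \<partial>lborel)"
  proof (rule nn_integral_mono_AE)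
    show "AE t in lborel. (\<integral>\<^sup>+x. ennreal (norm (z' (x, t))) \<partial>lborel) \<le> ennreal (M * indicator {0..T} t)"
      using borel_rep_slices[OF r]
    proof eventually_elim
      case (elim t)
      show ?case
      proof (cases "t \<in> {0..T}")
        case True
        then have rt: "borel_rep E (\<lambda>x. z (x, t)) (\<lambda>x. z' (x, t))" using elim by simp
        have i: "integrable lborel (\<lambda>x. z' (x, t))"
          using borel_rep_integrable[OF rt E'] z True by (auto simp: L1_curve_def)
        have "(LINT x|lebesgue_on E. \<bar>z (x, t)\<bar>) = (LINT x|lborel. \<bar>z' (x, t)\<bar>)"
          by (rule borel_rep_integral[OF borel_rep_map[OF rt] E']) auto
        then have "(LINT x|lborel. \<bar>z' (x, t)\<bar>) \<le> M" using M(2)[OF True] by simp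
        moreover have "(\<integral>\<^sup>+x. ennreal (norm (z' (x, t))) \<partial>lborel) = ennreal (LINT x|lborel. norm (z' (x, t)))"
          using i by (intro nn_integral_eq_integral) auto
        ultimately show ?thesis using True by (simp add: ennreal_leI)
      next
        case False
        then have "z' (x, t) = 0" for x using r by (auto simp: borel_rep_def)
        then show ?thesis by simp
      qed
    qed
  qed
  also have "\<dots> = ennreal M * emeasure lborel {0..T}"
    using M(1) by (simp add: ennreal_mult' nn_integral_cmult ennreal_indicator)
  also have "\<dots> < \<infinity>" by (simp add: ennreal_mult_less_top emeasure_lborel_Icc_eq)
  finally show "(\<integral>\<^sup>+w. ennreal (norm (z' w)) \<partial>lborel) < \<infinity>" .
qed

subsection \<open>The time-integrated weak identity\<close>

text \<open>For constant arguments the field is measurable in x. Simple functions approximating the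
  pair (u, D) reduce the general case to finitely many constants, and continuity in the last two
  arguments passes to the limit off a null set.\<close>

lemma caratheodory_measurable:
  fixes A :: "'a::euclidean_space \<Rightarrow> real \<Rightarrow> 'a \<Rightarrow> 'a"
  assumes E: "open E" and I: "(I :: real set) \<in> sets borel" and A: "caratheodory E A"
    and u: "u \<in> borel_measurable (lebesgue_on (E \<times> I))" and D: "D \<in> borel_measurable (lebesgue_on (E \<times> I))"
  shows "(\<lambda>z. A (fst z) (u z) (D z)) \<in> borel_measurable (lebesgue_on (E \<times> I))"
proof -
  let ?M = "lebesgue_on (E \<times> I)"
  have E': "E \<in> sets borel" using E by simp
  have S: "E \<times> I \<in> sets borel" using E' I by (rule borel_Times)
  have "(\<lambda>z. (u z, D z)) \<in> borel_measurable ?M" using u D by measurable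
  then obtain F where F: "\<And>i. simple_function ?M (F i)" "\<And>z. z \<in> space ?M \<Longrightarrow> (\<lambda>i. F i z) \<longlonglongrightarrow> (u z, D z)"
    using borel_measurable_implies_sequence_metric[of "\<lambda>z. (u z, D z)" ?M 0] by blast
  have "AE x in lborel. x \<in> E \<longrightarrow> continuous_on UNIV (\<lambda>(u, \<xi>). A x u \<xi>)"
    using A by (simp add: caratheodory_def AE_lebesgue_on_iff[OF E'])
  then obtain N where N: "\<And>x. x \<in> space lborel - N \<Longrightarrow> x \<in> E \<longrightarrow> continuous_on UNIV (\<lambda>(u, \<xi>). A x u \<xi>)" "N \<in> null_sets lborel"
    by (rule AE_E3) blast
  have Nb: "N \<in> sets borel" using N(2) by auto
  define g where "g i z = A (fst z) (fst (F i z)) (snd (F i z))" for i z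
  have cm: "(\<lambda>z. A (fst z) c d) \<in> borel_measurable ?M" for c d
  proof -
    have "(\<lambda>x. A x c d) \<in> borel_measurable (lebesgue_on E)" using A by (simp add: caratheodory_def)
    from separable_measurable[OF this E I, of "\<lambda>_. 1"] show ?thesis by (simp add: case_prod_unfold)
  qed
  have gm: "g i \<in> borel_measurable ?M" for i
    unfolding g_def
  proof (rule measurable_compose_countable'[where f="\<lambda>c z. A (fst z) (fst c) (snd c)" and I="F i ` space ?M"])
    show "F i \<in> ?M \<rightarrow>\<^sub>M count_space (F i ` space ?M)"
      by (rule measurableI) (use simple_functionD(2)[OF F(1)[of i]] in auto)
    show "countable (F i ` space ?M)" using simple_functionD(1)[OF F(1)[of i]] by (rule countable_finite)
  qed (rule cm)
  have "N \<times> (UNIV :: real set) \<in> sets borel" using Nb by (intro borel_Times) auto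
  then have "- (N \<times> (UNIV :: real set)) \<in> sets borel" by (rule borel_comp)
  then have im: "indicator (- (N \<times> UNIV)) \<in> borel_measurable ?M"
    by (intro measurable_restrict_space1 borel_measurable_indicator sets_completionI_sets) (simp only: sets_lborel)
  \<comment> \<open>The indicator removes the cylinder over the null set of x where continuity may
    fail.\<close>
  let ?h = "\<lambda>z. indicator (- (N \<times> UNIV)) z *\<^sub>R A (fst z) (u z) (D z)"
  have "?h \<in> borel_measurable ?M"
  proof (rule borel_measurable_LIMSEQ_metric)
    show "(\<lambda>z. indicator (- (N \<times> UNIV)) z *\<^sub>R g i z) \<in> borel_measurable ?M" for i
      using im gm by (rule borel_measurable_scaleR)
    fix z assume z: "z \<in> space ?M"
    show "(\<lambda>i. indicator (- (N \<times> UNIV)) z *\<^sub>R g i z) \<longlonglongrightarrow> ?h z"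
    proof (cases "fst z \<in> N")
      case False
      then have "continuous_on UNIV (\<lambda>(u, \<xi>). A (fst z) u \<xi>)" using N(1)[of "fst z"] z S by auto
      then have "isCont (\<lambda>(u, \<xi>). A (fst z) u \<xi>) (u z, D z)" by (simp add: continuous_on_eq_continuous_at)
      from isCont_tendsto_compose[OF this F(2)[OF z]]
      have "(\<lambda>i. g i z) \<longlonglongrightarrow> A (fst z) (u z) (D z)" by (simp add: g_def case_prod_unfold)
      then show ?thesis by (intro tendsto_intros)
    next
      case True
      then have "indicator (- (N \<times> UNIV)) z = (0::real)" by (auto simp: indicator_def mem_Times_iff)
      then show ?thesis by simp
    qed
  qed
  then obtain h' where h': "borel_rep (E \<times> I) ?h h'" by (rule borel_rep_exists[OF _ S])
  have "AE x in lborel. x \<notin> N" using N(2) by (rule AE_not_in)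
  from lborel_AE_fst[OF this]
  have "AE z in lborel. z \<in> E \<times> I \<longrightarrow> ?h z = A (fst z) (u z) (D z)"
  proof eventually_elim
    case (elim z)
    then have "indicator (- (N \<times> UNIV)) z = (1::real)" by (auto simp: indicator_def mem_Times_iff)
    then show ?case by simp
  qed
  from borel_rep_measurable[OF borel_rep_AE_cong[OF h' this] S] show ?thesis .
qed

text \<open>The weak identity is posed on (0, T], gradients are given on (0, T); the slice t = T is
  a null set.\<close>

lemma borel_rep_add_null:
  fixes T :: real
  assumes r: "borel_rep (E \<times> {0<..<T}) f g"
  shows "borel_rep (E \<times> {0<..T}) f g"
proof -
  have "AE t in lborel. t \<noteq> T" by (rule AE_lborel_singleton)
  from lborel_AE_snd[OF this]
  have "AE z in lborel. snd z \<noteq> (T :: real)" .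
  moreover have "AE z in lborel. z \<in> E \<times> {0<..<T} \<longrightarrow> f z = g z" using r by (simp add: borel_rep_def)
  ultimately have "AE z in lborel. z \<in> E \<times> {0<..T} \<longrightarrow> f z = g z"
    by eventually_elim (auto simp: mem_Times_iff)
  then show ?thesis using r by (auto simp: borel_rep_def)
qed

section \<open>Fubini, Young's inequality and the weak identity at a fixed time\<close>

lemma product_integrable:
  fixes f :: "'a::euclidean_space \<Rightarrow> real" and g :: "'b::euclidean_space \<Rightarrow> real"
  assumes f: "integrable lborel f" and g: "integrable lborel g"
  shows "integrable lborel (\<lambda>z. f (fst z) * g (snd z))"
proof -
  have [measurable]: "f \<in> borel_measurable borel" "g \<in> borel_measurable borel"
    using f g borel_measurable_integrable by fastforce+
  have "integrable (lborel \<Otimes>\<^sub>M lborel) (\<lambda>z. f (fst z) * g (snd z))"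
  proof (rule lborel_pair.Fubini_integrable)
    show "integrable lborel (\<lambda>x. LINT y|lborel. norm (f (fst (x, y)) * g (snd (x, y))))"
      using f by (simp add: abs_mult)
    show "AE x in lborel. integrable lborel (\<lambda>y. f (fst (x, y)) * g (snd (x, y)))"
      using g by simp
  qed measurable
  then show ?thesis by (simp add: lborel_prod)
qed

lemma lborel_Fubini:
  fixes f :: "'a::euclidean_space \<times> 'b::euclidean_space \<Rightarrow> 'c::euclidean_space"
  assumes "integrable lborel f"
  shows "(LINT t|lborel. (LINT x|lborel. f (x, t))) = (LINT z|lborel. f z)"
    "AE t in lborel. integrable lborel (\<lambda>x. f (x, t))"
    "integrable lborel (\<lambda>t. LINT x|lborel. f (x, t))"
proof -
  have i: "integrable (lborel \<Otimes>\<^sub>M lborel) (case_prod (\<lambda>x t. f (x, t)))" using assms by (simp add: lborel_prod)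
  show "(LINT t|lborel. (LINT x|lborel. f (x, t))) = (LINT z|lborel. f z)"
    using lborel_pair.integral_snd[OF i] by (simp add: lborel_prod)
  show "AE t in lborel. integrable lborel (\<lambda>x. f (x, t))" using lborel_pair.AE_integrable_snd[OF i] .
  show "integrable lborel (\<lambda>t. LINT x|lborel. f (x, t))" using lborel_pair.integrable_snd[OF i] .
qed

lemma lborel_Tonelli:
  fixes f :: "'a::euclidean_space \<times> 'b::euclidean_space \<Rightarrow> ennreal"
  assumes "f \<in> borel_measurable borel"
  shows "(\<integral>\<^sup>+t. (\<integral>\<^sup>+x. f (x, t) \<partial>lborel) \<partial>lborel) = (\<integral>\<^sup>+z. f z \<partial>lborel)"
proof -
  have "f \<in> borel_measurable (lborel \<Otimes>\<^sub>M lborel)" unfolding lborel_prod using assms by simp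
  from lborel_pair.nn_integral_snd[OF this] show ?thesis by (simp add: lborel_prod)
qed

lemma integrable_Ioo: "integrable lborel (indicator {a<..<b} :: real \<Rightarrow> real)"
  by (cases "a \<le> b") (auto intro!: integrable_real_indicator)

text \<open>The factors (p - 1)/p and 1/p of Young's inequality are at most 1 and are
  dropped.\<close>

lemma conjugate_Young:
  fixes a b :: real
  assumes p: "p > 1" and "a \<ge> 0" "b \<ge> 0"
  shows "a * b \<le> a powr (p / (p - 1)) + b powr p"
proof -
  have "1 / (p / (p - 1)) + 1 / p = 1" using p by (simp add: field_simps)
  then have "a * b \<le> a powr (p / (p - 1)) / (p / (p - 1)) + b powr p / p"
    using p assms by (intro Youngs_inequality) (auto simp: field_simps)
  also have "\<dots> \<le> a powr (p / (p - 1)) + b powr p"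
  proof (rule add_mono)
    have "a powr (p / (p - 1)) * ((p - 1) / p) \<le> a powr (p / (p - 1)) * 1"
      using p by (intro mult_left_mono) auto
    then show "a powr (p / (p - 1)) / (p / (p - 1)) \<le> a powr (p / (p - 1))" by simp
    have "b powr p * (1 / p) \<le> b powr p * 1" using p by (intro mult_left_mono) auto
    then show "b powr p / p \<le> b powr p" by simp
  qed
  finally show ?thesis .
qed

lemma Young_integrable:
  fixes X Y :: "'a \<Rightarrow> 'b::euclidean_space"
  assumes p: "p > 1" and X: "X \<in> borel_measurable M" "integrable M (\<lambda>z. norm (X z) powr (p / (p - 1)))"
    and Y: "Y \<in> borel_measurable M" "integrable M (\<lambda>z. norm (Y z) powr p)"
  shows "integrable M (\<lambda>z. X z \<bullet> Y z)" "integrable M (\<lambda>z. norm (X z) * norm (Y z))"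
proof -
  note [measurable] = X(1) Y(1)
  have b: "norm (X z) * norm (Y z) \<le> norm (X z) powr (p / (p - 1)) + norm (Y z) powr p" for z
    by (rule conjugate_Young[OF p]) auto
  have i: "integrable M (\<lambda>z. norm (X z) powr (p / (p - 1)) + norm (Y z) powr p)" using X Y by simp
  show "integrable M (\<lambda>z. X z \<bullet> Y z)"
  proof (rule Bochner_Integration.integrable_bound[OF i])
    show "AE z in M. norm (X z \<bullet> Y z) \<le> norm (norm (X z) powr (p / (p - 1)) + norm (Y z) powr p)"
    proof (rule AE_I2)
      fix z
      have "\<bar>X z \<bullet> Y z\<bar> \<le> norm (X z) powr (p / (p - 1)) + norm (Y z) powr p"
        using b[of z] Cauchy_Schwarz_ineq2[of "X z" "Y z"] by linarith
      then show "norm (X z \<bullet> Y z) \<le> norm (norm (X z) powr (p / (p - 1)) + norm (Y z) powr p)" by simp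
    qed
  qed measurable
  show "integrable M (\<lambda>z. norm (X z) * norm (Y z))"
  proof (rule Bochner_Integration.integrable_bound[OF i])
    show "AE z in M. norm (norm (X z) * norm (Y z)) \<le> norm (norm (X z) powr (p / (p - 1)) + norm (Y z) powr p)"
      using b by (intro AE_I2) simp
  qed measurable
qed

text \<open>D is constant in time and not integrable over all times, but X vanishes off the
  cylinder, so D may be multiplied by the indicator of (0, T).\<close>

lemma flux_pairing_integrable:
  fixes E :: "'a::euclidean_space set" and X :: "'a \<times> real \<Rightarrow> 'a"
  assumes p: "p > 1" and X: "X \<in> borel_measurable borel" "Lp_integrable (p / (p - 1)) X"
    and Xz: "\<And>z. z \<notin> E \<times> {0<..<T} \<Longrightarrow> X z = 0" and h: "W0 E p \<phi> D"
  shows "integrable lborel (\<lambda>z. X z \<bullet> D (fst z))"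
proof -
  have "(\<lambda>z. D (fst z)) \<in> borel_measurable (borel :: ('a \<times> real) measure)"
    by (rule measurable_compose[OF _ wgrad_D(2)[OF W0_D(1)[OF h]]]) (auto intro!: borel_measurable_continuous_onI continuous_intros)
  moreover have "snd \<in> borel_measurable (borel :: ('a \<times> real) measure)"
    by (auto intro!: borel_measurable_continuous_onI continuous_intros)
  ultimately have m: "(\<lambda>z. indicator {0<..<T} (snd z) *\<^sub>R D (fst z)) \<in> borel_measurable (lborel :: ('a \<times> real) measure)"
    by measurable
  have eq: "X z \<bullet> D (fst z) = X z \<bullet> (indicator {0<..<T} (snd z) *\<^sub>R D (fst z))" for z
    using Xz[of z] by (cases "snd z \<in> {0<..<T}") (auto simp: mem_Times_iff)
  have "integrable lborel (\<lambda>z. X z \<bullet> (indicator {0<..<T} (snd z) *\<^sub>R D (fst z)))"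
  proof (rule Young_integrable(1)[OF p _ X(2) m])
    have "integrable lborel (\<lambda>z. norm (D (fst z)) powr p * indicator {0<..<T} (snd z))"
      by (rule product_integrable[OF W0_D(3)[OF h] integrable_Ioo])
    moreover have "norm (indicator {0<..<T} (snd z) *\<^sub>R D (fst z)) powr p = norm (D (fst z)) powr p * indicator {0<..<T} (snd z)" for z
      by (auto simp: indicator_def)
    ultimately show "Lp_integrable p (\<lambda>z. indicator {0<..<T} (snd z) *\<^sub>R D (fst z))"
      by simp
  qed (use X in simp)
  then show ?thesis by (simp only: eq)
qed

lemma interval_average_tendsto:
  fixes m :: "real \<Rightarrow> real"
  assumes m: "continuous_on {0..T} m" and t: "0 \<le> t" "t < T"
    and h: "\<And>n. 0 < h n" "\<And>n. t + h n \<le> T" "h \<longlonglongrightarrow> 0"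
  shows "(\<lambda>n. (1 / h n) * (LINT s|lborel. indicator {t<..<t + h n} s * m s)) \<longlonglongrightarrow> m t"
proof (rule tendstoI)
  fix e :: real assume e: "e > 0"
  have "\<forall>e>0. \<exists>d>0. \<forall>s\<in>{0..T}. dist s t < d \<longrightarrow> dist (m s) (m t) < e"
    using m t unfolding continuous_on_iff by auto
  then obtain d where d: "d > 0" "\<And>s. s \<in> {0..T} \<Longrightarrow> dist s t < d \<Longrightarrow> dist (m s) (m t) < e / 2"
    using e by (metis half_gt_zero)
  have "\<forall>\<^sub>F n in sequentially. h n < d" using h(3) d(1) by (rule order_tendstoD(2))
  then show "\<forall>\<^sub>F n in sequentially. dist ((1 / h n) * (LINT s|lborel. indicator {t<..<t + h n} s * m s)) (m t) < e"
  proof eventually_elim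
    case (elim n)
    let ?I = "{t<..<t + h n}"
    have hn: "h n > 0" by (rule h(1))
    have i: "integrable lborel (\<lambda>s. indicator ?I s * m s)"
    proof -
      have "integrable lborel (\<lambda>s. indicator {t..t + h n} s *\<^sub>R m s)"
        using t h(2)[of n] by (intro borel_integrable_compact continuous_on_subset[OF m]) auto
      then have "integrable lborel (\<lambda>s. indicator ?I s *\<^sub>R (indicator {t..t + h n} s *\<^sub>R m s))"
        by (rule integrable_mult_indicator[rotated]) simp
      moreover have eq: "indicator ?I s *\<^sub>R (indicator {t..t + h n} s *\<^sub>R m s) = indicator ?I s * m s" for s
        by (auto simp: indicator_def)
      ultimately show ?thesis by (simp only: eq)
    qed
    have j: "integrable lborel (\<lambda>s. indicator ?I s * c)" for c :: real
      by (intro integrable_mult_left integrable_Ioo)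
    have c: "(LINT s|lborel. indicator ?I s * c) = h n * c" for c :: real using hn by simp
    have "(LINT s|lborel. indicator ?I s * m s) - h n * m t = (LINT s|lborel. indicator ?I s * m s - indicator ?I s * m t)"
      using i j[of "m t"] by (simp add: c del: integral_mult_left_zero)
    also have "\<bar>\<dots>\<bar> \<le> (LINT s|lborel. indicator ?I s * (e / 2))"
      unfolding real_norm_def[symmetric]
    proof (intro order_trans[OF integral_norm_bound] integral_mono)
      fix s
      show "norm (indicator ?I s * m s - indicator ?I s * m t) \<le> indicator ?I s * (e / 2)"
      proof (cases "s \<in> ?I")
        case True
        then have "dist (m s) (m t) < e / 2" using t h(2)[of n] elim by (intro d(2)) (auto simp: dist_real_def)
        then show ?thesis using True by (simp add: dist_real_def)
      qed simp
    qed (use i j in auto)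
    finally have "\<bar>(LINT s|lborel. indicator ?I s * m s) - h n * m t\<bar> \<le> h n * (e / 2)" by (simp only: c)
    moreover have "(1 / h n) * (LINT s|lborel. indicator ?I s * m s) - m t = ((LINT s|lborel. indicator ?I s * m s) - h n * m t) / h n"
      using hn by (simp add: field_simps)
    ultimately have "\<bar>(1 / h n) * (LINT s|lborel. indicator ?I s * m s) - m t\<bar> \<le> e / 2"
      using hn by (simp only: abs_divide abs_of_pos[OF hn]) (simp add: pos_divide_le_eq mult.commute)
    then show ?case using e unfolding dist_real_def by linarith
  qed
qed

text \<open>The test function is \<open>\<phi>\<close> times a ramp from 1 at t to 0 at t + h. As h
  -> 0 the time term is the average of a continuous function and the flux term is dominated; hence
  the identity holds at every t < T and not merely at almost every t.\<close>

lemma weak_identity_limit: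
  fixes E :: "'a::euclidean_space set"
  assumes E: "open E" "bounded E" and T: "T > 0" and p: "p > 1" and q: "q > 0"
    and u: "u \<in> C_L (q + 1) T E" and uo: "uo \<in> Lp_space (lebesgue_on E) (q + 1)"
    and id: "\<And>\<zeta> \<zeta>\<^sub>t D\<zeta>. \<zeta> \<in> parabolic_tests E T p q \<Longrightarrow> \<zeta>\<^sub>t \<in> L_L (q + 1) T E \<Longrightarrow>
       has_weak_time_derivative T E \<zeta> \<zeta>\<^sub>t \<Longrightarrow> has_spatial_gradient T E \<zeta> D\<zeta> \<Longrightarrow>
       (LINT (x, t)|lebesgue_on (E \<times> {0<..T}). (signed_power q (uo x) - signed_power q (u (x, t))) * \<zeta>\<^sub>t (x, t)
          + A x (u (x, t)) (Du (x, t)) \<bullet> D\<zeta> (x, t)) = 0"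
    and X: "borel_rep (E \<times> {0<..<T}) (\<lambda>z. A (fst z) (u z) (Du z)) X"
      "Lp_integrable (p / (p - 1)) X"
    and h: "W0 E p \<phi> D" "\<And>x. \<bar>\<phi> x\<bar> \<le> 1" and t: "0 \<le> t" "t < T"
  shows "(LINT x|lebesgue_on E. (signed_power q (u (x, t)) - signed_power q (uo x)) * \<phi> x) =
    - (LINT z|lborel. indicator {0..t} (snd z) * (X z \<bullet> D (fst z)))"
proof -
  have p0: "p > 0" using p by simp
  have E': "E \<in> sets borel" using E by simp
  note wD = wgrad_D[OF W0_D(1)[OF h(1)]]
  have Xm: "X \<in> borel_measurable borel" and Xz: "\<And>z. z \<notin> E \<times> {0<..<T} \<Longrightarrow> X z = 0" using X(1) unfolding borel_rep_def by blast+
  note [measurable] = wD(1,2) Xm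
  have fb: "fst \<in> borel_measurable (borel :: ('a \<times> real) measure)" "snd \<in> borel_measurable (borel :: ('a \<times> real) measure)"
    by (auto intro!: borel_measurable_continuous_onI continuous_intros)
  note [measurable] = fb
  define Z where "Z z = signed_power q (u z) - signed_power q (uo (fst z))" for z
  have Zc: "L1_curve T E Z"
  proof -
    note c = C_L_signed_power[OF E q u]
    have uoi: "integrable (lebesgue_on E) (\<lambda>x. signed_power q (uo x))" by (rule integrable_signed_power[OF E q uo])
    have "(\<lambda>z. signed_power q (uo (fst z))) \<in> borel_measurable (lebesgue_on (E \<times> {0..T}))"
      using separable_measurable[OF borel_measurable_integrable[OF uoi] E(1), of "{0..T}" "\<lambda>_. 1"] by (simp add: case_prod_unfold)
    then show ?thesis using c uoi unfolding L1_curve_def Z_def[abs_def] by auto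
  qed
  have S0: "E \<times> {0..T} \<in> sets borel" "E \<times> {0<..T} \<in> sets borel" using E' by (auto intro: borel_Times)
  obtain Z' where Z': "borel_rep (E \<times> {0..T}) Z Z'" using borel_rep_exists[OF _ S0(1), of Z] Zc by (auto simp: L1_curve_def)
  have Zi: "integrable lborel Z'" by (rule L1_curve_integrable[OF E(1) Zc Z'])
  have Zm[measurable]: "Z' \<in> borel_measurable borel" using Z' by (simp add: borel_rep_def)
  define m where "m s = (LINT x|lebesgue_on E. Z (x, s) * \<phi> x)" for s
  have pm: "\<phi> \<in> borel_measurable (lebesgue_on E)"
    using wD(1) by (intro measurable_restrict_space1) (auto intro: measurable_completion)
  have Zpi: "integrable (lebesgue_on E) (\<lambda>x. Z (x, s) * \<phi> x)" if s: "s \<in> {0..T}" for s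
  proof (rule Bochner_Integration.integrable_bound)
    show i: "integrable (lebesgue_on E) (\<lambda>x. Z (x, s))" using Zc s by (simp add: L1_curve_def)
    show "(\<lambda>x. Z (x, s) * \<phi> x) \<in> borel_measurable (lebesgue_on E)" using borel_measurable_integrable[OF i] pm by measurable
    show "AE x in lebesgue_on E. norm (Z (x, s) * \<phi> x) \<le> norm (Z (x, s))"
      using h(2) by (intro AE_I2) (simp add: abs_mult mult_left_le)
  qed
  have mc: "continuous_on {0..T} m"
  proof (rule L1_curve_integral_continuous[OF Zc])
    fix s r assume s: "s \<in> {0..T}" and r: "r \<in> {0..T}"
    have i: "integrable (lebesgue_on E) (\<lambda>x. Z (x, s))" "integrable (lebesgue_on E) (\<lambda>x. Z (x, r))" using Zc s r by (simp_all add: L1_curve_def)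
    have "\<bar>m s - m r\<bar> = \<bar>\<integral>x. Z (x, s) * \<phi> x - Z (x, r) * \<phi> x \<partial>lebesgue_on E\<bar>"
      unfolding m_def using Zpi[OF s] Zpi[OF r] by simp
    also have "\<dots> \<le> (LINT x|lebesgue_on E. \<bar>Z (x, s) - Z (x, r)\<bar>)"
      unfolding real_norm_def[symmetric]
    proof (intro order_trans[OF integral_norm_bound] integral_mono)
      show "norm (Z (x, s) * \<phi> x - Z (x, r) * \<phi> x) \<le> norm (Z (x, s) - Z (x, r))" for x
        using h(2)[of x] by (simp add: left_diff_distrib[symmetric] abs_mult mult_left_le)
    qed (use Zpi[OF s] Zpi[OF r] i in auto)
    finally show "\<bar>m s - m r\<bar> \<le> 1 * (LINT x|lebesgue_on E. \<bar>Z (x, s) - Z (x, r)\<bar>)" by simp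
  qed
  \<comment> \<open>With h <= T - t the ramp vanishes at T, as the test space demands.\<close>
  define h where "h n = (T - t) / Suc n" for n
  have hp: "h n > 0" and hT: "t + h n \<le> T" for n
  proof -
    show "h n > 0" using t by (simp add: h_def)
    have "(T - t) / Suc n \<le> (T - t) / 1" using t by (intro divide_left_mono) auto
    then show "t + h n \<le> T" by (simp add: h_def)
  qed
  have hl: "h \<longlonglongrightarrow> 0"
    using tendsto_mult_right_zero[OF LIMSEQ_inverse_real_of_nat, of "T - t"] by (simp add: h_def[abs_def] divide_inverse)
  define G2 where "G2 n z = ramp t (h n) (snd z) * (X z \<bullet> D (fst z))" for n z
  have XD: "integrable lborel (\<lambda>z. X z \<bullet> D (fst z))"
    by (rule flux_pairing_integrable[OF p Xm X(2) _ \<open>W0 E p \<phi> D\<close>]) (rule Xz)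
  have rm[measurable]: "ramp t (h n) \<in> borel_measurable borel" for n
    by (rule borel_measurable_continuous_onI[OF ramp_props(1)[OF hp]])
  note [measurable] = ramp_props(5)[OF hp]
  have G2b: "\<bar>G2 n z\<bar> \<le> \<bar>X z \<bullet> D (fst z)\<bar>" for n z
    using mult_right_mono[OF ramp_props(2)[OF hp, of t n "snd z"], of "\<bar>X z \<bullet> D (fst z)\<bar>"] by (simp add: G2_def abs_mult)
  have G2m[measurable]: "G2 n \<in> borel_measurable borel" for n unfolding G2_def[abs_def] by measurable
  have G2i: "integrable lborel (G2 n)" for n
    by (rule Bochner_Integration.integrable_bound[OF XD]) (use G2b in auto)
  \<comment> \<open>Two signs cancel: the identity contains the negative of \<open>Z\<close>, and
    the ramp has a negative derivative. So the integral of \<open>G1\<close> is a plain average over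
    (t, t + h).\<close>
  define G1 where "G1 n z = - (ramp' t (h n) (snd z) * (Z' z * \<phi> (fst z)))" for n z
  have G1m[measurable]: "G1 n \<in> borel_measurable borel" for n unfolding G1_def[abs_def] by measurable
  have G1i: "integrable lborel (G1 n)" for n
  proof (rule Bochner_Integration.integrable_bound[OF integrable_mult_right[OF Zi, of "1 / h n"]])
    show "AE z in lborel. norm (G1 n z) \<le> norm (1 / h n * Z' z)"
    proof (rule AE_I2)
      fix z
      have "\<bar>ramp' t (h n) (snd z)\<bar> * (\<bar>Z' z\<bar> * \<bar>\<phi> (fst z)\<bar>) \<le> 1 / h n * (\<bar>Z' z\<bar> * 1)"
        using ramp_props(6)[OF hp] \<open>\<And>x. \<bar>\<phi> x\<bar> \<le> 1\<close> hp[of n] by (intro mult_mono) auto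
      then show "norm (G1 n z) \<le> norm (1 / h n * Z' z)" using hp[of n] by (simp add: G1_def abs_mult)
    qed
  qed simp
  have eq: "(LINT z|lborel. G1 n z) + (LINT z|lborel. G2 n z) = 0" for n
  proof -
    note tp = parabolic_test_separable[OF E T p0 q \<open>W0 E p \<phi> D\<close> \<open>\<And>x. \<bar>\<phi> x\<bar> \<le> 1\<close> ramp_props(1)[OF hp[of n], of t]
      ramp_props(2)[OF hp[of n], of t] ramp_zero[OF hp[of n] hT[of n]] ramp_props(5)[OF hp[of n], of t]
      ramp_props(6)[OF hp[of n], of t] ramp_weak_derivative[OF hp[of n] T, of _ t]]
    let ?f = "\<lambda>z. (signed_power q (uo (fst z)) - signed_power q (u z)) * (ramp' t (h n) (snd z) * \<phi> (fst z))
          + A (fst z) (u z) (Du z) \<bullet> (ramp t (h n) (snd z) *\<^sub>R D (fst z))"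
    have 0: "(LINT z|lebesgue_on (E \<times> {0<..T}). ?f z) = 0"
      using id[OF tp] by (simp add: case_prod_unfold)
    have r: "borel_rep (E \<times> {0<..T}) ?f (\<lambda>z. G1 n z + G2 n z)"
      unfolding borel_rep_def
    proof (intro conjI allI impI)
      show "(\<lambda>z. G1 n z + G2 n z) \<in> borel_measurable borel" by measurable
      fix z assume z: "z \<notin> E \<times> {0<..T}"
      show "G1 n z + G2 n z = 0"
      proof (cases "fst z \<in> E")
        case True
        then have s: "snd z \<notin> {0<..T}" using z by (simp add: mem_Times_iff)
        then have "snd z \<notin> {t<..<t + h n}" using t hT[of n] by auto
        moreover have "X z = 0" using s by (intro Xz) (auto simp: mem_Times_iff)
        ultimately show ?thesis by (simp add: G1_def G2_def ramp'_def)
      next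
        case False then show ?thesis using wD(3,4) by (simp add: G1_def G2_def)
      qed
    next
      have a1: "AE z in lborel. z \<in> E \<times> {0..T} \<longrightarrow> Z z = Z' z" using Z' by (simp add: borel_rep_def)
      have a2: "AE z in lborel. z \<in> E \<times> {0<..T} \<longrightarrow> A (fst z) (u z) (Du z) = X z"
        using borel_rep_add_null[OF X(1)] by (simp add: borel_rep_def)
      from a1 a2 show "AE z in lborel. z \<in> E \<times> {0<..T} \<longrightarrow> ?f z = G1 n z + G2 n z"
      proof eventually_elim
        case (elim z)
        show ?case
        proof
          assume z: "z \<in> E \<times> {0<..T}"
          then have "z \<in> E \<times> {0..T}" by (auto simp: mem_Times_iff)
          with elim z have "Z z = Z' z" "A (fst z) (u z) (Du z) = X z" by auto
          then show "?f z = G1 n z + G2 n z" by (simp add: G1_def G2_def Z_def algebra_simps)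
        qed
      qed
    qed
    show ?thesis using borel_rep_integral[OF r S0(2)] 0 G1i G2i by simp
  qed
  have G1e: "(LINT z|lborel. G1 n z) = (1 / h n) * (LINT s|lborel. indicator {t<..<t + h n} s * m s)" for n
  proof -
    have "(LINT z|lborel. G1 n z) = (LINT s|lborel. (LINT x|lborel. G1 n (x, s)))"
      using lborel_Fubini(1)[OF G1i] by simp
    also have "\<dots> = (LINT s|lborel. (1 / h n) * (indicator {t<..<t + h n} s * m s))"
    proof (rule integral_cong_AE)
      show "(\<lambda>s. LINT x|lborel. G1 n (x, s)) \<in> borel_measurable lborel" by (rule borel_measurable_integrable[OF lborel_Fubini(3)[OF G1i]])
      have "(\<lambda>s. indicator {0..T} s *\<^sub>R m s) \<in> borel_measurable borel"
        by (rule borel_measurable_continuous_on_indicator[OF _ mc]) simp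
      then have "(\<lambda>s. (1 / h n) * (indicator {t<..<t + h n} s * (indicator {0..T} s *\<^sub>R m s))) \<in> borel_measurable lborel" by measurable
      moreover have eq: "(1 / h n) * (indicator {t<..<t + h n} s * (indicator {0..T} s *\<^sub>R m s)) = (1 / h n) * (indicator {t<..<t + h n} s * m s)" for s
        using t hT[of n] by (auto simp: indicator_def)
      ultimately show "(\<lambda>s. (1 / h n) * (indicator {t<..<t + h n} s * m s)) \<in> borel_measurable lborel" by (simp only: eq)
      show "AE s in lborel. (LINT x|lborel. G1 n (x, s)) = (1 / h n) * (indicator {t<..<t + h n} s * m s)"
        using borel_rep_slices[OF Z']
      proof eventually_elim
        case (elim s)
        show ?case
        proof (cases "s \<in> {t<..<t + h n}")
          case True
          then have sT: "s \<in> {0..T}" using t hT[of n] by auto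
          with elim have rs: "borel_rep E (\<lambda>x. Z (x, s)) (\<lambda>x. Z' (x, s))" by simp
          have "borel_rep E (\<lambda>x. Z (x, s) * \<phi> x) (\<lambda>x. Z' (x, s) * \<phi> x)"
            using rs wD(1) unfolding borel_rep_def by auto
          from borel_rep_integral[OF this E']
          have "(LINT x|lborel. Z' (x, s) * \<phi> x) = m s" by (simp add: m_def)
          then show ?thesis using True by (simp add: G1_def ramp'_def)
        qed (simp add: G1_def ramp'_def)
      qed
    qed
    finally show ?thesis by simp
  qed
  have L1: "(\<lambda>n. LINT z|lborel. G1 n z) \<longlonglongrightarrow> m t"
    unfolding G1e by (rule interval_average_tendsto[OF mc t hp hT hl])
  have L2: "(\<lambda>n. LINT z|lborel. G2 n z) \<longlonglongrightarrow> (LINT z|lborel. indicator {0..t} (snd z) * (X z \<bullet> D (fst z)))"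
  proof (rule integral_dominated_convergence[where w="\<lambda>z. \<bar>X z \<bullet> D (fst z)\<bar>"])
    show "integrable lborel (\<lambda>z. \<bar>X z \<bullet> D (fst z)\<bar>)" using XD by simp
    show "AE z in lborel. (\<lambda>n. G2 n z) \<longlonglongrightarrow> indicator {0..t} (snd z) * (X z \<bullet> D (fst z))"
    proof (rule AE_I2)
      fix z
      show "(\<lambda>n. G2 n z) \<longlonglongrightarrow> indicator {0..t} (snd z) * (X z \<bullet> D (fst z))"
      proof (cases "snd z \<le> t")
        case True
        have eq: "indicator {0..t} (snd z) * (X z \<bullet> D (fst z)) = X z \<bullet> D (fst z)"
        proof (cases "snd z \<ge> 0")
          case False
          then have "X z = 0" by (intro Xz) (auto simp: mem_Times_iff)
          then show ?thesis by simp
        qed (use True in simp)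
        have "G2 n z = X z \<bullet> D (fst z)" for n using ramp_props(4)[OF hp True] by (simp add: G2_def)
        then show ?thesis unfolding eq by simp
      next
        case False
        then have "\<forall>\<^sub>F n in sequentially. h n < snd z - t" using hl by (intro order_tendstoD(2)) auto
        then have "\<forall>\<^sub>F n in sequentially. G2 n z = 0"
          by eventually_elim (auto simp: G2_def intro: ramp_zero[OF hp])
        then show ?thesis using False by (intro tendsto_eventually) simp
      qed
    qed
  qed (use G2b in auto)
  have "(\<lambda>n. (LINT z|lborel. G1 n z) + (LINT z|lborel. G2 n z)) \<longlonglongrightarrow> m t + (LINT z|lborel. indicator {0..t} (snd z) * (X z \<bullet> D (fst z)))"
    by (rule tendsto_add[OF L1 L2])
  then have "m t + (LINT z|lborel. indicator {0..t} (snd z) * (X z \<bullet> D (fst z))) = 0"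
    unfolding eq by (rule LIMSEQ_unique[OF _ tendsto_const])
  then show ?thesis by (simp add: m_def Z_def)
qed

section \<open>Integrability of gradients and fluxes over the space-time cylinder\<close>

lemma has_weak_gradient_rep_cong:
  assumes E: "open E" and h: "has_weak_gradient E u G" and G: "borel_rep E G G'"
  shows "has_weak_gradient E u G'"
proof -
  obtain u1 G1 where 1: "wgrad E u1 G1" "borel_rep E u u1" "borel_rep E G G1"
    using has_weak_gradient_rep[OF E h] by blast
  have "borel_rep E G' G'" by (rule borel_rep_self) (use G in \<open>auto simp: borel_rep_def\<close>)
  then show ?thesis by (rule has_weak_gradient_of_rep[OF E has_weak_gradient_wgrad[OF E h 1(2) G] 1(2)])
qed

text \<open>Tonelli turns integrability in time of the p-th power of the Sobolev norm into joint
  integrability of |D|^p; the part of the norm with u itself is discarded.\<close>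

lemma L_W_gradient_integrable:
  fixes E :: "'a::euclidean_space set" and T :: real
  assumes E: "open E" and p: "p > 0" and W: "u \<in> L_W p T E"
    and D[measurable]: "D \<in> borel_measurable borel" and Dz: "\<And>z. z \<notin> E \<times> {0<..<T} \<Longrightarrow> D z = 0"
    and g: "AE t in lborel. t \<in> {0<..<T} \<longrightarrow> has_weak_gradient E (\<lambda>x. u (x, t)) (\<lambda>x. D (x, t))"
  shows "Lp_integrable p D"
proof (rule integrableI_bounded)
  have E': "E \<in> sets borel" using E by simp
  let ?I = "{0<..<T}"
  have I: "?I \<in> sets borel" by simp
  let ?N = "\<lambda>t. W1p_norm E p (\<lambda>x. u (x, t)) powr p"
  have iN: "integrable (lebesgue_on ?I) ?N" using W by (simp add: L_W_def bochner_Lp_def)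
  obtain n where n: "borel_rep ?I ?N n" using borel_rep_exists[OF borel_measurable_integrable[OF iN] I] .
  have inn: "integrable lborel n" using borel_rep_integrable[OF n I] iN by simp
  have ur: "u \<in> borel_measurable (lebesgue_on (E \<times> ?I))" using W by (simp add: L_W_def bochner_Lp_def)
  obtain u' where u': "borel_rep (E \<times> ?I) u u'" using borel_rep_exists[OF ur borel_Times[OF E' I]] .
  have uW: "AE t in lborel. t \<in> ?I \<longrightarrow> (\<lambda>x. u (x, t)) \<in> W1p E p"
    using W AE_lebesgue_on_iff[OF I] by (simp add: L_W_def bochner_Lp_def)
  have ae: "AE t in lborel. (\<integral>\<^sup>+x. ennreal (norm (D (x, t)) powr p) \<partial>lborel) \<le> ennreal (norm (n t))"
  proof -
    have n': "AE t in lborel. t \<in> ?I \<longrightarrow> ?N t = n t" using n by (simp add: borel_rep_def)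
    from uW borel_rep_slices[OF u'] g n' show ?thesis
    proof eventually_elim
      case (elim t)
      show ?case
      proof (cases "t \<in> ?I")
        case True
        with elim have e: "(\<lambda>x. u (x, t)) \<in> W1p E p" "borel_rep E (\<lambda>x. u (x, t)) (\<lambda>x. u' (x, t))"
          "has_weak_gradient E (\<lambda>x. u (x, t)) (\<lambda>x. D (x, t))" "?N t = n t" by auto
        have rD: "borel_rep E (\<lambda>x. D (x, t)) (\<lambda>x. D (x, t))"
          by (rule borel_rep_self[OF borel_slice[OF D]]) (use Dz in auto)
        note w = W1p_rep[OF E e(1,3,2) rD]
        have "?N t = (Lp_integral p (\<lambda>x. u' (x, t))) + (Lp_integral p (\<lambda>x. D (x, t)))"
          unfolding W1p_norm_eq[OF E p e(3,2) rD] using p by (simp add: powr_powr)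
        then have "(Lp_integral p (\<lambda>x. D (x, t))) \<le> n t" using e(4) by simp
        moreover have "(\<integral>\<^sup>+x. ennreal (norm (D (x, t)) powr p) \<partial>lborel) = ennreal (Lp_integral p (\<lambda>x. D (x, t)))"
          using w(3) by (intro nn_integral_eq_integral) auto
        ultimately show ?thesis by (auto intro!: ennreal_leI)
      next
        case False
        then have "D (x, t) = 0" for x by (intro Dz) auto
        then show ?thesis using p by simp
      qed
    qed
  qed
  have "(\<integral>\<^sup>+z. ennreal (norm (norm (D z) powr p)) \<partial>lborel) = (\<integral>\<^sup>+t. (\<integral>\<^sup>+x. ennreal (norm (D (x, t)) powr p) \<partial>lborel) \<partial>lborel)"
    using lborel_Tonelli[of "\<lambda>z. ennreal (norm (D z) powr p)"] by simp
  also have "\<dots> \<le> (\<integral>\<^sup>+t. ennreal (norm (n t)) \<partial>lborel)" by (rule nn_integral_mono_AE[OF ae])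
  also have "\<dots> < \<infinity>" using inn by (simp add: integrable_iff_bounded)
  finally show "(\<integral>\<^sup>+z. ennreal (norm (norm (D z) powr p)) \<partial>lborel) < \<infinity>" .
qed measurable

text \<open>The conjugate exponent p/(p-1) turns |D|^(p-1) into |D|^p, and the constant 1 is
  integrable on a bounded set. S is general because the lemma is applied to the cylinder and again
  to the domain with two times.\<close>

lemma flux_integrable:
  fixes S :: "'c::euclidean_space set" and X :: "'c \<Rightarrow> 'b::euclidean_space" and D :: "'c \<Rightarrow> 'd::euclidean_space"
  assumes S: "bounded S" "S \<in> sets borel" and p: "p > 1" and C: "C > 0"
    and m: "X \<in> borel_measurable borel" "D \<in> borel_measurable borel"
    and z: "\<And>z. z \<notin> S \<Longrightarrow> X z = 0"
    and D: "Lp_integrable p D"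
    and b: "AE z in lborel. z \<in> S \<longrightarrow> norm (X z) \<le> C * (1 + norm (D z) powr (p - 1))"
  shows "Lp_integrable (p / (p - 1)) X"
proof -
  note [measurable] = m S(2)
  let ?r = "p / (p - 1)"
  have r: "?r > 0" using p by simp
  show ?thesis
  proof (rule Bochner_Integration.integrable_bound)
    show "integrable lborel (\<lambda>z. C powr ?r * (2 powr ?r * (indicator S z + norm (D z) powr p)))"
      using emeasure_bounded_finite[OF S(1)] S(2) D
      by (intro integrable_mult_right Bochner_Integration.integrable_add integrable_real_indicator) auto
    show "AE z in lborel. norm (norm (X z) powr ?r) \<le> norm (C powr ?r * (2 powr ?r * (indicator S z + norm (D z) powr p)))"
      using b
    proof eventually_elim
      case (elim z)
      show ?case
      proof (cases "z \<in> S")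
        case True
        have "norm (X z) powr ?r \<le> (C * (1 + norm (D z) powr (p - 1))) powr ?r"
          using elim True r by (intro powr_mono2) auto
        also have "\<dots> = C powr ?r * (1 + norm (D z) powr (p - 1)) powr ?r" using C by (simp add: powr_mult)
        also have "\<dots> \<le> C powr ?r * (2 powr ?r * (1 powr ?r + (norm (D z) powr (p - 1)) powr ?r))"
          using r by (intro mult_left_mono powr_add_le) auto
        also have "(norm (D z) powr (p - 1)) powr ?r = norm (D z) powr p" using p by (simp add: powr_powr)
        finally show ?thesis using True by simp
      next
        case False then show ?thesis using z[of z] r by simp
      qed
    qed
  qed measurable
qed

text \<open>Collects what is used of a weak solution afterwards: a Borel gradient, a Borel flux,
  their integrability, and an identity at fixed times in which only test functions of space
  remain.\<close>

lemma solution_data: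
  fixes E :: "'a::euclidean_space set"
  assumes E: "open E" "bounded E" and T: "T > 0" and p: "p > 1" and q: "q > 0" and C: "C > 0"
    and A: "caratheodory E A"
    and growth: "AE x in lebesgue_on E. \<forall>u \<xi>. norm (A x u \<xi>) \<le> C * (1 + norm \<xi> powr (p - 1))"
    and u: "u \<in> C_L (q + 1) T E" "u \<in> L_W p T E" and uo: "uo \<in> Lp_space (lebesgue_on E) (q + 1)"
    and wi: "weak_identity E T p q A uo u"
  obtains D X where "D \<in> borel_measurable borel" "X \<in> borel_measurable borel"
    "\<And>z. z \<notin> E \<times> {0<..<T} \<Longrightarrow> D z = 0" "\<And>z. z \<notin> E \<times> {0<..<T} \<Longrightarrow> X z = 0"
    "Lp_integrable p D" "Lp_integrable (p / (p - 1)) X"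
    "AE t in lborel. t \<in> {0<..<T} \<longrightarrow> has_weak_gradient E (\<lambda>x. u (x, t)) (\<lambda>x. D (x, t))"
    "AE z in lborel. z \<in> E \<times> {0<..<T} \<longrightarrow> X z = A (fst z) (u z) (D z)"
    "\<And>\<phi> G t. W0 E p \<phi> G \<Longrightarrow> (\<And>x. \<bar>\<phi> x\<bar> \<le> 1) \<Longrightarrow> 0 \<le> t \<Longrightarrow> t < T \<Longrightarrow>
      (LINT x|lebesgue_on E. (signed_power q (u (x, t)) - signed_power q (uo x)) * \<phi> x) =
      - (LINT z|lborel. indicator {0..t} (snd z) * (X z \<bullet> G (fst z)))"
proof -
  let ?S = "E \<times> {0<..<T}"
  have E': "E \<in> sets borel" using E by simp
  have S: "?S \<in> sets borel" "bounded ?S" using E' E(2) by (auto intro: borel_Times bounded_Times)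
  obtain Du where sg: "has_spatial_gradient T E u Du"
    and id: "\<And>\<zeta> \<zeta>\<^sub>t D\<zeta>. \<zeta> \<in> parabolic_tests E T p q \<Longrightarrow> \<zeta>\<^sub>t \<in> L_L (q + 1) T E \<Longrightarrow>
       has_weak_time_derivative T E \<zeta> \<zeta>\<^sub>t \<Longrightarrow> has_spatial_gradient T E \<zeta> D\<zeta> \<Longrightarrow>
       (LINT (x, t)|lebesgue_on (E \<times> {0<..T}). (signed_power q (uo x) - signed_power q (u (x, t))) * \<zeta>\<^sub>t (x, t)
          + A x (u (x, t)) (Du (x, t)) \<bullet> D\<zeta> (x, t)) = 0"
    using wi unfolding weak_identity_def by blast
  have Dum: "Du \<in> borel_measurable (lebesgue_on ?S)" using sg by (simp add: has_spatial_gradient_def)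
  have um: "u \<in> borel_measurable (lebesgue_on ?S)" using u(2) by (simp add: L_W_def bochner_Lp_def)
  obtain D where D: "borel_rep ?S Du D" using borel_rep_exists[OF Dum S(1)] .
  have "(\<lambda>z. A (fst z) (u z) (Du z)) \<in> borel_measurable (lebesgue_on ?S)"
    by (rule caratheodory_measurable[OF E(1) _ A um Dum]) simp
  then obtain X where X: "borel_rep ?S (\<lambda>z. A (fst z) (u z) (Du z)) X" using borel_rep_exists[OF _ S(1)] by blast
  have m: "D \<in> borel_measurable borel" "X \<in> borel_measurable borel" using D X by (auto simp: borel_rep_def)
  have z: "\<And>z. z \<notin> ?S \<Longrightarrow> D z = 0" "\<And>z. z \<notin> ?S \<Longrightarrow> X z = 0" using D X unfolding borel_rep_def by blast+
  have sg': "AE t in lborel. t \<in> {0<..<T} \<longrightarrow> has_weak_gradient E (\<lambda>x. u (x, t)) (\<lambda>x. Du (x, t))"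
    using sg AE_lebesgue_on_iff[of "{0<..<T}"] by (simp add: has_spatial_gradient_def)
  have g: "AE t in lborel. t \<in> {0<..<T} \<longrightarrow> has_weak_gradient E (\<lambda>x. u (x, t)) (\<lambda>x. D (x, t))"
    using sg' borel_rep_slices[OF D] by eventually_elim (auto intro: has_weak_gradient_rep_cong[OF E(1)])
  have Di: "Lp_integrable p D"
    by (rule L_W_gradient_integrable[OF E(1) _ u(2) m(1) z(1) g]) (use p in simp)
  have XA: "AE z in lborel. z \<in> ?S \<longrightarrow> X z = A (fst z) (u z) (D z)"
  proof -
    have "AE z in lborel. z \<in> ?S \<longrightarrow> Du z = D z" "AE z in lborel. z \<in> ?S \<longrightarrow> A (fst z) (u z) (Du z) = X z"
      using D X by (auto simp: borel_rep_def)
    then show ?thesis by eventually_elim auto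
  qed
  have "AE x in lborel. x \<in> E \<longrightarrow> (\<forall>u \<xi>. norm (A x u \<xi>) \<le> C * (1 + norm \<xi> powr (p - 1)))"
    using growth AE_lebesgue_on_iff[OF E'] by simp
  from lborel_AE_fst[OF this] XA
  have b: "AE z in lborel. z \<in> ?S \<longrightarrow> norm (X z) \<le> C * (1 + norm (D z) powr (p - 1))"
    by eventually_elim (auto simp: mem_Times_iff)
  have Xi: "Lp_integrable (p / (p - 1)) X"
    by (rule flux_integrable[OF S(2,1) p C m(2,1) _ Di b]) (rule z(2))
  show ?thesis
  proof (rule that[OF m _ _ Di Xi g XA])
    show "D z = 0" "X z = 0" if "z \<notin> ?S" for z using z[OF that] by auto
    fix \<phi> G t assume h: "W0 E p \<phi> G" "\<And>x. \<bar>\<phi> x\<bar> \<le> 1" and t: "0 \<le> t" "t < T"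
    show "(LINT x|lebesgue_on E. (signed_power q (u (x, t)) - signed_power q (uo x)) * \<phi> x) =
      - (LINT z|lborel. indicator {0..t} (snd z) * (X z \<bullet> G (fst z)))"
      by (rule weak_identity_limit[where A=A and Du=Du, OF E T p q u(1) uo _ X Xi h(1) _ t])
        (rule id, assumption+, rule h(2))
  qed
qed

subsection \<open>A smooth approximation of the Heaviside function\<close>

text \<open>The square makes the function C^1 across r = 0, which is all that the chain rule asks
  for; the rational form yields the bound of |r| H'(r) that is uniform in d.\<close>

definition heavi :: "real \<Rightarrow> real \<Rightarrow> real" where
  "heavi d r = (max 0 r)\<^sup>2 / (d + (max 0 r)\<^sup>2)"

definition heavi' :: "real \<Rightarrow> real \<Rightarrow> real" where
  "heavi' d r = 2 * d * max 0 r / (d + (max 0 r)\<^sup>2)\<^sup>2"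

lemma heavi_neg: "r \<le> 0 \<Longrightarrow> heavi d r = 0" "r \<le> 0 \<Longrightarrow> heavi' d r = 0"
  by (simp_all add: heavi_def heavi'_def max_def)

text \<open>With m = max 0 r, the last bound is 4 d m^2 <= (d + m^2)^2, the inequality of the
  arithmetic and geometric means, and is independent of d. The bound 1 + 1/d is crude and serves
  only for fixed d.\<close>

lemma heavi_bounds:
  assumes d: "d > 0"
  shows "0 \<le> heavi d r" "heavi d r \<le> 1" "0 \<le> heavi' d r" "\<bar>heavi' d r\<bar> \<le> 1 + 1 / d" "\<bar>r\<bar> * heavi' d r \<le> 1 / 2"
proof -
  let ?m = "max 0 r"
  have m: "?m \<ge> 0" by simp
  have s: "d + ?m\<^sup>2 > 0" using d by (simp add: add_pos_nonneg)
  show "0 \<le> heavi d r" "heavi d r \<le> 1" using s d by (simp_all add: heavi_def divide_le_eq)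
  show h0: "0 \<le> heavi' d r" using d by (simp add: heavi'_def)
  have "2 * d * ?m \<le> (1 + 1 / d) * (d + ?m\<^sup>2)\<^sup>2"
  proof -
    have "2 * ?m \<le> 1 + ?m\<^sup>2" using sum_squares_bound[of 1 ?m] by simp
    also have "\<dots> \<le> (1 + 1 / d) * (d + ?m\<^sup>2)" using d by (simp add: algebra_simps add_increasing2)
    finally have "d * (2 * ?m) \<le> (d + ?m\<^sup>2) * ((1 + 1 / d) * (d + ?m\<^sup>2))"
      by (rule mult_mono[rotated]) (use d in auto)
    then show ?thesis by (simp add: power2_eq_square mult_ac)
  qed
  then have "heavi' d r \<le> 1 + 1 / d" using s unfolding heavi'_def by (subst pos_divide_le_eq) auto
  then show "\<bar>heavi' d r\<bar> \<le> 1 + 1 / d" using h0 by simp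
  have "4 * d * ?m\<^sup>2 \<le> (d + ?m\<^sup>2)\<^sup>2" using sum_squares_bound[of d "?m\<^sup>2"] by (simp add: power2_sum)
  then have "2 * d * ?m * ?m \<le> (1 / 2) * (d + ?m\<^sup>2)\<^sup>2" by (simp add: power2_eq_square)
  then have "?m * heavi' d r \<le> 1 / 2" using s unfolding heavi'_def by (simp add: pos_divide_le_eq mult_ac)
  moreover have eq: "\<bar>r\<bar> * heavi' d r = ?m * heavi' d r" by (cases "r \<le> 0") (simp_all add: heavi_neg)
  ultimately show "\<bar>r\<bar> * heavi' d r \<le> 1 / 2" by (simp only: eq)
qed

lemma max_square_deriv: "((\<lambda>r::real. (max 0 r)\<^sup>2) has_real_derivative 2 * max 0 r) (at r)"
proof (cases r "0::real" rule: linorder_cases)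
  case less
  have "((\<lambda>_. 0) has_real_derivative 2 * max 0 r) (at r)" using less by (simp add: max_def)
  then show ?thesis
    by (rule has_field_derivative_transform_within_open[where S="{..<0}"]) (use less in auto)
next
  case equal
  have "((\<lambda>h::real. (max 0 h)\<^sup>2 / h) \<longlongrightarrow> 0) (at 0)"
  proof (rule Lim_null_comparison)
    have "(max 0 h)\<^sup>2 \<le> \<bar>h\<bar> * \<bar>h\<bar>" for h :: real by (auto simp: max_def power2_eq_square)
    then have "norm ((max 0 h)\<^sup>2 / h) \<le> \<bar>h\<bar>" for h :: real
      by (cases "h = 0") (auto simp: abs_divide pos_divide_le_eq)
    then show "\<forall>\<^sub>F h in at 0. norm ((max 0 h)\<^sup>2 / h) \<le> \<bar>h :: real\<bar>" by (intro always_eventually allI)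
    show "((\<lambda>h::real. \<bar>h\<bar>) \<longlongrightarrow> 0) (at 0)" by (intro tendsto_eq_intros) auto
  qed
  then show ?thesis using equal by (simp add: has_field_derivative_iff)
next
  case greater
  have "((\<lambda>r. r\<^sup>2) has_real_derivative 2 * max 0 r) (at r)"
    using greater by (auto intro!: derivative_eq_intros)
  then show ?thesis
    by (rule has_field_derivative_transform_within_open[where S="{0<..}"]) (use greater in auto)
qed

lemma heavi_deriv:
  assumes d: "d > 0"
  shows "(heavi d has_real_derivative heavi' d r) (at r)"
proof -
  have s: "d + (max 0 r)\<^sup>2 \<noteq> 0" using d by (smt (verit) zero_le_power2)
  have "((\<lambda>r. (max 0 r)\<^sup>2 / (d + (max 0 r)\<^sup>2)) has_real_derivative
    (2 * max 0 r * (d + (max 0 r)\<^sup>2) - (max 0 r)\<^sup>2 * (0 + 2 * max 0 r)) / ((d + (max 0 r)\<^sup>2) * (d + (max 0 r)\<^sup>2))) (at r)"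
    by (intro DERIV_divide DERIV_add DERIV_const max_square_deriv s)
  moreover have "(2 * max 0 r * (d + (max 0 r)\<^sup>2) - (max 0 r)\<^sup>2 * (0 + 2 * max 0 r)) / ((d + (max 0 r)\<^sup>2) * (d + (max 0 r)\<^sup>2)) = heavi' d r"
    by (simp add: heavi'_def power2_eq_square[of "d + (max 0 r)\<^sup>2"] algebra_simps)
  ultimately show ?thesis by (simp add: heavi_def[abs_def])
qed

lemma heavi'_continuous:
  assumes d: "d > 0" shows "continuous_on UNIV (heavi' d)"
  unfolding heavi'_def[abs_def]
proof (intro continuous_intros ballI)
  show "(d + (max 0 r)\<^sup>2)\<^sup>2 \<noteq> 0" for r using d by (smt (verit) zero_le_power2 zero_eq_power2)
qed

lemma heavi_continuous: "d > 0 \<Longrightarrow> continuous_on UNIV (heavi d)"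
  using heavi_deriv by (meson DERIV_isCont continuous_at_imp_continuous_on)

lemma heavi_mono:
  assumes d: "d > 0" and "r \<le> s" shows "heavi d r \<le> heavi d s"
  using DERIV_nonneg_imp_nondecreasing[OF assms(2), of "heavi d"] heavi_deriv[OF d] heavi_bounds(3)[OF d] by blast

lemma heavi_tendsto:
  "(\<lambda>n. heavi (1 / real (Suc n)) r) \<longlonglongrightarrow> (if r > 0 then 1 else 0)"
  "(\<lambda>n. r * heavi' (1 / real (Suc n)) r) \<longlonglongrightarrow> 0"
proof -
  have l: "(\<lambda>n. 1 / real (Suc n)) \<longlonglongrightarrow> 0" using LIMSEQ_inverse_real_of_nat by (simp add: inverse_eq_divide)
  have "(\<lambda>n. heavi (1 / real (Suc n)) r) \<longlonglongrightarrow> (if r > 0 then 1 else 0) \<and> (\<lambda>n. r * heavi' (1 / real (Suc n)) r) \<longlonglongrightarrow> 0"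
  proof (cases "r > 0")
    case True
    have "(\<lambda>n. r\<^sup>2 / (1 / real (Suc n) + r\<^sup>2)) \<longlonglongrightarrow> r\<^sup>2 / (0 + r\<^sup>2)"
      using True by (intro tendsto_intros l) auto
    moreover have "(\<lambda>n. r * (2 * (1 / real (Suc n)) * r / (1 / real (Suc n) + r\<^sup>2)\<^sup>2)) \<longlonglongrightarrow> r * (2 * 0 * r / (0 + r\<^sup>2)\<^sup>2)"
      using True by (intro tendsto_intros l) auto
    ultimately show ?thesis using True by (simp add: heavi_def heavi'_def max_def)
  qed (simp add: heavi_neg)
  then show "(\<lambda>n. heavi (1 / real (Suc n)) r) \<longlonglongrightarrow> (if r > 0 then 1 else 0)"
    "(\<lambda>n. r * heavi' (1 / real (Suc n)) r) \<longlonglongrightarrow> 0" by auto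
qed

text \<open>
  With $b(s) = |s|^{q-1}s$ and $z = b(v)$ this is $\int_{b(k)}^{z} H(b^{-1}(y) - k)\,dy$ if
  $z \ge b(k)$, and $0$ otherwise; it is convex in $z$ for nondecreasing $H$.
\<close>

definition excess :: "real \<Rightarrow> (real \<Rightarrow> real) \<Rightarrow> real \<Rightarrow> real \<Rightarrow> real" where
  "excess q H z k = (LINT y|lborel. indicator {signed_power q k..z} y * H (signed_power (1 / q) y - k))"

text \<open>Continuity, monotonicity and bounds of H are all that the energy inequality uses; the
  derivative of H enters only through the admissibility of the test functions.\<close>

locale cutoff_function =
  fixes H :: "real \<Rightarrow> real" and q :: real
  assumes q: "q > 0" and H_cont: "continuous_on UNIV H" and H_mono: "\<And>r s. r \<le> s \<Longrightarrow> H r \<le> H s"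
    and H_le: "\<And>r. H r \<le> 1" and H_neg: "\<And>r. r \<le> 0 \<Longrightarrow> H r = 0"
begin

abbreviation "b \<equiv> signed_power q"
abbreviation "\<beta> \<equiv> signed_power (1 / q)"

lemma H_ge: "H r \<ge> 0" using H_mono[of "min r 0" r] H_neg[of "min r 0"] by simp

lemma beta_mono: "x \<le> y \<Longrightarrow> \<beta> x \<le> \<beta> y"
  using signed_power_strict_mono[of "1 / q"] q by (simp add: strict_mono_less_eq)

lemma beta_b: "\<beta> (b s) = s" by (rule signed_power_inverse[OF q])

lemma measurable_H[measurable]: "H \<in> borel_measurable borel" "b \<in> borel_measurable borel" "\<beta> \<in> borel_measurable borel"
  using H_cont signed_power_continuous[OF q] signed_power_continuous[of "1 / q"] q by (auto intro: borel_measurable_continuous_onI)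

lemma excess_integrable: "integrable lborel (\<lambda>y. indicator {c..z} y * H (\<beta> y - k))"
proof (rule Bochner_Integration.integrable_bound[of lborel "indicator {c..z} :: real \<Rightarrow> real"])
  show "integrable lborel (indicator {c..z} :: real \<Rightarrow> real)" by (cases "c \<le> z") (auto intro!: integrable_real_indicator)
  show "AE y in lborel. norm (indicator {c..z} y * H (\<beta> y - k)) \<le> norm (indicator {c..z} y :: real)"
    using H_le H_ge by (intro AE_I2) (auto simp: indicator_def)
qed measurable

text \<open>The supporting line inequality of a convex function, with the slope at
  \<open>z2\<close>. If \<open>z2\<close> is the later value in time, it bounds the increment of the
  excess by the increment of z times the test function at the later time. Below b(k) the slope is 0
  by \<open>H_neg\<close>.\<close>

lemma excess_convex: "excess q H z2 k - excess q H z1 k \<le> (z2 - z1) * H (\<beta> z2 - k)"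
proof -
  let ?i = "\<lambda>z y. indicator {b k..z} y * H (\<beta> y - k)"
  have e: "excess q H z2 k - excess q H z1 k = (LINT y|lborel. ?i z2 y - ?i z1 y)"
    unfolding excess_def by (intro Bochner_Integration.integral_diff[symmetric] excess_integrable)
  have d: "integrable lborel (\<lambda>y. ?i z2 y - ?i z1 y)" by (intro Bochner_Integration.integrable_diff excess_integrable)
  show ?thesis
  proof (cases "z1 \<le> z2")
    case True
    have "(LINT y|lborel. ?i z2 y - ?i z1 y) \<le> (LINT y|lborel. indicator {z1..z2} y * H (\<beta> z2 - k))"
    proof (rule integral_mono[OF d])
      show "integrable lborel (\<lambda>y. indicator {z1..z2} y * H (\<beta> z2 - k))"
        using True by (intro integrable_mult_left integrable_real_indicator) auto
      show "?i z2 y - ?i z1 y \<le> indicator {z1..z2} y * H (\<beta> z2 - k)" for y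
        using True H_mono[of "\<beta> y - k" "\<beta> z2 - k"] beta_mono[of y z2] H_ge[of "\<beta> z2 - k"]
        by (auto simp: indicator_def)
    qed
    also have "\<dots> = (z2 - z1) * H (\<beta> z2 - k)" using True by simp
    finally show ?thesis using e by simp
  next
    case False
    have "(LINT y|lborel. indicator {z2<..z1} y * H (\<beta> z2 - k)) \<le> (LINT y|lborel. - (?i z2 y - ?i z1 y))"
    proof (rule integral_mono)
      show "integrable lborel (\<lambda>y. indicator {z2<..z1} y * H (\<beta> z2 - k))"
        using False by (intro integrable_mult_left integrable_real_indicator) auto
      show "integrable lborel (\<lambda>y. - (?i z2 y - ?i z1 y))" using d by (rule integrable_minus)
      fix y
      have "H (\<beta> z2 - k) = 0" if "z2 < b k"
        using beta_mono[of z2 "b k"] that by (intro H_neg) (simp add: beta_b)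
      then show "indicator {z2<..z1} y * H (\<beta> z2 - k) \<le> - (?i z2 y - ?i z1 y)"
        using False H_mono[of "\<beta> z2 - k" "\<beta> y - k"] beta_mono[of z2 y] H_ge[of "\<beta> y - k"]
        by (auto simp: indicator_def not_le)
    qed
    moreover have "(LINT y|lborel. indicator {z2<..z1} y * H (\<beta> z2 - k)) = (z1 - z2) * H (\<beta> z2 - k)" using False by simp
    moreover have "(LINT y|lborel. - (?i z2 y - ?i z1 y)) = - (excess q H z2 k - excess q H z1 k)"
      by (simp only: Bochner_Integration.integral_minus e)
    ultimately show ?thesis by (simp add: algebra_simps)
  qed
qed

text \<open>Supporting lines at both points, with slopes in [0, 1].\<close>

lemma excess_lipschitz: "\<bar>excess q H z2 k - excess q H z1 k\<bar> \<le> \<bar>z2 - z1\<bar>"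
proof -
  have a: "x * H r \<le> \<bar>x\<bar>" for x r using H_le[of r] H_ge[of r] by (smt (verit) mult_left_le mult_nonpos_nonneg)
  show ?thesis using excess_convex[of z2 k z1] excess_convex[of z1 k z2] a[of "z2 - z1" "\<beta> z2 - k"] a[of "z1 - z2" "\<beta> z1 - k"] by linarith
qed

lemma excess_at: "excess q H (b k) k = 0"
proof -
  have "indicator {b k..b k} y * H (\<beta> y - k) = 0" for y
    using H_neg[of 0] by (auto simp: indicator_def beta_b)
  then show ?thesis unfolding excess_def by (simp only: Bochner_Integration.integral_zero)
qed

lemma excess_bound: "\<bar>excess q H z k\<bar> \<le> \<bar>z\<bar> + \<bar>b k\<bar>"
  using excess_lipschitz[of z k "b k"] excess_at[of k] by linarith

lemma excess_measurable:
  assumes [measurable]: "f \<in> borel_measurable M" "g \<in> borel_measurable M"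
  shows "(\<lambda>x. excess q H (f x) (g x)) \<in> borel_measurable M"
proof -
  have "(\<lambda>(x, y). indicator {b (g x)..f x} y * H (\<beta> y - g x)) =
    (\<lambda>w. (if b (g (fst w)) \<le> snd w \<and> snd w \<le> f (fst w) then 1 else 0) * H (\<beta> (snd w) - g (fst w)))"
    by (auto simp: fun_eq_iff indicator_def)
  moreover have "(\<lambda>w. (if b (g (fst w)) \<le> snd w \<and> snd w \<le> f (fst w) then 1 else 0) * H (\<beta> (snd w) - g (fst w))) \<in> borel_measurable (M \<Otimes>\<^sub>M lborel)"
    by measurable
  ultimately have "(\<lambda>(x, y). indicator {b (g x)..f x} y * H (\<beta> y - g x)) \<in> borel_measurable (M \<Otimes>\<^sub>M lborel)" by simp
  from lborel.borel_measurable_lebesgue_integral[OF this] show ?thesis by (simp add: excess_def[abs_def])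
qed

end

lemma heavi_cutoff: "d > 0 \<Longrightarrow> q > 0 \<Longrightarrow> cutoff_function (heavi d) q"
  by unfold_locales (auto simp: heavi_continuous heavi_mono heavi_bounds heavi_neg)

lemma excess_heavi_tendsto:
  assumes q: "q > 0"
  shows "(\<lambda>n. excess q (heavi (1 / real (Suc n))) z k) \<longlonglongrightarrow> max 0 (z - signed_power q k)"
proof -
  let ?b = "signed_power q" and ?\<beta> = "signed_power (1 / q)"
  have d: "1 / real (Suc n) > 0" for n by simp
  have [measurable]: "heavi (1 / real (Suc n)) \<in> borel_measurable borel" "?\<beta> \<in> borel_measurable borel" for n
    using cutoff_function.measurable_H[OF heavi_cutoff[OF d q]] by auto
  have "(\<lambda>n. excess q (heavi (1 / real (Suc n))) z k) \<longlonglongrightarrow> (LINT y|lborel. indicator {?b k<..z} y)"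
    unfolding excess_def
  proof (rule integral_dominated_convergence[where w="indicator {?b k..z}"])
    show "integrable lborel (indicator {?b k..z} :: real \<Rightarrow> real)" by (cases "?b k \<le> z") (auto intro!: integrable_real_indicator)
    show "AE y in lborel. (\<lambda>n. indicator {?b k..z} y * heavi (1 / real (Suc n)) (?\<beta> y - k)) \<longlonglongrightarrow> indicator {?b k<..z} y"
    proof (rule AE_I2)
      fix y
      have "?\<beta> y - k > 0 \<longleftrightarrow> y > ?b k"
        using strict_mono_less[OF signed_power_strict_mono[of "1 / q"], of "?b k" y] signed_power_inverse[OF q, of k] q by simp
      then have "(\<lambda>n. heavi (1 / real (Suc n)) (?\<beta> y - k)) \<longlonglongrightarrow> (if y > ?b k then 1 else 0)"
        using heavi_tendsto(1)[of "?\<beta> y - k"] by simp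
      then have "(\<lambda>n. indicator {?b k..z} y * heavi (1 / real (Suc n)) (?\<beta> y - k)) \<longlonglongrightarrow> indicator {?b k..z} y * (if y > ?b k then 1 else 0)"
        by (intro tendsto_intros)
      moreover have "indicator {?b k..z} y * (if y > ?b k then 1 else 0) = (indicator {?b k<..z} y :: real)" by (auto simp: indicator_def)
      ultimately show "(\<lambda>n. indicator {?b k..z} y * heavi (1 / real (Suc n)) (?\<beta> y - k)) \<longlonglongrightarrow> indicator {?b k<..z} y" by (simp only:)
    qed
    show "AE y in lborel. norm (indicator {?b k..z} y * heavi (1 / real (Suc n)) (?\<beta> y - k)) \<le> indicator {?b k..z} y" for n
      using heavi_bounds(1,2)[OF d] by (intro AE_I2) (auto simp: indicator_def)
  qed measurable
  moreover have "(LINT y|lborel. indicator {?b k<..z} y) = max 0 (z - ?b k)"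
    by (cases "?b k \<le> z") (auto simp: max_def)
  ultimately show ?thesis by simp
qed

subsection \<open>The energy inequality\<close>

lemma lborel_Fubini_fst:
  fixes f :: "'a::euclidean_space \<times> 'b::euclidean_space \<Rightarrow> 'c::euclidean_space"
  assumes "integrable lborel f"
  shows "(LINT x|lborel. (LINT t|lborel. f (x, t))) = (LINT z|lborel. f z)"
    "AE x in lborel. integrable lborel (\<lambda>t. f (x, t))"
    "integrable lborel (\<lambda>x. LINT t|lborel. f (x, t))"
proof -
  have i: "integrable (lborel \<Otimes>\<^sub>M lborel) f" using assms by (simp add: lborel_prod)
  show "(LINT x|lborel. (LINT t|lborel. f (x, t))) = (LINT z|lborel. f z)"
    using lborel_pair.integral_fst'[OF i] by (simp add: lborel_prod)
  show "AE x in lborel. integrable lborel (\<lambda>t. f (x, t))" using lborel_pair.AE_integrable_fst'[OF i] .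
  show "integrable lborel (\<lambda>x. LINT t|lborel. f (x, t))" using lborel_pair.integrable_fst'[OF i] .
qed

text \<open>Young's inequality with a weight l: first l is chosen so that the contribution of Y is
  below e/2, then continuity of translations in the conjugate exponent makes the other term
  small.\<close>

lemma pairing_translation:
  fixes X Y :: "'c::euclidean_space \<Rightarrow> 'b::euclidean_space"
  assumes p: "p > 1" and X: "X \<in> borel_measurable borel" "Lp_integrable (p / (p - 1)) X"
    and Y: "Y \<in> borel_measurable borel" "Lp_integrable p Y" and e: "e > 0"
  obtains \<delta> where "\<delta> > 0" "\<And>v. norm v < \<delta> \<Longrightarrow> (LINT w|lborel. norm (X (w + v) - X w) * norm (Y w)) \<le> e"
proof -
  let ?r = "p / (p - 1)"
  have r: "?r > 0" using p by simp
  note [measurable] = X(1) Y(1)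
  define N where "N = (Lp_integral p Y)"
  have N: "N \<ge> 0" by (simp add: N_def)
  define l where "l = (e / (2 * (N + 1))) powr (1 / p)"
  have l: "l > 0" using e N by (simp add: l_def add_nonneg_pos)
  have lp: "l powr p = e / (2 * (N + 1))" using e N p by (simp add: l_def powr_powr)
  have lN: "l powr p * N \<le> e / 2"
  proof -
    have "N / (N + 1) \<le> 1" using N by (simp add: divide_le_eq)
    from mult_left_mono[OF this, of "e / 2"] show ?thesis using e by (simp add: lp)
  qed
  have e2: "e / 2 * l powr ?r > 0" using e l by simp
  obtain \<delta> where d: "\<delta> > 0" "\<And>v. norm v < \<delta> \<Longrightarrow> (Lp_integral ?r (\<lambda>w. X (w + v) - X w)) \<le> e / 2 * l powr ?r"
    using Lr_translation_continuous[OF X r e2] by blast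
  show ?thesis
  proof (rule that[OF d(1)])
    fix v :: 'c assume v: "norm v < \<delta>"
    have iX: "Lp_integrable ?r (\<lambda>w. X (w + v) - X w)"
      by (rule integrable_powr_diff[OF _ X(2) r])
        (use X(2) in \<open>auto simp: lborel_integrable_shift[of "\<lambda>w. norm (X w) powr ?r"]\<close>)
    have "(LINT w|lborel. norm (X (w + v) - X w) * norm (Y w)) \<le>
      (LINT w|lborel. l powr (- ?r) * norm (X (w + v) - X w) powr ?r + l powr p * norm (Y w) powr p)"
    proof (rule integral_mono)
      show "integrable lborel (\<lambda>w. norm (X (w + v) - X w) * norm (Y w))"
        by (rule Young_integrable(2)[OF p _ iX _ Y(2)]) measurable
      show "norm (X (w + v) - X w) * norm (Y w) \<le> l powr (- ?r) * norm (X (w + v) - X w) powr ?r + l powr p * norm (Y w) powr p" for w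
      proof -
        have "norm (X (w + v) - X w) * norm (Y w) = (norm (X (w + v) - X w) / l) * (l * norm (Y w))" using l by simp
        also have "\<dots> \<le> (norm (X (w + v) - X w) / l) powr ?r + (l * norm (Y w)) powr p"
          using l by (intro conjugate_Young[OF p]) auto
        also have "\<dots> = l powr (- ?r) * norm (X (w + v) - X w) powr ?r + l powr p * norm (Y w) powr p"
          using l by (simp add: powr_divide powr_mult powr_minus_divide)
        finally show ?thesis .
      qed
    qed (use iX Y(2) in simp)
    also have "\<dots> = l powr (- ?r) * (Lp_integral ?r (\<lambda>w. X (w + v) - X w)) + l powr p * N"
      using iX Y(2) by (simp add: N_def)
    also have "\<dots> \<le> l powr (- ?r) * (e / 2 * l powr ?r) + e / 2"
      using d(2)[OF v] lN by (intro add_mono mult_left_mono) auto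
    also have "\<dots> = e" using l by (simp add: powr_minus field_simps)
    finally show "(LINT w|lborel. norm (X (w + v) - X w) * norm (Y w)) \<le> e" .
  qed
qed

text \<open>The flux over (t - h, t], paired with a test function frozen at the end time t, is
  integrated over t. Writing the time of the flux as t - s turns this into an integral over shifts s
  in [0, h) of pairings of the translated flux with Y, to which continuity of translations
  applies.\<close>

lemma shift_Fubini:
  fixes X Y :: "'a::euclidean_space \<times> real \<Rightarrow> 'b::euclidean_space"
  assumes p: "p > 1" and X: "X \<in> borel_measurable borel" "Lp_integrable (p / (p - 1)) X"
    and Y: "Y \<in> borel_measurable borel" "Lp_integrable p Y" and h: "h > 0"
    and J: "J \<in> sets borel"
  obtains g :: "real \<Rightarrow> real" where "integrable lborel g"
    "AE t in lborel. g t = indicator J t * (LINT w|lborel. indicator {t - h<..t} (snd w) * (X w \<bullet> Y (fst w, t)))"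
    "(LINT t|lborel. g t) = (LINT s|lborel. indicator {0..<h} s * (LINT w|lborel. indicator J (snd w) * (X (w - (0, s)) \<bullet> Y w)))"
    "integrable lborel (\<lambda>s. indicator {0..<h} s * (LINT w|lborel. indicator J (snd w) * (X (w - (0, s)) \<bullet> Y w)))"
proof -
  let ?r = "p / (p - 1)"
  have r: "?r > 0" using p by simp
  have cm: "f \<in> borel_measurable borel" if "continuous_on UNIV f" for f :: "'c::euclidean_space \<Rightarrow> 'd::euclidean_space"
    using that by (rule borel_measurable_continuous_onI)
  have fm: "fst \<in> borel_measurable (borel :: (('a \<times> real) \<times> real) measure)" "snd \<in> borel_measurable (borel :: (('a \<times> real) \<times> real) measure)"
    "(\<lambda>W. snd (fst W)) \<in> borel_measurable (borel :: (('a \<times> real) \<times> real) measure)"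
    "(\<lambda>W. fst W - (0, snd W)) \<in> borel_measurable (borel :: (('a \<times> real) \<times> real) measure)"
    "snd \<in> borel_measurable (borel :: ('a \<times> real) measure)"
    by (auto intro!: cm continuous_intros)
  note [measurable] = X(1) Y(1) J fm
  \<comment> \<open>The integrand in the variables ((x, t), s); both sides of the claim are iterated
    integrals of it.\<close>
  define \<Psi> where "\<Psi> W = indicator {0..<h} (snd W) * (indicator J (snd (fst W)) * (X (fst W - (0, snd W)) \<bullet> Y (fst W)))" for W
  let ?h = "indicator {0..<h} :: real \<Rightarrow> real"
  have hi: "integrable lborel ?h" using h by (auto intro!: integrable_real_indicator)
  have Xs: "(\<lambda>W. X (fst W - (0, snd W))) \<in> borel_measurable borel" by (rule measurable_compose[OF fm(4) X(1)])
  have Ys: "(\<lambda>W. Y (fst W)) \<in> borel_measurable (borel :: (('a \<times> real) \<times> real) measure)" by (rule measurable_compose[OF fm(1) Y(1)])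
  note [measurable] = Xs Ys
  have i1: "integrable lborel (\<lambda>W. ?h (snd W) * norm (X (fst W - (0, snd W))) powr ?r)"
  proof (rule integrableI_bounded)
    have "(\<integral>\<^sup>+W. ennreal (norm (?h (snd W) * norm (X (fst W - (0, snd W))) powr ?r)) \<partial>lborel) =
      (\<integral>\<^sup>+s. (\<integral>\<^sup>+w. ennreal (norm (?h s * norm (X (w - (0, s))) powr ?r)) \<partial>lborel) \<partial>lborel)"
    proof -
      have m: "(\<lambda>W. ennreal (norm (?h (snd W) * norm (X (fst W - (0, snd W))) powr ?r))) \<in> borel_measurable borel"
        by measurable
      show ?thesis using lborel_Tonelli[OF m] by (simp only: fst_conv snd_conv)
    qed
    also have "\<dots> = (\<integral>\<^sup>+s. ennreal (?h s * (Lp_integral ?r X)) \<partial>lborel)"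
    proof (rule nn_integral_cong)
      fix s :: real
      have sh: "w - (0, s) = w + (0, - s)" for w :: "'a \<times> real" by (cases w) simp
      have i: "Lp_integrable ?r (\<lambda>w. X (w - (0, s)))"
        using X(2) lborel_integrable_shift[of "\<lambda>w. norm (X w) powr ?r" "(0, - s)"] by (simp add: sh)
      have "(\<integral>\<^sup>+w. ennreal (norm (?h s * norm (X (w - (0, s))) powr ?r)) \<partial>lborel) = ennreal (LINT w|lborel. ?h s * norm (X (w - (0, s))) powr ?r)"
        using i by (subst nn_integral_eq_integral[symmetric]) (auto simp: indicator_def)
      also have "(LINT w|lborel. ?h s * norm (X (w - (0, s))) powr ?r) = ?h s * (Lp_integral ?r X)"
        using lborel_integral_shift[of "\<lambda>w. norm (X w) powr ?r" "(0, - s)"] by (simp add: sh)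
      finally show "(\<integral>\<^sup>+w. ennreal (norm (?h s * norm (X (w - (0, s))) powr ?r)) \<partial>lborel) = ennreal (?h s * (Lp_integral ?r X))" .
    qed
    also have "\<dots> = (\<integral>\<^sup>+s. ennreal (norm (?h s * (Lp_integral ?r X))) \<partial>lborel)"
      by (intro nn_integral_cong) (simp add: indicator_def)
    also have "\<dots> < \<infinity>" using integrable_mult_left[OF impI[OF hi, of "(Lp_integral ?r X) \<noteq> 0", THEN mp]]
      integrable_mult_left[of "Lp_integral ?r X" lborel ?h] hi
      unfolding integrable_iff_bounded by blast
    finally show "(\<integral>\<^sup>+W. ennreal (norm (?h (snd W) * norm (X (fst W - (0, snd W))) powr ?r)) \<partial>lborel) < \<infinity>" .
  qed measurable
  have i2: "integrable lborel (\<lambda>W. norm (Y (fst W)) powr p * ?h (snd W))"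
    by (rule product_integrable[OF Y(2) hi])
  have \<Psi>m: "\<Psi> \<in> borel_measurable borel" unfolding \<Psi>_def[abs_def] by measurable
  have \<Psi>i: "integrable lborel \<Psi>"
  proof (rule Bochner_Integration.integrable_bound[OF Bochner_Integration.integrable_add[OF i1 i2]])
    show "\<Psi> \<in> borel_measurable lborel" using \<Psi>m by simp
    show "AE W in lborel. norm (\<Psi> W) \<le> norm (?h (snd W) * norm (X (fst W - (0, snd W))) powr ?r + norm (Y (fst W)) powr p * ?h (snd W))"
    proof (rule AE_I2)
      fix W
      have "\<bar>X (fst W - (0, snd W)) \<bullet> Y (fst W)\<bar> \<le> norm (X (fst W - (0, snd W))) powr ?r + norm (Y (fst W)) powr p"
        using Cauchy_Schwarz_ineq2[of "X (fst W - (0, snd W))" "Y (fst W)"]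
          conjugate_Young[OF p, of "norm (X (fst W - (0, snd W)))" "norm (Y (fst W))"] by simp
      then show "norm (\<Psi> W) \<le> norm (?h (snd W) * norm (X (fst W - (0, snd W))) powr ?r + norm (Y (fst W)) powr p * ?h (snd W))"
        by (auto simp: \<Psi>_def indicator_def abs_mult)
    qed
  qed
  define g where "g t = (LINT x|lborel. (LINT s|lborel. \<Psi> ((x, t), s)))" for t
  note F1 = lborel_Fubini_fst[OF \<Psi>i]
  note F2 = lborel_Fubini[OF F1(3)]
  note F3 = lborel_Fubini[OF \<Psi>i]
  have sl: "(LINT w|lborel. \<Psi> (w, s)) = ?h s * (LINT w|lborel. indicator J (snd w) * (X (w - (0, s)) \<bullet> Y w))" for s
    by (simp add: \<Psi>_def)
  show ?thesis
  proof (rule that)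
    show "integrable lborel g" using F2(3) by (simp add: g_def[abs_def])
    have "(LINT t|lborel. g t) = (LINT W|lborel. \<Psi> W)" using F2(1) F1(1) by (simp add: g_def)
    also have "\<dots> = (LINT s|lborel. ?h s * (LINT w|lborel. indicator J (snd w) * (X (w - (0, s)) \<bullet> Y w)))"
      using F3(1) by (simp only: sl)
    finally show "(LINT t|lborel. g t) = (LINT s|lborel. ?h s * (LINT w|lborel. indicator J (snd w) * (X (w - (0, s)) \<bullet> Y w)))" .
    show "integrable lborel (\<lambda>s. ?h s * (LINT w|lborel. indicator J (snd w) * (X (w - (0, s)) \<bullet> Y w)))"
      using F3(3) by (simp only: sl)
    show "AE t in lborel. g t = indicator J t * (LINT w|lborel. indicator {t - h<..t} (snd w) * (X w \<bullet> Y (fst w, t)))"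
      using lborel_Fubini(2)[OF Y(2)]
    proof eventually_elim
      case (elim t)
      have Yt: "(\<lambda>w. Y (fst w, t)) \<in> borel_measurable (borel :: ('a \<times> real) measure)"
        by (rule measurable_compose[OF _ Y(1)]) (auto intro!: cm continuous_intros)
      note [measurable] = Yt
      let ?f = "\<lambda>w. X w \<bullet> (indicator {t - h<..t} (snd w) *\<^sub>R Y (fst w, t))"
      have fi: "integrable lborel ?f"
      proof (rule Young_integrable(1)[OF p _ X(2)])
        have "integrable lborel (\<lambda>w. norm (Y (fst w, t)) powr p * indicator {t - h<..t} (snd w))"
          using h by (intro product_integrable[OF elim] integrable_real_indicator) auto
        moreover have "norm (indicator {t - h<..t} (snd w) *\<^sub>R Y (fst w, t)) powr p = norm (Y (fst w, t)) powr p * indicator {t - h<..t} (snd w)" for w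
          by (auto simp: indicator_def)
        ultimately show "Lp_integrable p (\<lambda>w. indicator {t - h<..t} (snd w) *\<^sub>R Y (fst w, t))"
          by (simp only:)
      qed measurable
      have "(LINT s|lborel. \<Psi> ((x, t), s)) = indicator J t * (\<integral>\<tau>. ?f (x, \<tau>) \<partial>lborel)" for x
      proof -
        have fx: "(\<lambda>\<tau>. ?f (x, \<tau>)) \<in> borel_measurable borel"
        proof -
          have [measurable]: "(\<lambda>\<tau>. X (x, \<tau>)) \<in> borel_measurable borel"
            by (rule measurable_compose[OF _ X(1)]) (auto intro!: cm continuous_intros)
          show ?thesis by measurable
        qed
        \<comment> \<open>The reflection \<tau> = t - s maps [0, h) onto (t - h, t].\<close>
        have "(\<integral>\<tau>. ?f (x, \<tau>) \<partial>lborel) = (LINT s|lborel. ?f (x, t - s))"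
          by (rule lborel_integral_reflect[OF fx, symmetric])
        moreover have "\<Psi> ((x, t), s) = indicator J t * ?f (x, t - s)" for s
          by (auto simp: \<Psi>_def indicator_def)
        ultimately show ?thesis by simp
      qed
      then have "g t = indicator J t * (LINT w|lborel. ?f w)"
        using lborel_Fubini_fst(1)[OF fi] by (simp add: g_def)
      then show ?case by simp
    qed
  qed
qed

context cutoff_function
begin

text \<open>Backward differences of step h stand in for the time derivative. Convexity bounds the
  increment of the excess from s - h to s by the increment of z times H taken at s, and the weak
  identity with the test function frozen at s converts this into a flux over (s - h, s]. Integration
  over s, division by h and h -> 0 recover the values at t1 and t2 by continuity and the flux by
  \<open>pairing_translation\<close>.\<close>

lemma energy_inequality:
  fixes E :: "'a::euclidean_space set" and X Y :: "'a \<times> real \<Rightarrow> 'a"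
  assumes E: "open E" and p: "p > 1" and z: "L1_curve T E z"
    and X: "X \<in> borel_measurable borel" "Lp_integrable (p / (p - 1)) X"
    and weak: "\<And>\<phi> G t1 t2. W0 E p \<phi> G \<Longrightarrow> (\<And>x. \<bar>\<phi> x\<bar> \<le> 1) \<Longrightarrow> 0 \<le> t1 \<Longrightarrow> t1 \<le> t2 \<Longrightarrow> t2 < T \<Longrightarrow>
      (LINT x|lebesgue_on E. (z (x, t2) - z (x, t1)) * \<phi> x) =
      - (LINT w|lborel. indicator {t1<..t2} (snd w) * (X w \<bullet> G (fst w)))"
    and k: "k \<in> borel_measurable (lebesgue_on E)" "integrable (lebesgue_on E) (\<lambda>x. b (k x))"
    and Y: "Y \<in> borel_measurable borel" "Lp_integrable p Y"
    and admissible: "AE t in lborel. t \<in> {0<..<T} \<longrightarrow>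
      (\<exists>\<phi>. W0 E p \<phi> (\<lambda>x. Y (x, t)) \<and> (\<forall>x. \<bar>\<phi> x\<bar> \<le> 1) \<and> borel_rep E (\<lambda>x. H (\<beta> (z (x, t)) - k x)) \<phi>)"
    and t: "0 \<le> t1" "t1 \<le> t2" "t2 < T"
  defines "f \<equiv> \<lambda>t. LINT x|lebesgue_on E. excess q H (z (x, t)) (k x)"
  shows "f t2 - f t1 \<le> - (LINT w|lborel. indicator {t1<..<t2} (snd w) * (X w \<bullet> Y w))"
    and "continuous_on {0..T} f"
proof -
  have E': "E \<in> sets borel" using E by simp
  have T: "T > 0" using t by simp
  have zi: "integrable (lebesgue_on E) (\<lambda>x. z (x, s))" if "s \<in> {0..T}" for s using z that by (simp add: L1_curve_def)
  have exi: "integrable (lebesgue_on E) (\<lambda>x. excess q H (z (x, s)) (k x))" if s: "s \<in> {0..T}" for s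
  proof (rule Bochner_Integration.integrable_bound)
    show "integrable (lebesgue_on E) (\<lambda>x. \<bar>z (x, s)\<bar> + \<bar>b (k x)\<bar>)" using zi[OF s] k(2) by simp
    show "(\<lambda>x. excess q H (z (x, s)) (k x)) \<in> borel_measurable (lebesgue_on E)"
      using borel_measurable_integrable[OF zi[OF s]] k(1) by (rule excess_measurable)
    show "AE x in lebesgue_on E. norm (excess q H (z (x, s)) (k x)) \<le> norm (\<bar>z (x, s)\<bar> + \<bar>b (k x)\<bar>)"
      using excess_bound by (intro AE_I2) auto
  qed
  show fc: "continuous_on {0..T} f"
  proof (rule L1_curve_integral_continuous[OF z])
    fix s r assume s: "s \<in> {0..T}" and r: "r \<in> {0..T}"
    have "\<bar>f s - f r\<bar> = \<bar>\<integral>x. excess q H (z (x, s)) (k x) - excess q H (z (x, r)) (k x) \<partial>lebesgue_on E\<bar>"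
      unfolding f_def using exi[OF s] exi[OF r] by simp
    also have "\<dots> \<le> (LINT x|lebesgue_on E. \<bar>z (x, s) - z (x, r)\<bar>)"
      unfolding real_norm_def[symmetric]
      by (intro order_trans[OF integral_norm_bound] integral_mono)
        (use exi[OF s] exi[OF r] zi[OF s] zi[OF r] excess_lipschitz in auto)
    finally show "\<bar>f s - f r\<bar> \<le> 1 * (LINT x|lebesgue_on E. \<bar>z (x, s) - z (x, r)\<bar>)" by simp
  qed
  \<comment> \<open>t2 + h stays strictly below T, where the identity at fixed times is
    available.\<close>
  define h where "h n = (T - t2) / (2 * real (Suc n))" for n
  have hp: "h n > 0" for n using t by (simp add: h_def)
  have hT: "t2 + h n < T" for n
  proof -
    have "(T - t2) / (2 * real (Suc n)) \<le> (T - t2) / 2" using t by (intro divide_left_mono) auto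
    then have "h n \<le> (T - t2) / 2" unfolding h_def .
    moreover have "(T - t2) / 2 < T - t2" using t by simp
    ultimately show ?thesis by linarith
  qed
  have hl: "h \<longlonglongrightarrow> 0"
  proof -
    have "(T - t2) / 2 * inverse (real (Suc n)) = h n" for n by (simp only: h_def divide_inverse inverse_mult_distrib mult.assoc)
    then show ?thesis using tendsto_mult_right_zero[OF LIMSEQ_inverse_real_of_nat, of "(T - t2) / 2"] by (simp only:)
  qed
  \<comment> \<open>Extension by zero makes all shifts of f defined on the line.\<close>
  define F where "F s = indicator {0..T} s * f s" for s
  have Fi: "integrable lborel F"
    using borel_integrable_compact[OF compact_Icc fc] by (simp add: F_def[abs_def])
  have Fm[measurable]: "F \<in> borel_measurable borel" using Fi by auto
  have FI: "integrable lborel (\<lambda>s. indicator {a<..<c} s * F s)" for a c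
    using integrable_mult_indicator[OF _ Fi, of "{a<..<c}"] by simp
  \<comment> \<open>The window is shifted by h so that the earlier time s - h runs through (t1, t2)
    and stays nonnegative.\<close>
  let ?J = "\<lambda>n. {t1 + h n<..<t2 + h n}"
  \<comment> \<open>Telescoping: the integrals over the overlap cancel and two boundary integrals of
    length h remain.\<close>
  have shift_eq: "(LINT s|lborel. indicator (?J n) s * (F s - F (s - h n))) =
    (LINT s|lborel. indicator {t2<..<t2 + h n} s * F s) - (LINT s|lborel. indicator {t1<..<t1 + h n} s * F s)" for n
  proof -
    have 1: "integrable lborel (\<lambda>s. indicator (?J n) s * F (s - h n))"
      and 2: "(LINT s|lborel. indicator (?J n) s * F (s - h n)) = (LINT s|lborel. indicator {t1<..<t2} s * F s)"
    proof -
      have e: "indicator (?J n) s * F (s - h n) = indicator {t1<..<t2} (s + - h n) * F (s + - h n)" for s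
        by (auto simp: indicator_def)
      show "integrable lborel (\<lambda>s. indicator (?J n) s * F (s - h n))"
        unfolding e using FI by (subst lborel_integrable_shift[of "\<lambda>s. indicator {t1<..<t2} s * F s"]) auto
      show "(LINT s|lborel. indicator (?J n) s * F (s - h n)) = (LINT s|lborel. indicator {t1<..<t2} s * F s)"
        unfolding e by (rule lborel_integral_shift) measurable
    qed
    have "(LINT s|lborel. indicator (?J n) s * (F s - F (s - h n))) = (LINT s|lborel. indicator (?J n) s * F s) - (LINT s|lborel. indicator (?J n) s * F (s - h n))"
      using FI 1 by (simp add: right_diff_distrib)
    also have "\<dots> = (LINT s|lborel. indicator (?J n) s * F s - indicator {t1<..<t2} s * F s)"
      using FI by (simp add: 2)
    also have "\<dots> = (LINT s|lborel. indicator {t2<..<t2 + h n} s * F s - indicator {t1<..<t1 + h n} s * F s)"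
    proof (rule integral_cong_AE)
      have "AE s in lborel. s \<noteq> t1" "AE s in lborel. s \<noteq> t2" "AE s in lborel. s \<noteq> t1 + h n" "AE s in lborel. s \<noteq> t2 + h n"
        by (rule AE_lborel_singleton)+
      then show "AE s in lborel. indicator (?J n) s * F s - indicator {t1<..<t2} s * F s = indicator {t2<..<t2 + h n} s * F s - indicator {t1<..<t1 + h n} s * F s"
      proof eventually_elim
        case (elim s)
        then show ?case using hp[of n] t by (auto simp: indicator_def)
      qed
    qed measurable
    finally show ?thesis using FI by simp
  qed
  have lim: "(\<lambda>n. (1 / h n) * (LINT s|lborel. indicator (?J n) s * (F s - F (s - h n)))) \<longlonglongrightarrow> f t2 - f t1"
  proof -
    have e: "indicator {a<..<a + h n} s * F s = indicator {a<..<a + h n} s * f s" if "a \<ge> 0" "a \<le> t2" for a s n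
      using that hT[of n] by (auto simp: F_def indicator_def)
    have a: "(\<lambda>n. (1 / h n) * (LINT s|lborel. indicator {a<..<a + h n} s * F s)) \<longlonglongrightarrow> f a" if "a \<ge> 0" "a \<le> t2" for a
      unfolding e[OF that]
    proof (rule interval_average_tendsto[OF fc _ _ hp _ hl])
      show "a + h n \<le> T" for n using hT[of n] that by simp
    qed (use that t in auto)
    have "(\<lambda>n. (1 / h n) * (LINT s|lborel. indicator {t2<..<t2 + h n} s * F s) - (1 / h n) * (LINT s|lborel. indicator {t1<..<t1 + h n} s * F s)) \<longlonglongrightarrow> f t2 - f t1"
      using t by (intro tendsto_diff a) auto
    then show ?thesis unfolding shift_eq by (simp only: right_diff_distrib)
  qed
  let ?P = "LINT w|lborel. indicator {t1<..<t2} (snd w) * (X w \<bullet> Y w)"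
  have XY: "integrable lborel (\<lambda>w. X w \<bullet> Y w)" by (rule Young_integrable(1)[OF p _ X(2) _ Y(2)]) (use X Y in auto)
  have sm[measurable]: "snd \<in> borel_measurable (borel :: ('a \<times> real) measure)"
    by (auto intro!: borel_measurable_continuous_onI continuous_intros)
  note [measurable] = X(1) Y(1)
  have Jlim: "(\<lambda>n. LINT w|lborel. indicator (?J n) (snd w) * (X w \<bullet> Y w)) \<longlonglongrightarrow> ?P"
  proof (rule integral_dominated_convergence[where w="\<lambda>w. \<bar>X w \<bullet> Y w\<bar>"])
    have "AE w in lborel. snd (w :: 'a \<times> real) \<noteq> t2" by (rule lborel_AE_snd[OF AE_lborel_singleton])
    moreover have "AE w in lborel. snd (w :: 'a \<times> real) \<noteq> t1" by (rule lborel_AE_snd[OF AE_lborel_singleton])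
    ultimately show "AE w in lborel. (\<lambda>n. indicator (?J n) (snd w) * (X w \<bullet> Y w)) \<longlonglongrightarrow> indicator {t1<..<t2} (snd (w :: 'a \<times> real)) * (X w \<bullet> Y w)"
    proof eventually_elim
      case (elim w)
      have "\<forall>\<^sub>F n in sequentially. indicator (?J n) (snd w) = (indicator {t1<..<t2} (snd w) :: real)"
      proof (cases "t1 < snd w \<and> snd w < t2")
        case True
        then have "\<forall>\<^sub>F n in sequentially. h n < snd w - t1" using hl by (intro order_tendstoD(2)) auto
        then show ?thesis
        proof eventually_elim
          case (elim n) then show ?case using True hp[of n] by (auto simp: indicator_def)
        qed
      next
        case False
        show ?thesis
        proof (cases "snd w < t1")
          case True
          then have "indicator (?J n) (snd w) = (indicator {t1<..<t2} (snd w) :: real)" for n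
            using hp[of n] by (auto simp: indicator_def)
          then show ?thesis by (intro always_eventually allI)
        next
          case F: False
          then have "\<forall>\<^sub>F n in sequentially. h n < snd w - t2" using hl False elim by (intro order_tendstoD(2)) auto
          then show ?thesis
          proof eventually_elim
            case (elim n) then show ?case using False by (auto simp: indicator_def)
          qed
        qed
      qed
      then show ?case by (intro tendsto_mult_right tendsto_eventually)
    qed
  qed (use XY in \<open>auto simp: indicator_def\<close>)
  show "f t2 - f t1 \<le> - ?P"
  proof (rule field_le_epsilon)
    fix e :: real assume e: "e > 0"
    have e2: "e / 2 > 0" using e by simp
    have Pe: "?P - e / 2 < ?P" using e by simp
    obtain \<delta> where d: "\<delta> > 0" "\<And>v. norm v < \<delta> \<Longrightarrow> (LINT w|lborel. norm (X (w + v) - X w) * norm (Y w)) \<le> e / 2"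
      using pairing_translation[OF p X Y e2] by blast
    have "\<forall>\<^sub>F n in sequentially. (1 / h n) * (LINT s|lborel. indicator (?J n) s * (F s - F (s - h n))) \<le> - ?P + e"
      using order_tendstoD(2)[OF hl d(1)] order_tendstoD(1)[OF Jlim Pe]
    proof eventually_elim
      case (elim n)
      have hn: "h n > 0" by (rule hp)
      have Jb: "?J n \<in> sets borel" by simp
      obtain g where g: "integrable lborel g"
        "AE t in lborel. g t = indicator (?J n) t * (LINT w|lborel. indicator {t - h n<..t} (snd w) * (X w \<bullet> Y (fst w, t)))"
        "(LINT t|lborel. g t) = (LINT s|lborel. indicator {0..<h n} s * (LINT w|lborel. indicator (?J n) (snd w) * (X (w - (0, s)) \<bullet> Y w)))"
        "integrable lborel (\<lambda>s. indicator {0..<h n} s * (LINT w|lborel. indicator (?J n) (snd w) * (X (w - (0, s)) \<bullet> Y w)))"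
        by (rule shift_Fubini[OF p X Y hn Jb])
      have "(LINT s|lborel. indicator (?J n) s * (F s - F (s - h n))) \<le> (LINT t|lborel. - g t)"
      proof (rule integral_mono_AE)
        have "integrable lborel (\<lambda>s. F s - F (s + - h n))"
          using Fi by (simp add: lborel_integrable_shift del: add_uminus_conv_diff)
        then show "integrable lborel (\<lambda>s. indicator (?J n) s * (F s - F (s - h n)))"
          using integrable_mult_indicator[OF _ _, of "?J n" lborel "\<lambda>s. F s - F (s - h n)"] by simp
        show "integrable lborel (\<lambda>t. - g t)" using g(1) by simp
        show "AE s in lborel. indicator (?J n) s * (F s - F (s - h n)) \<le> - g s"
          using g(2) admissible
        proof eventually_elim
          case (elim s)
          show ?case
          proof (cases "s \<in> ?J n")
            case True
            then have s: "s \<in> {0<..<T}" "s \<in> {0..T}" "s - h n \<in> {0..T}" "0 \<le> s - h n" "s - h n \<le> s" "s < T"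
              using t hT[of n] hn by auto
            obtain \<phi> where \<phi>: "W0 E p \<phi> (\<lambda>x. Y (x, s))" "\<And>x. \<bar>\<phi> x\<bar> \<le> 1" "borel_rep E (\<lambda>x. H (\<beta> (z (x, s)) - k x)) \<phi>"
              using elim(2) s(1) by blast
            have pm: "\<phi> \<in> borel_measurable (lebesgue_on E)"
              using wgrad_D(1)[OF W0_D(1)[OF \<phi>(1)]] by (intro measurable_restrict_space1) (auto intro: measurable_completion)
            have ae: "AE x in lebesgue_on E. H (\<beta> (z (x, s)) - k x) = \<phi> x"
              using \<phi>(3) by (simp add: AE_lebesgue_on_iff[OF E'] borel_rep_def)
            have zd: "integrable (lebesgue_on E) (\<lambda>x. z (x, s) - z (x, s - h n))" using zi[OF s(2)] zi[OF s(3)] by simp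
            have pint: "integrable (lebesgue_on E) (\<lambda>x. (z (x, s) - z (x, s - h n)) * \<phi> x)"
            proof (rule Bochner_Integration.integrable_bound[OF zd])
              show "AE x in lebesgue_on E. norm ((z (x, s) - z (x, s - h n)) * \<phi> x) \<le> norm (z (x, s) - z (x, s - h n))"
                using \<phi>(2) by (intro AE_I2) (simp add: abs_mult mult_left_le)
            qed (use borel_measurable_integrable[OF zd] pm in measurable)
            have "F s - F (s - h n) = (LINT x|lebesgue_on E. excess q H (z (x, s)) (k x) - excess q H (z (x, s - h n)) (k x))"
              using s exi[OF s(2)] exi[OF s(3)] by (simp add: F_def f_def)
            also have "\<dots> \<le> (LINT x|lebesgue_on E. (z (x, s) - z (x, s - h n)) * \<phi> x)"
            proof (rule integral_mono_AE[OF _ pint])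
              show "AE x in lebesgue_on E. excess q H (z (x, s)) (k x) - excess q H (z (x, s - h n)) (k x) \<le> (z (x, s) - z (x, s - h n)) * \<phi> x"
                using ae
              proof eventually_elim
                case (elim x) then show ?case using excess_convex[of "z (x, s)" "k x" "z (x, s - h n)"] by simp
              qed
            qed (use exi[OF s(2)] exi[OF s(3)] in simp)
            also have "\<dots> = - (LINT w|lborel. indicator {s - h n<..s} (snd w) * (X w \<bullet> Y (fst w, s)))"
              by (rule weak[OF \<phi>(1,2) s(4-6)])
            also have "\<dots> = - g s" using elim(1) True by simp
            finally show ?thesis using True by simp
          next
            case False then show ?thesis using elim(1) by simp
          qed
        qed
      qed
      also have "\<dots> = - (LINT s|lborel. indicator {0..<h n} s * (LINT w|lborel. indicator (?J n) (snd w) * (X (w - (0, s)) \<bullet> Y w)))"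
        using g(3) by simp
      \<comment> \<open>For each shift s in [0, h) the translation costs at most e / 2, and
        replacing the window by (t1, t2) costs at most another e / 2.\<close>
      also have "\<dots> \<le> - (LINT s|lborel. indicator {0..<h n} s * (?P - e))"
      proof (rule le_imp_neg_le, rule integral_mono[OF _ g(4)])
        show "integrable lborel (\<lambda>s. indicator {0..<h n} s * (?P - e))"
          using hn by (intro integrable_mult_left integrable_real_indicator) auto
        fix s
        show "indicator {0..<h n} s * (?P - e) \<le> indicator {0..<h n} s * (LINT w|lborel. indicator (?J n) (snd w) * (X (w - (0, s)) \<bullet> Y w))"
        proof (cases "s \<in> {0..<h n}")
          case True
          let ?v = "(0, - s) :: 'a \<times> real"
          have sv: "w - (0, s) = w + ?v" for w :: "'a \<times> real" by (cases w) simp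
          have nv: "norm ?v < \<delta>" using True elim(1) by (simp add: norm_Pair)
          have Xv: "(\<lambda>w. X (w + ?v)) \<in> borel_measurable borel" by (rule measurable_compose[OF _ X(1)]) measurable
          note [measurable] = Xv
          have iX: "Lp_integrable (p / (p - 1)) (\<lambda>w. X (w + ?v))"
            using X(2) by (subst lborel_integrable_shift[of "\<lambda>w. norm (X w) powr (p / (p - 1))"]) auto
          have r: "p / (p - 1) > 0" using p by simp
          have i0: "integrable lborel (\<lambda>w. indicator A (snd w) * (G w \<bullet> Y w))"
            if "G \<in> borel_measurable borel" "Lp_integrable (p / (p - 1)) G" "A \<in> sets borel"
            for A and G :: "'a \<times> real \<Rightarrow> 'a"
          proof -
            note [measurable] = that(1,3)
            have "integrable lborel (\<lambda>w. G w \<bullet> Y w)" by (rule Young_integrable(1)[OF p _ that(2) _ Y(2)]) measurable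
            then show ?thesis
              by (rule Bochner_Integration.integrable_bound) (auto simp: indicator_def)
          qed
          have iD: "integrable lborel (\<lambda>w. norm (X (w + ?v) - X w) * norm (Y w))"
            by (rule Young_integrable(2)[OF p _ integrable_powr_diff[OF iX X(2) r] _ Y(2)]) measurable
          have "(LINT w|lborel. indicator (?J n) (snd w) * (X w \<bullet> Y w)) - (LINT w|lborel. indicator (?J n) (snd w) * (X (w + ?v) \<bullet> Y w))
            = (LINT w|lborel. indicator (?J n) (snd w) * (X w \<bullet> Y w) - indicator (?J n) (snd w) * (X (w + ?v) \<bullet> Y w))"
            by (intro Bochner_Integration.integral_diff[symmetric] i0 X Xv iX Jb)
          also have "\<dots> \<le> (LINT w|lborel. norm (X (w + ?v) - X w) * norm (Y w))"
          proof (rule integral_mono[OF _ iD])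
            show "integrable lborel (\<lambda>w. indicator (?J n) (snd w) * (X w \<bullet> Y w) - indicator (?J n) (snd w) * (X (w + ?v) \<bullet> Y w))"
              by (intro Bochner_Integration.integrable_diff i0 X Xv iX Jb)
            fix w
            have "X w \<bullet> Y w - X (w + ?v) \<bullet> Y w \<le> norm (X (w + ?v) - X w) * norm (Y w)"
              using norm_cauchy_schwarz[of "X w - X (w + ?v)" "Y w"] by (simp only: inner_diff_left norm_minus_commute)
            then show "indicator (?J n) (snd w) * (X w \<bullet> Y w) - indicator (?J n) (snd w) * (X (w + ?v) \<bullet> Y w) \<le> norm (X (w + ?v) - X w) * norm (Y w)"
              by (auto simp: indicator_def)
          qed
          also have "\<dots> \<le> e / 2" by (rule d(2)[OF nv])
          finally have "?P - e \<le> (LINT w|lborel. indicator (?J n) (snd w) * (X (w + ?v) \<bullet> Y w))" using elim(2) by simp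
          then show ?thesis using True by (simp only: sv) simp
        qed simp
      qed
      also have "\<dots> = h n * (- ?P + e)" using hn by (simp add: algebra_simps)
      finally have "(LINT s|lborel. indicator (?J n) s * (F s - F (s - h n))) \<le> h n * (- ?P + e)" .
      then show ?case using hn by (simp only: times_divide_eq_left mult_1 pos_divide_le_eq) (simp only: mult.commute)
    qed
    then show "f t2 - f t1 \<le> - ?P + e" by (intro tendsto_upperbound[OF lim]) auto
  qed
qed

end

subsection \<open>Doubling of the time variable\<close>

text \<open>On a slightly larger fixed interval f has an antiderivative g, and the integral is g(a +
  e) - g(a).\<close>

lemma moving_interval_deriv:
  fixes f :: "real \<Rightarrow> real"
  assumes f: "continuous_on UNIV f" and e: "e \<ge> 0"
  shows "((\<lambda>a. integral {0..e} (\<lambda>s. f (a + s))) has_real_derivative f (a + e) - f a) (at a)"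
proof -
  let ?I = "{a - 1..a + e + 1}"
  obtain g where g: "\<And>x. x \<in> ?I \<Longrightarrow> (g has_vector_derivative f x) (at x within ?I)"
    using antiderivative_continuous[OF continuous_on_subset[OF f subset_UNIV], of "a - 1" "a + e + 1"] by blast
  have gd: "(g has_real_derivative f x) (at x)" if "x \<in> {a - 1<..<a + e + 1}" for x
  proof -
    have "at x within ?I = at x" using that by (intro at_within_interior) (simp add: interior_atLeastAtMost_real)
    then show ?thesis using g[of x] that by (simp add: has_real_derivative_iff_has_vector_derivative)
  qed
  have eq: "integral {0..e} (\<lambda>s. f (x + s)) = g (x + e) - g x" if x: "x \<in> {a - 1<..<a + 1}" for x
  proof -
    have "((\<lambda>s. f (x + s)) has_integral (g (x + e) - g (x + 0))) {0..e}"
    proof (rule fundamental_theorem_of_calculus[OF e])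
      fix s assume s: "s \<in> {0..e}"
      have "((\<lambda>s. g (x + s)) has_real_derivative f (x + s) * 1) (at s)"
        by (rule DERIV_chain'[OF _ gd]) (use s x in \<open>auto intro!: derivative_eq_intros\<close>)
      then show "((\<lambda>s. g (x + s)) has_vector_derivative f (x + s)) (at s within {0..e})"
        by (simp add: has_real_derivative_iff_has_vector_derivative has_vector_derivative_at_within)
    qed
    then show ?thesis by (simp add: integral_unique)
  qed
  have "((\<lambda>x. g (x + e) - g x) has_real_derivative f (a + e) * 1 - f a) (at a)"
    by (intro DERIV_diff DERIV_chain'[OF _ gd] gd) (use e in \<open>auto intro!: derivative_eq_intros\<close>)
  then have "((\<lambda>x. g (x + e) - g x) has_real_derivative f (a + e) - f a) (at a)" by simp
  then show ?thesis
    by (rule has_field_derivative_transform_within_open[where S="{a - 1<..<a + 1}"]) (auto simp: eq)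
qed

lemma continuous_on_curried:
  assumes C: "continuous_on UNIV (\<lambda>(t, s). C t s)" and "continuous_on S f" "continuous_on S g"
  shows "continuous_on S (\<lambda>x. C (f x) (g x))"
  using continuous_on_compose2[OF C continuous_on_Pair[OF assms(2,3)]] by simp

text \<open>The chain rule along the diagonal for the average with two independent shifts a and b.
  Each partial derivative is computed with its own variable outermost, whence the exchange of
  integrals in \<open>K2\<close>.\<close>

lemma diagonal_average_deriv:
  fixes C :: "real \<Rightarrow> real \<Rightarrow> real"
  assumes C: "continuous_on UNIV (\<lambda>(t, s). C t s)" and e: "e \<ge> 0"
  shows "((\<lambda>a. integral {0..e} (\<lambda>\<sigma>. integral {0..e} (\<lambda>\<rho>. C (a + \<sigma>) (a + \<rho>)))) has_real_derivative
    integral {0..e} (\<lambda>\<rho>. C (a + e) (a + \<rho>) - C a (a + \<rho>)) +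
    integral {0..e} (\<lambda>\<sigma>. C (a + \<sigma>) (a + e) - C (a + \<sigma>) a)) (at a)"
proof -
  note Cc = continuous_on_curried[OF C]
  define K where "K a b = integral {0..e} (\<lambda>\<sigma>. integral {0..e} (\<lambda>\<rho>. C (a + \<sigma>) (b + \<rho>)))" for a b
  define m where "m t b = integral {0..e} (\<lambda>\<rho>. C t (b + \<rho>))" for t b
  define n where "n a s = integral {0..e} (\<lambda>\<sigma>. C (a + \<sigma>) s)" for a s
  have mc: "continuous_on UNIV (\<lambda>z. m (fst z) (snd z))" unfolding m_def
    by (rule integral_continuous_on_param[of UNIV 0 e, unfolded cbox_interval])
      (auto simp: case_prod_unfold intro!: Cc continuous_intros)
  have nc: "continuous_on UNIV (\<lambda>z. n (fst z) (snd z))" unfolding n_def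
    by (rule integral_continuous_on_param[of UNIV 0 e, unfolded cbox_interval])
      (auto simp: case_prod_unfold intro!: Cc continuous_intros)
  have mc1: "continuous_on UNIV (\<lambda>t. m t b)" for b
    using continuous_on_compose2[OF mc, of UNIV "\<lambda>t. (t, b)"] by (simp add: continuous_on_Pair)
  have nc1: "continuous_on UNIV (\<lambda>s. n a s)" for a
    using continuous_on_compose2[OF nc, of UNIV "\<lambda>s. (a, s)"] by (simp add: continuous_on_Pair)
  have K1: "K a b = integral {0..e} (\<lambda>\<sigma>. m (a + \<sigma>) b)" for a b by (simp add: K_def m_def)
  have K2: "K a b = integral {0..e} (\<lambda>\<rho>. n a (b + \<rho>))" for a b
    unfolding K_def n_def
    using integral_swap_continuous[of 0 0 e e "\<lambda>\<sigma> \<rho>. C (a + \<sigma>) (b + \<rho>)", unfolded cbox_interval]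
    by (simp add: case_prod_unfold Cc continuous_intros)
  have D1: "((\<lambda>a. K a b) has_real_derivative m (a + e) b - m a b) (at a)" for a b
    unfolding K1 by (rule moving_interval_deriv[OF mc1 e])
  have D2: "((\<lambda>b. K a b) has_real_derivative n a (b + e) - n a b) (at b)" for a b
    unfolding K2 by (rule moving_interval_deriv[OF nc1 e])
  \<comment> \<open>Total differentiability from the partial derivatives; joint continuity is
    checked only for the derivative in the second variable.\<close>
  have "((\<lambda>(x, y). K x y) has_derivative (\<lambda>(tx, ty). (m (a + e) a - m a a) * tx + blinfun_mult_right (n a (a + e) - n a a) ty)) (at (a, a) within UNIV \<times> UNIV)"
  proof (rule has_derivative_partialsI[where fy="\<lambda>x y. blinfun_mult_right (n x (y + e) - n x y)"])
    show "((\<lambda>x. K x a) has_derivative (*) (m (a + e) a - m a a)) (at a within UNIV)"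
      using D1[of a a] by (simp add: has_field_derivative_def)
    show "(K x has_derivative blinfun_apply (blinfun_mult_right (n x (y + e) - n x y))) (at y within UNIV)" for x y
      using D2[of x y] by (simp add: has_field_derivative_def)
    have "continuous_on UNIV (\<lambda>z. n (fst z) (snd z + e) - n (fst z) (snd z))"
    proof (rule continuous_on_diff[OF _ nc])
      have "continuous_on UNIV (\<lambda>z :: real \<times> real. (fst z, snd z + e))" by (intro continuous_intros)
      from continuous_on_compose2[OF nc this] show "continuous_on UNIV (\<lambda>z. n (fst z) (snd z + e))" by simp
    qed
    then have "continuous_on UNIV (\<lambda>z. blinfun_mult_right (n (fst z) (snd z + e) - n (fst z) (snd z)))"
      by (rule bounded_linear.continuous_on[OF bounded_linear_blinfun_mult_right])
    then show "continuous (at (a, a) within UNIV \<times> UNIV) (\<lambda>(x, y). blinfun_mult_right (n x (y + e) - n x y))"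
      by (simp add: case_prod_unfold continuous_on_eq_continuous_at)
  qed auto
  then have "((\<lambda>(x, y). K x y) has_derivative (\<lambda>(tx, ty). (m (a + e) a - m a a) * tx + (n a (a + e) - n a a) * ty)) (at (a, a))"
    by simp
  from has_derivative_compose[OF has_derivative_Pair[OF has_derivative_ident has_derivative_ident], OF this, of UNIV]
  have "((\<lambda>a. K a a) has_derivative (\<lambda>h. (m (a + e) a - m a a) * h + (n a (a + e) - n a a) * h)) (at a)"
    by simp
  then have "((\<lambda>a. K a a) has_real_derivative (m (a + e) a - m a a) + (n a (a + e) - n a a)) (at a)"
    unfolding has_field_derivative_def by (rule has_derivative_eq_rhs) (simp add: fun_eq_iff distrib_right)
  moreover have "m (a + e) a - m a a = integral {0..e} (\<lambda>\<rho>. C (a + e) (a + \<rho>) - C a (a + \<rho>))"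
    unfolding m_def by (subst integral_diff) (auto intro!: integrable_continuous_real Cc continuous_intros)
  moreover have "n a (a + e) - n a a = integral {0..e} (\<lambda>\<sigma>. C (a + \<sigma>) (a + e) - C (a + \<sigma>) a)"
    unfolding n_def by (subst integral_diff) (auto intro!: integrable_continuous_real Cc continuous_intros)
  ultimately show ?thesis by (simp add: K_def)
qed

lemma double_integral_bounds:
  fixes C :: "real \<Rightarrow> real \<Rightarrow> real"
  assumes C: "continuous_on UNIV (\<lambda>(t, s). C t s)" and e: "e \<ge> 0"
    and b: "\<And>\<sigma> \<rho>. 0 \<le> \<sigma> \<Longrightarrow> \<sigma> \<le> e \<Longrightarrow> 0 \<le> \<rho> \<Longrightarrow> \<rho> \<le> e \<Longrightarrow> l \<le> C (a + \<sigma>) (a + \<rho>) \<and> C (a + \<sigma>) (a + \<rho>) \<le> u"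
  shows "e * (e * l) \<le> integral {0..e} (\<lambda>\<sigma>. integral {0..e} (\<lambda>\<rho>. C (a + \<sigma>) (a + \<rho>)))"
    "integral {0..e} (\<lambda>\<sigma>. integral {0..e} (\<lambda>\<rho>. C (a + \<sigma>) (a + \<rho>))) \<le> e * (e * u)"
proof -
  note Cc = continuous_on_curried[OF C]
  let ?m = "\<lambda>\<sigma>. integral {0..e} (\<lambda>\<rho>. C (a + \<sigma>) (a + \<rho>))"
  have i1: "(\<lambda>\<rho>. C (a + \<sigma>) (a + \<rho>)) integrable_on {0..e}" for \<sigma>
    by (intro integrable_continuous_real Cc continuous_intros)
  have "continuous_on {0..e} ?m"
    by (rule integral_continuous_on_param[of "{0..e}" 0 e, unfolded cbox_interval])
      (auto simp: case_prod_unfold intro!: Cc continuous_intros)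
  then have i2: "?m integrable_on {0..e}" by (rule integrable_continuous_real)
  have c: "integral {0..e} (\<lambda>_. k) = e * k" for k :: real using e by simp
  have m1: "e * l \<le> ?m \<sigma>" "?m \<sigma> \<le> e * u" if "\<sigma> \<in> {0..e}" for \<sigma>
    unfolding c[symmetric] by (intro integral_le i1; use b that in auto)+
  show "e * (e * l) \<le> integral {0..e} ?m" "integral {0..e} ?m \<le> e * (e * u)"
    unfolding c[of "e * l", symmetric] c[of "e * u", symmetric]
    by (intro integral_le i2; use m1 in auto)+
qed

text \<open>F is merely continuous, so it is averaged over the squares [a, a + e]^2. The average is
  differentiable in a, the hypothesis says that its derivative is nonpositive, and for small e it is
  close to F on the diagonal.\<close>

lemma diagonal_monotone:
  fixes F :: "real \<Rightarrow> real \<Rightarrow> real"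
  assumes F: "continuous_on ({0..T} \<times> {0..T}) (\<lambda>(t, s). F t s)" and t: "0 \<le> \<tau>" "\<tau> < T"
    and h: "\<And>a e. 0 \<le> a \<Longrightarrow> e > 0 \<Longrightarrow> a + e < T \<Longrightarrow>
      integral {a..a + e} (\<lambda>s. F (a + e) s - F a s) + integral {a..a + e} (\<lambda>t. F t (a + e) - F t a) \<le> 0"
  shows "F \<tau> \<tau> \<le> F 0 0"
proof (rule field_le_epsilon)
  fix \<eta> :: real assume \<eta>: "\<eta> > 0"
  \<comment> \<open>Clamping the times extends F to a continuous function on the plane, as the
    differentiation lemmas require; it agrees with F wherever the hypothesis is applied.\<close>
  define c where "c t = max 0 (min T t)" for t
  have cc: "continuous_on UNIV c" unfolding c_def[abs_def] by (intro continuous_intros)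
  have cT: "c t \<in> {0..T}" for t using t by (auto simp: c_def)
  have ci: "c t = t" if "t \<in> {0..T}" for t using that by (auto simp: c_def)
  define C where "C t s = F (c t) (c s)" for t s
  have C: "continuous_on UNIV (\<lambda>(t, s). C t s)"
  proof -
    have c1: "continuous_on UNIV (\<lambda>z. (c (fst z), c (snd z)))"
      by (intro continuous_on_Pair continuous_on_compose2[OF cc] continuous_intros) auto
    have c2: "(\<lambda>z. (c (fst z), c (snd z))) ` UNIV \<subseteq> {0..T} \<times> {0..T}" using cT by auto
    show ?thesis using continuous_on_compose2[OF F c1 c2] by (simp add: C_def case_prod_unfold)
  qed
  have near: "\<exists>d>0. \<forall>\<sigma> \<rho>. 0 \<le> \<sigma> \<and> \<sigma> < d \<and> 0 \<le> \<rho> \<and> \<rho> < d \<longrightarrow> \<bar>C (a + \<sigma>) (a + \<rho>) - C a a\<bar> < \<eta> / 2" for a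
  proof -
    have "isCont (\<lambda>(t, s). C t s) (a, a)" using C by (simp add: continuous_on_eq_continuous_at)
    then obtain d where d: "d > 0" "\<And>z. dist z (a, a) < d \<Longrightarrow> dist (case z of (t, s) \<Rightarrow> C t s) (C a a) < \<eta> / 2"
      using \<eta> unfolding continuous_at_eps_delta by (metis half_gt_zero case_prod_conv)
    show ?thesis
    proof (intro exI[of _ "d / 2"] conjI allI impI)
      fix \<sigma> \<rho> assume s: "0 \<le> \<sigma> \<and> \<sigma> < d / 2 \<and> 0 \<le> \<rho> \<and> \<rho> < d / 2"
      have "dist (a + \<sigma>, a + \<rho>) (a, a) \<le> \<bar>\<sigma>\<bar> + \<bar>\<rho>\<bar>"
        using sqrt_sum_squares_le_sum_abs[of \<sigma> \<rho>] by (simp add: dist_Pair_Pair dist_real_def)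
      then show "\<bar>C (a + \<sigma>) (a + \<rho>) - C a a\<bar> < \<eta> / 2" using d(2)[of "(a + \<sigma>, a + \<rho>)"] s by (simp add: dist_real_def)
    qed (use d in simp)
  qed
  obtain d1 where d1: "d1 > 0" "\<And>\<sigma> \<rho>. 0 \<le> \<sigma> \<Longrightarrow> \<sigma> < d1 \<Longrightarrow> 0 \<le> \<rho> \<Longrightarrow> \<rho> < d1 \<Longrightarrow> \<bar>C (\<tau> + \<sigma>) (\<tau> + \<rho>) - C \<tau> \<tau>\<bar> < \<eta> / 2"
    using near[of \<tau>] by blast
  obtain d2 where d2: "d2 > 0" "\<And>\<sigma> \<rho>. 0 \<le> \<sigma> \<Longrightarrow> \<sigma> < d2 \<Longrightarrow> 0 \<le> \<rho> \<Longrightarrow> \<rho> < d2 \<Longrightarrow> \<bar>C (0 + \<sigma>) (0 + \<rho>) - C 0 0\<bar> < \<eta> / 2"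
    using near[of 0] by blast
  define e where "e = min (min d1 d2) (T - \<tau>) / 2"
  have e: "e > 0" "e < d1" "e < d2" "\<tau> + e < T" using d1(1) d2(1) t by (auto simp: e_def min_def field_simps)
  let ?K = "\<lambda>a. integral {0..e} (\<lambda>\<sigma>. integral {0..e} (\<lambda>\<rho>. C (a + \<sigma>) (a + \<rho>)))"
  have "?K \<tau> \<le> ?K 0"
  proof (rule DERIV_nonpos_imp_nonincreasing[OF t(1)])
    fix a assume a: "0 \<le> a" "a \<le> \<tau>"
    have aT: "a + e < T" using a e by simp
    have "integral {0..e} (\<lambda>\<rho>. C (a + e) (a + \<rho>) - C a (a + \<rho>)) = integral {0 + a..e + a} (\<lambda>s. C (a + e) s - C a s)"
      using integral_shift_Icc_real[of 0 e "\<lambda>s. C (a + e) s - C a s" a] by (simp add: o_def)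
    also have "\<dots> = integral {a..a + e} (\<lambda>s. F (a + e) s - F a s)"
      unfolding add_0 add.commute[of e a] using a aT e by (intro integral_cong) (simp add: C_def ci)
    finally have 1: "integral {0..e} (\<lambda>\<rho>. C (a + e) (a + \<rho>) - C a (a + \<rho>)) = integral {a..a + e} (\<lambda>s. F (a + e) s - F a s)" .
    have "integral {0..e} (\<lambda>\<sigma>. C (a + \<sigma>) (a + e) - C (a + \<sigma>) a) = integral {0 + a..e + a} (\<lambda>t. C t (a + e) - C t a)"
      using integral_shift_Icc_real[of 0 e "\<lambda>t. C t (a + e) - C t a" a] by (simp add: o_def)
    also have "\<dots> = integral {a..a + e} (\<lambda>t. F t (a + e) - F t a)"
      unfolding add_0 add.commute[of e a] using a aT e by (intro integral_cong) (simp add: C_def ci)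
    finally have 2: "integral {0..e} (\<lambda>\<sigma>. C (a + \<sigma>) (a + e) - C (a + \<sigma>) a) = integral {a..a + e} (\<lambda>t. F t (a + e) - F t a)" .
    show "\<exists>y. (?K has_real_derivative y) (at a) \<and> y \<le> 0"
      using diagonal_average_deriv[OF C less_imp_le[OF e(1)], of a] h[OF a(1) e(1) aT] unfolding 1 2 by blast
  qed
  moreover have "e * (e * (C \<tau> \<tau> - \<eta> / 2)) \<le> ?K \<tau>"
  proof (rule double_integral_bounds(1)[OF C, where u="C \<tau> \<tau> + \<eta> / 2"])
    fix \<sigma> \<rho> assume "0 \<le> \<sigma>" "\<sigma> \<le> e" "0 \<le> \<rho>" "\<rho> \<le> e"
    then have "\<bar>C (\<tau> + \<sigma>) (\<tau> + \<rho>) - C \<tau> \<tau>\<bar> < \<eta> / 2" using e by (intro d1(2)) auto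
    then show "C \<tau> \<tau> - \<eta> / 2 \<le> C (\<tau> + \<sigma>) (\<tau> + \<rho>) \<and> C (\<tau> + \<sigma>) (\<tau> + \<rho>) \<le> C \<tau> \<tau> + \<eta> / 2" by linarith
  qed (use e in simp)
  moreover have "?K 0 \<le> e * (e * (C 0 0 + \<eta> / 2))"
  proof (rule double_integral_bounds(2)[OF C, where l="C 0 0 - \<eta> / 2"])
    fix \<sigma> \<rho> assume "0 \<le> \<sigma>" "\<sigma> \<le> e" "0 \<le> \<rho>" "\<rho> \<le> e"
    then have "\<bar>C (0 + \<sigma>) (0 + \<rho>) - C 0 0\<bar> < \<eta> / 2" using e by (intro d2(2)) auto
    then show "C 0 0 - \<eta> / 2 \<le> C (0 + \<sigma>) (0 + \<rho>) \<and> C (0 + \<sigma>) (0 + \<rho>) \<le> C 0 0 + \<eta> / 2" by linarith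
  qed (use e in simp)
  ultimately have "e * (e * (C \<tau> \<tau> - \<eta> / 2)) \<le> e * (e * (C 0 0 + \<eta> / 2))" by linarith
  then have "C \<tau> \<tau> - \<eta> / 2 \<le> C 0 0 + \<eta> / 2" using e(1) by simp
  then show "F \<tau> \<tau> \<le> F 0 0 + \<eta>" using t by (simp add: C_def ci)
qed

text \<open>A point ((x, t), s) carries the time t of v and the time s of w: \<open>fst W\<close> is
  the space-time point for v, and \<open>fst (swap_times W)\<close> the one for w.\<close>

definition swap_times :: "('a::euclidean_space \<times> real) \<times> real \<Rightarrow> ('a \<times> real) \<times> real" where
  "swap_times W = ((fst (fst W), snd W), snd (fst W))"

lemma swap_times_swap_times [simp]: "swap_times (swap_times W) = W"
  by (simp add: swap_times_def)

lemma swap_times_measurable: "swap_times \<in> borel_measurable borel"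
  unfolding swap_times_def[abs_def] by (auto intro!: borel_measurable_continuous_onI continuous_intros)

lemma swap_times_Basis: "swap_times ` Basis = (Basis :: (('a::euclidean_space \<times> real) \<times> real) set)"
proof -
  have s: "swap_times ` Basis \<subseteq> (Basis :: (('a \<times> real) \<times> real) set)"
    by (auto simp: swap_times_def Basis_prod_def zero_prod_def image_iff)
  have "swap_times ` (swap_times ` Basis) \<subseteq> swap_times ` (Basis :: (('a \<times> real) \<times> real) set)" using s by blast
  then have "Basis \<subseteq> swap_times ` (Basis :: (('a \<times> real) \<times> real) set)" by (simp add: image_image)
  with s show ?thesis by blast
qed

lemma swap_times_inner: "swap_times x \<bullet> y = x \<bullet> swap_times y"
  by (simp add: swap_times_def inner_prod_def)

text \<open>The map permutes coordinates and therefore carries boxes to boxes of the same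
  volume.\<close>

lemma swap_times_distr: "distr lborel borel swap_times = (lborel :: (('a::euclidean_space \<times> real) \<times> real) measure)"
proof (rule lborel_eqI[symmetric])
  fix l u :: "('a \<times> real) \<times> real"
  assume lu: "\<And>b. b \<in> Basis \<Longrightarrow> l \<bullet> b \<le> u \<bullet> b"
  have inj: "inj_on swap_times (Basis :: (('a \<times> real) \<times> real) set)"
    by (rule inj_on_inverseI[of _ swap_times]) simp
  have mem: "swap_times b \<in> Basis" if "b \<in> Basis" for b :: "('a \<times> real) \<times> real"
    using swap_times_Basis that by blast
  have "swap_times -` box l u = box (swap_times l) (swap_times u)"
  proof (intro set_eqI iffI)
    fix x assume "x \<in> swap_times -` box l u"
    then have x: "swap_times x \<in> box l u" by simp
    show "x \<in> box (swap_times l) (swap_times u)"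
      unfolding mem_box
    proof
      fix b :: "('a \<times> real) \<times> real" assume "b \<in> Basis"
      from mem[OF this] x show "swap_times l \<bullet> b < x \<bullet> b \<and> x \<bullet> b < swap_times u \<bullet> b"
        by (auto simp: mem_box swap_times_inner)
    qed
  next
    fix x assume x: "x \<in> box (swap_times l) (swap_times u)"
    have "swap_times x \<in> box l u"
      unfolding mem_box
    proof
      fix b :: "('a \<times> real) \<times> real" assume "b \<in> Basis"
      from mem[OF this] x show "l \<bullet> b < swap_times x \<bullet> b \<and> swap_times x \<bullet> b < u \<bullet> b"
        by (auto simp: mem_box swap_times_inner)
    qed
    then show "x \<in> swap_times -` box l u" by simp
  qed
  then have "emeasure (distr lborel borel swap_times) (box l u) = emeasure lborel (box (swap_times l) (swap_times u))"
    by (subst emeasure_distr) (simp_all add: swap_times_measurable)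
  also have "\<dots> = ennreal (\<Prod>b\<in>Basis. (swap_times u - swap_times l) \<bullet> b)"
    using lu mem by (intro emeasure_lborel_box) (simp add: swap_times_inner)
  also have "(\<Prod>b\<in>Basis. (swap_times u - swap_times l) \<bullet> b) = (\<Prod>b\<in>Basis. (u - l) \<bullet> swap_times b)"
    by (simp add: inner_diff_left swap_times_inner)
  also have "\<dots> = (\<Prod>b\<in>swap_times ` Basis. (u - l) \<bullet> b)"
    using prod.reindex[OF inj, of "\<lambda>b. (u - l) \<bullet> b"] by (simp add: o_def)
  also have "\<dots> = (\<Prod>b\<in>Basis. (u - l) \<bullet> b)" by (simp only: swap_times_Basis)
  finally show "emeasure (distr lborel borel swap_times) (box l u) = ennreal (\<Prod>b\<in>Basis. (u - l) \<bullet> b)" .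
qed simp

lemma
  fixes g :: "('a::euclidean_space \<times> real) \<times> real \<Rightarrow> 'c::{banach, second_countable_topology}"
  assumes g: "g \<in> borel_measurable borel"
  shows swap_times_integral: "(LINT W|lborel. g (swap_times W)) = (LINT W|lborel. g W)"
    and swap_times_integrable: "integrable lborel (\<lambda>W. g (swap_times W)) \<longleftrightarrow> integrable lborel g"
proof -
  have m: "swap_times \<in> lborel \<rightarrow>\<^sub>M borel" using swap_times_measurable by simp
  show "(LINT W|lborel. g (swap_times W)) = (LINT W|lborel. g W)"
    using integral_distr[OF m g] by (simp add: swap_times_distr)
  show "integrable lborel (\<lambda>W. g (swap_times W)) \<longleftrightarrow> integrable lborel g"
    using integrable_distr_eq[OF m g] by (simp add: swap_times_distr)
qed

lemma swap_times_AE: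
  assumes "AE W in (lborel :: (('a::euclidean_space \<times> real) \<times> real) measure). P W"
  shows "AE W in (lborel :: (('a \<times> real) \<times> real) measure). P (swap_times W)"
proof -
  have "swap_times \<in> lborel \<rightarrow>\<^sub>M (borel :: (('a \<times> real) \<times> real) measure)" using swap_times_measurable by simp
  moreover have "AE W in distr lborel borel (swap_times :: ('a \<times> real) \<times> real \<Rightarrow> _). P W" unfolding swap_times_distr by (rule assms)
  ultimately show ?thesis by (rule AE_distrD)
qed

lemma Ioo_integral_continuous:
  fixes f :: "real \<Rightarrow> real"
  assumes "continuous_on {a..b} f"
  shows "(LINT s|lborel. indicator {a<..<b} s * f s) = integral {a..b} f"
    and "integrable lborel (\<lambda>s. indicator {a<..<b} s * f s)"
proof -
  have i: "integrable lborel (\<lambda>s. indicator {a..b} s *\<^sub>R f s)" by (rule borel_integrable_compact[OF _ assms]) simp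
  have "integrable lborel (\<lambda>s. indicator {a<..<b} s *\<^sub>R (indicator {a..b} s *\<^sub>R f s))"
    by (rule integrable_mult_indicator[OF _ i]) simp
  moreover have eq: "indicator {a<..<b} s *\<^sub>R (indicator {a..b} s *\<^sub>R f s) = indicator {a<..<b} s * f s" for s
    by (auto simp: indicator_def)
  ultimately show j: "integrable lborel (\<lambda>s. indicator {a<..<b} s * f s)" by (simp only: eq)
  have "set_integrable lborel {a<..<b} f" using j by (simp add: set_integrable_def)
  from set_borel_integral_eq_integral(2)[OF this]
  show "(LINT s|lborel. indicator {a<..<b} s * f s) = integral {a..b} f"
    by (simp add: set_lebesgue_integral_def integral_open_interval_real)
qed

lemma (in cutoff_function) excess_integral_measurable:
  fixes f :: "'a::euclidean_space \<Rightarrow> real" and k :: "'a \<times> real \<Rightarrow> real"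
  assumes f[measurable]: "f \<in> borel_measurable borel" and k: "k \<in> borel_measurable borel"
  shows "(\<lambda>s. LINT x|lborel. excess q H (f x) (k (x, s))) \<in> borel_measurable borel"
proof -
  have k': "(\<lambda>w. k (snd w, fst w)) \<in> borel_measurable (borel \<Otimes>\<^sub>M borel :: (real \<times> 'a) measure)"
    unfolding borel_prod by (rule measurable_compose[OF _ k]) (auto intro!: borel_measurable_continuous_onI continuous_intros)
  have "(\<lambda>w. excess q H (f (snd w)) (k (snd w, fst w))) \<in> borel_measurable (borel \<Otimes>\<^sub>M borel :: (real \<times> 'a) measure)"
    by (rule excess_measurable[OF _ k']) measurable
  then have "(\<lambda>w. excess q H (f (snd w)) (k (snd w, fst w))) \<in> borel_measurable (borel \<Otimes>\<^sub>M lborel :: (real \<times> 'a) measure)"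
    by simp
  then have "(\<lambda>(s, x). excess q H (f x) (k (x, s))) \<in> borel_measurable (borel \<Otimes>\<^sub>M lborel :: (real \<times> 'a) measure)"
    by (simp add: case_prod_unfold)
  from lborel.borel_measurable_lebesgue_integral[OF this] show ?thesis by simp
qed

text \<open>The setting after both weak formulations are reduced to identities at fixed times. The
  field no longer appears: its growth is contained in the integrability of the fluxes, its
  monotonicity and Lipschitz continuity in the one inequality \<open>structure_bound\<close> between
  values at the same x and two times.\<close>

locale doubling =
  fixes E :: "'a::euclidean_space set" and T p q \<Lambda> :: real
    and v w v' w' :: "'a \<times> real \<Rightarrow> real" and Dv Dw Xv Xw :: "'a \<times> real \<Rightarrow> 'a"
  assumes E: "open E" "bounded E" and T: "T > 0" and p: "p > 1" and q: "q > 0" and \<Lambda>: "\<Lambda> \<ge> 0"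
    and zv: "L1_curve T E (\<lambda>z. signed_power q (v z))" and zw: "L1_curve T E (\<lambda>z. signed_power q (w z))"
    and rv: "borel_rep (E \<times> {0<..<T}) v v'" and rw: "borel_rep (E \<times> {0<..<T}) w w'"
    and w'0: "\<And>z. w' z \<ge> 0"
    and Dv: "Dv \<in> borel_measurable borel" "\<And>z. z \<notin> E \<times> {0<..<T} \<Longrightarrow> Dv z = 0" "Lp_integrable p Dv"
    and Dw: "Dw \<in> borel_measurable borel" "\<And>z. z \<notin> E \<times> {0<..<T} \<Longrightarrow> Dw z = 0" "Lp_integrable p Dw"
    and Xv: "Xv \<in> borel_measurable borel" "Lp_integrable (p / (p - 1)) Xv"
      "\<And>z. z \<notin> E \<times> {0<..<T} \<Longrightarrow> Xv z = 0"
    and Xw: "Xw \<in> borel_measurable borel" "Lp_integrable (p / (p - 1)) Xw"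
      "\<And>z. z \<notin> E \<times> {0<..<T} \<Longrightarrow> Xw z = 0"
    and vW: "AE t in lborel. t \<in> {0<..<T} \<longrightarrow> W0 E p (\<lambda>x. v' (x, t)) (\<lambda>x. Dv (x, t))"
    and wW: "AE t in lborel. t \<in> {0<..<T} \<longrightarrow> wgrad E (\<lambda>x. w' (x, t)) (\<lambda>x. Dw (x, t)) \<and>
      Lp_integrable p (\<lambda>x. w' (x, t)) \<and> Lp_integrable p (\<lambda>x. Dw (x, t))"
    and weak_v: "\<And>\<phi> G t1 t2. W0 E p \<phi> G \<Longrightarrow> (\<And>x. \<bar>\<phi> x\<bar> \<le> 1) \<Longrightarrow> 0 \<le> t1 \<Longrightarrow> t1 \<le> t2 \<Longrightarrow> t2 < T \<Longrightarrow>
      (LINT x|lebesgue_on E. (signed_power q (v (x, t2)) - signed_power q (v (x, t1))) * \<phi> x) =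
      - (LINT w|lborel. indicator {t1<..t2} (snd w) * (Xv w \<bullet> G (fst w)))"
    and weak_w: "\<And>\<phi> G t1 t2. W0 E p \<phi> G \<Longrightarrow> (\<And>x. \<bar>\<phi> x\<bar> \<le> 1) \<Longrightarrow> 0 \<le> t1 \<Longrightarrow> t1 \<le> t2 \<Longrightarrow> t2 < T \<Longrightarrow>
      (LINT x|lebesgue_on E. (signed_power q (w (x, t2)) - signed_power q (w (x, t1))) * \<phi> x) =
      - (LINT w|lborel. indicator {t1<..t2} (snd w) * (Xw w \<bullet> G (fst w)))"
    and structure_bound: "AE W in lborel. fst W \<in> E \<times> {0<..<T} \<longrightarrow> fst (swap_times W) \<in> E \<times> {0<..<T} \<longrightarrow>
      (Xv (fst W) - Xw (fst (swap_times W))) \<bullet> (Dv (fst W) - Dw (fst (swap_times W))) \<ge>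
      - (\<Lambda> * \<bar>v' (fst W) - w' (fst (swap_times W))\<bar> * (1 + norm (Dw (fst (swap_times W))) powr (p - 1)) *
         norm (Dv (fst W) - Dw (fst (swap_times W))))"
begin

abbreviation "\<sigma> \<equiv> signed_power q"
abbreviation "I \<equiv> {0<..<T}"

lemma E_borel: "E \<in> sets borel" using E by simp

lemma S_borel: "E \<times> I \<in> sets borel" using E_borel by (intro borel_Times) auto

lemma measurable_maps[measurable]:
  "fst \<in> borel_measurable (borel :: (('a \<times> real) \<times> real) measure)"
  "snd \<in> borel_measurable (borel :: (('a \<times> real) \<times> real) measure)"
  "(\<lambda>W. snd (fst W)) \<in> borel_measurable (borel :: (('a \<times> real) \<times> real) measure)"
  "(\<lambda>W. fst (swap_times W)) \<in> borel_measurable (borel :: (('a \<times> real) \<times> real) measure)"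
  "snd \<in> borel_measurable (borel :: ('a \<times> real) measure)"
  unfolding swap_times_def by (auto intro!: borel_measurable_continuous_onI continuous_intros)

lemma measurable_data[measurable]:
  "v' \<in> borel_measurable borel" "w' \<in> borel_measurable borel" "Dv \<in> borel_measurable borel"
  "Dw \<in> borel_measurable borel" "Xv \<in> borel_measurable borel" "Xw \<in> borel_measurable borel"
  using rv rw Dv(1) Dw(1) Xv(1) Xw(1) by (simp_all add: borel_rep_def)

text \<open>Dv does not depend on the second time; the indicator makes it p-integrable over the
  domain with two times. \<open>Dw2\<close> treats Dw in the same way.\<close>

definition Dv2 :: "('a \<times> real) \<times> real \<Rightarrow> 'a" where "Dv2 W = indicator I (snd W) *\<^sub>R Dv (fst W)"
definition Dw2 :: "('a \<times> real) \<times> real \<Rightarrow> 'a" where "Dw2 W = indicator I (snd (fst W)) *\<^sub>R Dw (fst (swap_times W))"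
text \<open>The spatial gradient of H(v(x, t) - w(x, s)); it is the gradient of the test function in
  both equations.\<close>

definition Y :: "real \<Rightarrow> ('a \<times> real) \<times> real \<Rightarrow> 'a" where
  "Y d W = heavi' d (v' (fst W) - w' (fst (swap_times W))) *\<^sub>R (Dv2 W - Dw2 W)"

lemma lift_integrable:
  fixes f :: "'a \<times> real \<Rightarrow> real"
  assumes "integrable lborel f"
  shows "integrable lborel (\<lambda>W. f (fst W) * indicator I (snd W))"
    "integrable lborel (\<lambda>W. f (fst (swap_times W)) * indicator I (snd (fst W)))"
proof -
  show a: "integrable lborel (\<lambda>W. f (fst W) * indicator I (snd W))"
    by (rule product_integrable[OF assms integrable_Ioo])
  have "f \<in> borel_measurable borel" using assms borel_measurable_integrable by fastforce
  then have "(\<lambda>W. f (fst W) * indicator I (snd W)) \<in> borel_measurable (borel :: (('a \<times> real) \<times> real) measure)"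
    by measurable
  from swap_times_integrable[OF this] a
  show "integrable lborel (\<lambda>W. f (fst (swap_times W)) * indicator I (snd (fst W)))"
    by (simp add: swap_times_def)
qed

lemma D2_measurable[measurable]: "Dv2 \<in> borel_measurable borel" "Dw2 \<in> borel_measurable borel"
  unfolding Dv2_def[abs_def] Dw2_def[abs_def] by measurable

lemma D2_integrable:
  "Lp_integrable p Dv2" "Lp_integrable p Dw2"
  "Lp_integrable p (\<lambda>W. Dv2 W - Dw2 W)"
proof -
  have "norm (Dv2 W) powr p = norm (Dv (fst W)) powr p * indicator I (snd W)"
    "norm (Dw2 W) powr p = norm (Dw (fst (swap_times W))) powr p * indicator I (snd (fst W))" for W
    using p by (auto simp: Dv2_def Dw2_def indicator_def)
  then show i: "Lp_integrable p Dv2" "Lp_integrable p Dw2"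
    using lift_integrable(1)[OF Dv(3)] lift_integrable(2)[OF Dw(3)] by simp_all
  show "Lp_integrable p (\<lambda>W. Dv2 W - Dw2 W)"
    by (rule integrable_powr_diff[OF i]) (use p in auto)
qed

lemma heavi'_measurable: "d > 0 \<Longrightarrow> heavi' d \<in> borel_measurable borel"
  using heavi'_continuous by (rule borel_measurable_continuous_onI)

lemma Y_measurable: "d > 0 \<Longrightarrow> Y d \<in> borel_measurable borel"
proof -
  assume "d > 0"
  note [measurable] = heavi'_measurable[OF this]
  show ?thesis unfolding Y_def[abs_def] by measurable
qed

lemma Y_integrable:
  assumes d: "d > 0" shows "Lp_integrable p (\<lambda>W. Y d W)"
proof (rule integrable_powr_bound[where g="\<lambda>W. (1 + 1 / d) *\<^sub>R (Dv2 W - Dw2 W)"])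
  have "1 + 1 / d \<ge> 0" using d by (simp add: add_nonneg_nonneg)
  then show "Lp_integrable p (\<lambda>W. (1 + 1 / d) *\<^sub>R (Dv2 W - Dw2 W))"
    using D2_integrable(3) by (simp add: powr_mult)
  show "Y d \<in> borel_measurable lborel" using Y_measurable[OF d] by simp
  show "AE W in lborel. norm (Y d W) \<le> norm ((1 + 1 / d) *\<^sub>R (Dv2 W - Dw2 W))"
  proof (rule AE_I2)
    fix W
    have "\<bar>heavi' d (v' (fst W) - w' (fst (swap_times W)))\<bar> \<le> \<bar>1 + 1 / d\<bar>"
      using heavi_bounds(4)[OF d] by (rule order_trans) simp
    then show "norm (Y d W) \<le> norm ((1 + 1 / d) *\<^sub>R (Dv2 W - Dw2 W))"
      by (simp add: Y_def mult_right_mono)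
  qed
qed (use p in simp)

lemma zv_slice: "t \<in> {0..T} \<Longrightarrow> integrable (lebesgue_on E) (\<lambda>x. \<sigma> (v (x, t)))"
  and zw_slice: "t \<in> {0..T} \<Longrightarrow> integrable (lebesgue_on E) (\<lambda>x. \<sigma> (w (x, t)))"
  using zv zw by (auto simp: L1_curve_def)

lemma slice_measurable:
  assumes "t \<in> {0..T}"
  shows "(\<lambda>x. v (x, t)) \<in> borel_measurable (lebesgue_on E)" "(\<lambda>x. w (x, t)) \<in> borel_measurable (lebesgue_on E)"
proof -
  have [measurable]: "signed_power (1 / q) \<in> borel_measurable borel"
    using q by (intro borel_measurable_continuous_onI signed_power_continuous) simp
  have [measurable]: "(\<lambda>x. \<sigma> (v (x, t))) \<in> borel_measurable (lebesgue_on E)" "(\<lambda>x. \<sigma> (w (x, t))) \<in> borel_measurable (lebesgue_on E)"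
    using zv_slice[OF assms] zw_slice[OF assms] by auto
  have "(\<lambda>x. signed_power (1 / q) (\<sigma> (v (x, t)))) \<in> borel_measurable (lebesgue_on E)"
    "(\<lambda>x. signed_power (1 / q) (\<sigma> (w (x, t)))) \<in> borel_measurable (lebesgue_on E)" by measurable
  then show "(\<lambda>x. v (x, t)) \<in> borel_measurable (lebesgue_on E)" "(\<lambda>x. w (x, t)) \<in> borel_measurable (lebesgue_on E)"
    by (simp_all add: signed_power_inverse[OF q])
qed

text \<open>Both orders of the quantifiers occur, as the equation of v is tested for fixed s and
  that of w for fixed t. Each follows from conditions on s alone and on t alone, so no exceptional
  set of pairs has to be measured.\<close>

lemma admissible:
  assumes d: "d > 0"
  defines "adm s t \<equiv> \<exists>\<phi>. W0 E p \<phi> (\<lambda>x. Y d ((x, t), s)) \<and> (\<forall>x. \<bar>\<phi> x\<bar> \<le> 1) \<and>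
    borel_rep E (\<lambda>x. heavi d (v (x, t) - w (x, s))) \<phi>"
  shows "AE s in lborel. AE t in lborel. s \<in> I \<longrightarrow> t \<in> I \<longrightarrow> adm s t"
    "AE t in lborel. AE s in lborel. s \<in> I \<longrightarrow> t \<in> I \<longrightarrow> adm s t"
proof -
  have hm[measurable]: "heavi d \<in> borel_measurable borel"
    by (rule borel_measurable_continuous_onI[OF heavi_continuous[OF d]])
  have *: "adm s t"
    if ts: "s \<in> I" "t \<in> I" and v1: "W0 E p (\<lambda>x. v' (x, t)) (\<lambda>x. Dv (x, t))"
      and w1: "wgrad E (\<lambda>x. w' (x, s)) (\<lambda>x. Dw (x, s))" "Lp_integrable p (\<lambda>x. w' (x, s))" "Lp_integrable p (\<lambda>x. Dw (x, s))"
      and v2: "borel_rep E (\<lambda>x. v (x, t)) (\<lambda>x. v' (x, t))" and w2: "borel_rep E (\<lambda>x. w (x, s)) (\<lambda>x. w' (x, s))" for s t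
    unfolding adm_def
  proof (intro exI conjI allI)
    have "W0 E p (\<lambda>x. heavi d (v' (x, t) - w' (x, s))) (\<lambda>x. heavi' d (v' (x, t) - w' (x, s)) *\<^sub>R (Dv (x, t) - Dw (x, s)))"
      by (rule W0_compose_diff[OF E(1) _ v1 w1 w'0 heavi_deriv[OF d] heavi'_continuous[OF d] heavi_bounds(4)[OF d] heavi_neg])
        (use p in auto)
    moreover have "(\<lambda>x. heavi' d (v' (x, t) - w' (x, s)) *\<^sub>R (Dv (x, t) - Dw (x, s))) = (\<lambda>x. Y d ((x, t), s))"
      using ts by (simp add: Y_def Dv2_def Dw2_def swap_times_def fun_eq_iff)
    ultimately show "W0 E p (\<lambda>x. heavi d (v' (x, t) - w' (x, s))) (\<lambda>x. Y d ((x, t), s))" by simp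
    show "\<bar>heavi d (v' (x, t) - w' (x, s))\<bar> \<le> 1" for x
      using heavi_bounds(1,2)[OF d, of "v' (x, t) - w' (x, s)"] by (simp add: abs_le_iff)
    show "borel_rep E (\<lambda>x. heavi d (v (x, t) - w (x, s))) (\<lambda>x. heavi d (v' (x, t) - w' (x, s)))"
      by (rule borel_rep_map[OF borel_rep_diff[OF v2 w2] hm heavi_neg(1)]) simp
  qed
  have gv: "AE t in lborel. t \<in> I \<longrightarrow> W0 E p (\<lambda>x. v' (x, t)) (\<lambda>x. Dv (x, t)) \<and> borel_rep E (\<lambda>x. v (x, t)) (\<lambda>x. v' (x, t))"
    using vW borel_rep_slices[OF rv] by eventually_elim auto
  have gw: "AE s in lborel. s \<in> I \<longrightarrow> wgrad E (\<lambda>x. w' (x, s)) (\<lambda>x. Dw (x, s)) \<and>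
      Lp_integrable p (\<lambda>x. w' (x, s)) \<and> Lp_integrable p (\<lambda>x. Dw (x, s)) \<and> borel_rep E (\<lambda>x. w (x, s)) (\<lambda>x. w' (x, s))"
    using wW borel_rep_slices[OF rw] by eventually_elim auto
  show "AE s in lborel. AE t in lborel. s \<in> I \<longrightarrow> t \<in> I \<longrightarrow> adm s t"
    using gw
  proof eventually_elim
    case (elim s)
    from gv show ?case by eventually_elim (use elim * in blast)
  qed
  show "AE t in lborel. AE s in lborel. s \<in> I \<longrightarrow> t \<in> I \<longrightarrow> adm s t"
    using gv
  proof eventually_elim
    case (elim t)
    from gw show ?case by eventually_elim (use elim * in blast)
  qed
qed

definition fB :: "real \<Rightarrow> real \<Rightarrow> real \<Rightarrow> real" where
  "fB d t s = (LINT x|lebesgue_on E. excess q (heavi d) (\<sigma> (v (x, t))) (w (x, s)))"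
text \<open>The equation of w is read as one for -w, with -b(w) = b(-w) and level -v(.,t). The
  argument of the cutoff becomes v - w, so both equations receive the same test function, with
  opposite signs of the flux.\<close>

definition fD :: "real \<Rightarrow> real \<Rightarrow> real \<Rightarrow> real" where
  "fD d t s = (LINT x|lebesgue_on E. excess q (heavi d) (- \<sigma> (w (x, s))) (- v (x, t)))"

lemma energy_v:
  assumes d: "d > 0" and t: "0 \<le> t1" "t1 \<le> t2" "t2 < T"
  shows "AE s in lborel. s \<in> I \<longrightarrow> fB d t2 s - fB d t1 s \<le>
    - (LINT z|lborel. indicator {t1<..<t2} (snd z) * (Xv z \<bullet> Y d (z, s)))"
  using admissible(1)[OF d] lborel_Fubini(2)[OF Y_integrable[OF d]]
proof eventually_elim
  case (elim s)
  interpret cutoff_function "heavi d" q by (rule heavi_cutoff[OF d q])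
  show ?case
  proof
    assume s: "s \<in> I"
    then have s': "s \<in> {0..T}" by simp
    show "fB d t2 s - fB d t1 s \<le> - (LINT z|lborel. indicator {t1<..<t2} (snd z) * (Xv z \<bullet> Y d (z, s)))"
      unfolding fB_def
    proof (rule energy_inequality(1)[where z="\<lambda>z. \<sigma> (v z)" and k="\<lambda>x. w (x, s)" and Y="\<lambda>z. Y d (z, s)", OF E(1) p zv Xv(1,2) weak_v _ _ _ _ _ t])
      show "(\<lambda>x. w (x, s)) \<in> borel_measurable (lebesgue_on E)" by (rule slice_measurable(2)[OF s'])
      show "integrable (lebesgue_on E) (\<lambda>x. \<sigma> (w (x, s)))" by (rule zw_slice[OF s'])
      show "(\<lambda>z. Y d (z, s)) \<in> borel_measurable borel" by (rule borel_slice[OF Y_measurable[OF d]])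
      show "Lp_integrable p (\<lambda>w. Y d (w, s))" by (rule elim(2))
      show "AE t in lborel. t \<in> I \<longrightarrow> (\<exists>\<phi>. W0 E p \<phi> (\<lambda>x. Y d ((x, t), s)) \<and> (\<forall>x. \<bar>\<phi> x\<bar> \<le> 1) \<and>
          borel_rep E (\<lambda>x. heavi d (signed_power (1 / q) (\<sigma> (v (x, t))) - w (x, s))) \<phi>)"
        using elim(1) s by (simp add: signed_power_inverse[OF q])
    qed
  qed
qed

lemma energy_w:
  assumes d: "d > 0" and t: "0 \<le> t1" "t1 \<le> t2" "t2 < T"
  shows "AE t in lborel. t \<in> I \<longrightarrow> fD d t t2 - fD d t t1 \<le>
    (LINT z|lborel. indicator {t1<..<t2} (snd z) * (Xw z \<bullet> Y d (swap_times (z, t))))"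
proof -
  have Ym: "(\<lambda>W. Y d (swap_times W)) \<in> borel_measurable borel"
    by (rule measurable_compose[OF swap_times_measurable Y_measurable[OF d]])
  have Yn: "(\<lambda>W. norm (Y d W) powr p) \<in> borel_measurable borel" using Y_measurable[OF d] by measurable
  have Yi: "Lp_integrable p (\<lambda>W. Y d (swap_times W))"
    using swap_times_integrable[OF Yn] Y_integrable[OF d] by simp
  show ?thesis
    using admissible(2)[OF d] lborel_Fubini(2)[OF Yi]
  proof eventually_elim
    case (elim t)
    interpret cutoff_function "heavi d" q by (rule heavi_cutoff[OF d q])
    show ?case
    proof
      assume tI: "t \<in> I"
      then have t': "t \<in> {0..T}" by simp
      have zw': "L1_curve T E (\<lambda>z. - \<sigma> (w z))" using zw unfolding L1_curve_def by (auto simp: abs_minus_commute)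
      have Xw': "(\<lambda>z. - Xw z) \<in> borel_measurable borel" "Lp_integrable (p / (p - 1)) (\<lambda>z. - Xw z)"
        using Xw by auto
      have "fD d t t2 - fD d t t1 \<le> - (LINT z|lborel. indicator {t1<..<t2} (snd z) * ((- Xw z) \<bullet> Y d (swap_times (z, t))))"
        unfolding fD_def
      proof (rule energy_inequality(1)[where z="\<lambda>z. - \<sigma> (w z)" and k="\<lambda>x. - v (x, t)" and Y="\<lambda>z. Y d (swap_times (z, t))", OF E(1) p zw' Xw' _ _ _ _ _ _ t])
        fix \<phi> G s1 s2 assume h: "W0 E p \<phi> G" "\<And>x. \<bar>\<phi> x\<bar> \<le> 1" "0 \<le> s1" "s1 \<le> s2" "s2 < T"
        have "(LINT x|lebesgue_on E. (- \<sigma> (w (x, s2)) - - \<sigma> (w (x, s1))) * \<phi> x) = (LINT x|lebesgue_on E. - ((\<sigma> (w (x, s2)) - \<sigma> (w (x, s1))) * \<phi> x))"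
          by (intro Bochner_Integration.integral_cong) (auto simp: algebra_simps)
        also have "\<dots> = - (LINT x|lebesgue_on E. (\<sigma> (w (x, s2)) - \<sigma> (w (x, s1))) * \<phi> x)" by simp
        also have "\<dots> = (LINT z|lborel. indicator {s1<..s2} (snd z) * (Xw z \<bullet> G (fst z)))" by (simp only: weak_w[OF h] minus_minus)
        also have "\<dots> = - (LINT z|lborel. indicator {s1<..s2} (snd z) * (- Xw z \<bullet> G (fst z)))" by simp
        finally show "(LINT x|lebesgue_on E. (- \<sigma> (w (x, s2)) - - \<sigma> (w (x, s1))) * \<phi> x) =
          - (LINT z|lborel. indicator {s1<..s2} (snd z) * (- Xw z \<bullet> G (fst z)))" .
      next
        show "(\<lambda>x. - v (x, t)) \<in> borel_measurable (lebesgue_on E)" using slice_measurable(1)[OF t'] by simp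
        show "integrable (lebesgue_on E) (\<lambda>x. \<sigma> (- v (x, t)))" using zv_slice[OF t'] by (simp add: signed_power_uminus)
        show "(\<lambda>z. Y d (swap_times (z, t))) \<in> borel_measurable borel" by (rule borel_slice[OF Ym])
        show "Lp_integrable p (\<lambda>w. Y d (swap_times (w, t)))" by (rule elim(2))
        have e: "signed_power (1 / q) (- \<sigma> (w z)) - - v z' = v z' - w z" for z z'
          by (simp add: signed_power_uminus signed_power_inverse[OF q])
        show "AE s in lborel. s \<in> I \<longrightarrow> (\<exists>\<phi>. W0 E p \<phi> (\<lambda>x. Y d (swap_times ((x, s), t))) \<and> (\<forall>x. \<bar>\<phi> x\<bar> \<le> 1) \<and>
            borel_rep E (\<lambda>x. heavi d (signed_power (1 / q) (- \<sigma> (w (x, s))) - - v (x, t))) \<phi>)"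
          using elim(1) tI unfolding e by (simp add: swap_times_def)
      qed
      then show "fD d t t2 - fD d t t1 \<le> (LINT z|lborel. indicator {t1<..<t2} (snd z) * (Xw z \<bullet> Y d (swap_times (z, t))))" by simp
    qed
  qed
qed

definition F :: "real \<Rightarrow> real \<Rightarrow> real" where
  "F t s = (LINT x|lebesgue_on E. max 0 (\<sigma> (v (x, t)) - \<sigma> (w (x, s))))"

lemma F_integrable:
  assumes "t \<in> {0..T}" "s \<in> {0..T}"
  shows "integrable (lebesgue_on E) (\<lambda>x. max 0 (\<sigma> (v (x, t)) - \<sigma> (w (x, s))))"
  using zv_slice[OF assms(1)] zw_slice[OF assms(2)] by (intro integrable_max) auto

lemma F_lipschitz:
  assumes t: "t \<in> {0..T}" "t' \<in> {0..T}" and s: "s \<in> {0..T}" "s' \<in> {0..T}"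
  shows "\<bar>F t s - F t' s'\<bar> \<le> (LINT x|lebesgue_on E. \<bar>\<sigma> (v (x, t)) - \<sigma> (v (x, t'))\<bar>) + (LINT x|lebesgue_on E. \<bar>\<sigma> (w (x, s)) - \<sigma> (w (x, s'))\<bar>)"
proof -
  have i: "integrable (lebesgue_on E) (\<lambda>x. \<bar>\<sigma> (v (x, t)) - \<sigma> (v (x, t'))\<bar>)" "integrable (lebesgue_on E) (\<lambda>x. \<bar>\<sigma> (w (x, s)) - \<sigma> (w (x, s'))\<bar>)"
    using zv_slice t zw_slice s by auto
  have "\<bar>F t s - F t' s'\<bar> = \<bar>\<integral>x. max 0 (\<sigma> (v (x, t)) - \<sigma> (w (x, s))) - max 0 (\<sigma> (v (x, t')) - \<sigma> (w (x, s'))) \<partial>lebesgue_on E\<bar>"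
    unfolding F_def using F_integrable t s by simp
  also have "\<dots> \<le> (LINT x|lebesgue_on E. \<bar>\<sigma> (v (x, t)) - \<sigma> (v (x, t'))\<bar> + \<bar>\<sigma> (w (x, s)) - \<sigma> (w (x, s'))\<bar>)"
    unfolding real_norm_def[symmetric]
  proof (intro order_trans[OF integral_norm_bound] integral_mono)
    show "integrable (lebesgue_on E) (\<lambda>x. norm (max 0 (\<sigma> (v (x, t)) - \<sigma> (w (x, s))) - max 0 (\<sigma> (v (x, t')) - \<sigma> (w (x, s')))))"
      by (intro integrable_norm Bochner_Integration.integrable_diff F_integrable t s)
    show "integrable (lebesgue_on E) (\<lambda>x. norm (\<sigma> (v (x, t)) - \<sigma> (v (x, t'))) + norm (\<sigma> (w (x, s)) - \<sigma> (w (x, s'))))"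
      using i by simp
    show "norm (max 0 (\<sigma> (v (x, t)) - \<sigma> (w (x, s))) - max 0 (\<sigma> (v (x, t')) - \<sigma> (w (x, s')))) \<le>
      norm (\<sigma> (v (x, t)) - \<sigma> (v (x, t'))) + norm (\<sigma> (w (x, s)) - \<sigma> (w (x, s')))" for x
      by (auto simp: max_def)
  qed
  also have "\<dots> = (LINT x|lebesgue_on E. \<bar>\<sigma> (v (x, t)) - \<sigma> (v (x, t'))\<bar>) + (LINT x|lebesgue_on E. \<bar>\<sigma> (w (x, s)) - \<sigma> (w (x, s'))\<bar>)"
    using i by simp
  finally show ?thesis .
qed

lemma F_continuous: "continuous_on ({0..T} \<times> {0..T}) (\<lambda>(t, s). F t s)"
  unfolding continuous_on_def
proof (intro ballI)
  fix z assume "z \<in> {0..T} \<times> {0..T}"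
  then obtain t s where z: "z = (t, s)" "t \<in> {0..T}" "s \<in> {0..T}" by auto
  let ?A = "at (t, s) within {0..T} \<times> {0..T}"
  let ?f = "\<lambda>t'. LINT x|lebesgue_on E. \<bar>\<sigma> (v (x, t')) - \<sigma> (v (x, t))\<bar>" and ?g = "\<lambda>s'. LINT x|lebesgue_on E. \<bar>\<sigma> (w (x, s')) - \<sigma> (w (x, s))\<bar>"
  have f: "(?f \<longlongrightarrow> ?f t) (at t within {0..T})" and g: "(?g \<longlongrightarrow> ?g s) (at s within {0..T})"
    using zv zw z by (auto simp: L1_curve_def)
  have "continuous (at t within {0..T}) ?f" "continuous (at s within {0..T}) ?g" using f g by (simp_all add: continuous_within)
  moreover have im: "fst ` ({0..T} \<times> {0..T}) = {0..T}" "snd ` ({0..T} \<times> {0..T}) = {0..T}" using T by auto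
  ultimately have c: "continuous (at (fst (t, s)) within fst ` ({0..T} \<times> {0..T})) ?f"
    "continuous (at (snd (t, s)) within snd ` ({0..T} \<times> {0..T})) ?g" by (simp_all only: im fst_conv snd_conv)
  have "continuous ?A (\<lambda>y. ?f (fst y))" "continuous ?A (\<lambda>y. ?g (snd y))"
    by (rule continuous_within_compose2[OF continuous_fst[OF continuous_ident] c(1)])
      (rule continuous_within_compose2[OF continuous_snd[OF continuous_ident] c(2)])
  then have "((\<lambda>y. ?f (fst y)) \<longlongrightarrow> ?f t) ?A" "((\<lambda>y. ?g (snd y)) \<longlongrightarrow> ?g s) ?A"
    unfolding continuous_within by simp_all
  then have "((\<lambda>y. ?f (fst y) + ?g (snd y)) \<longlongrightarrow> 0) ?A" by (intro tendsto_eq_intros) auto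
  then have "((\<lambda>y. F (fst y) (snd y) - F t s) \<longlongrightarrow> 0) ?A"
  proof (rule Lim_null_comparison[rotated])
    show "\<forall>\<^sub>F y in ?A. norm (F (fst y) (snd y) - F t s) \<le> ?f (fst y) + ?g (snd y)"
      unfolding eventually_at_filter using F_lipschitz z by (intro always_eventually) (auto simp: mem_Times_iff)
  qed
  then show "((\<lambda>(t, s). F t s) \<longlongrightarrow> (case z of (t, s) \<Rightarrow> F t s)) (at z within {0..T} \<times> {0..T})"
    by (simp add: z LIM_zero_iff case_prod_unfold)
qed

text \<open>Both excess integrals have the same limit: for \<open>fD\<close> the two sign changes
  cancel in the positive part. The bounds are uniform in n and become majorants for the integration
  in time.\<close>

lemma fB_tendsto:
  assumes t: "t \<in> {0..T}" and s: "s \<in> {0..T}"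
  shows "(\<lambda>n. fB (1 / real (Suc n)) t s) \<longlonglongrightarrow> F t s" "(\<lambda>n. fD (1 / real (Suc n)) t s) \<longlonglongrightarrow> F t s"
    and "\<bar>fB (1 / real (Suc n)) t s\<bar> \<le> (LINT x|lebesgue_on E. \<bar>\<sigma> (v (x, t))\<bar>) + (LINT x|lebesgue_on E. \<bar>\<sigma> (w (x, s))\<bar>)"
    and "\<bar>fD (1 / real (Suc n)) t s\<bar> \<le> (LINT x|lebesgue_on E. \<bar>\<sigma> (v (x, t))\<bar>) + (LINT x|lebesgue_on E. \<bar>\<sigma> (w (x, s))\<bar>)"
proof -
  have d: "1 / real (Suc n) > 0" for n by simp
  note c = heavi_cutoff[OF d q]
  note sm = slice_measurable(1)[OF t] slice_measurable(2)[OF s]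
  have bm: "(\<lambda>x. \<sigma> (v (x, t))) \<in> borel_measurable (lebesgue_on E)" "(\<lambda>x. - \<sigma> (w (x, s))) \<in> borel_measurable (lebesgue_on E)"
    using zv_slice[OF t] zw_slice[OF s] by auto
  have i: "integrable (lebesgue_on E) (\<lambda>x. \<bar>\<sigma> (v (x, t))\<bar> + \<bar>\<sigma> (w (x, s))\<bar>)" using zv_slice[OF t] zw_slice[OF s] by simp
  have m1: "(\<lambda>x. excess q (heavi (1 / real (Suc n))) (\<sigma> (v (x, t))) (w (x, s))) \<in> borel_measurable (lebesgue_on E)" for n
    by (rule cutoff_function.excess_measurable[OF c bm(1) sm(2)])
  have m2: "(\<lambda>x. excess q (heavi (1 / real (Suc n))) (- \<sigma> (w (x, s))) (- v (x, t))) \<in> borel_measurable (lebesgue_on E)" for n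
    by (rule cutoff_function.excess_measurable[OF c bm(2)]) (use sm in simp)
  have b1: "\<bar>excess q (heavi (1 / real (Suc n))) (\<sigma> (v (x, t))) (w (x, s))\<bar> \<le> \<bar>\<sigma> (v (x, t))\<bar> + \<bar>\<sigma> (w (x, s))\<bar>" for n x
    by (rule cutoff_function.excess_bound[OF c])
  have b2: "\<bar>excess q (heavi (1 / real (Suc n))) (- \<sigma> (w (x, s))) (- v (x, t))\<bar> \<le> \<bar>\<sigma> (v (x, t))\<bar> + \<bar>\<sigma> (w (x, s))\<bar>" for n x
    using cutoff_function.excess_bound[OF c, of n "- \<sigma> (w (x, s))" "- v (x, t)"] by (simp add: signed_power_uminus)
  have mm: "(\<lambda>x. max 0 (\<sigma> (v (x, t)) - \<sigma> (w (x, s)))) \<in> borel_measurable (lebesgue_on E)" using F_integrable[OF t s] by auto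
  show "(\<lambda>n. fB (1 / real (Suc n)) t s) \<longlonglongrightarrow> F t s"
    unfolding fB_def F_def
    by (rule integral_dominated_convergence[OF mm m1 i]) (use b1 excess_heavi_tendsto[OF q] in auto)
  have "(\<lambda>n. excess q (heavi (1 / real (Suc n))) (- \<sigma> (w (x, s))) (- v (x, t))) \<longlonglongrightarrow> max 0 (\<sigma> (v (x, t)) - \<sigma> (w (x, s)))" for x
    using excess_heavi_tendsto[OF q, of "- \<sigma> (w (x, s))" "- v (x, t)"] by (simp add: signed_power_uminus)
  then show "(\<lambda>n. fD (1 / real (Suc n)) t s) \<longlonglongrightarrow> F t s"
    unfolding fD_def F_def
    by (intro integral_dominated_convergence[OF mm m2 i]) (use b2 in auto)
  have e: "(LINT x|lebesgue_on E. \<bar>\<sigma> (v (x, t))\<bar> + \<bar>\<sigma> (w (x, s))\<bar>) = (LINT x|lebesgue_on E. \<bar>\<sigma> (v (x, t))\<bar>) + (LINT x|lebesgue_on E. \<bar>\<sigma> (w (x, s))\<bar>)"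
    using zv_slice[OF t] zw_slice[OF s] by simp
  show "\<bar>fB (1 / real (Suc n)) t s\<bar> \<le> (LINT x|lebesgue_on E. \<bar>\<sigma> (v (x, t))\<bar>) + (LINT x|lebesgue_on E. \<bar>\<sigma> (w (x, s))\<bar>)"
    unfolding fB_def real_norm_def[symmetric] unfolding e[unfolded real_norm_def[symmetric], symmetric]
  proof (intro order_trans[OF integral_norm_bound] integral_mono)
    show "integrable (lebesgue_on E) (\<lambda>x. norm (excess q (heavi (1 / real (Suc n))) (\<sigma> (v (x, t))) (w (x, s))))"
      by (rule Bochner_Integration.integrable_bound[OF i]) (use m1[of n] b1[of n] in auto)
  qed (use i b1[of n] in auto)
  show "\<bar>fD (1 / real (Suc n)) t s\<bar> \<le> (LINT x|lebesgue_on E. \<bar>\<sigma> (v (x, t))\<bar>) + (LINT x|lebesgue_on E. \<bar>\<sigma> (w (x, s))\<bar>)"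
    unfolding fD_def real_norm_def[symmetric] unfolding e[unfolded real_norm_def[symmetric], symmetric]
  proof (intro order_trans[OF integral_norm_bound] integral_mono)
    show "integrable (lebesgue_on E) (\<lambda>x. norm (excess q (heavi (1 / real (Suc n))) (- \<sigma> (w (x, s))) (- v (x, t))))"
      by (rule Bochner_Integration.integrable_bound[OF i]) (use m2[of n] b2[of n] in auto)
  qed (use i b2[of n] in auto)
qed

text \<open>
  The curves $s \mapsto$ \<open>fB d t s\<close> are only almost everywhere equal to Borel functions, so the
  energy inequalities are integrated for Borel representatives.
\<close>

lemma excess_curve_Borel:
  assumes d: "d > 0" and f: "f \<in> borel_measurable (lebesgue_on E)" and k: "borel_rep (E \<times> I) k k'"
  obtains g where "g \<in> borel_measurable borel"
    "AE s in lborel. s \<in> I \<longrightarrow> g s = (LINT x|lebesgue_on E. excess q (heavi d) (f x) (k (x, s)))"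
proof -
  interpret cutoff_function "heavi d" q by (rule heavi_cutoff[OF d q])
  obtain f' where f': "borel_rep E f f'" using borel_rep_exists[OF f E_borel] by blast
  have fm: "f' \<in> borel_measurable borel" and km: "k' \<in> borel_measurable borel" using f' k by (auto simp: borel_rep_def)
  show ?thesis
  proof (rule that[OF excess_integral_measurable[OF fm km]])
    show "AE s in lborel. s \<in> I \<longrightarrow> (LINT x|lborel. excess q (heavi d) (f' x) (k' (x, s))) =
      (LINT x|lebesgue_on E. excess q (heavi d) (f x) (k (x, s)))"
      using borel_rep_slices[OF k]
    proof eventually_elim
      case (elim s)
      show ?case
      proof
        assume "s \<in> I"
        with elim have r: "borel_rep E (\<lambda>x. k (x, s)) (\<lambda>x. k' (x, s))" by simp
        have "borel_rep E (\<lambda>x. excess q (heavi d) (f x) (k (x, s))) (\<lambda>x. excess q (heavi d) (f' x) (k' (x, s)))"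
          unfolding borel_rep_def
        proof (intro conjI allI impI)
          show "(\<lambda>x. excess q (heavi d) (f' x) (k' (x, s))) \<in> borel_measurable borel"
            by (rule excess_measurable[OF fm borel_slice[OF km]])
          show "excess q (heavi d) (f' x) (k' (x, s)) = 0" if "x \<notin> E" for x
            using f' r that excess_at[of 0] by (simp add: borel_rep_def)
          have "AE x in lborel. x \<in> E \<longrightarrow> f x = f' x" "AE x in lborel. x \<in> E \<longrightarrow> k (x, s) = k' (x, s)"
            using f' r by (auto simp: borel_rep_def)
          then show "AE x in lborel. x \<in> E \<longrightarrow> excess q (heavi d) (f x) (k (x, s)) = excess q (heavi d) (f' x) (k' (x, s))"
            by eventually_elim auto
        qed
        from borel_rep_integral[OF this E_borel]
        show "(LINT x|lborel. excess q (heavi d) (f' x) (k' (x, s))) = (LINT x|lebesgue_on E. excess q (heavi d) (f x) (k (x, s)))" by simp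
      qed
    qed
  qed
qed

lemma fB_Borel:
  assumes "d > 0" and t: "t \<in> {0..T}"
  obtains g where "g \<in> borel_measurable borel" "AE s in lborel. s \<in> I \<longrightarrow> g s = fB d t s"
  unfolding fB_def by (rule excess_curve_Borel[OF assms(1) borel_measurable_integrable[OF zv_slice[OF t]] rw])

lemma fD_Borel:
  assumes "d > 0" and s: "s \<in> {0..T}"
  obtains g where "g \<in> borel_measurable borel" "AE t in lborel. t \<in> I \<longrightarrow> g t = fD d t s"
  unfolding fD_def
  by (rule excess_curve_Borel[OF assms(1) borel_measurable_uminus[OF borel_measurable_integrable[OF zw_slice[OF s]]] borel_rep_uminus[OF rv]])

end

section \<open>Energy inequalities integrated over a square of times, and the limit of the
  cutoff\<close>

context doubling
begin

definition gv :: "real \<Rightarrow> real \<Rightarrow> real \<Rightarrow> ('a \<times> real) \<times> real \<Rightarrow> real" where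
  "gv a c d W = indicator {a<..<c} (snd W) * (indicator {a<..<c} (snd (fst W)) * (Xv (fst W) \<bullet> Y d W))"
definition gw :: "real \<Rightarrow> real \<Rightarrow> real \<Rightarrow> ('a \<times> real) \<times> real \<Rightarrow> real" where
  "gw a c d W = indicator {a<..<c} (snd W) * (indicator {a<..<c} (snd (fst W)) * (Xw (fst (swap_times W)) \<bullet> Y d W))"

lemma pairing_integrable:
  assumes d: "d > 0" and t: "0 \<le> a" "c < T"
  shows "integrable lborel (gv a c d)" "integrable lborel (gw a c d)"
proof -
  have pq: "p / (p - 1) > 0" using p by simp
  note [measurable] = Y_measurable[OF d]
  define V where "V W = indicator I (snd W) *\<^sub>R Xv (fst W)" for W :: "('a \<times> real) \<times> real"
  define Z where "Z W = indicator I (snd (fst W)) *\<^sub>R Xw (fst (swap_times W))" for W :: "('a \<times> real) \<times> real"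
  have [measurable]: "V \<in> borel_measurable borel" "Z \<in> borel_measurable borel"
    unfolding V_def[abs_def] Z_def[abs_def] by measurable
  have e: "norm (V W) powr (p / (p - 1)) = norm (Xv (fst W)) powr (p / (p - 1)) * indicator I (snd W)"
    "norm (Z W) powr (p / (p - 1)) = norm (Xw (fst (swap_times W))) powr (p / (p - 1)) * indicator I (snd (fst W))" for W
    using pq by (auto simp: V_def Z_def indicator_def)
  have "Lp_integrable (p / (p - 1)) V" "Lp_integrable (p / (p - 1)) Z"
    unfolding e using lift_integrable(1)[OF Xv(2)] lift_integrable(2)[OF Xw(2)] by simp_all
  then have i: "integrable lborel (\<lambda>W. V W \<bullet> Y d W)" "integrable lborel (\<lambda>W. Z W \<bullet> Y d W)"
    by (auto intro!: Young_integrable(1)[OF p _ _ _ Y_integrable[OF d]])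
  have A: "{W. snd W \<in> {a<..<c} \<and> snd (fst W) \<in> {a<..<c}} \<in> sets (borel :: (('a \<times> real) \<times> real) measure)"
    by measurable
  have eq: "gv a c d W = indicator {W. snd W \<in> {a<..<c} \<and> snd (fst W) \<in> {a<..<c}} W *\<^sub>R (V W \<bullet> Y d W)"
    "gw a c d W = indicator {W. snd W \<in> {a<..<c} \<and> snd (fst W) \<in> {a<..<c}} W *\<^sub>R (Z W \<bullet> Y d W)" for W
    using t by (auto simp: gv_def gw_def V_def Z_def indicator_def)
  have A': "{W. snd W \<in> {a<..<c} \<and> snd (fst W) \<in> {a<..<c}} \<in> sets (lborel :: (('a \<times> real) \<times> real) measure)"
    using A by (simp only: sets_lborel)
  have "integrable lborel (\<lambda>W. gv a c d W)" "integrable lborel (\<lambda>W. gw a c d W)"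
    unfolding eq by (rule integrable_mult_indicator[OF A' i(1)]) (rule integrable_mult_indicator[OF A' i(2)])
  then show "integrable lborel (gv a c d)" "integrable lborel (gw a c d)" by simp_all
qed

lemma excess_bounded:
  obtains M where "M \<ge> 0"
    "\<And>n t s. t \<in> {0..T} \<Longrightarrow> s \<in> {0..T} \<Longrightarrow> \<bar>fB (1 / real (Suc n)) t s\<bar> \<le> M"
    "\<And>n t s. t \<in> {0..T} \<Longrightarrow> s \<in> {0..T} \<Longrightarrow> \<bar>fD (1 / real (Suc n)) t s\<bar> \<le> M"
proof -
  obtain M1 where M1: "M1 \<ge> 0" "\<And>t. t \<in> {0..T} \<Longrightarrow> (LINT x|lebesgue_on E. \<bar>\<sigma> (v (x, t))\<bar>) \<le> M1"
    using L1_curve_bounded[OF zv] by blast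
  obtain M2 where M2: "M2 \<ge> 0" "\<And>t. t \<in> {0..T} \<Longrightarrow> (LINT x|lebesgue_on E. \<bar>\<sigma> (w (x, t))\<bar>) \<le> M2"
    using L1_curve_bounded[OF zw] by blast
  show ?thesis
  proof (rule that[of "M1 + M2"])
    fix n t s assume h: "t \<in> {0..T}" "s \<in> {0..T}"
    show "\<bar>fB (1 / real (Suc n)) t s\<bar> \<le> M1 + M2" by (rule order_trans[OF fB_tendsto(3)[OF h] add_mono[OF M1(2)[OF h(1)] M2(2)[OF h(2)]]])
    show "\<bar>fD (1 / real (Suc n)) t s\<bar> \<le> M1 + M2" by (rule order_trans[OF fB_tendsto(4)[OF h] add_mono[OF M1(2)[OF h(1)] M2(2)[OF h(2)]]])
  qed (use M1 M2 in simp)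
qed

text \<open>f itself need not be measurable, so its integral over (a, c) is expressed by a
  measurable g that agrees with it almost everywhere; h supplies this version.\<close>

lemma integrated_bound:
  fixes f :: "real \<Rightarrow> real" and K :: "('a \<times> real) \<times> real \<Rightarrow> real"
  assumes Q: "0 \<le> a" "c < T" and M: "\<And>s. s \<in> {a<..<c} \<Longrightarrow> \<bar>f s\<bar> \<le> M"
    and h: "h \<in> borel_measurable borel" "AE s in lborel. s \<in> I \<longrightarrow> h s = f s"
    and K: "integrable lborel K" "\<And>z s. s \<notin> {a<..<c} \<Longrightarrow> K (z, s) = 0"
    and le: "AE s in lborel. s \<in> {a<..<c} \<longrightarrow> f s \<le> (LINT z|lborel. K (z, s))"
  shows "\<exists>g. integrable lborel g \<and> (AE s in lborel. g s = indicator {a<..<c} s * f s) \<and>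
    (LINT s|lborel. g s) \<le> (LINT W|lborel. K W)"
proof -
  define g where "g s = indicator {a<..<c} s * h s" for s
  have gm: "g \<in> borel_measurable lborel" unfolding g_def[abs_def] using h(1) by measurable
  have ge: "AE s in lborel. g s = indicator {a<..<c} s * f s"
    using h(2) by eventually_elim (use Q in \<open>auto simp: g_def indicator_def\<close>)
  have gi: "integrable lborel g"
  proof (rule Bochner_Integration.integrable_bound[OF _ gm])
    show "integrable lborel (\<lambda>s. M * indicator {a<..<c} s)" using integrable_Ioo by (intro integrable_mult_right)
    show "AE s in lborel. norm (g s) \<le> norm (M * indicator {a<..<c} s)"
      using ge
    proof eventually_elim
      case (elim s)
      then show ?case using M[of s] by (cases "s \<in> {a<..<c}") auto
    qed
  qed
  have "(LINT s|lborel. g s) \<le> (LINT s|lborel. (LINT z|lborel. K (z, s)))"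
  proof (rule integral_mono_AE[OF gi lborel_Fubini(3)[OF K(1)]])
    show "AE s in lborel. g s \<le> (LINT z|lborel. K (z, s))"
      using ge le
    proof eventually_elim
      case (elim s)
      then show ?case by (cases "s \<in> {a<..<c}") (simp_all add: K(2))
    qed
  qed
  then show ?thesis using gi ge unfolding lborel_Fubini(1)[OF K(1)] by blast
qed

lemma energy_v_integrated:
  assumes t: "0 \<le> a" "a < c" "c < T"
  shows "\<exists>g. integrable lborel g \<and>
    (AE s in lborel. g s = indicator {a<..<c} s * (fB (1 / real (Suc n)) c s - fB (1 / real (Suc n)) a s)) \<and>
    (LINT s|lborel. g s) \<le> (LINT W|lborel. - gv a c (1 / real (Suc n)) W)"
proof -
  let ?d = "1 / real (Suc n)"
  have d: "?d > 0" by simp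
  have ac: "a \<in> {0..T}" "c \<in> {0..T}" using t by auto
  obtain M where M: "\<And>n t s. t \<in> {0..T} \<Longrightarrow> s \<in> {0..T} \<Longrightarrow> \<bar>fB (1 / real (Suc n)) t s\<bar> \<le> M" by (rule excess_bounded) blast
  obtain g1 where g1: "g1 \<in> borel_measurable borel" "AE s in lborel. s \<in> I \<longrightarrow> g1 s = fB ?d a s" by (rule fB_Borel[OF d ac(1)])
  obtain g2 where g2: "g2 \<in> borel_measurable borel" "AE s in lborel. s \<in> I \<longrightarrow> g2 s = fB ?d c s" by (rule fB_Borel[OF d ac(2)])
  show ?thesis
  proof (rule integrated_bound[OF t(1,3)])
    show "\<bar>fB ?d c s - fB ?d a s\<bar> \<le> M + M" if "s \<in> {a<..<c}" for s
      by (rule order_trans[OF abs_triangle_ineq4 add_mono[OF M M]]) (use that t ac in auto)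
    show "(\<lambda>s. g2 s - g1 s) \<in> borel_measurable borel" using g1(1) g2(1) by measurable
    show "AE s in lborel. s \<in> I \<longrightarrow> g2 s - g1 s = fB ?d c s - fB ?d a s" using g1(2) g2(2) by eventually_elim auto
    show "integrable lborel (\<lambda>W. - gv a c ?d W)" using pairing_integrable(1)[OF d t(1,3)] by simp
    show "- gv a c ?d (z, s) = 0" if "s \<notin> {a<..<c}" for z s using that by (simp add: gv_def)
    show "AE s in lborel. s \<in> {a<..<c} \<longrightarrow> fB ?d c s - fB ?d a s \<le> (LINT z|lborel. - gv a c ?d (z, s))"
      using energy_v[OF d t(1) _ t(3), OF less_imp_le[OF t(2)]]
      by eventually_elim (use t in \<open>auto simp: gv_def\<close>)
  qed
qed

lemma energy_w_integrated:
  assumes t: "0 \<le> a" "a < c" "c < T"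
  shows "\<exists>g. integrable lborel g \<and>
    (AE t in lborel. g t = indicator {a<..<c} t * (fD (1 / real (Suc n)) t c - fD (1 / real (Suc n)) t a)) \<and>
    (LINT t|lborel. g t) \<le> (LINT W|lborel. gw a c (1 / real (Suc n)) W)"
proof -
  let ?d = "1 / real (Suc n)"
  have d: "?d > 0" by simp
  have ac: "a \<in> {0..T}" "c \<in> {0..T}" using t by auto
  obtain M where M: "\<And>n t s. t \<in> {0..T} \<Longrightarrow> s \<in> {0..T} \<Longrightarrow> \<bar>fD (1 / real (Suc n)) t s\<bar> \<le> M" by (rule excess_bounded) blast
  obtain g1 where g1: "g1 \<in> borel_measurable borel" "AE t in lborel. t \<in> I \<longrightarrow> g1 t = fD ?d t a" by (rule fD_Borel[OF d ac(1)])
  obtain g2 where g2: "g2 \<in> borel_measurable borel" "AE t in lborel. t \<in> I \<longrightarrow> g2 t = fD ?d t c" by (rule fD_Borel[OF d ac(2)])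
  note gwi = pairing_integrable(2)[OF d t(1,3)]
  have gwm: "gw a c ?d \<in> borel_measurable borel" using borel_measurable_integrable[OF gwi] by simp
  have e: "gw a c ?d (swap_times (z, s)) =
      indicator {a<..<c} s * (indicator {a<..<c} (snd z) * (Xw z \<bullet> Y ?d (swap_times (z, s))))" for z s
    by (simp add: gw_def swap_times_def)
  show ?thesis
    unfolding swap_times_integral[OF gwm, symmetric]
  proof (rule integrated_bound[OF t(1,3)])
    show "\<bar>fD ?d s c - fD ?d s a\<bar> \<le> M + M" if "s \<in> {a<..<c}" for s
      by (rule order_trans[OF abs_triangle_ineq4 add_mono[OF M M]]) (use that t ac in auto)
    show "(\<lambda>s. g2 s - g1 s) \<in> borel_measurable borel" using g1(1) g2(1) by measurable
    show "AE s in lborel. s \<in> I \<longrightarrow> g2 s - g1 s = fD ?d s c - fD ?d s a" using g1(2) g2(2) by eventually_elim auto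
    show "integrable lborel (\<lambda>W. gw a c ?d (swap_times W))" using swap_times_integrable[OF gwm] gwi by simp
    show "gw a c ?d (swap_times (z, s)) = 0" if "s \<notin> {a<..<c}" for z s using that by (subst e) simp
    show "AE s in lborel. s \<in> {a<..<c} \<longrightarrow> fD ?d s c - fD ?d s a \<le> (LINT z|lborel. gw a c ?d (swap_times (z, s)))"
      using energy_w[OF d t(1) _ t(3), OF less_imp_le[OF t(2)]] unfolding e
      by eventually_elim (use t in auto)
  qed
qed

definition weight :: "('a \<times> real) \<times> real \<Rightarrow> real" where
  "weight W = indicator ((E \<times> I) \<times> I) W * (1 + norm (Dw2 W) powr (p - 1))"
text \<open>The Lipschitz error without its factor |r| H'(r); it does not depend on the cutoff
  parameter.\<close>

definition remainder :: "('a \<times> real) \<times> real \<Rightarrow> real" where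
  "remainder W = \<Lambda> * (weight W * norm (Dv2 W - Dw2 W))"

lemma cube_borel: "(E \<times> I) \<times> I \<in> sets borel"
  by (rule borel_Times[OF S_borel]) simp

lemma weight_measurable[measurable]: "weight \<in> borel_measurable borel"
proof -
  note [measurable] = cube_borel
  show ?thesis unfolding weight_def[abs_def] by measurable
qed

lemma remainder_nonneg: "remainder W \<ge> 0"
  using \<Lambda> by (simp add: remainder_def weight_def)

text \<open>\<open>weight\<close> grows like a flux with constant 1, so it lies in L^(p/(p-1)), and
  Young's inequality pairs it with the difference of the gradients.\<close>

lemma remainder_integrable: "integrable lborel remainder"
proof -
  have S: "bounded ((E \<times> I) \<times> I)" "(E \<times> I) \<times> I \<in> sets borel"
    using E(2) cube_borel by (auto intro!: bounded_Times)
  have "Lp_integrable (p / (p - 1)) weight"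
  proof (rule flux_integrable[OF S p zero_less_one _ D2_measurable(2) _ D2_integrable(2)])
    show "weight \<in> borel_measurable borel" by measurable
    show "weight W = 0" if "W \<notin> (E \<times> I) \<times> I" for W using that by (simp add: weight_def)
    show "AE W in lborel. W \<in> (E \<times> I) \<times> I \<longrightarrow> norm (weight W) \<le> 1 * (1 + norm (Dw2 W) powr (p - 1))"
      by (rule AE_I2) (simp add: weight_def)
  qed
  then have "integrable lborel (\<lambda>W. weight W \<bullet> norm (Dv2 W - Dw2 W))"
    by (intro Young_integrable(1)[OF p]) (use D2_integrable(3) in simp_all)
  then show ?thesis unfolding remainder_def[abs_def] by simp
qed

text \<open>Inside the square of times the left-hand side is minus the product of the flux
  difference and the gradient difference, times H' >= 0. The structure inequality leaves only the
  Lipschitz error, in which the factor |r| meets H'(r).\<close>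

lemma monotone_pairing:
  assumes d: "d > 0" and t: "0 \<le> a" "c < T"
  shows "AE W in lborel. gw a c d W - gv a c d W \<le>
    \<bar>v' (fst W) - w' (fst (swap_times W))\<bar> * heavi' d (v' (fst W) - w' (fst (swap_times W))) * remainder W"
  using structure_bound
proof eventually_elim
  case (elim W)
  let ?r = "v' (fst W) - w' (fst (swap_times W))"
  have nn: "\<bar>?r\<bar> * heavi' d ?r * remainder W \<ge> 0" using heavi_bounds(3)[OF d] remainder_nonneg by (simp add: mult_nonneg_nonneg)
  have sp: "fst (swap_times W) = (fst (fst W), snd W)" by (simp add: swap_times_def)
  show ?case
  proof (cases "snd W \<in> {a<..<c} \<and> snd (fst W) \<in> {a<..<c}")
    case False
    then have "gw a c d W = 0" "gv a c d W = 0" by (auto simp: gw_def gv_def)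
    then show ?thesis using nn by simp
  next
    case True
    then have tI: "snd W \<in> I" "snd (fst W) \<in> I" using t by auto
    have e: "gw a c d W - gv a c d W = - ((Xv (fst W) - Xw (fst (swap_times W))) \<bullet> Y d W)"
      using True by (simp add: gw_def gv_def inner_diff_left)
    show ?thesis
    proof (cases "fst (fst W) \<in> E")
      case False
      then have "fst W \<notin> E \<times> I" "fst (swap_times W) \<notin> E \<times> I" by (auto simp: sp mem_Times_iff)
      then have "Xv (fst W) = 0" "Xw (fst (swap_times W)) = 0" using Xv(3) Xw(3) by blast+
      then show ?thesis using nn by (simp add: e)
    next
      case xE: True
      then have m: "fst W \<in> E \<times> I" "fst (swap_times W) \<in> E \<times> I" "W \<in> (E \<times> I) \<times> I" using tI by (auto simp: sp mem_Times_iff)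
      let ?D = "Dv (fst W) - Dw (fst (swap_times W))"
      have D2: "Dv2 W = Dv (fst W)" "Dw2 W = Dw (fst (swap_times W))" using tI by (simp_all add: Dv2_def Dw2_def)
      have "- ((Xv (fst W) - Xw (fst (swap_times W))) \<bullet> ?D) \<le>
          \<Lambda> * \<bar>?r\<bar> * (1 + norm (Dw (fst (swap_times W))) powr (p - 1)) * norm ?D"
        using elim m by linarith
      from mult_left_mono[OF this heavi_bounds(3)[OF d, of ?r]]
      show ?thesis unfolding e by (simp add: Y_def remainder_def weight_def D2 m(3) algebra_simps)
    qed
  qed
qed

text \<open>|r| H'(r) is at most 1/2 and tends to 0 at every r, so half of \<open>remainder\<close>
  is a majorant for dominated convergence.\<close>

lemma remainder_tendsto:
  "(\<lambda>n. LINT W|lborel. \<bar>v' (fst W) - w' (fst (swap_times W))\<bar> * heavi' (1 / real (Suc n)) (v' (fst W) - w' (fst (swap_times W))) * remainder W) \<longlonglongrightarrow> 0"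
    (is "?A") and
  remainder_cutoff_integrable:
  "integrable lborel (\<lambda>W. \<bar>v' (fst W) - w' (fst (swap_times W))\<bar> * heavi' (1 / real (Suc n)) (v' (fst W) - w' (fst (swap_times W))) * remainder W)"
    (is "?B n")
proof -
  define r where "r W = v' (fst W) - w' (fst (swap_times W))" for W
  have [measurable]: "r \<in> borel_measurable borel" unfolding r_def[abs_def] by measurable
  have [measurable]: "heavi' (1 / real (Suc n)) \<in> borel_measurable borel" for n by (rule heavi'_measurable) simp
  have [measurable]: "remainder \<in> borel_measurable borel" using borel_measurable_integrable[OF remainder_integrable] by simp
  let ?f = "\<lambda>n W. \<bar>r W\<bar> * heavi' (1 / real (Suc n)) (r W) * remainder W"
  have m: "?f n \<in> borel_measurable lborel" for n by measurable
  have i: "integrable lborel (\<lambda>W. 1 / 2 * remainder W)" using remainder_integrable by (rule integrable_mult_right)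
  have b: "norm (?f n W) \<le> 1 / 2 * remainder W" for n W
  proof -
    have d: "1 / real (Suc n) > 0" by simp
    have "\<bar>r W\<bar> * heavi' (1 / real (Suc n)) (r W) * remainder W \<le> 1 / 2 * remainder W"
      by (rule mult_right_mono[OF heavi_bounds(5)[OF d] remainder_nonneg])
    moreover have "0 \<le> \<bar>r W\<bar> * heavi' (1 / real (Suc n)) (r W) * remainder W"
      using heavi_bounds(3)[OF d] remainder_nonneg by (simp add: mult_nonneg_nonneg)
    ultimately show ?thesis by simp
  qed
  have l: "(\<lambda>n. ?f n W) \<longlonglongrightarrow> 0" for W
  proof -
    have "(\<lambda>n. \<bar>r W * heavi' (1 / real (Suc n)) (r W)\<bar>) \<longlonglongrightarrow> 0" using heavi_tendsto(2) by (rule tendsto_rabs_zero)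
    moreover have "\<bar>r W * heavi' (1 / real (Suc n)) (r W)\<bar> = \<bar>r W\<bar> * heavi' (1 / real (Suc n)) (r W)" for n
      using heavi_bounds(3)[of "1 / real (Suc n)" "r W"] by (simp add: abs_mult)
    ultimately have "(\<lambda>n. \<bar>r W\<bar> * heavi' (1 / real (Suc n)) (r W)) \<longlonglongrightarrow> 0" by simp
    then show ?thesis by (rule tendsto_mult_left_zero)
  qed
  have "(\<lambda>n. LINT W|lborel. ?f n W) \<longlonglongrightarrow> (\<integral>W. 0 \<partial>(lborel :: (('a \<times> real) \<times> real) measure))"
    by (rule integral_dominated_convergence[OF _ m i]) (use l b in auto)
  then show ?A by (simp add: r_def)
  have "integrable lborel (?f n)" by (rule Bochner_Integration.integrable_bound[OF i m]) (rule AE_I2, rule order_trans[OF b], simp)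
  then show "?B n" by (simp add: r_def)
qed

lemma F_continuous_slices:
  assumes "t \<in> {0..T}" "{a..c} \<subseteq> {0..T}"
  shows "continuous_on {a..c} (\<lambda>s. F t s)" "continuous_on {a..c} (\<lambda>s. F s t)"
proof -
  have "continuous_on {a..c} (\<lambda>s. (\<lambda>(t, s). F t s) (t, s))"
    by (rule continuous_on_compose2[OF F_continuous]) (use assms in \<open>auto intro!: continuous_intros\<close>)
  then show "continuous_on {a..c} (\<lambda>s. F t s)" by simp
  have "continuous_on {a..c} (\<lambda>s. (\<lambda>(t, s). F t s) (s, t))"
    by (rule continuous_on_compose2[OF F_continuous]) (use assms in \<open>auto intro!: continuous_intros\<close>)
  then show "continuous_on {a..c} (\<lambda>s. F s t)" by simp
qed

text \<open>The null sets for the functions \<open>g n\<close> depend on n; countably many are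
  combined before dominated convergence.\<close>

lemma square_limit:
  fixes g h :: "nat \<Rightarrow> real \<Rightarrow> real"
  assumes g: "\<And>n. integrable lborel (g n)" "\<And>n. AE s in lborel. g n s = indicator {a<..<c} s * h n s"
    and M: "\<And>n s. s \<in> {a<..<c} \<Longrightarrow> \<bar>h n s\<bar> \<le> M"
    and l: "\<And>s. s \<in> {a<..<c} \<Longrightarrow> (\<lambda>n. h n s) \<longlonglongrightarrow> f s" and f: "continuous_on {a..c} f"
  shows "(\<lambda>n. LINT s|lborel. g n s) \<longlonglongrightarrow> integral {a..c} f"
proof -
  have "AE s in lborel. \<forall>n. g n s = indicator {a<..<c} s * h n s" using g(2) by (simp add: AE_all_countable)
  have "(\<lambda>n. LINT s|lborel. g n s) \<longlonglongrightarrow> (LINT s|lborel. indicator {a<..<c} s * f s)"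
  proof (rule integral_dominated_convergence)
    show "(\<lambda>s. indicator {a<..<c} s * f s) \<in> borel_measurable lborel"
      using Ioo_integral_continuous(2)[OF f] by (rule borel_measurable_integrable)
    show "g n \<in> borel_measurable lborel" for n using g(1) by (rule borel_measurable_integrable)
    show "integrable lborel (\<lambda>s. M * indicator {a<..<c} s)" using integrable_Ioo by (intro integrable_mult_right)
    show "AE s in lborel. (\<lambda>n. g n s) \<longlonglongrightarrow> indicator {a<..<c} s * f s"
      using \<open>AE s in lborel. \<forall>n. _ n s\<close>
    proof eventually_elim
      case (elim s)
      show ?case by (cases "s \<in> {a<..<c}") (use elim l in auto)
    qed
    show "AE s in lborel. norm (g n s) \<le> M * indicator {a<..<c} s" for n
      using g(2)[of n]
    proof eventually_elim
      case (elim s)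
      show ?case by (cases "s \<in> {a<..<c}") (use elim M in auto)
    qed
  qed
  then show ?thesis by (simp only: Ioo_integral_continuous(1)[OF f])
qed

text \<open>In the sum of the two integrated energy inequalities the right-hand side is bounded by
  the Lipschitz error. As the cutoff tends to the Heaviside function this error disappears, and both
  excess integrals become F.\<close>

lemma square_inequality:
  assumes t: "0 \<le> a" "e > 0" "a + e < T"
  shows "integral {a..a + e} (\<lambda>s. F (a + e) s - F a s) + integral {a..a + e} (\<lambda>t. F t (a + e) - F t a) \<le> 0"
proof -
  let ?c = "a + e"
  have ac: "a < ?c" "a \<in> {0..T}" "?c \<in> {0..T}" "{a..?c} \<subseteq> {0..T}" using t by auto
  have s: "s \<in> {0..T}" if "s \<in> {a<..<?c}" for s using that t by auto
  obtain M where M: "M \<ge> 0"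
    "\<And>n t s. t \<in> {0..T} \<Longrightarrow> s \<in> {0..T} \<Longrightarrow> \<bar>fB (1 / real (Suc n)) t s\<bar> \<le> M"
    "\<And>n t s. t \<in> {0..T} \<Longrightarrow> s \<in> {0..T} \<Longrightarrow> \<bar>fD (1 / real (Suc n)) t s\<bar> \<le> M" by (rule excess_bounded) blast
  \<comment> \<open>One representative is fixed for each cutoff parameter 1/(n + 1), so that a
    sequence is available for the limit.\<close>
  define g where "g n = (SOME g. integrable lborel g \<and>
    (AE s in lborel. g s = indicator {a<..<?c} s * (fB (1 / real (Suc n)) ?c s - fB (1 / real (Suc n)) a s)) \<and>
    (LINT s|lborel. g s) \<le> (LINT W|lborel. - gv a ?c (1 / real (Suc n)) W))" for n
  have g: "integrable lborel (g n) \<and>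
    (AE s in lborel. g n s = indicator {a<..<?c} s * (fB (1 / real (Suc n)) ?c s - fB (1 / real (Suc n)) a s)) \<and>
    (LINT s|lborel. g n s) \<le> (LINT W|lborel. - gv a ?c (1 / real (Suc n)) W)" for n
    unfolding g_def by (rule someI_ex[OF energy_v_integrated[OF t(1) ac(1) t(3)]])
  define h where "h n = (SOME g. integrable lborel g \<and>
    (AE t in lborel. g t = indicator {a<..<?c} t * (fD (1 / real (Suc n)) t ?c - fD (1 / real (Suc n)) t a)) \<and>
    (LINT s|lborel. g s) \<le> (LINT W|lborel. gw a ?c (1 / real (Suc n)) W))" for n
  have h: "integrable lborel (h n) \<and>
    (AE t in lborel. h n t = indicator {a<..<?c} t * (fD (1 / real (Suc n)) t ?c - fD (1 / real (Suc n)) t a)) \<and>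
    (LINT s|lborel. h n s) \<le> (LINT W|lborel. gw a ?c (1 / real (Suc n)) W)" for n
    unfolding h_def by (rule someI_ex[OF energy_w_integrated[OF t(1) ac(1) t(3)]])
  have lg: "(\<lambda>n. LINT s|lborel. g n s) \<longlonglongrightarrow> integral {a..?c} (\<lambda>s. F ?c s - F a s)"
  proof (rule square_limit)
    show "integrable lborel (g n)"
      "AE s in lborel. g n s = indicator {a<..<?c} s * (fB (1 / real (Suc n)) ?c s - fB (1 / real (Suc n)) a s)" for n
      using g by blast+
    fix s assume "s \<in> {a<..<?c}"
    note s = s[OF this]
    show "\<bar>fB (1 / real (Suc n)) ?c s - fB (1 / real (Suc n)) a s\<bar> \<le> M + M" for n
      by (rule order_trans[OF abs_triangle_ineq4 add_mono[OF M(2)[OF ac(3) s] M(2)[OF ac(2) s]]])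
    show "(\<lambda>n. fB (1 / real (Suc n)) ?c s - fB (1 / real (Suc n)) a s) \<longlonglongrightarrow> F ?c s - F a s"
      by (rule tendsto_diff[OF fB_tendsto(1)[OF ac(3) s] fB_tendsto(1)[OF ac(2) s]])
  qed (intro continuous_intros F_continuous_slices ac)
  have lh: "(\<lambda>n. LINT s|lborel. h n s) \<longlonglongrightarrow> integral {a..?c} (\<lambda>t. F t ?c - F t a)"
  proof (rule square_limit)
    show "integrable lborel (h n)"
      "AE t in lborel. h n t = indicator {a<..<?c} t * (fD (1 / real (Suc n)) t ?c - fD (1 / real (Suc n)) t a)" for n
      using h by blast+
    fix s assume "s \<in> {a<..<?c}"
    note s = s[OF this]
    show "\<bar>fD (1 / real (Suc n)) s ?c - fD (1 / real (Suc n)) s a\<bar> \<le> M + M" for n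
      by (rule order_trans[OF abs_triangle_ineq4 add_mono[OF M(3)[OF s ac(3)] M(3)[OF s ac(2)]]])
    show "(\<lambda>n. fD (1 / real (Suc n)) s ?c - fD (1 / real (Suc n)) s a) \<longlonglongrightarrow> F s ?c - F s a"
      by (rule tendsto_diff[OF fB_tendsto(2)[OF s ac(3)] fB_tendsto(2)[OF s ac(2)]])
  qed (intro continuous_intros F_continuous_slices ac)
  show ?thesis
  proof (rule LIMSEQ_le[OF tendsto_add[OF lg lh] remainder_tendsto], intro exI allI impI)
    fix n
    have d: "1 / real (Suc n) > 0" by simp
    note i = pairing_integrable[OF d t(1,3)]
    have "(LINT s|lborel. g n s) + (LINT s|lborel. h n s) \<le>
      (LINT W|lborel. gw a ?c (1 / real (Suc n)) W) - (LINT W|lborel. gv a ?c (1 / real (Suc n)) W)"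
      using g[of n] h[of n] by simp
    also have "\<dots> = (LINT W|lborel. gw a ?c (1 / real (Suc n)) W - gv a ?c (1 / real (Suc n)) W)"
      by (rule Bochner_Integration.integral_diff[OF i(2,1), symmetric])
    also have "\<dots> \<le> (LINT W|lborel. \<bar>v' (fst W) - w' (fst (swap_times W))\<bar> * heavi' (1 / real (Suc n)) (v' (fst W) - w' (fst (swap_times W))) * remainder W)"
      by (rule integral_mono_AE[OF Bochner_Integration.integrable_diff[OF i(2,1)] remainder_cutoff_integrable monotone_pairing[OF d t(1,3)]])
    finally show "(LINT s|lborel. g n s) + (LINT s|lborel. h n s) \<le> \<dots>" .
  qed
qed

lemma F_diagonal: "0 \<le> \<tau> \<Longrightarrow> \<tau> < T \<Longrightarrow> F \<tau> \<tau> \<le> F 0 0"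
  by (rule diagonal_monotone[OF F_continuous _ _ square_inequality])

text \<open>The order of the initial values gives F(0, 0) = 0, so a nonnegative function has
  vanishing integral at time \<open>\<tau>\<close>; strict monotonicity of b then removes the
  powers.\<close>

lemma comparison:
  assumes initial: "AE x in lebesgue_on E. v (x, 0) \<le> w (x, 0)" and \<tau>: "0 \<le> \<tau>" "\<tau> < T"
  shows "AE x in lebesgue_on E. v (x, \<tau>) \<le> w (x, \<tau>)"
proof -
  have mono: "\<sigma> r \<le> \<sigma> s \<longleftrightarrow> r \<le> s" for r s
    using signed_power_strict_mono[OF q] by (rule strict_mono_less_eq)
  have "F 0 0 = (LINT x|lebesgue_on E. 0)"
    unfolding F_def
  proof (rule integral_cong_AE)
    show "(\<lambda>x. max 0 (\<sigma> (v (x, 0)) - \<sigma> (w (x, 0)))) \<in> borel_measurable (lebesgue_on E)"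
      using F_integrable[of 0 0] T by auto
    show "AE x in lebesgue_on E. max 0 (\<sigma> (v (x, 0)) - \<sigma> (w (x, 0))) = 0"
      using initial by eventually_elim (simp add: mono)
  qed simp
  then have "F \<tau> \<tau> \<le> 0" using F_diagonal[OF \<tau>] by simp
  moreover have "F \<tau> \<tau> \<ge> 0" unfolding F_def by (rule integral_nonneg_AE) simp
  ultimately have "F \<tau> \<tau> = 0" by simp
  moreover have "integrable (lebesgue_on E) (\<lambda>x. max 0 (\<sigma> (v (x, \<tau>)) - \<sigma> (w (x, \<tau>))))"
    by (rule F_integrable) (use \<tau> in auto)
  ultimately have "AE x in lebesgue_on E. max 0 (\<sigma> (v (x, \<tau>)) - \<sigma> (w (x, \<tau>))) = 0"
    unfolding F_def by (subst integral_nonneg_eq_0_iff_AE[symmetric]) auto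
  then show ?thesis
  proof eventually_elim
    case (elim x)
    then have "\<sigma> (v (x, \<tau>)) \<le> \<sigma> (w (x, \<tau>))" by (simp add: max_def split: if_splits)
    then show ?case by (simp only: mono)
  qed
qed

end

section \<open>Reduction of the comparison principle to the setting with two times\<close>

lemma W0_test:
  assumes \<psi>: "\<psi> \<in> test_functions E" and p: "p > 0"
  shows "W0 E p \<psi> (grad \<psi>)"
  unfolding W0_def using wgrad_test[OF \<psi>] test_powr_integrable[OF \<psi> p] \<psi> by (auto intro!: bexI[of _ \<psi>])

lemma test_functions_bounded:
  assumes "\<psi> \<in> test_functions E"
  obtains M where "M > 0" "\<And>x. \<bar>\<psi> x\<bar> \<le> M"
proof -
  obtain K where K: "compact K" "\<And>x. x \<notin> K \<Longrightarrow> \<psi> x = 0" using test_functions_support[OF assms] by metis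
  have "continuous_on K \<psi>" using test_functions_D(2)[OF assms] by (rule continuous_on_subset) simp
  then have "bounded (\<psi> ` K)" using K(1) by (intro compact_imp_bounded compact_continuous_image)
  then obtain M where M: "\<And>x. x \<in> K \<Longrightarrow> \<bar>\<psi> x\<bar> \<le> M" by (auto simp: bounded_iff)
  show ?thesis
  proof (rule that[of "\<bar>M\<bar> + 1"])
    show "\<bar>\<psi> x\<bar> \<le> \<bar>M\<bar> + 1" for x using M[of x] K(2)[of x] by (cases "x \<in> K") auto
  qed simp
qed

text \<open>Serves to show that the datum in the weak identity is attained at t = 0. Test functions
  are divided by a bound of their modulus to satisfy |\<phi>| <= 1.\<close>

lemma W0_orthogonal_AE_zero:
  fixes E :: "'a::euclidean_space set"
  assumes E: "open E" and p: "p > 0" and f: "integrable (lebesgue_on E) f"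
    and z: "\<And>\<phi> G. W0 E p \<phi> G \<Longrightarrow> (\<And>x. \<bar>\<phi> x\<bar> \<le> 1) \<Longrightarrow> (LINT x|lebesgue_on E. f x * \<phi> x) = 0"
  shows "AE x in lebesgue_on E. f x = 0"
proof -
  have E': "E \<in> sets borel" using E by simp
  obtain g where g: "borel_rep E f g" using borel_rep_exists[OF borel_measurable_integrable[OF f] E'] .
  have gm: "g \<in> borel_measurable borel" and gE: "AE x in lborel. x \<in> E \<longrightarrow> f x = g x" using g by (auto simp: borel_rep_def)
  have gi: "integrable lborel g" using borel_rep_integrable[OF g E'] f by simp
  have "AE x in lborel. x \<in> E \<longrightarrow> g x = 0"
  proof (rule fundamental_lemma_variations[OF E gm])
    show "integrable lborel (\<lambda>x. indicator K x *\<^sub>R g x)" if "compact K" for K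
      by (rule integrable_mult_indicator[OF _ gi]) (use that in \<open>simp add: borel_compact\<close>)
    fix \<psi> assume \<psi>: "\<psi> \<in> test_functions E"
    obtain M where M: "M > 0" "\<And>x. \<bar>\<psi> x\<bar> \<le> M" by (rule test_functions_bounded[OF \<psi>]) blast
    have "(LINT x|lebesgue_on E. f x * (1 / M * \<psi> x)) = 0"
      by (rule z[OF W0_cmult[OF p W0_test[OF \<psi> p]]]) (use M in \<open>simp add: abs_mult divide_le_eq\<close>)
    moreover have "(LINT x|lebesgue_on E. f x * (1 / M * \<psi> x)) = 1 / M * (LINT x|lebesgue_on E. f x * \<psi> x)"
      by (simp add: mult.left_commute flip: integral_mult_right_zero)
    ultimately have "(LINT x|lebesgue_on E. f x * \<psi> x) = 0" using M(1) by simp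
    moreover have "borel_rep E (\<lambda>x. f x * \<psi> x) (\<lambda>x. g x * \<psi> x)"
      using g test_functions_D(5)[OF \<psi>] by (auto simp: borel_rep_def)
    ultimately show "(LINT x|lborel. g x * \<psi> x) = 0" using borel_rep_integral[OF _ E'] by metis
  qed
  with gE have "AE x in lborel. x \<in> E \<longrightarrow> f x = 0" by eventually_elim simp
  then show ?thesis by (simp add: AE_lebesgue_on_iff[OF E'])
qed

text \<open>Subtracting the identities at two times eliminates the datum \<open>zo\<close> and
  leaves the flux over (t1, t2].\<close>

lemma weak_identity_difference:
  fixes E :: "'a::euclidean_space set" and X :: "'a \<times> real \<Rightarrow> 'a"
  assumes E: "open E" and p: "p > 1"
    and X: "X \<in> borel_measurable borel" "Lp_integrable (p / (p - 1)) X" "\<And>z. z \<notin> E \<times> {0<..<T} \<Longrightarrow> X z = 0"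
    and z: "\<And>t. t \<in> {0..T} \<Longrightarrow> integrable (lebesgue_on E) (\<lambda>x. z (x, t))" and zo: "integrable (lebesgue_on E) zo"
    and h: "W0 E p \<phi> G" "\<And>x. \<bar>\<phi> x\<bar> \<le> 1" and t: "0 \<le> t1" "t1 \<le> t2" "t2 < T"
    and star: "\<And>t. 0 \<le> t \<Longrightarrow> t < T \<Longrightarrow> (LINT x|lebesgue_on E. (z (x, t) - zo x) * \<phi> x) =
      - (LINT w|lborel. indicator {0..t} (snd w) * (X w \<bullet> G (fst w)))"
  shows "(LINT x|lebesgue_on E. (z (x, t2) - z (x, t1)) * \<phi> x) =
      - (LINT w|lborel. indicator {t1<..t2} (snd w) * (X w \<bullet> G (fst w)))"
proof -
  have E': "E \<in> sets borel" using E by simp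
  have \<phi>: "borel_rep E \<phi> \<phi>" using wgrad_D(1,3)[OF W0_D(1)[OF h(1)]] by (intro borel_rep_self)
  have \<phi>m: "\<phi> \<in> borel_measurable (lebesgue_on E)" by (rule borel_rep_measurable[OF \<phi> E'])
  have i: "integrable (lebesgue_on E) (\<lambda>x. (z (x, t) - zo x) * \<phi> x)" if "t \<in> {0..T}" for t
  proof (rule Bochner_Integration.integrable_bound[OF Bochner_Integration.integrable_diff[OF z[OF that] zo]])
    show "(\<lambda>x. (z (x, t) - zo x) * \<phi> x) \<in> borel_measurable (lebesgue_on E)"
      using borel_measurable_integrable[OF z[OF that]] borel_measurable_integrable[OF zo] \<phi>m by measurable
    show "AE x in lebesgue_on E. norm ((z (x, t) - zo x) * \<phi> x) \<le> norm (z (x, t) - zo x)"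
      by (rule AE_I2) (use h(2) in \<open>simp add: abs_mult mult_left_le\<close>)
  qed
  have Pi: "integrable lborel (\<lambda>w. X w \<bullet> G (fst w))" by (rule flux_pairing_integrable[OF p X h(1)])
  have sm: "snd \<in> borel_measurable (borel :: ('a \<times> real) measure)"
    by (intro borel_measurable_continuous_onI continuous_intros)
  have iX: "integrable lborel (\<lambda>w. indicator {0..t} (snd w) * (X w \<bullet> G (fst w)))" for t
  proof -
    have "snd -` {0..t} \<in> sets (lborel :: ('a \<times> real) measure)" using measurable_sets[OF sm, of "{0..t}"] by simp
    from integrable_mult_indicator[OF this Pi] show ?thesis by (simp add: indicator_def vimage_def)
  qed
  have t': "t1 \<in> {0..T}" "t2 \<in> {0..T}" "0 \<le> t2" "t1 < T" using t by auto
  have "(LINT x|lebesgue_on E. (z (x, t2) - z (x, t1)) * \<phi> x) =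
    (LINT x|lebesgue_on E. (z (x, t2) - zo x) * \<phi> x - (z (x, t1) - zo x) * \<phi> x)"
    by (simp add: algebra_simps)
  also have "\<dots> = (LINT x|lebesgue_on E. (z (x, t2) - zo x) * \<phi> x) - (LINT x|lebesgue_on E. (z (x, t1) - zo x) * \<phi> x)"
    using i t' by (intro Bochner_Integration.integral_diff)
  also have "\<dots> = - ((LINT w|lborel. indicator {0..t2} (snd w) * (X w \<bullet> G (fst w))) - (LINT w|lborel. indicator {0..t1} (snd w) * (X w \<bullet> G (fst w))))"
    using star t t' by simp
  also have "\<dots> = - (LINT w|lborel. indicator {0..t2} (snd w) * (X w \<bullet> G (fst w)) - indicator {0..t1} (snd w) * (X w \<bullet> G (fst w)))"
    using iX by (simp add: Bochner_Integration.integral_diff)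
  also have "\<dots> = - (LINT w|lborel. indicator {t1<..t2} (snd w) * (X w \<bullet> G (fst w)))"
    using t by (intro arg_cong[where f=uminus] Bochner_Integration.integral_cong) (auto simp: indicator_def)
  finally show ?thesis .
qed

text \<open>The value of A at (u, \<xi>') is inserted: one difference has equal u and is monotone,
  the other has equal gradients and is Lipschitz in u. So the weight contains the gradient of the
  second function only.\<close>

lemma structure_lower_bound:
  fixes A :: "real \<Rightarrow> 'a::real_inner \<Rightarrow> 'a"
  assumes mono: "\<And>u \<xi>1 \<xi>2. (A u \<xi>1 - A u \<xi>2) \<bullet> (\<xi>1 - \<xi>2) \<ge> 0"
    and lip: "\<And>u1 u2 \<xi>. norm (A u1 \<xi> - A u2 \<xi>) \<le> L * \<bar>u1 - u2\<bar> * (1 + norm \<xi> powr r)"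
  shows "(A u \<xi> - A u' \<xi>') \<bullet> (\<xi> - \<xi>') \<ge> - (L * \<bar>u - u'\<bar> * (1 + norm \<xi>' powr r) * norm (\<xi> - \<xi>'))"
proof -
  have "(A u \<xi> - A u' \<xi>') \<bullet> (\<xi> - \<xi>') = (A u \<xi> - A u \<xi>') \<bullet> (\<xi> - \<xi>') + (A u \<xi>' - A u' \<xi>') \<bullet> (\<xi> - \<xi>')"
    by (simp add: inner_diff_left)
  moreover have "\<bar>(A u \<xi>' - A u' \<xi>') \<bullet> (\<xi> - \<xi>')\<bar> \<le> norm (A u \<xi>' - A u' \<xi>') * norm (\<xi> - \<xi>')"
    by (rule Cauchy_Schwarz_ineq2)
  moreover have "norm (A u \<xi>' - A u' \<xi>') * norm (\<xi> - \<xi>') \<le> L * \<bar>u - u'\<bar> * (1 + norm \<xi>' powr r) * norm (\<xi> - \<xi>')"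
    by (rule mult_right_mono[OF lip norm_ge_zero])
  ultimately show ?thesis using mono[of u \<xi> \<xi>'] by linarith
qed

text \<open>Null slices make a null set only if that set is measurable, hence the restriction to
  Borel functions; Tonelli is applied to the indicator of the exceptional set.\<close>

lemma AE_slices_le:
  fixes f g :: "'a::euclidean_space \<times> real \<Rightarrow> real"
  assumes [measurable]: "f \<in> borel_measurable borel" "g \<in> borel_measurable borel" "S \<in> sets borel"
    and h: "AE t in lborel. AE x in lborel. (x, t) \<in> S \<longrightarrow> f (x, t) \<le> g (x, t)"
  shows "AE z in lborel. z \<in> S \<longrightarrow> f z \<le> g z"
proof -
  let ?B = "{z \<in> S. g z < f z}"
  have B[measurable]: "?B \<in> sets borel" by measurable
  have im: "(indicator ?B :: _ \<Rightarrow> ennreal) \<in> borel_measurable borel" by measurable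
  have "(\<integral>\<^sup>+z. indicator ?B z \<partial>lborel) = (\<integral>\<^sup>+t. (\<integral>\<^sup>+x. indicator ?B (x, t) \<partial>lborel) \<partial>lborel)"
    by (rule lborel_Tonelli[OF im, symmetric])
  also have "\<dots> = (\<integral>\<^sup>+t. 0 \<partial>(lborel :: real measure))"
  proof (rule nn_integral_cong_AE)
    show "AE t in lborel. (\<integral>\<^sup>+x. indicator ?B (x, t) \<partial>lborel) = (0::ennreal)"
      using h
    proof eventually_elim
      case (elim t)
      have "(\<integral>\<^sup>+x. indicator ?B (x, t) \<partial>lborel) = (\<integral>\<^sup>+x. 0 \<partial>(lborel :: 'a measure))"
        by (rule nn_integral_cong_AE) (use elim in eventually_elim, auto simp: indicator_def)
      then show ?case by simp
    qed
  qed
  finally have "(\<integral>\<^sup>+z. indicator ?B z \<partial>lborel) = 0" by simp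
  then have "AE z in lborel. indicator ?B z = (0::ennreal)" using nn_integral_0_iff_AE[of "indicator ?B" lborel] im by simp
  then show ?thesis by eventually_elim (auto simp: indicator_def split: if_splits)
qed

theorem comparison_principle:
  fixes E :: "'a::euclidean_space set" and A :: "'a \<Rightarrow> real \<Rightarrow> 'a \<Rightarrow> 'a"
  assumes E: "open E" "bounded E" and T: "T > 0" and p: "p > 1" and q: "q > 0" and C: "C > 0" and L: "L \<ge> 0"
    and A: "caratheodory E A"
    and growth: "AE x in lebesgue_on E. \<forall>u \<xi>. norm (A x u \<xi>) \<le> C * (1 + norm \<xi> powr (p - 1))"
    and monotone: "AE x in lebesgue_on E. \<forall>u \<xi>1 \<xi>2. (A x u \<xi>1 - A x u \<xi>2) \<bullet> (\<xi>1 - \<xi>2) \<ge> 0"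
    and lipschitz: "AE x in lebesgue_on E. \<forall>u1 u2 \<xi>.
      norm (A x u1 \<xi> - A x u2 \<xi>) \<le> L * \<bar>u1 - u2\<bar> * (1 + norm \<xi> powr (p - 1))"
    and w: "weak_solution E T p q A w" and w0: "AE z in lebesgue_on (E \<times> {0<..T}). w z \<ge> 0"
    and v: "weak_solution_CD E T p q A (\<lambda>_. 0) vo v"
    and le: "AE x in lebesgue_on E. vo x \<le> w (x, 0)"
  shows "AE z in lebesgue_on (E \<times> {0<..T}). v z \<le> w z"
proof -
  let ?I = "{0<..<T}" and ?b = "signed_power q"
  have E': "E \<in> sets borel" using E by simp
  have S: "E \<times> ?I \<in> sets borel" "E \<times> {0<..T} \<in> sets borel" using E' by (auto intro!: borel_Times)
  have p0: "p > 0" using p by simp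
  have wC: "w \<in> C_L (q + 1) T E" and wL: "w \<in> L_W p T E" and wI: "weak_identity E T p q A (\<lambda>x. w (x, 0)) w"
    using w by (auto simp: weak_solution_def)
  have vC: "v \<in> C_L (q + 1) T E" and vL0: "v \<in> L_W0 p T E" and vI: "weak_identity E T p q A vo v"
    and vo: "vo \<in> Lp_space (lebesgue_on E) (q + 1)"
    using v by (auto simp: weak_solution_CD_def)
  have wo: "(\<lambda>x. w (x, 0)) \<in> Lp_space (lebesgue_on E) (q + 1)"
    using wC T by (simp add: C_L_def continuous_curves_def)
  \<comment> \<open>\<open>L_W0\<close> and \<open>L_W\<close> use the same seminorm, so the
    inclusion of the spaces of slices gives v in \<open>L_W\<close>.\<close>
  have W10: "W1p0 E p \<subseteq> W1p E p" by (auto simp: W1p0_def)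
  then have vL: "v \<in> L_W p T E"
    using vL0 unfolding L_W_def L_W0_def bochner_Lp_def strongly_measurable_def
    by (auto elim!: eventually_mono; blast)
  note sv = solution_data[OF E T p q C A growth vC vL vo vI]
  note sw = solution_data[OF E T p q C A growth wC wL wo wI]
  obtain Dv Xv where Dv: "Dv \<in> borel_measurable borel" and Xv: "Xv \<in> borel_measurable borel"
    and z: "\<And>z. z \<notin> E \<times> ?I \<Longrightarrow> Dv z = 0" "\<And>z. z \<notin> E \<times> ?I \<Longrightarrow> Xv z = 0"
    and i: "Lp_integrable p Dv" "Lp_integrable (p / (p - 1)) Xv"
    and gv: "AE t in lborel. t \<in> ?I \<longrightarrow> has_weak_gradient E (\<lambda>x. v (x, t)) (\<lambda>x. Dv (x, t))"
    and Av: "AE z in lborel. z \<in> E \<times> ?I \<longrightarrow> Xv z = A (fst z) (v z) (Dv z)"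
    and star_v: "\<And>\<phi> G t. W0 E p \<phi> G \<Longrightarrow> (\<And>x. \<bar>\<phi> x\<bar> \<le> 1) \<Longrightarrow> 0 \<le> t \<Longrightarrow> t < T \<Longrightarrow>
      (LINT x|lebesgue_on E. (?b (v (x, t)) - ?b (vo x)) * \<phi> x) = - (LINT z|lborel. indicator {0..t} (snd z) * (Xv z \<bullet> G (fst z)))"
    by (rule sv) blast
  obtain Dw Xw where Dw: "Dw \<in> borel_measurable borel" and Xw: "Xw \<in> borel_measurable borel"
    and z': "\<And>z. z \<notin> E \<times> ?I \<Longrightarrow> Dw z = 0" "\<And>z. z \<notin> E \<times> ?I \<Longrightarrow> Xw z = 0"
    and i': "Lp_integrable p Dw" "Lp_integrable (p / (p - 1)) Xw"
    and gw: "AE t in lborel. t \<in> ?I \<longrightarrow> has_weak_gradient E (\<lambda>x. w (x, t)) (\<lambda>x. Dw (x, t))"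
    and Aw: "AE z in lborel. z \<in> E \<times> ?I \<longrightarrow> Xw z = A (fst z) (w z) (Dw z)"
    and star_w: "\<And>\<phi> G t. W0 E p \<phi> G \<Longrightarrow> (\<And>x. \<bar>\<phi> x\<bar> \<le> 1) \<Longrightarrow> 0 \<le> t \<Longrightarrow> t < T \<Longrightarrow>
      (LINT x|lebesgue_on E. (?b (w (x, t)) - ?b (w (x, 0))) * \<phi> x) = - (LINT z|lborel. indicator {0..t} (snd z) * (Xw z \<bullet> G (fst z)))"
    by (rule sw) blast
  have zv: "L1_curve T E (\<lambda>z. ?b (v z))" and zw: "L1_curve T E (\<lambda>z. ?b (w z))"
    by (rule C_L_signed_power[OF E q vC], rule C_L_signed_power[OF E q wC])
  have zi: "integrable (lebesgue_on E) (\<lambda>x. ?b (v (x, t)))" "integrable (lebesgue_on E) (\<lambda>x. ?b (w (x, t)))" if "t \<in> {0..T}" for t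
    using zv zw that by (auto simp: L1_curve_def)
  have bo: "integrable (lebesgue_on E) (\<lambda>x. ?b (vo x))" "integrable (lebesgue_on E) (\<lambda>x. ?b (w (x, 0)))"
    using integrable_signed_power[OF E q vo] zi(2)[of 0] T by auto
  have vm: "v \<in> borel_measurable (lebesgue_on (E \<times> ?I))" "w \<in> borel_measurable (lebesgue_on (E \<times> ?I))"
    using vL wL by (auto simp: L_W_def bochner_Lp_def)
  obtain v' where rv: "borel_rep (E \<times> ?I) v v'" using borel_rep_exists[OF vm(1) S(1)] .
  obtain w1 where rw1: "borel_rep (E \<times> ?I) w w1" using borel_rep_exists[OF vm(2) S(1)] .
  \<comment> \<open>The positive part makes the representative nonnegative at every point, as the
    admissibility of the test functions requires; it still represents w because w >= 0 almost
    everywhere.\<close>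
  define w' where "w' z = max 0 (w1 z)" for z
  have w0': "AE z in lborel. z \<in> E \<times> {0<..T} \<longrightarrow> w z \<ge> 0" using w0 by (simp only: AE_lebesgue_on_iff[OF S(2)])
  have "borel_rep (E \<times> ?I) (\<lambda>z. max 0 (w z)) w'"
    unfolding w'_def[abs_def] by (rule borel_rep_map[OF rw1]) auto
  then have rw: "borel_rep (E \<times> ?I) w w'"
    by (rule borel_rep_AE_cong) (use w0' in eventually_elim, auto)
  have vW: "AE t in lborel. t \<in> ?I \<longrightarrow> W0 E p (\<lambda>x. v' (x, t)) (\<lambda>x. Dv (x, t))"
  proof -
    have "AE t in lborel. t \<in> ?I \<longrightarrow> (\<lambda>x. v (x, t)) \<in> W1p0 E p"
      using vL0 AE_lebesgue_on_iff[of ?I] by (simp add: L_W0_def bochner_Lp_def)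
    then show ?thesis using gv borel_rep_slices[OF rv]
    proof eventually_elim
      case (elim t)
      have "borel_rep E (\<lambda>x. Dv (x, t)) (\<lambda>x. Dv (x, t))" by (rule borel_rep_self[OF borel_slice[OF Dv]]) (simp add: z)
      with elim show ?case by (blast intro: W1p0_imp_W0[OF E(1) p0])
    qed
  qed
  have wW: "AE t in lborel. t \<in> ?I \<longrightarrow> wgrad E (\<lambda>x. w' (x, t)) (\<lambda>x. Dw (x, t)) \<and>
      Lp_integrable p (\<lambda>x. w' (x, t)) \<and> Lp_integrable p (\<lambda>x. Dw (x, t))"
  proof -
    have "AE t in lborel. t \<in> ?I \<longrightarrow> (\<lambda>x. w (x, t)) \<in> W1p E p"
      using wL AE_lebesgue_on_iff[of ?I] by (simp add: L_W_def bochner_Lp_def)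
    then show ?thesis using gw borel_rep_slices[OF rw]
    proof eventually_elim
      case (elim t)
      have r: "borel_rep E (\<lambda>x. Dw (x, t)) (\<lambda>x. Dw (x, t))" by (rule borel_rep_self[OF borel_slice[OF Dw]]) (simp add: z')
      show ?case
      proof
        assume "t \<in> ?I"
        with elim have "(\<lambda>x. w (x, t)) \<in> W1p E p" "has_weak_gradient E (\<lambda>x. w (x, t)) (\<lambda>x. Dw (x, t))"
          "borel_rep E (\<lambda>x. w (x, t)) (\<lambda>x. w' (x, t))" by auto
        from W1p_rep[OF E(1) this r] show "wgrad E (\<lambda>x. w' (x, t)) (\<lambda>x. Dw (x, t)) \<and>
          Lp_integrable p (\<lambda>x. w' (x, t)) \<and> Lp_integrable p (\<lambda>x. Dw (x, t))" by simp
      qed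
    qed
  qed
  have sb: "AE W in lborel. fst W \<in> E \<times> ?I \<longrightarrow> fst (swap_times W) \<in> E \<times> ?I \<longrightarrow>
      (Xv (fst W) - Xw (fst (swap_times W))) \<bullet> (Dv (fst W) - Dw (fst (swap_times W))) \<ge>
      - (L * \<bar>v' (fst W) - w' (fst (swap_times W))\<bar> * (1 + norm (Dw (fst (swap_times W))) powr (p - 1)) *
         norm (Dv (fst W) - Dw (fst (swap_times W))))"
  proof -
    have pv: "AE z in lborel. z \<in> E \<times> ?I \<longrightarrow> Xv z = A (fst z) (v' z) (Dv z)"
    proof -
      have "AE z in lborel. z \<in> E \<times> ?I \<longrightarrow> v z = v' z" using rv by (simp add: borel_rep_def)
      with Av show ?thesis by eventually_elim auto
    qed
    have pw: "AE z in lborel. z \<in> E \<times> ?I \<longrightarrow> Xw z = A (fst z) (w' z) (Dw z)"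
    proof -
      have "AE z in lborel. z \<in> E \<times> ?I \<longrightarrow> w z = w' z" using rw by (simp add: borel_rep_def)
      with Aw show ?thesis by eventually_elim auto
    qed
    have ml: "AE x in lborel. x \<in> E \<longrightarrow> (\<forall>u \<xi>1 \<xi>2. (A x u \<xi>1 - A x u \<xi>2) \<bullet> (\<xi>1 - \<xi>2) \<ge> 0) \<and>
      (\<forall>u1 u2 \<xi>. norm (A x u1 \<xi> - A x u2 \<xi>) \<le> L * \<bar>u1 - u2\<bar> * (1 + norm \<xi> powr (p - 1)))"
      using monotone lipschitz unfolding AE_lebesgue_on_iff[OF E'] by eventually_elim auto
    \<comment> \<open>The null sets for v, for w and for x alone are lifted to the domain with two
      times, the one for w through \<open>swap_times\<close>.\<close>
    show ?thesis
      using lborel_AE_fst[OF pv, where 'b=real] swap_times_AE[OF lborel_AE_fst[OF pw]]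
        lborel_AE_fst[OF lborel_AE_fst[OF ml, where 'b=real], where 'b=real]
    proof eventually_elim
      case (elim W)
      show ?case
      proof (intro impI)
        assume m: "fst W \<in> E \<times> ?I" "fst (swap_times W) \<in> E \<times> ?I"
        have x: "fst (fst (swap_times W)) = fst (fst W)" by (simp add: swap_times_def)
        have xE: "fst (fst W) \<in> E" using m(1) by (simp add: mem_Times_iff)
        have e: "Xv (fst W) = A (fst (fst W)) (v' (fst W)) (Dv (fst W))"
          "Xw (fst (swap_times W)) = A (fst (fst W)) (w' (fst (swap_times W))) (Dw (fst (swap_times W)))"
          using elim(1,2) m x by auto
        show "(Xv (fst W) - Xw (fst (swap_times W))) \<bullet> (Dv (fst W) - Dw (fst (swap_times W))) \<ge>
          - (L * \<bar>v' (fst W) - w' (fst (swap_times W))\<bar> * (1 + norm (Dw (fst (swap_times W))) powr (p - 1)) *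
             norm (Dv (fst W) - Dw (fst (swap_times W))))"
          unfolding e by (rule structure_lower_bound[where A="A (fst (fst W))"]) (use elim(3) xE in blast)+
      qed
    qed
  qed
  interpret doubling E T p q L v w v' w' Dv Dw Xv Xw
  proof (rule doubling.intro[OF E T p q L zv zw rv rw _ Dv z(1) i(1) Dw z'(1) i'(1) Xv i(2) z(2) Xw i'(2) z'(2) vW wW _ _ sb])
    show "w' z \<ge> 0" for z by (simp add: w'_def)
    show "(LINT x|lebesgue_on E. (?b (v (x, t2)) - ?b (v (x, t1))) * \<phi> x) =
      - (LINT w|lborel. indicator {t1<..t2} (snd w) * (Xv w \<bullet> G (fst w)))"
      if "W0 E p \<phi> G" "\<And>x. \<bar>\<phi> x\<bar> \<le> 1" "0 \<le> t1" "t1 \<le> t2" "t2 < T" for \<phi> G t1 t2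
      by (rule weak_identity_difference[where z="\<lambda>z. ?b (v z)", OF E(1) p Xv i(2) z(2) zi(1) bo(1) that star_v[OF that(1,2)]])
    show "(LINT x|lebesgue_on E. (?b (w (x, t2)) - ?b (w (x, t1))) * \<phi> x) =
      - (LINT w|lborel. indicator {t1<..t2} (snd w) * (Xw w \<bullet> G (fst w)))"
      if "W0 E p \<phi> G" "\<And>x. \<bar>\<phi> x\<bar> \<le> 1" "0 \<le> t1" "t1 \<le> t2" "t2 < T" for \<phi> G t1 t2
      by (rule weak_identity_difference[where z="\<lambda>z. ?b (w z)", OF E(1) p Xw i'(2) z'(2) zi(2) bo(2) that star_w[OF that(1,2)]])
  qed
  \<comment> \<open>At t = 0 the flux term is an integral over the slice of time 0, where
    \<open>Xv\<close> vanishes by its extension by zero; hence v attains its datum.\<close>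
  have "AE x in lebesgue_on E. ?b (v (x, 0)) - ?b (vo x) = 0"
  proof (rule W0_orthogonal_AE_zero[OF E(1) p0])
    show "integrable (lebesgue_on E) (\<lambda>x. ?b (v (x, 0)) - ?b (vo x))" using zi(1)[of 0] bo(1) T by simp
    fix \<phi> G assume h: "W0 E p \<phi> G" "\<And>x. \<bar>\<phi> x\<bar> \<le> 1"
    have e: "indicator {0..0} (snd y) * (Xv y \<bullet> G (fst y)) = 0" for y
      using z(2)[of y] by (cases "snd y = 0") (auto simp: mem_Times_iff)
    show "(LINT x|lebesgue_on E. (?b (v (x, 0)) - ?b (vo x)) * \<phi> x) = 0"
      unfolding star_v[OF h order_refl T] e by simp
  qed
  then have initial: "AE x in lebesgue_on E. v (x, 0) \<le> w (x, 0)"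
    using le
  proof eventually_elim
    case (elim x)
    then have "v (x, 0) = vo x" using strict_mono_eq[OF signed_power_strict_mono[OF q]] by simp
    with elim show ?case by simp
  qed
  \<comment> \<open>The comparison holds at each time with its own null set; on Borel
    representatives these combine to one null set in space-time.\<close>
  have "AE t in lborel. AE x in lborel. (x, t) \<in> E \<times> ?I \<longrightarrow> v' (x, t) \<le> w' (x, t)"
    using borel_rep_slices[OF rv] borel_rep_slices[OF rw]
  proof eventually_elim
    case (elim t)
    show ?case
    proof (cases "t \<in> ?I")
      case True
      have "AE x in lborel. x \<in> E \<longrightarrow> v (x, t) = v' (x, t)" "AE x in lborel. x \<in> E \<longrightarrow> w (x, t) = w' (x, t)"
        using elim True by (auto simp: borel_rep_def)
      moreover have "AE x in lborel. x \<in> E \<longrightarrow> v (x, t) \<le> w (x, t)"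
        using comparison[OF initial, of t] True by (simp add: AE_lebesgue_on_iff[OF E'])
      ultimately show ?thesis by eventually_elim auto
    next
      case False
      then show ?thesis by (intro AE_I2) auto
    qed
  qed
  then have "AE z in lborel. z \<in> E \<times> ?I \<longrightarrow> v' z \<le> w' z"
    by (intro AE_slices_le[OF _ _ S(1)]) (use rv rw in \<open>auto simp: borel_rep_def\<close>)
  moreover have "AE z in lborel. z \<in> E \<times> ?I \<longrightarrow> v z = v' z" "AE z in lborel. z \<in> E \<times> ?I \<longrightarrow> w z = w' z"
    using rv rw by (auto simp: borel_rep_def)
  moreover have "AE z in (lborel :: ('a \<times> real) measure). snd z \<noteq> T" by (rule lborel_AE_snd[OF AE_lborel_singleton])
  ultimately have "AE z in lborel. z \<in> E \<times> {0<..T} \<longrightarrow> v z \<le> w z"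
    by eventually_elim (auto simp: mem_Times_iff)
  then show ?thesis by (simp only: AE_lebesgue_on_iff[OF S(2)])
qed

theorem proposition4p16:
  fixes E :: "(real ^ 'n) set"
    and A :: "real ^ 'n \<Rightarrow> real \<Rightarrow> real ^ 'n \<Rightarrow> real ^ 'n"
    and v w :: "(real ^ 'n) \<times> real \<Rightarrow> real"
    and v\<^sub>o :: "real ^ 'n \<Rightarrow> real"
    and T p q C\<^sub>1 \<Lambda> :: real
  assumes "open E" and "bounded E" and "T > 0" and "p > 1" and "q > 0"
    and "C\<^sub>1 > 0" and "\<Lambda> > 0"
    and "caratheodory E A"
    and growth: "AE x in lebesgue_on E. \<forall>u \<xi>.
      norm (A x u \<xi>) \<le> C\<^sub>1 * (1 + norm \<xi> powr (p - 1))"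
    and monotone: "AE x in lebesgue_on E. \<forall>u \<xi>\<^sub>1 \<xi>\<^sub>2.
      (A x u \<xi>\<^sub>1 - A x u \<xi>\<^sub>2) \<bullet> (\<xi>\<^sub>1 - \<xi>\<^sub>2) \<ge> 0"
    and lipschitz: "AE x in lebesgue_on E. \<forall>u\<^sub>1 u\<^sub>2 \<xi>.
      norm (A x u\<^sub>1 \<xi> - A x u\<^sub>2 \<xi>) \<le> \<Lambda> * \<bar>u\<^sub>1 - u\<^sub>2\<bar> * (1 + norm \<xi> powr (p - 1))"
    and "weak_solution E T p q A w"
    and "AE z in lebesgue_on (E \<times> {0<..T}). w z \<ge> 0"
    and "v\<^sub>o \<in> Lp_space (lebesgue_on E) (q + 1)"
    and "AE x in lebesgue_on E. v\<^sub>o x \<ge> 0"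
    and "weak_solution_CD E T p q A (\<lambda>_. 0) v\<^sub>o v"
    and "AE z in lebesgue_on (E \<times> {0<..T}). v z \<ge> 0"
    and "AE x in lebesgue_on E. v\<^sub>o x \<le> w (x, 0)"
  shows "AE z in lebesgue_on (E \<times> {0<..T}). v z \<le> w z"
  by (rule comparison_principle[OF assms(1-6) less_imp_le[OF assms(7)] assms(8) growth monotone lipschitz
        assms(12,13,16,18)])

end
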